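(* Let $0<\delta<1$ and $k\ge 1$. In the insert-only streaming model there is an algorithm for the parameterized weighted $k$-matching problem such that, on input $(\mathcal{S},k)$, where $\mathcal{S}$ is an insert-only stream of a weighted graph $G$, the algorithm outputs a matching $M'$ satisfying: (1) if $G$ contains a $k$-matching then, with probability at least $1-\delta$, $M'$ is a maximum-weight $k$-matching of $G$; and (2) if $G$ does not contain a $k$-matching then $M'=\emptyset$. The algorithm runs in $O(k^2\log\frac{1}{\delta})$ space and has $O(\log\frac{1}{\delta})$ update time. In particular, for any constant $\delta$, it runs in $O(k^2)$ space and has $O(1)$ update time.
   Context: All graphs are undirected and simple, with weight function $wt: E(G)\to\mathbb{R}_{\ge 0}$. A matching is a set of edges no two of which share an endpoint; a $k$-matching is a matching with exactly $k$ edges; the weight of a matching is the sum of its edge weights; a maximum-weight $k$-matching is a $k$-matching of maximum weight among all $k$-matchings. Insert-only streaming model: the vertex set is $V=\{0,\dots,n-1\}$; the graph is given as a stream (of length polynomial in $n$) of elements $(e_i, wt(e_i))$, each being the insertion of an edge $e_i$ with its weight. The update time is the time to process one stream element; the space includes the space to maintain the data structure and to answer the query. Space is measured in words, and basic operations on words take constant time and space. *)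

theory Defs
  imports "HOL-Probability.Probability"
begin

section \<open>Weighted graphs and matchings\<close>

text \<open>A simple graph on the vertex set \<open>{0..<n}\<close> is given by its set of two-element edges.\<close>

definition weighted_graph :: "nat \<Rightarrow> nat set set \<Rightarrow> (nat set \<Rightarrow> real) \<Rightarrow> bool" where
  "weighted_graph n E wt \<longleftrightarrow>
     (\<forall>e\<in>E. e \<subseteq> {0..<n} \<and> card e = 2) \<and> (\<forall>e\<in>E. 0 \<le> wt e)"

definition matching :: "nat set set \<Rightarrow> nat set set \<Rightarrow> bool" where
  "matching E M \<longleftrightarrow> M \<subseteq> E \<and> (\<forall>e\<in>M. \<forall>f\<in>M. e \<noteq> f \<longrightarrow> e \<inter> f = {})"

definition k_matching :: "nat \<Rightarrow> nat set set \<Rightarrow> nat set set \<Rightarrow> bool" where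
  "k_matching k E M \<longleftrightarrow> matching E M \<and> finite M \<and> card M = k"

definition max_weight_k_matching ::
  "nat \<Rightarrow> nat set set \<Rightarrow> (nat set \<Rightarrow> real) \<Rightarrow> nat set set \<Rightarrow> bool" where
  "max_weight_k_matching k E wt M \<longleftrightarrow>
     k_matching k E M \<and> (\<forall>N. k_matching k E N \<longrightarrow> sum wt N \<le> sum wt M)"

text \<open>A stream element \<open>(u, v, w)\<close> inserts the edge \<open>{u, v}\<close> with weight \<open>w\<close>. The graph is
  simple, so every edge is inserted exactly once (the length is thus at most \<open>n choose 2\<close>);
  the order of the elements and of the two endpoints is arbitrary.\<close>

type_synonym element = "nat \<times> nat \<times> real"

definition insert_only_stream ::
  "nat set set \<Rightarrow> (nat set \<Rightarrow> real) \<Rightarrow> element list \<Rightarrow> bool" where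
  "insert_only_stream E wt xs \<longleftrightarrow>
     distinct (map (\<lambda>(u, v, w). {u, v}) xs) \<and>
     set (map (\<lambda>(u, v, w). {u, v}) xs) = E \<and>
     (\<forall>(u, v, w)\<in>set xs. w = wt {u, v})"


section \<open>Randomized one-pass streaming algorithms on a word RAM\<close>

text \<open>The machine has two randomly addressable memories: \<open>mem\<close> holds integer words and \<open>wmem\<close>
  holds weights, one weight per word. Weights can only be moved, added and compared.
  \<open>input\<close> is the unread part of the stream, accessible only through the instruction \<open>Read\<close>.
  \<open>reads\<close> counts the executed \<open>Read\<close> instructions; no instruction can inspect it.\<close>

record state =
  mem :: "nat \<Rightarrow> nat"
  wmem :: "nat \<Rightarrow> real"
  input :: "element list"
  reads :: nat

datatype binop = Plus | Minus | Times | Div | Mod | Less | Equal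

fun binop_apply :: "binop \<Rightarrow> nat \<Rightarrow> nat \<Rightarrow> nat" where
  "binop_apply Plus x y = x + y"
| "binop_apply Minus x y = x - y"
| "binop_apply Times x y = x * y"
| "binop_apply Div x y = x div y"
| "binop_apply Mod x y = x mod y"
| "binop_apply Less x y = of_bool (x < y)"
| "binop_apply Equal x y = of_bool (x = y)"

text \<open>Numeric operands are memory addresses, except for the literal of \<open>Const\<close>.
  \<open>Load\<close>, \<open>Store\<close> and the weight instructions \<open>WMove\<close>, \<open>WPlus\<close>, \<open>WLess\<close> address indirectly
  through \<open>mem\<close>.\<close>

datatype instr =
    Const nat nat
  | Op binop nat nat nat
  | Load nat nat
  | Store nat nat
  | Random nat nat
  | WMove nat nat
  | WPlus nat nat nat
  | WLess nat nat nat
  | Read nat nat nat nat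

fun exec_instr :: "instr \<Rightarrow> state \<Rightarrow> state pmf" where
  "exec_instr (Const a c) s = return_pmf (s\<lparr>mem := (mem s)(a := c)\<rparr>)"
| "exec_instr (Op f a b c) s =
     return_pmf (s\<lparr>mem := (mem s)(a := binop_apply f (mem s b) (mem s c))\<rparr>)"
| "exec_instr (Load a b) s = return_pmf (s\<lparr>mem := (mem s)(a := mem s (mem s b))\<rparr>)"
| "exec_instr (Store a b) s = return_pmf (s\<lparr>mem := (mem s)(mem s a := mem s b)\<rparr>)"
| "exec_instr (Random a b) s =
     map_pmf (\<lambda>r. s\<lparr>mem := (mem s)(a := r)\<rparr>)
       (if mem s b = 0 then return_pmf 0 else pmf_of_set {0..<mem s b})"
| "exec_instr (WMove a b) s =
     return_pmf (s\<lparr>wmem := (wmem s)(mem s a := wmem s (mem s b))\<rparr>)"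
| "exec_instr (WPlus a b c) s =
     return_pmf (s\<lparr>wmem := (wmem s)(mem s a := wmem s (mem s b) + wmem s (mem s c))\<rparr>)"
| "exec_instr (WLess a b c) s =
     return_pmf (s\<lparr>mem := (mem s)(a := of_bool (wmem s (mem s b) < wmem s (mem s c)))\<rparr>)"
| "exec_instr (Read a b c d) s = return_pmf
     (case input s of
        [] \<Rightarrow> s\<lparr>mem := (mem s)(a := 0), reads := Suc (reads s)\<rparr>
      | (u, v, w) # xs \<Rightarrow>
          s\<lparr>mem := (mem s)(a := 1, b := u, c := v), wmem := (wmem s)(d := w),
            input := xs, reads := Suc (reads s)\<rparr>)"

text \<open>Each instruction has a constant number of operands and costs one step, as does each test
  \<open>mem a \<noteq> 0\<close> of \<open>If a\<close> and \<open>While a\<close>. A program is a fixed finite term without recursion, so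
  control needs no memory that depends on the input.\<close>

datatype prog =
    Skip
  | Instr instr
  | Seq prog prog
  | If nat prog prog
  | While nat prog

type_synonym config = "prog \<times> state"

fun step :: "config \<Rightarrow> config pmf" where
  "step (Skip, s) = return_pmf (Skip, s)"
| "step (Instr i, s) = map_pmf (Pair Skip) (exec_instr i s)"
| "step (Seq p q, s) =
     (if p = Skip then return_pmf (q, s)
      else map_pmf (\<lambda>(p', s'). (Seq p' q, s')) (step (p, s)))"
| "step (If a p q, s) = return_pmf (if mem s a \<noteq> 0 then p else q, s)"
| "step (While a p, s) = return_pmf (if mem s a \<noteq> 0 then Seq p (While a p) else Skip, s)"

fun run :: "nat \<Rightarrow> config \<Rightarrow> config pmf" where
  "run 0 c = return_pmf c"
| "run (Suc t) c = bind_pmf (step c) (run t)"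

definition reachable :: "config \<Rightarrow> config set" where
  "reachable c = (\<Union>t. set_pmf (run t c))"

text \<open>Cells 0 and 1 initially hold \<open>n\<close> and \<open>k\<close>; all other cells are zero.\<close>

definition initial :: "prog \<Rightarrow> nat \<Rightarrow> nat \<Rightarrow> element list \<Rightarrow> config" where
  "initial P n k xs =
     (P, \<lparr>mem = (\<lambda>_. 0)(0 := n, 1 := k), wmem = (\<lambda>_. 0), input = xs, reads = 0\<rparr>)"

text \<open>\<open>D\<close> is the distribution of the final configuration; all runs have to halt within a common
  number of steps. As halted configurations do not change, there is at most one such \<open>D\<close>.\<close>

definition halts_with :: "config \<Rightarrow> config pmf \<Rightarrow> bool" where
  "halts_with c D \<longleftrightarrow> (\<exists>t. D = run t c) \<and> (\<forall>c'\<in>set_pmf D. fst c' = Skip)"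

lemma run_add: "run (s + t) c = bind_pmf (run s c) (run t)"
  by (induction s arbitrary: c)
    (auto simp: bind_return_pmf bind_assoc_pmf intro!: bind_pmf_cong)

lemma run_halted: "fst c = Skip \<Longrightarrow> run t c = return_pmf c"
  by (induction t) (cases c; simp add: bind_return_pmf)+

lemma halts_with_unique:
  assumes "halts_with c D" "halts_with c D'"
  shows "D = D'"
proof -
  have *: "run (s + t) c = run s c" if "\<forall>c'\<in>set_pmf (run s c). fst c' = Skip" for s t
  proof -
    have "bind_pmf (run s c) (run t) = bind_pmf (run s c) return_pmf"
      using that by (intro bind_pmf_cong) (auto simp: run_halted)
    then show ?thesis by (simp add: run_add bind_return_pmf')
  qed
  obtain s t where "D = run s c" "D' = run t c"
    using assms unfolding halts_with_def by blast
  then show ?thesis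
    using *[of s t] *[of t s] assms by (simp add: halts_with_def add.commute)
qed

text \<open>On halting, cell 0 holds the number of output edges and cell 1 the address of the array in
  which their endpoints are stored consecutively.\<close>

definition answer :: "config \<Rightarrow> nat set set" where
  "answer c = (let m = mem (snd c) in (\<lambda>i. {m (m 1 + 2 * i), m (m 1 + 2 * i + 1)}) ` {0..<m 0})"

text \<open>Every memory cell that is ever used lies in the first \<open>s\<close> integer or the first \<open>t\<close> weight
  cells (cells outside stay zero and thus store nothing). The space covers the whole run, i.e.
  preprocessing, processing of the stream, and computation of the answer. Every integer word is
  less than \<open>W\<close> throughout.\<close>

definition runs_in_space :: "nat \<Rightarrow> nat \<Rightarrow> config \<Rightarrow> bool" where
  "runs_in_space W S c \<longleftrightarrow> (\<exists>s t. s + t \<le> S \<and>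
     (\<forall>c'\<in>reachable c.
        (\<forall>a. mem (snd c') a < W) \<and>
        (\<forall>a\<ge>s. mem (snd c') a = 0) \<and>
        (\<forall>a\<ge>t. wmem (snd c') a = 0)))"

text \<open>Whenever an element has been read, every run executes the next \<open>Read\<close> within \<open>T\<close> steps;
  for the last element, this is the \<open>Read\<close> that detects the end of the stream. Neither the preprocessing before
  the first \<open>Read\<close> nor the computation after the end of the stream has been detected is counted.\<close>

definition update_time_le :: "nat \<Rightarrow> config \<Rightarrow> bool" where
  "update_time_le T c \<longleftrightarrow>
     (\<forall>c'\<in>reachable c. 1 \<le> reads (snd c') \<and> reads (snd c') \<le> length (input (snd c)) \<longrightarrow>
        (\<forall>c''\<in>set_pmf (run T c'). reads (snd c') < reads (snd c'')))"


section \<open>The parameterized weighted matching problem\<close>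

definition solves_k_matching ::
  "real \<Rightarrow> nat \<Rightarrow> nat set set \<Rightarrow> (nat set \<Rightarrow> real) \<Rightarrow> config \<Rightarrow> bool" where
  "solves_k_matching \<delta> k E wt c \<longleftrightarrow> (\<exists>D. halts_with c D \<and>
     (\<forall>c'\<in>set_pmf D. matching E (answer c')) \<and>
     ((\<exists>M. k_matching k E M) \<longrightarrow>
        measure_pmf.prob D {c'. max_weight_k_matching k E wt (answer c')} \<ge> 1 - \<delta>) \<and>
     (\<not> (\<exists>M. k_matching k E M) \<longrightarrow> (\<forall>c'\<in>set_pmf D. answer c' = {})))"

text \<open>The factor \<open>log (1/\<delta>)\<close> of the bounds, rounded up so that it does not vanish as \<open>\<delta>\<close>
  approaches 1.\<close>

definition log_inv :: "real \<Rightarrow> nat" where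
  "log_inv \<delta> = nat \<lceil>log 2 (1 / \<delta>)\<rceil>"

end

theory Submission
  imports Defs
begin

text \<open>Use \<open>L = log_inv \<delta>\<close> hash functions \<open>x \<mapsto> (a * x mod (R * n)) div n\<close> with \<open>R = 32 * k\<^sup>2\<close> and random
  multipliers \<open>a\<close>. Two vertices collide with probability at most \<open>4 / R\<close>, so each function is injective on the \<open>2 * k\<close>
  vertices of a fixed optimal matching with probability at least \<open>1 / 2\<close>, and all of them fail with probability at most
  \<open>(1 / 2) ^ L\<close>. If one succeeds, then it suffices to keep, for this function, a set of edges in which every dropped edge
  is dominated: whatever \<open>2 * k - 2\<close> buckets the other edges of the matching occupy, a kept edge that is at least as heavy
  avoids them. Heaviest-first thinning of every bucket to \<open>O(k)\<close> edges and of the survivors to \<open>O(k\<^sup>2)\<close> edges has this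
  property, and the property survives composition and later insertions. Hence the stored \<open>O(k\<^sup>2 * L)\<close> edges
  can be compressed in rounds, each linear in the number of edges times \<open>L\<close>.

  To bound the update time in the worst case, new elements are pushed onto a stack, and every loop iteration of the
  compression polls the input; each \<open>P\<close>-th poll, \<open>P = 961 * L\<close>, reads one element. Since a round finishes before the
  stack holds more than a constant fraction of the space, the stack never overflows. Thinning needs an approximate
  median with only constant-size overhead per element, which a merge sort that drops every second element of the merged
  runs in alternate passes provides in linear time. At the end of the stream an optimal matching of the stored
  edges is found by exhaustive search over all \<open>k\<close>-tuples.\<close>

section \<open>Total correctness of machine programs with a clock\<close>

text \<open>The worst-case bound shapes everything: a compression is cheap only when averaged over
  many elements. Because every loop iteration polls, counting becomes uniform: the time between two
  reads is a bounded number of polls, and the iterations of a round determine how many elements pile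
  up. Hence a small structured language whose semantics records nothing but iterations, and one
  simulation theorem that yields time, space and word size together. The modulus of the hash
  functions is a multiple of \<open>n\<close> instead of a prime, so no prime has to be found;
  counting multiples in short intervals replaces arithmetic in a field. Parallel edges must be
  removed, since otherwise a single forbidden bucket could hit all kept edges of another bucket. A
  table of bucket pairs would take on the order of \<open>k ^ 4\<close> cells, so they are found
  bucket by bucket with one uninitialised array. The error is one-sided because hashing only decides
  which edges are stored, while the search tests true endpoints.\<close>

definition tick :: "nat \<Rightarrow> state \<Rightarrow> state \<Rightarrow> nat" where
  "tick g s s' = (if reads s' = reads s then Suc g else 0)"

text \<open>The clock \<open>g\<close> is the number of steps since the last \<open>Read\<close>.\<close>

inductive ev :: "(nat \<Rightarrow> state \<Rightarrow> bool) \<Rightarrow> (nat \<Rightarrow> state \<Rightarrow> bool) \<Rightarrow> prog \<Rightarrow> nat \<Rightarrow> state \<Rightarrow> bool"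
  for I Q where
  ev_done: "I g s \<Longrightarrow> Q g s \<Longrightarrow> ev I Q Skip g s"
| ev_step: "p \<noteq> Skip \<Longrightarrow> I g s \<Longrightarrow>
    (\<And>p' s'. (p', s') \<in> set_pmf (step (p, s)) \<Longrightarrow> ev I Q p' (tick g s s') s') \<Longrightarrow> ev I Q p g s"

lemma ev_inv: "ev I Q p g s \<Longrightarrow> I g s"
  by (auto elim: ev.cases)

lemma ev_mono:
  assumes "ev I Q p g s" "\<And>g s. I g s \<Longrightarrow> Q g s \<Longrightarrow> Q' g s"
  shows "ev I Q' p g s"
  using assms(1) by (induction rule: ev.induct) (auto intro: ev.intros assms(2))

text \<open>Discarding a finished \<open>Skip\<close> at the head of a \<open>Seq\<close> is a step
  of its own, which accounts for the \<open>Suc g\<close> at which \<open>q\<close> starts.\<close>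

lemma ev_Seq:
  assumes "ev I R p g s" "\<And>g s. I g s \<Longrightarrow> R g s \<Longrightarrow> ev I Q q (Suc g) s"
  shows "ev I Q (Seq p q) g s"
  using assms(1)
proof (induction rule: ev.induct)
  case (ev_done g s)
  show ?case
    by (rule ev_step) (use ev_done assms(2) in \<open>auto simp: tick_def\<close>)
next
  case (ev_step p g s)
  show ?case
    by (rule ev.ev_step) (use ev_step in auto)
qed

lemma ev_Instr:
  assumes "I g s" "\<And>s'. s' \<in> set_pmf (exec_instr i s) \<Longrightarrow> I (tick g s s') s' \<and> Q (tick g s s') s'"
  shows "ev I Q (Instr i) g s"
  by (rule ev_step) (use assms in \<open>auto intro: ev_done\<close>)

lemma ev_If:
  assumes "I g s" "ev I Q (if mem s a \<noteq> 0 then p else q) (Suc g) s"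
  shows "ev I Q (If a p q) g s"
  by (rule ev_step) (use assms in \<open>auto simp: tick_def\<close>)

lemma ev_While_exit:
  assumes "I g s" "I (Suc g) s" "Q (Suc g) s" "mem s a = 0"
  shows "ev I Q (While a p) g s"
  by (rule ev_step) (use assms in \<open>auto simp: tick_def intro: ev_done\<close>)

lemma ev_While_enter:
  assumes "I g s" "mem s a \<noteq> 0"
    "ev I (\<lambda>g s. ev I Q (While a p) (Suc g) s) p (Suc g) s"
  shows "ev I Q (While a p) g s"
  by (rule ev_step) (use assms in \<open>auto simp: tick_def intro!: ev_Seq[OF assms(3)]\<close>)

lemma finite_set_exec: "finite (set_pmf (exec_instr i s))"
  by (cases i) (auto split: list.splits simp: set_pmf_of_set)

lemma finite_set_step: "finite (set_pmf (step (p, s)))"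
  by (induction p) (auto simp: finite_set_exec)

lemma reads_exec: "s' \<in> set_pmf (exec_instr i s) \<Longrightarrow> reads s \<le> reads s'"
  by (cases i) (auto split: list.splits)

lemma reads_step: "(p', s') \<in> set_pmf (step (p, s)) \<Longrightarrow> reads s \<le> reads s'"
  by (induction p arbitrary: p' s') (auto split: if_splits simp: reads_exec)

lemma reads_run: "c' \<in> set_pmf (run t c) \<Longrightarrow> reads (snd c) \<le> reads (snd c')"
proof (induction t arbitrary: c)
  case (Suc t)
  then obtain c1 where "c1 \<in> set_pmf (step c)" "c' \<in> set_pmf (run t c1)" by auto
  with Suc.IH[of c1] reads_step[of "fst c1" "snd c1" "fst c" "snd c"] show ?case by auto
qed auto

text \<open>Every step has finite support, so the halting times of the successors have a maximum. It
  gives one number of steps for all runs, as \<open>halts_with\<close> demands.\<close>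

lemma ev_halts:
  assumes "ev I Q p g s"
  shows "\<exists>t. \<forall>c'\<in>set_pmf (run t (p, s)). fst c' = Skip \<and> (\<exists>g'. I g' (snd c') \<and> Q g' (snd c'))"
  using assms
proof (induction rule: ev.induct)
  case (ev_done g s)
  then show ?case by (intro exI[of _ 0]) auto
next
  case (ev_step p g s)
  have "\<forall>c\<in>set_pmf (step (p, s)). \<exists>t. \<forall>c'\<in>set_pmf (run t c).
      fst c' = Skip \<and> (\<exists>g'. I g' (snd c') \<and> Q g' (snd c'))"
    using ev_step.IH by auto
  then obtain f where f: "\<And>c c'. c \<in> set_pmf (step (p, s)) \<Longrightarrow> c' \<in> set_pmf (run (f c) c) \<Longrightarrow>
      fst c' = Skip \<and> (\<exists>g'. I g' (snd c') \<and> Q g' (snd c'))"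
    by metis
  define t where "t = Max (f ` set_pmf (step (p, s)))"
  have "fst c' = Skip \<and> (\<exists>g'. I g' (snd c') \<and> Q g' (snd c'))"
    if c': "c' \<in> set_pmf (run (Suc t) (p, s))" for c'
  proof -
    obtain c where c: "c \<in> set_pmf (step (p, s))" "c' \<in> set_pmf (run t c)"
      using c' by auto
    have "f c \<le> t" using c finite_set_step by (auto simp: t_def intro!: Max_ge)
    then have "c' \<in> set_pmf (run (f c + (t - f c)) c)" using c by simp
    then obtain d where d: "d \<in> set_pmf (run (f c) c)" "c' \<in> set_pmf (run (t - f c) d)"
      unfolding run_add by auto
    then have "c' = d" using f[OF c(1) d(1)] by (simp add: run_halted)
    then show ?thesis using f[OF c(1) d(1)] by simp
  qed
  then show ?case by blast
qed

lemma ev_run: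
  assumes "ev I Q p g s" "c' \<in> set_pmf (run t (p, s))"
  shows "\<exists>g'. ev I Q (fst c') g' (snd c')"
  using assms
proof (induction arbitrary: t rule: ev.induct)
  case (ev_done g s)
  then have "c' = (Skip, s)" by (simp add: run_halted)
  then show ?case using ev_done by (auto intro: ev.ev_done)
next
  case (ev_step p g s)
  show ?case
  proof (cases t)
    case 0
    moreover have "ev I Q p g s" using ev_step.hyps by (rule ev.ev_step)
    ultimately show ?thesis using ev_step.prems by (auto intro!: exI[of _ g])
  next
    case (Suc u)
    then obtain q s' where "(q, s') \<in> set_pmf (step (p, s))" "c' \<in> set_pmf (run u (q, s'))"
      using ev_step.prems by auto
    then show ?thesis using ev_step.IH by blast
  qed
qed

lemma ev_reachable:
  assumes "ev I Q p g s" "c' \<in> reachable (p, s)"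
  shows "\<exists>g'. I g' (snd c')"
  using assms ev_run ev_inv unfolding reachable_def by blast

text \<open>Only a \<open>Read\<close> resets the clock. Without one for \<open>T - g\<close> steps
  the clock would reach \<open>T\<close> against the invariant; halting earlier is no way out, since
  then \<open>Q\<close> says that more than \<open>N\<close> reads have been done.\<close>

lemma ev_next_read:
  assumes "ev I Q p g s" "1 \<le> reads s" "reads s \<le> N"
    and I: "\<And>g s. I g s \<Longrightarrow> 1 \<le> reads s \<Longrightarrow> reads s \<le> N \<Longrightarrow> g < T"
    and Q: "\<And>g s. Q g s \<Longrightarrow> N < reads s"
  shows "\<forall>c''\<in>set_pmf (run (T - g) (p, s)). reads s < reads (snd c'')"
  using assms(1-3)
proof (induction rule: ev.induct)
  case (ev_done g s)
  then show ?case using Q by fastforce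
next
  case (ev_step p g s)
  have "g < T" using ev_step I by blast
  then obtain u where u: "T - g = Suc u" by (metis Suc_diff_Suc)
  show ?case
  proof
    fix c'' assume "c'' \<in> set_pmf (run (T - g) (p, s))"
    then obtain q s' where q: "(q, s') \<in> set_pmf (step (p, s))" "c'' \<in> set_pmf (run u (q, s'))"
      using u by auto
    show "reads s < reads (snd c'')"
    proof (cases "reads s' = reads s")
      case True
      have "T - Suc g = u" using u by simp
      then show ?thesis using ev_step.IH[OF q(1)] True ev_step.prems q(2) by (auto simp: tick_def)
    next
      case False
      then show ?thesis using reads_step[OF q(1)] reads_run[OF q(2)] by simp
    qed
  qed
qed

text \<open>A reachable configuration has some clock value \<open>g'\<close>. From there
  \<open>T - g'\<close> steps suffice, and \<open>reads\<close> does not decrease in the remaining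
  ones.\<close>

lemma ev_update_time:
  assumes "ev I Q p g s"
    and I: "\<And>g s. I g s \<Longrightarrow> 1 \<le> reads s \<Longrightarrow> reads s \<le> length (input s0) \<Longrightarrow> g < T"
    and Q: "\<And>g s. Q g s \<Longrightarrow> length (input s0) < reads s"
    and "s0 = s"
  shows "update_time_le T (p, s)"
  unfolding update_time_le_def
proof (intro ballI impI)
  fix c' c'' assume c': "c' \<in> reachable (p, s)"
    "1 \<le> reads (snd c') \<and> reads (snd c') \<le> length (input (snd (p, s)))"
    and c'': "c'' \<in> set_pmf (run T c')"
  obtain t where "c' \<in> set_pmf (run t (p, s))" using c' unfolding reachable_def by auto
  then obtain g' where g': "ev I Q (fst c') g' (snd c')" using ev_run[OF assms(1)] by blast
  then have *: "\<forall>c''\<in>set_pmf (run (T - g') (fst c', snd c')). reads (snd c') < reads (snd c'')"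
    using ev_next_read[OF g' _ _ I Q] c' assms(4) by auto
  have "c'' \<in> set_pmf (run ((T - g') + (T - (T - g'))) c')" using c'' by simp
  then obtain d where "d \<in> set_pmf (run (T - g') c')" "c'' \<in> set_pmf (run (T - (T - g')) d)"
    unfolding run_add by auto
  then show "reads (snd c') < reads (snd c'')" using * reads_run by fastforce
qed

section \<open>Probability bounds for terminating runs\<close>

lemma prob_run_step:
  assumes "c \<notin> B" "\<And>t c'. c' \<in> set_pmf (step c) \<Longrightarrow> measure_pmf.prob (run t c') B \<le> f c'"
    "0 \<le> x" "measure_pmf.expectation (step c) f \<le> x" "finite (set_pmf (step c))"
  shows "measure_pmf.prob (run t c) B \<le> x"
proof (cases t)
  case 0
  then show ?thesis using assms by simp
next
  case (Suc u)
  have "measure_pmf.prob (run t c) B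
      = measure_pmf.expectation (step c) (\<lambda>c'. measure_pmf.prob (run u c') B)"
    unfolding Suc run.simps
    by (subst measure_pmf_bind, subst measure_pmf.measure_bind[where N="count_space UNIV"]) 
       (auto simp: space_subprob_algebra intro!: prob_space_imp_subprob_space measure_pmf.prob_space_axioms)
  also have "\<dots> \<le> measure_pmf.expectation (step c) f"
    using assms by (intro integral_mono_AE)
      (auto intro!: integrable_measure_pmf_finite simp: AE_measure_pmf_iff)
  finally show ?thesis using assms by simp
qed

text \<open>Bad outcomes are halted configurations, so none occurs while \<open>p\<close> is
  running. Every run of \<open>p\<close> ends by \<open>ev\<close>, and the bound for
  \<open>q\<close> holds for any number of remaining steps.\<close>

lemma prob_run_Seq:
  assumes "ev I R p g s" "\<And>g s t. I g s \<Longrightarrow> R g s \<Longrightarrow> measure_pmf.prob (run t (q, s)) B \<le> x"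
    and B: "\<And>c. c \<in> B \<Longrightarrow> fst c = Skip" and "0 \<le> x"
  shows "measure_pmf.prob (run t (Seq p q, s)) B \<le> x"
  using assms(1)
proof (induction arbitrary: t rule: ev.induct)
  case (ev_done g s)
  have nb: "(Seq Skip q, s) \<notin> B" using B by force
  show ?case
    by (rule prob_run_step[where f="\<lambda>_. x"]) (use nb assms(2,4) ev_done in auto)
next
  case (ev_step p g s)
  have nb: "(Seq p q, s) \<notin> B" using B by force
  show ?case
    by (rule prob_run_step[where f="\<lambda>_. x"])
      (use nb assms(4) ev_step in \<open>auto simp: finite_set_step\<close>)
qed

lemma prob_run_ev:
  assumes "ev I R p g s" "\<And>g s. I g s \<Longrightarrow> R g s \<Longrightarrow> (Skip, s) \<notin> B"
    and B: "\<And>c. c \<in> B \<Longrightarrow> fst c = Skip"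
  shows "measure_pmf.prob (run t (p, s)) B = 0"
proof -
  have "measure_pmf.prob (run t (p, s)) B \<le> 0"
    using assms(1)
  proof (induction arbitrary: t rule: ev.induct)
    case (ev_done g s)
    then show ?case using assms(2) by (simp add: run_halted)
  next
    case (ev_step p g s)
    show ?case
      by (rule prob_run_step[where f="\<lambda>_. 0"])
        (use B ev_step in \<open>auto simp: finite_set_step\<close>)
  qed
  then show ?thesis by (simp add: measure_le_0_iff)
qed


subsection \<open>Straight-line code\<close>

fun exi :: "instr \<Rightarrow> state \<Rightarrow> state" where
  "exi (Const a c) s = s\<lparr>mem := (mem s)(a := c)\<rparr>"
| "exi (Op f a b c) s = s\<lparr>mem := (mem s)(a := binop_apply f (mem s b) (mem s c))\<rparr>"
| "exi (Load a b) s = s\<lparr>mem := (mem s)(a := mem s (mem s b))\<rparr>"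
| "exi (Store a b) s = s\<lparr>mem := (mem s)(mem s a := mem s b)\<rparr>"
| "exi (WMove a b) s = s\<lparr>wmem := (wmem s)(mem s a := wmem s (mem s b))\<rparr>"
| "exi (WPlus a b c) s =
     s\<lparr>wmem := (wmem s)(mem s a := wmem s (mem s b) + wmem s (mem s c))\<rparr>"
| "exi (WLess a b c) s =
     s\<lparr>mem := (mem s)(a := of_bool (wmem s (mem s b) < wmem s (mem s c)))\<rparr>"
| "exi _ s = s"

fun det_instr :: "instr \<Rightarrow> bool" where
  "det_instr (Random _ _) = False"
| "det_instr (Read _ _ _ _) = False"
| "det_instr _ = True"

lemma exec_det: "det_instr i \<Longrightarrow> exec_instr i s = return_pmf (exi i s)"
  by (cases i) auto

lemma reads_exi [simp]: "reads (exi i s) = reads s"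
  by (cases i) auto

fun seqs :: "instr list \<Rightarrow> prog" where
  "seqs [] = Skip"
| "seqs (i # is) = Seq (Instr i) (seqs is)"

text \<open>A weakest precondition by symbolic execution. \<open>S\<close> is demanded in every
  intermediate state because the space bound covers the whole run.\<close>

fun lst :: "(state \<Rightarrow> bool) \<Rightarrow> instr list \<Rightarrow> state \<Rightarrow> (state \<Rightarrow> bool) \<Rightarrow> bool" where
  "lst S [] s Q \<longleftrightarrow> S s \<and> Q s"
| "lst S (i # is) s Q \<longleftrightarrow> S s \<and> det_instr i \<and> lst S is (exi i s) Q"

lemma lst_safe: "lst S is s Q \<Longrightarrow> S s"
  by (cases "is") auto

lemma lst_append: "lst S (xs @ ys) s Q \<longleftrightarrow> lst S xs s (\<lambda>s. lst S ys s Q)"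
  by (induction xs arbitrary: s) (auto dest: lst_safe)

lemma lst_mono: "lst S is s Q \<Longrightarrow> (\<And>s. S s \<Longrightarrow> Q s \<Longrightarrow> Q' s) \<Longrightarrow> lst S is s Q'"
  by (induction "is" arbitrary: s) auto

text \<open>The clock is constrained only from the first read up to the one that detects the end of
  a stream of length \<open>N\<close>, the window in which update time counts.\<close>

definition ck :: "nat \<Rightarrow> nat \<Rightarrow> nat \<Rightarrow> state \<Rightarrow> bool" where
  "ck N m g s \<longleftrightarrow> (1 \<le> reads s \<and> reads s \<le> N \<longrightarrow> g \<le> m)"

lemma ck_mono: "ck N m g s \<Longrightarrow> m \<le> m' \<Longrightarrow> ck N m' g s"
  by (auto simp: ck_def)

lemma ck_Suc: "ck N m g s \<Longrightarrow> ck N (Suc m) (Suc g) s"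
  by (auto simp: ck_def)

text \<open>Two steps per instruction: its execution and the removal of the resulting
  \<open>Skip\<close>.\<close>

lemma ev_seqs:
  assumes "lst S is s Q" "ck N m g s" "m + 2 * length is \<le> T"
  shows "ev (\<lambda>g s. S s \<and> ck N T g s) (\<lambda>g s. Q s \<and> ck N (m + 2 * length is) g s) (seqs is) g s"
  using assms
proof (induction "is" arbitrary: s g m)
  case Nil
  then show ?case by (auto intro!: ev_done dest: ck_mono)
next
  case (Cons i "is")
  have *: "ck N (Suc m) (Suc g) (exi i s)" using Cons.prems by (simp add: ck_def)
  show ?case
    unfolding seqs.simps
  proof (rule ev_Seq[where R="\<lambda>g' s'. s' = exi i s \<and> g' = Suc g"])
    show "ev (\<lambda>g s. S s \<and> ck N T g s) (\<lambda>g' s'. s' = exi i s \<and> g' = Suc g) (Instr i) g s"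
      using Cons.prems ck_mono[OF *] lst_safe[of S "is" "exi i s" Q]
      by (intro ev_Instr) (auto simp: exec_det tick_def intro: ck_mono)
    show "ev (\<lambda>g s. S s \<and> ck N T g s) (\<lambda>g s. Q s \<and> ck N (m + 2 * length (i # is)) g s) (seqs is) (Suc g') s'"
      if "s' = exi i s \<and> g' = Suc g" for g' s'
      using Cons.IH[of "exi i s" "Suc (Suc m)" "Suc (Suc g)"] Cons.prems ck_Suc[OF *] that by simp
  qed
qed

section \<open>A structured language on top of the machine\<close>

text \<open>Cells 0--29 are program variables, 30--99 temporaries, 100--119 belong to the input handling,
  the output region occupies the next \<open>2 * k\<close> cells. All arrays share the remaining cells: entry \<open>i\<close> of array \<open>j < 16\<close>
  has offset \<open>16 * i + j\<close>, so no array needs a size. Arrays 0 and 1 belong to the input handling.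
  Entry \<open>i\<close> of weight array \<open>j < 4\<close> is cell \<open>4 * i + j\<close>; array 0 and cell 3 belong to the input handling.

  Variables 0--6 hold \<open>n\<close>, \<open>k\<close>, the modulus \<open>R * n\<close> of the hash functions, \<open>R\<close>, the capacity \<open>D\<close> of a bucket,
  \<open>D\<^sup>2\<close>, and the number of stored edges. Stored edge \<open>e\<close> has its endpoints in arrays 2 and 3 and its weight in weight
  array 1. Array 4 marks the edges kept by a round and array 5 those kept for the current hash function. The linked lists of
  the buckets consist of array 6 (heads), 7 (links) and 8 (bucket of a node, nodes \<open>3 * e\<close>, \<open>3 * e + 1\<close>, \<open>3 * e + 2\<close> belonging
  to edge \<open>e\<close>); a link to node \<open>h\<close> is stored as \<open>h + 1\<close>, and 0 ends the list. Array 9 finds parallel edges, 10--12 serve the filter, 13 holds the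
  multipliers of the hash functions, 14 and 15 the current and the best tuple of the exhaustive search.\<close>

datatype exp = Num nat | Var nat | Bin binop exp exp | Arr nat exp

datatype atom =
    Asg nat exp
  | Sto nat exp exp
  | Out exp exp
  | WMv nat exp nat exp
  | WAd nat exp nat exp nat exp
  | WLs nat nat exp nat exp

datatype com = Skp | At atom | Sq com com | Cnd exp com com | Whl exp com

record pst =
  vv :: "nat \<Rightarrow> nat"
  aa :: "nat \<Rightarrow> nat \<Rightarrow> nat"
  ww :: "nat \<Rightarrow> nat \<Rightarrow> real"
  outp :: "nat \<Rightarrow> nat"

record iost =
  live :: bool
  polls :: nat
  stack :: "element list"
  rest :: "element list"

fun val :: "exp \<Rightarrow> pst \<Rightarrow> nat" where
  "val (Num c) p = c"
| "val (Var x) p = vv p x"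
| "val (Bin f a c) p = binop_apply f (val a p) (val c p)"
| "val (Arr j a) p = aa p j (val a p)"

fun eff :: "atom \<Rightarrow> pst \<Rightarrow> pst" where
  "eff (Asg x e) p = p\<lparr>vv := (vv p)(x := val e p)\<rparr>"
| "eff (Sto j e f) p = p\<lparr>aa := (aa p)(j := (aa p j)(val e p := val f p))\<rparr>"
| "eff (Out e f) p = p\<lparr>outp := (outp p)(val e p := val f p)\<rparr>"
| "eff (WMv j e j' f) p = p\<lparr>ww := (ww p)(j := (ww p j)(val e p := ww p j' (val f p)))\<rparr>"
| "eff (WAd j e j' f j'' g) p =
     p\<lparr>ww := (ww p)(j := (ww p j)(val e p := ww p j' (val f p) + ww p j'' (val g p)))\<rparr>"
| "eff (WLs x j e j' f) p =
     p\<lparr>vv := (vv p)(x := of_bool (ww p j (val e p) < ww p j' (val f p)))\<rparr>"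

text \<open>The value of a \<open>small\<close> expression cannot exceed that of a variable, array entry or literal.\<close>

fun small :: "exp \<Rightarrow> bool" where
  "small (Bin f a c) \<longleftrightarrow> f = Less \<or> f = Equal \<or> (f = Minus \<or> f = Div \<or> f = Mod) \<and> small a"
| "small _ \<longleftrightarrow> True"

text \<open>Used in two ways: \<open>b ^ esz e\<close> will bound the value of \<open>e\<close>, and
  \<open>esz e\<close> the number of temporaries that its evaluation occupies.\<close>

fun esz :: "exp \<Rightarrow> nat" where
  "esz (Num c) = 1"
| "esz (Var x) = 1"
| "esz (Bin f a c) = esz a + esz c + 1"
| "esz (Arr j a) = esz a + 3"

text \<open>Cell 103 holds the offset of the arrays, which depends on \<open>k\<close> and so cannot
  be a literal of the program.\<close>

definition adr :: "nat \<Rightarrow> nat \<Rightarrow> instr list" where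
  "adr j t = [Const (Suc t) 16, Op Times t t (Suc t), Const (Suc t) j, Op Plus t t (Suc t), Op Plus t t 103]"

definition wadr :: "nat \<Rightarrow> nat \<Rightarrow> instr list" where
  "wadr j t = [Const (Suc t) 4, Op Times t t (Suc t), Const (Suc t) j, Op Plus t t (Suc t)]"

text \<open>The machine has no move between fixed cells; a copy is an addition of zero.\<close>

fun cexp :: "exp \<Rightarrow> nat \<Rightarrow> instr list" where
  "cexp (Num c) t = [Const t c]"
| "cexp (Var x) t = [Const t 0, Op Plus t t x]"
| "cexp (Bin f a c) t = cexp a t @ cexp c (Suc t) @ [Op f t t (Suc t)]"
| "cexp (Arr j a) t = cexp a t @ adr j t @ [Load t t]"

fun catom :: "atom \<Rightarrow> instr list" where
  "catom (Asg x e) = cexp e 30 @ [Const 31 0, Op Plus x 30 31]"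
| "catom (Sto j e f) = (cexp e 30 @ adr j 30) @ cexp f 31 @ [Store 30 31]"
| "catom (Out e f) = cexp e 30 @ [Const 31 120, Op Plus 30 30 31] @ cexp f 31 @ [Store 30 31]"
| "catom (WMv j e j' f) = (cexp e 30 @ wadr j 30) @ (cexp f 31 @ wadr j' 31) @ [WMove 30 31]"
| "catom (WAd j e j' f j'' g) = (cexp e 30 @ wadr j 30) @ (cexp f 31 @ wadr j' 31) @
     (cexp g 32 @ wadr j'' 32) @ [WPlus 30 31 32]"
| "catom (WLs x j e j' f) = (cexp e 30 @ wadr j 30) @ (cexp f 31 @ wadr j' 31) @ [WLess x 30 31]"

text \<open>Every \<open>P\<close>-th poll reads a stream element and pushes it onto the stack.\<close>

definition POLL :: "nat \<Rightarrow> prog" where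
  "POLL P = If 100
     (Seq (seqs [Const 104 1, Op Plus 101 101 104, Const 104 P, Op Less 105 101 104])
       (If 105 Skip
         (Seq (seqs [Const 101 0, Const 104 16, Op Times 108 102 104, Op Plus 108 108 103,
                Const 104 1, Op Plus 109 108 104, Const 104 4, Op Times 110 102 104, Const 111 3])
           (Seq (Instr (Read 100 106 107 3))
             (If 100 (seqs [Store 108 106, Store 109 107, WMove 110 111, Const 104 1,
                Op Plus 102 102 104]) Skip)))))
     Skip"

text \<open>Moves the top of the stack to the end of the stored edges. It is written by hand because
  well-formed structured code has no access to arrays 0 and 1.\<close>

definition POP :: "instr list" where
  "POP = [Const 104 1, Op Minus 102 102 104, Const 104 16, Op Times 108 102 104, Op Plus 108 108 103,
     Const 104 1, Op Plus 109 108 104, Load 106 108, Load 107 109,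
     Const 104 16, Op Times 112 6 104, Op Plus 112 112 103, Const 104 2, Op Plus 112 112 104,
     Store 112 106, Const 104 1, Op Plus 112 112 104, Store 112 107,
     Const 104 4, Op Times 110 102 104, Op Times 112 6 104, Const 104 1, Op Plus 112 112 104,
     WMove 112 110, Op Plus 6 6 104]"

text \<open>Only loops poll, after the body and before the next test. Code without loops is bounded
  by its length, so one poll per iteration keeps the distance between polls bounded.\<close>

fun comp :: "nat \<Rightarrow> com \<Rightarrow> prog" where
  "comp P Skp = Skip"
| "comp P (At a) = seqs (catom a)"
| "comp P (Sq c d) = Seq (comp P c) (comp P d)"
| "comp P (Cnd e c d) = Seq (seqs (cexp e 30)) (If 30 (comp P c) (comp P d))"
| "comp P (Whl e c) = Seq (seqs (cexp e 30))
     (While 30 (Seq (comp P c) (Seq (POLL P) (seqs (cexp e 30)))))"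

text \<open>Counts the steps outside complete loop iterations. A body is counted once, because the
  poll at the end of each iteration opens a new account.\<close>

fun sz :: "com \<Rightarrow> nat" where
  "sz Skp = 0"
| "sz (At a) = 2 * length (catom a)"
| "sz (Sq c d) = sz c + sz d + 1"
| "sz (Cnd e c d) = 2 * length (cexp e 30) + sz c + sz d + 2"
| "sz (Whl e c) = 2 * length (cexp e 30) + sz c + 4"

definition poll :: "nat \<Rightarrow> iost \<Rightarrow> iost" where
  "poll P io = (if \<not> live io then io
     else if Suc (polls io) < P then io\<lparr>polls := Suc (polls io)\<rparr>
     else (case rest io of
         [] \<Rightarrow> io\<lparr>polls := 0, live := False\<rparr>
       | x # xs \<Rightarrow> io\<lparr>polls := 0, stack := stack io @ [x], rest := xs\<rparr>))"

section \<open>Simulation of expressions and assignments by machine code\<close>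

lemma stride_eq_iff:
  fixes i j :: nat
  assumes "j < m" "j' < m"
  shows "m * i + j = m * i' + j' \<longleftrightarrow> i = i' \<and> j = j'"
proof -
  have "(m * i + j) div m = i" "(m * i + j) mod m = j" "(m * i' + j') div m = i'" "(m * i' + j') mod m = j'"
    using assms by auto
  then show ?thesis by metis
qed

text \<open>\<open>b\<close> bounds what variables and arrays hold between assignments,
  \<open>lb\<close> the literals, \<open>SZ\<close> the entries of an array, \<open>c2\<close> the
  steps from one poll to the next; \<open>len\<close> is the length of the stream. The bound
  \<open>b ^ 100\<close> on words leaves room for values inside expressions.\<close>

locale machine =
  fixes k b lb SZ P len c2 :: nat
  assumes b_large: "200 + 2 * k + 100 * SZ \<le> b" and lb_less: "lb < b" and P_le: "P \<le> lb"
    and P_ge: "2 \<le> P" and SZ_ge: "1 \<le> SZ"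
begin

abbreviation "W \<equiv> b ^ 100"
abbreviation "SM \<equiv> 120 + 2 * k + 16 * SZ"
abbreviation "SW \<equiv> 4 * SZ"
abbreviation "OFF \<equiv> 120 + 2 * k"

fun wfe :: "exp \<Rightarrow> bool" where
  "wfe (Num c) \<longleftrightarrow> c \<le> lb"
| "wfe (Var x) \<longleftrightarrow> x < 30"
| "wfe (Bin f a c) \<longleftrightarrow> wfe a \<and> wfe c"
| "wfe (Arr j a) \<longleftrightarrow> 2 \<le> j \<and> j < 16 \<and> wfe a"

text \<open>The limit 60 keeps the temporaries, which start at cells 30 to 32, below cell 100, and
  addresses formed from the value below \<open>b ^ 100\<close>.\<close>

definition wfx :: "exp \<Rightarrow> bool" where "wfx e \<longleftrightarrow> wfe e \<and> esz e \<le> 60"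

fun wfa :: "atom \<Rightarrow> bool" where
  "wfa (Asg x e) \<longleftrightarrow> x < 30 \<and> wfx e"
| "wfa (Sto j e f) \<longleftrightarrow> 2 \<le> j \<and> j < 16 \<and> wfx e \<and> wfx f"
| "wfa (Out e f) \<longleftrightarrow> wfx e \<and> wfx f"
| "wfa (WMv j e j' f) \<longleftrightarrow> j \<in> {1, 2} \<and> j' \<in> {1, 2} \<and> wfx e \<and> wfx f"
| "wfa (WAd j e j' f j'' g) \<longleftrightarrow> j \<in> {1, 2} \<and> j' \<in> {1, 2} \<and> j'' \<in> {1, 2} \<and> wfx e \<and> wfx f \<and> wfx g"
| "wfa (WLs x j e j' f) \<longleftrightarrow> x < 30 \<and> j \<in> {1, 2} \<and> j' \<in> {1, 2} \<and> wfx e \<and> wfx f"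

fun wfc :: "com \<Rightarrow> bool" where
  "wfc Skp \<longleftrightarrow> True"
| "wfc (At a) \<longleftrightarrow> wfa a"
| "wfc (Sq c d) \<longleftrightarrow> wfc c \<and> wfc d"
| "wfc (Cnd e c d) \<longleftrightarrow> wfx e \<and> wfc c \<and> wfc d"
| "wfc (Whl e c) \<longleftrightarrow> wfx e \<and> wfc c"

text \<open>Addresses are restricted for writes only, since reading a cell outside the arrays does
  not extend the space.\<close>

fun cond :: "atom \<Rightarrow> pst \<Rightarrow> bool" where
  "cond (Asg x e) p \<longleftrightarrow> small e \<or> val e p < b"
| "cond (Sto j e f) p \<longleftrightarrow> val e p < SZ \<and> (small f \<or> val f p < b)"
| "cond (Out e f) p \<longleftrightarrow> val e p < 2 * k \<and> (small f \<or> val f p < b)"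
| "cond (WMv j e j' f) p \<longleftrightarrow> val e p < SZ"
| "cond (WAd j e j' f j'' g) p \<longleftrightarrow> val e p < SZ"
| "cond (WLs x j e j' f) p \<longleftrightarrow> True"

text \<open>\<open>bs c p m p'\<close>: \<open>c\<close> leads from \<open>p\<close> to \<open>p'\<close> with \<open>m\<close> loop iterations, hence \<open>m\<close> polls.\<close>

inductive bs :: "com \<Rightarrow> pst \<Rightarrow> nat \<Rightarrow> pst \<Rightarrow> bool" where
  bs_Skp: "bs Skp p 0 p"
| bs_At: "cond a p \<Longrightarrow> bs (At a) p 0 (eff a p)"
| bs_Sq: "bs c p m p' \<Longrightarrow> bs d p' m' p'' \<Longrightarrow> bs (Sq c d) p (m + m') p''"
| bs_Cnd: "bs (if val e p \<noteq> 0 then c else d) p m p' \<Longrightarrow> bs (Cnd e c d) p m p'"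
| bs_Whl_exit: "val e p = 0 \<Longrightarrow> bs (Whl e c) p 0 p"
| bs_Whl: "val e p \<noteq> 0 \<Longrightarrow> bs c p m p' \<Longrightarrow> bs (Whl e c) p' m' p'' \<Longrightarrow> bs (Whl e c) p (Suc (m + m')) p''"

definition sm :: "(nat \<Rightarrow> nat) \<Rightarrow> bool" where
  "sm f \<longleftrightarrow> (\<forall>a. f a < W) \<and> (\<forall>a\<ge>SM. f a = 0)"

definition sw :: "(nat \<Rightarrow> real) \<Rightarrow> bool" where
  "sw f \<longleftrightarrow> (\<forall>a\<ge>SW. f a = 0)"

definition safe :: "state \<Rightarrow> bool" where
  "safe s \<longleftrightarrow> sm (mem s) \<and> sw (wmem s)"

lemma sm_upd [simp]: "sm f \<Longrightarrow> a < SM \<Longrightarrow> v < W \<Longrightarrow> sm (f(a := v))"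
  by (auto simp: sm_def)

lemma sw_upd [simp]: "sw f \<Longrightarrow> a < SW \<Longrightarrow> sw (f(a := v))"
  by (auto simp: sw_def)

text \<open>The case distinction at the end fixes the meaning of \<open>live\<close>: the read that
  finds the stream empty is the one numbered \<open>Suc len\<close>. The bounds by \<open>b\<close>
  hold after every assignment, although expressions may exceed them on the way.\<close>

definition RR :: "pst \<Rightarrow> iost \<Rightarrow> state \<Rightarrow> bool" where
  "RR p io s \<longleftrightarrow> safe s \<and>
     (\<forall>x<30. mem s x = vv p x \<and> vv p x < b) \<and>
     mem s 103 = OFF \<and>
     (\<forall>j i. 2 \<le> j \<and> j < 16 \<longrightarrow> mem s (OFF + 16 * i + j) = aa p j i \<and> aa p j i < b) \<and>
     (\<forall>t<2 * k. mem s (120 + t) = outp p t \<and> outp p t < b) \<and>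
     (\<forall>j i. j = 1 \<or> j = 2 \<longrightarrow> wmem s (4 * i + j) = ww p j i) \<and>
     mem s 100 = of_bool (live io) \<and> mem s 101 = polls io \<and> polls io < P \<and>
     mem s 102 = length (stack io) \<and>
     (\<forall>i<length (stack io).
        (mem s (OFF + 16 * i), mem s (OFF + 16 * i + 1), wmem s (4 * i)) = stack io ! i) \<and>
     (\<forall>(u, v, w)\<in>set (stack io) \<union> set (rest io). u < b \<and> v < b) \<and>
     length (stack io) \<le> SZ \<and>
     input s = rest io \<and>
     (if live io then reads s + length (rest io) = len else reads s = Suc len \<and> rest io = [])"

definition tmp :: "nat \<Rightarrow> state \<Rightarrow> state \<Rightarrow> bool" where
  "tmp t s s' \<longleftrightarrow> safe s' \<and> wmem s' = wmem s \<and> input s' = input s \<and> reads s' = reads s \<and>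
     (\<forall>a. a < t \<or> 100 \<le> a \<longrightarrow> mem s' a = mem s a)"

lemma tmp_trans: "tmp t s s' \<Longrightarrow> tmp t' s' s'' \<Longrightarrow> t \<le> t' \<Longrightarrow> tmp t s s''"
  by (simp add: tmp_def)

lemma tmp_upd:
  "tmp t s s' \<Longrightarrow> t \<le> a \<Longrightarrow> a < 100 \<Longrightarrow> v < W \<Longrightarrow> tmp t s (s'\<lparr>mem := (mem s')(a := v)\<rparr>)"
  by (auto simp: tmp_def safe_def)

lemma tmp_RR: "tmp t s s' \<Longrightarrow> RR p io s \<Longrightarrow> 30 \<le> t \<Longrightarrow> RR p io s'"
  unfolding tmp_def RR_def by (elim conjE, intro conjI) auto

lemma RR_safe: "RR p io s \<Longrightarrow> safe s"
  by (simp add: RR_def)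

lemma safe_upd: "safe s \<Longrightarrow> a < SM \<Longrightarrow> v < W \<Longrightarrow> safe (s\<lparr>mem := (mem s)(a := v)\<rparr>)"
  by (auto simp: safe_def)

lemma safe_wupd: "safe s \<Longrightarrow> a < SW \<Longrightarrow> safe (s\<lparr>wmem := (wmem s)(a := v)\<rparr>)"
  by (auto simp: safe_def)

lemma b_ge: "200 \<le> b" "2 * k < b" "100 * SZ < b" "SZ < b" "120 + 2 * k < b" "300 \<le> b"
  using b_large SZ_ge by auto

lemma b_pow: "m \<le> m' \<Longrightarrow> b ^ m \<le> b ^ m'"
  using b_ge(1) by (intro power_increasing) auto

lemma b_le_W: "b \<le> W"
  using b_pow[of 1 100] by simp

text \<open>Two numbers that are at least 2 have a product no smaller than their sum.\<close>

lemma b_add: "x < b ^ m \<Longrightarrow> y < b ^ m' \<Longrightarrow> 1 \<le> m \<Longrightarrow> 1 \<le> m' \<Longrightarrow> x + y < b ^ (m + m')"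
proof -
  assume a: "x < b ^ m" "y < b ^ m'" "1 \<le> m" "1 \<le> m'"
  have 2: "2 \<le> b ^ m" "2 \<le> b ^ m'" using b_pow[OF a(3)] b_pow[OF a(4)] b_ge(1) by auto
  have "(b ^ m - 1) * (b ^ m' - 1) \<ge> 1" using 2 by (simp add: Suc_le_eq)
  moreover have "b ^ m * b ^ m' = (b ^ m - 1) * (b ^ m' - 1) + (b ^ m - 1) + (b ^ m' - 1) + 1"
    using 2 by (cases "b ^ m"; cases "b ^ m'") (auto simp: algebra_simps)
  ultimately show ?thesis using a by (simp add: power_add)
qed

lemma binop_less:
  assumes "x < b ^ m" "y < b ^ m'" "1 \<le> m" "1 \<le> m'"
  shows "binop_apply f x y < b ^ (m + m')"
proof -
  have le: "b ^ m \<le> b ^ (m + m')" "1 < b ^ (m + m')"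
    using b_pow[of m "m + m'"] b_pow[of 1 "m + m'"] b_ge(1) assms by auto
  show ?thesis
  proof (cases f)
    case Plus
    then show ?thesis using b_add[OF assms] by simp
  next
    case Times
    have "x * y < b ^ m * b ^ m'" using assms b_ge(1) by (intro mult_strict_mono) auto
    then show ?thesis using Times by (simp add: power_add)
  next
    case Minus
    then show ?thesis using assms(1) le by simp
  next
    case Div
    then show ?thesis using assms(1) le by simp (meson div_le_dividend le_less_trans less_le_trans)
  next
    case Mod
    then show ?thesis using assms(1) le by simp (meson mod_less_eq_dividend le_less_trans less_le_trans)
  qed (use le b_ge(1) in \<open>auto simp: of_bool_def\<close>)
qed

lemma esz_pos: "1 \<le> esz e"
  by (induction e) auto

lemma val_less: "RR p io s \<Longrightarrow> wfe e \<Longrightarrow> val e p < b ^ esz e"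
proof (induction e)
  case (Num c)
  then show ?case using lb_less by simp
next
  case (Var x)
  then show ?case by (simp add: RR_def)
next
  case (Bin f a c)
  have "binop_apply f (val a p) (val c p) < b ^ (esz a + esz c)"
    using Bin by (intro binop_less esz_pos) auto
  also have "\<dots> \<le> b ^ esz (Bin f a c)" by (rule b_pow) simp
  finally show ?case by simp
next
  case (Arr j a)
  then have "aa p j (val a p) < b" by (simp add: RR_def)
  also have "b \<le> b ^ esz (Arr j a)" using b_pow[of 1 "esz (Arr j a)"] by simp
  finally show ?case by simp
qed

lemma small_less: "RR p io s \<Longrightarrow> wfe e \<Longrightarrow> small e \<Longrightarrow> val e p < b"
proof (induction e)
  case (Bin f a c)
  have "1 < b" using b_ge(1) by simp
  then show ?case using Bin
    by (auto simp: of_bool_def intro: le_less_trans[OF div_le_dividend] le_less_trans[OF mod_less_eq_dividend])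
qed (use lb_less in \<open>auto simp: RR_def\<close>)

text \<open>Scaling by 16 and adding the offset costs at most two further factors \<open>b\<close>,
  which the gap between 90 and 100 covers.\<close>

lemma adr_less:
  assumes "v < b ^ m" "j < 16" "m \<le> 90" "1 \<le> m"
  shows "16 * v < W" "16 * v + j < W" "OFF + (16 * v + j) < W" "4 * v < W" "4 * v + j < W" "120 + v < W"
proof -
  have "300 * Suc v \<le> b * b ^ m" using assms(1) b_ge(6) by (intro mult_mono) auto
  moreover have "b \<le> b ^ m" using b_pow[OF assms(4)] by simp
  moreover have "b ^ m * 2 \<le> b ^ m * b" using b_ge(1) by (intro mult_mono) auto
  moreover define z where "z = b * b ^ m"
  ultimately have "300 * v + 300 \<le> z" "2 * b \<le> z" by (auto simp: mult.commute)
  then have "OFF + (16 * v + j) < z + z" using b_ge(5) assms(2) by linarith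
  also have "\<dots> = 2 * b ^ (m + 1)" by (simp add: z_def)
  also have "\<dots> \<le> b * b ^ (m + 1)" using b_ge(1) by (intro mult_mono) auto
  also have "\<dots> = b ^ (m + 2)" by simp
  also have "\<dots> \<le> W" using assms by (intro b_pow) auto
  finally show *: "OFF + (16 * v + j) < W" .
  then show "16 * v < W" "16 * v + j < W" "4 * v < W" "4 * v + j < W" "120 + v < W" by linarith+
qed

lemma adr_lst:
  assumes "mem s t = v" "v < b ^ m" "j < 16" "1 \<le> m" "m \<le> 90" "t < 99" "30 \<le> t" "RR p io s"
  shows "lst safe (adr j t) s (\<lambda>s'. mem s' t = OFF + 16 * v + j \<and> tmp t s s')"
proof -
  note le = adr_less[OF assms(2,3,5,4)]
  have "safe s" "mem s 103 = OFF" using assms(8) by (auto simp: RR_def)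
  moreover have "16 < W" "j < W" using b_le_W b_ge(1) assms(3) by linarith+
  ultimately show ?thesis using assms le
    by (auto simp: adr_def tmp_def safe_def add.commute add.left_commute mult.commute)
qed

lemma wadr_lst:
  assumes "mem s t = v" "v < b ^ m" "j < 16" "1 \<le> m" "m \<le> 90" "t < 99" "30 \<le> t" "RR p io s"
  shows "lst safe (wadr j t) s (\<lambda>s'. mem s' t = 4 * v + j \<and> tmp t s s')"
proof -
  note le = adr_less[OF assms(2,3,5,4)]
  have "safe s" using assms(8) by (auto simp: RR_def)
  moreover have "4 < W" "j < W" using b_le_W b_ge(1) assms(3) by linarith+
  ultimately show ?thesis using assms le
    by (auto simp: wadr_def tmp_def safe_def add.commute add.left_commute mult.commute)
qed

lemma cexp_lst:
  assumes "RR p io s" "wfe e" "t + esz e \<le> 98" "30 \<le> t"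
  shows "lst safe (cexp e t) s (\<lambda>s'. mem s' t = val e p \<and> tmp t s s')"
  using assms
proof (induction e arbitrary: s t)
  case (Num c)
  have "c < W" using Num lb_less b_le_W by simp
  then show ?case using Num RR_safe[OF Num(1)] by (auto simp: tmp_def safe_def)
next
  case (Var x)
  have "vv p x < W" "0 < W" "mem s x = vv p x" using Var b_le_W b_ge(1) by (auto simp: RR_def intro: less_le_trans)
  then show ?case using Var RR_safe[OF Var(1)] by (auto simp: tmp_def safe_def)
next
  case (Bin f a c)
  have W: "val (Bin f a c) p < W"
    using val_less[OF Bin.prems(1,2)] b_pow[of "esz (Bin f a c)" 100] Bin.prems(3) by simp
  have 1: "lst safe (cexp a t) s (\<lambda>s'. mem s' t = val a p \<and> tmp t s s')"
    using Bin by (intro Bin.IH) auto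
  have 2: "lst safe (cexp c (Suc t)) s' (\<lambda>s''. mem s'' (Suc t) = val c p \<and> tmp (Suc t) s' s'')"
    if "tmp t s s'" for s'
    using Bin tmp_RR[OF that] by (intro Bin.IH) auto
  show ?case
    unfolding cexp.simps lst_append
  proof (rule lst_mono[OF 1], rule lst_mono[OF 2])
    fix s' s'' assume a: "mem s' t = val a p \<and> tmp t s s'"
      "mem s'' (Suc t) = val c p \<and> tmp (Suc t) s' s''" "safe s''"
    have "mem s'' t = val a p" using a by (simp add: tmp_def)
    moreover have "tmp t s s''" using a tmp_trans[of t s s' "Suc t" s''] by simp
    ultimately show "lst safe [Op f t t (Suc t)] s'' (\<lambda>s'. mem s' t = val (Bin f a c) p \<and> tmp t s s')"
      using a W Bin.prems by (auto intro!: tmp_upd safe_upd)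
  qed auto
next
  case (Arr j a)
  have 1: "lst safe (cexp a t) s (\<lambda>s'. mem s' t = val a p \<and> tmp t s s')"
    using Arr by (intro Arr.IH) auto
  have 2: "lst safe (adr j t) s' (\<lambda>s''. mem s'' t = OFF + 16 * val a p + j \<and> tmp t s' s'')"
    if "mem s' t = val a p" "tmp t s s'" for s'
    using val_less[OF Arr.prems(1), of a] Arr tmp_RR[OF that(2)] that(1) esz_pos[of a]
    by (intro adr_lst[where m="esz a"]) auto
  have aa: "mem s (OFF + 16 * val a p + j) = aa p j (val a p)" "aa p j (val a p) < b"
    using Arr.prems by (auto simp: RR_def)
  then have aW: "aa p j (val a p) < W" using b_le_W by simp
  show ?case
    unfolding cexp.simps lst_append
  proof (rule lst_mono[OF 1], rule lst_mono[OF 2])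
    fix s' s'' assume a: "mem s' t = val a p \<and> tmp t s s'"
      "mem s'' t = OFF + 16 * val a p + j \<and> tmp t s' s''" "safe s''"
    have "tmp t s s''" using a tmp_trans[of t s s' t s''] by simp
    moreover have "mem s'' (OFF + 16 * val a p + j) = aa p j (val a p)"
      using aa \<open>tmp t s s''\<close> by (simp add: tmp_def)
    ultimately show "lst safe [Load t t] s'' (\<lambda>s'. mem s' t = val (Arr j a) p \<and> tmp t s s')"
      using a aa aW Arr.prems by (auto intro!: tmp_upd safe_upd)
  qed auto
qed

lemma cexp_adr_lst:
  assumes "RR p io s" "wfx e" "j < 16" "30 \<le> t" "t \<le> 32"
  shows "lst safe (cexp e t @ adr j t) s (\<lambda>s'. mem s' t = OFF + 16 * val e p + j \<and> tmp t s s')"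
  unfolding lst_append
proof (rule lst_mono[OF cexp_lst])
  fix s' assume a: "mem s' t = val e p \<and> tmp t s s'"
  show "lst safe (adr j t) s' (\<lambda>s'. mem s' t = OFF + 16 * val e p + j \<and> tmp t s s')"
    by (rule lst_mono[OF adr_lst[where m="esz e" and v="val e p"]])
      (use a assms tmp_RR esz_pos val_less in \<open>auto simp: wfx_def intro: tmp_trans\<close>)
qed (use assms in \<open>auto simp: wfx_def\<close>)

lemma cexp_wadr_lst:
  assumes "RR p io s" "wfx e" "j < 16" "30 \<le> t" "t \<le> 32"
  shows "lst safe (cexp e t @ wadr j t) s (\<lambda>s'. mem s' t = 4 * val e p + j \<and> tmp t s s')"
  unfolding lst_append
proof (rule lst_mono[OF cexp_lst])
  fix s' assume a: "mem s' t = val e p \<and> tmp t s s'"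
  show "lst safe (wadr j t) s' (\<lambda>s'. mem s' t = 4 * val e p + j \<and> tmp t s s')"
    by (rule lst_mono[OF wadr_lst[where m="esz e" and v="val e p"]])
      (use a assms tmp_RR esz_pos val_less in \<open>auto simp: wfx_def intro: tmp_trans\<close>)
qed (use assms in \<open>auto simp: wfx_def\<close>)

lemma RR_var:
  assumes "RR p io s" "x < 30" "v < b"
  shows "RR (p\<lparr>vv := (vv p)(x := v)\<rparr>) io (s\<lparr>mem := (mem s)(x := v)\<rparr>)"
  using assms safe_upd[of s x v] b_le_W unfolding RR_def by (elim conjE, intro conjI) auto

lemma RR_arr:
  assumes "RR p io s" "2 \<le> j" "j < 16" "i < SZ" "v < b"
  shows "RR (p\<lparr>aa := (aa p)(j := (aa p j)(i := v))\<rparr>) io (s\<lparr>mem := (mem s)(OFF + 16 * i + j := v)\<rparr>)"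
proof -
  have "OFF + 16 * i + j < SM" using assms by simp
  then have 1: "safe (s\<lparr>mem := (mem s)(OFF + 16 * i + j := v)\<rparr>)"
    using assms b_le_W by (intro safe_upd) (auto simp: RR_safe)
  have 2: "16 * i' + j' = 16 * i + j \<longleftrightarrow> i' = i \<and> j' = j" if "j' < 16" for i' j'
    using that assms(3) by (intro stride_eq_iff) auto
  show ?thesis using assms 1 2 2[of 0] 2[of 1] unfolding RR_def by (elim conjE, intro conjI) auto
qed

lemma RR_out:
  assumes "RR p io s" "t < 2 * k" "v < b"
  shows "RR (p\<lparr>outp := (outp p)(t := v)\<rparr>) io (s\<lparr>mem := (mem s)(120 + t := v)\<rparr>)"
proof -
  have "120 + t < SM" using assms by simp
  then have 1: "safe (s\<lparr>mem := (mem s)(120 + t := v)\<rparr>)"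
    using assms b_le_W by (intro safe_upd) (auto simp: RR_safe)
  show ?thesis using assms 1 unfolding RR_def by (elim conjE, intro conjI) auto
qed

lemma RR_w:
  assumes "RR p io s" "j = 1 \<or> j = 2" "i < SZ"
  shows "RR (p\<lparr>ww := (ww p)(j := (ww p j)(i := v))\<rparr>) io (s\<lparr>wmem := (wmem s)(4 * i + j := v)\<rparr>)"
proof -
  have "4 * i + j < SW" using assms by auto
  then have 1: "safe (s\<lparr>wmem := (wmem s)(4 * i + j := v)\<rparr>)"
    using assms by (intro safe_wupd) (auto simp: RR_safe)
  have 2: "4 * i' + j' = 4 * i + j \<longleftrightarrow> i' = i \<and> j' = j" if "j' < 4" for i' j'
    using that assms(2) by (intro stride_eq_iff) auto
  show ?thesis using assms 1 2 2[of 0] unfolding RR_def by (elim conjE, intro conjI) auto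
qed

lemma cexp_lst':
  assumes "RR p io s" "wfx e" "30 \<le> t" "t \<le> 32"
  shows "lst safe (cexp e t) s (\<lambda>s'. mem s' t = val e p \<and> tmp t s s')"
  using assms by (intro cexp_lst) (auto simp: wfx_def)

lemma lst_chain:
  "lst S xs s Q \<Longrightarrow> (\<And>s'. S s' \<Longrightarrow> Q s' \<Longrightarrow> lst S ys s' Q') \<Longrightarrow> lst S (xs @ ys) s Q'"
  unfolding lst_append by (rule lst_mono)

lemma small_or_less: "RR p io s \<Longrightarrow> wfx e \<Longrightarrow> small e \<or> val e p < b \<Longrightarrow> val e p < b"
  using small_less by (auto simp: wfx_def)

lemma RR_wmem: "RR p io s \<Longrightarrow> j = 1 \<or> j = 2 \<Longrightarrow> wmem s (4 * i + j) = ww p j i"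
  by (auto simp: RR_def)

lemma catom_lst:
  assumes R: "RR p io s" and wf: "wfa a" and c: "cond a p"
  shows "lst safe (catom a) s (RR (eff a p) io)"
proof (cases a)
  case (Asg x e)
  have v: "val e p < b" using small_or_less[OF R, of e] c wf Asg by simp
  show ?thesis unfolding Asg catom.simps
  proof (rule lst_chain[OF cexp_lst'[OF R]])
    fix s' assume a: "mem s' 30 = val e p \<and> tmp 30 s s'" "safe s'"
    have "0 < W" using b_ge(1) by simp
    then have t: "tmp 30 s (s'\<lparr>mem := (mem s')(31 := 0)\<rparr>)" using a by (intro tmp_upd) auto
    have "RR (p\<lparr>vv := (vv p)(x := val e p)\<rparr>) io
       (s'\<lparr>mem := (mem s')(31 := 0), mem := ((mem s')(31 := 0))(x := val e p)\<rparr>)"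
      using RR_var[OF tmp_RR[OF t R], of x "val e p"] wf v Asg by simp
    then show "lst safe [Const 31 0, Op Plus x 30 31] s' (RR (eff (Asg x e) p) io)"
      using a t by (auto simp: RR_safe tmp_def)
  qed (use wf Asg in auto)
next
  case (Sto j e f)
  have v: "val f p < b" using small_or_less[OF R, of f] c wf Sto by simp
  show ?thesis unfolding Sto catom.simps
  proof (rule lst_chain[OF cexp_adr_lst[OF R]], goal_cases)
    case (5 s')
    show ?case
    proof (rule lst_chain[OF cexp_lst'[OF tmp_RR[OF _ R]]])
      fix s'' assume a: "mem s'' 31 = val f p \<and> tmp 31 s' s''" "safe s''"
      have "tmp 30 s s''" using 5 a tmp_trans[of 30 s s' 31 s''] by simp
      note * = RR_arr[OF tmp_RR[OF this R], of j "val e p" "val f p"]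
      have "mem s'' 30 = mem s' 30" using a by (simp add: tmp_def)
      then show "lst safe [Store 30 31] s'' (RR (eff (Sto j e f) p) io)"
        using 5 a * wf c v Sto by (auto simp: RR_safe)
    qed (use 5 wf Sto in auto)
  qed (use wf Sto in auto)
next
  case (Out e f)
  have v: "val f p < b" using small_or_less[OF R, of f] c wf Out by simp
  have e: "120 + val e p < W" "120 < W"
    using c b_ge(5) b_le_W Out by auto
  show ?thesis unfolding Out catom.simps
  proof (rule lst_chain[OF cexp_lst'[OF R]], goal_cases)
    case (4 s0)
    have 1: "lst safe [Const 31 120, Op Plus 30 30 31] s0 (\<lambda>s'. mem s' 30 = 120 + val e p \<and> tmp 30 s s')"
      using 4 e by (auto simp: tmp_def safe_def add.commute)
    show ?case
    proof (rule lst_chain[OF 1])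
      fix s' assume "mem s' 30 = 120 + val e p \<and> tmp 30 s s'"
      then have s': "mem s' 30 = 120 + val e p" "tmp 30 s s'" by auto
      show "lst safe (cexp f 31 @ [Store 30 31]) s' (RR (eff (Out e f) p) io)"
      proof (rule lst_chain[OF cexp_lst'[OF tmp_RR[OF s'(2) R]]])
        fix s'' assume a: "mem s'' 31 = val f p \<and> tmp 31 s' s''" "safe s''"
        have "tmp 30 s s''" using a s' tmp_trans[of 30 s s' 31 s''] by simp
        note * = RR_out[OF tmp_RR[OF this R], of "val e p" "val f p"]
        have "mem s'' 30 = mem s' 30" using a by (simp add: tmp_def)
        then show "lst safe [Store 30 31] s'' (RR (eff (Out e f) p) io)"
          using a s' * wf c v Out by (auto simp: RR_safe)
      qed (use wf Out in auto)
    qed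
  qed (use wf Out in auto)
next
  case (WMv j e j' f)
  show ?thesis unfolding WMv catom.simps
  proof (rule lst_chain[OF cexp_wadr_lst[OF R]], goal_cases)
    case (5 s')
    show ?case
    proof (rule lst_chain[OF cexp_wadr_lst[OF tmp_RR[OF _ R]]])
      fix s'' assume a: "mem s'' 31 = 4 * val f p + j' \<and> tmp 31 s' s''" "safe s''"
      have R'': "RR p io s''" using 5 a tmp_trans[of 30 s s' 31 s''] tmp_RR[OF _ R] by auto
      have w: "wmem s'' (4 * val f p + j') = ww p j' (val f p)"
        using RR_wmem[OF R''] wf WMv by auto
      have R1: "RR (eff (WMv j e j' f) p) io (s''\<lparr>wmem := (wmem s'')(4 * val e p + j := ww p j' (val f p))\<rparr>)"
        unfolding eff.simps by (rule RR_w[OF R'']) (use wf c WMv in auto)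
      have "mem s'' 30 = mem s' 30" using a by (simp add: tmp_def)
      then show "lst safe [WMove 30 31] s'' (RR (eff (WMv j e j' f) p) io)"
        using 5 a R1 RR_safe[OF R1] w by simp
    qed (use 5 wf WMv in auto)
  qed (use wf WMv in auto)
next
  case (WAd j e j' f j'' g)
  show ?thesis unfolding WAd catom.simps
  proof (rule lst_chain[OF cexp_wadr_lst[OF R]], goal_cases)
    case (5 s')
    show ?case
    proof (rule lst_chain[OF cexp_wadr_lst[OF tmp_RR[OF _ R]]])
      fix s'' assume a: "mem s'' 31 = 4 * val f p + j' \<and> tmp 31 s' s''" "safe s''"
      have R'': "RR p io s''" using 5 a tmp_trans[of 30 s s' 31 s''] tmp_RR[OF _ R] by auto
      have m: "mem s'' 30 = mem s' 30" using a by (simp add: tmp_def)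
      show "lst safe ((cexp g 32 @ wadr j'' 32) @ [WPlus 30 31 32]) s'' (RR (eff (WAd j e j' f j'' g) p) io)"
      proof (rule lst_chain[OF cexp_wadr_lst[OF R'']])
        fix t assume b: "mem t 32 = 4 * val g p + j'' \<and> tmp 32 s'' t" "safe t"
        have Rt: "RR p io t" using b tmp_RR[OF _ R''] by auto
        have w: "wmem t (4 * val f p + j') = ww p j' (val f p)" "wmem t (4 * val g p + j'') = ww p j'' (val g p)"
          using RR_wmem[OF Rt] wf WAd by auto
        have R1: "RR (eff (WAd j e j' f j'' g) p) io
            (t\<lparr>wmem := (wmem t)(4 * val e p + j := ww p j' (val f p) + ww p j'' (val g p))\<rparr>)"
          unfolding eff.simps by (rule RR_w[OF Rt]) (use wf c WAd in auto)
        have "mem t 30 = mem s'' 30" "mem t 31 = mem s'' 31" using b by (auto simp: tmp_def)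
        then show "lst safe [WPlus 30 31 32] t (RR (eff (WAd j e j' f j'' g) p) io)"
          using 5 a b m R1 RR_safe[OF R1] w by simp
      qed (use wf WAd in auto)
    qed (use 5 wf WAd in auto)
  qed (use wf WAd in auto)
next
  case (WLs x j e j' f)
  show ?thesis unfolding WLs catom.simps
  proof (rule lst_chain[OF cexp_wadr_lst[OF R]], goal_cases)
    case (5 s')
    show ?case
    proof (rule lst_chain[OF cexp_wadr_lst[OF tmp_RR[OF _ R]]])
      fix s'' assume a: "mem s'' 31 = 4 * val f p + j' \<and> tmp 31 s' s''" "safe s''"
      have R'': "RR p io s''" using 5 a tmp_trans[of 30 s s' 31 s''] tmp_RR[OF _ R] by auto
      have "of_bool (ww p j (val e p) < ww p j' (val f p)) < b" using b_ge(1) by simp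
      then have R1: "RR (eff (WLs x j e j' f) p) io
          (s''\<lparr>mem := (mem s'')(x := of_bool (ww p j (val e p) < ww p j' (val f p)))\<rparr>)"
        unfolding eff.simps by (intro RR_var[OF R'']) (use wf WLs in auto)
      have w: "wmem s'' (4 * val e p + j) = ww p j (val e p)" "wmem s'' (4 * val f p + j') = ww p j' (val f p)"
        using RR_wmem[OF R''] wf WLs by auto
      have "mem s'' 30 = mem s' 30" using a by (simp add: tmp_def)
      then show "lst safe [WLess x 30 31] s'' (RR (eff (WLs x j e j' f) p) io)"
        using 5 a R1 RR_safe[OF R1] w by simp
    qed (use 5 wf WLs in auto)
  qed (use wf WLs in auto)
qed

end

section \<open>Polling the input within bounded time\<close>

context machine
begin

text \<open>Fewer than \<open>P\<close> polls pass without a read, each at most \<open>c2\<close>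
  steps after its predecessor. The other summands cover the code up to the poll that reads, and that
  poll itself.\<close>

definition I :: "nat \<Rightarrow> state \<Rightarrow> bool" where
  "I g s \<longleftrightarrow> safe s \<and> ck len (c2 * P + c2 + 100) g s"

lemma I_intro: "safe s \<Longrightarrow> ck len m g s \<Longrightarrow> m \<le> c2 * P + c2 + 100 \<Longrightarrow> I g s"
  by (auto simp: I_def dest: ck_mono)

lemma ev_seqs_I:
  assumes "lst safe is s Q" "ck len m g s" "m + 2 * length is \<le> c2 * P + c2 + 100"
  shows "ev I (\<lambda>g s. Q s \<and> ck len (m + 2 * length is) g s) (seqs is) g s"
  using ev_seqs[OF assms] by (simp add: I_def[abs_def])

text \<open>Once the end of the stream is detected, \<open>reads\<close> exceeds \<open>len\<close>
  and the clock is unconstrained, so the final search may take any time.\<close>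

lemma RR_dead: "RR p io s \<Longrightarrow> \<not> live io \<Longrightarrow> ck len m g s"
  by (auto simp: RR_def ck_def)

lemma RR_polls:
  assumes "RR p io s" "sm f" "f 101 = c" "c < P"
    "\<And>a. a \<noteq> 101 \<Longrightarrow> a < 104 \<or> 120 \<le> a \<Longrightarrow> f a = mem s a"
  shows "RR p (io\<lparr>polls := c\<rparr>) (s\<lparr>mem := f\<rparr>)"
  using assms unfolding RR_def safe_def by (elim conjE, intro conjI) auto

lemma RR_eof:
  assumes "RR p io s" "live io" "rest io = []" "sm f" "f 100 = 0" "f 101 = 0"
    "\<And>a. a < 100 \<or> a = 102 \<or> a = 103 \<or> 120 \<le> a \<Longrightarrow> f a = mem s a"
  shows "RR p (io\<lparr>polls := 0, live := False\<rparr>) (s\<lparr>mem := f, reads := Suc (reads s)\<rparr>)"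
  using assms P_ge unfolding RR_def safe_def by (elim conjE, intro conjI) auto

text \<open>\<open>Read\<close> writes to fixed cells only, so the weight arrives in weight cell 3
  and is then copied to the stack. Cell 3 belongs neither to weight arrays 1 and 2 nor to a stack
  entry.\<close>

lemma RR_push:
  assumes R: "RR p io s" and "live io" "rest io = (u, v, w) # xs" "length (stack io) < SZ" and f: "sm f"
    and f': "f 100 = 1" "f 101 = 0" "f 102 = Suc (length (stack io))"
    "f (OFF + 16 * length (stack io)) = u" "f (OFF + 16 * length (stack io) + 1) = v"
    and f'': "\<And>a. a < 100 \<or> a = 103 \<or> 120 \<le> a \<Longrightarrow> a \<noteq> OFF + 16 * length (stack io) \<Longrightarrow>
      a \<noteq> OFF + 16 * length (stack io) + 1 \<Longrightarrow> f a = mem s a"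
  shows "RR p (io\<lparr>polls := 0, stack := stack io @ [(u, v, w)], rest := xs\<rparr>)
    (s\<lparr>mem := f, wmem := (wmem s)(3 := w, 4 * length (stack io) := w), input := xs, reads := Suc (reads s)\<rparr>)"
proof -
  let ?l = "length (stack io)"
  have e0: "f (OFF + 16 * i + j) = mem s (OFF + 16 * i + j)"
    if "2 \<le> j" "j < 16" for i j
    using that stride_eq_iff[of j 16 0 i ?l] stride_eq_iff[of j 16 1 i ?l] by (intro f'') auto
  have e1: "f (OFF + 16 * i) = mem s (OFF + 16 * i)" "f (OFF + 16 * i + 1) = mem s (OFF + 16 * i + 1)"
    if "i < ?l" for i
    using that by (auto intro!: f'') presburger+
  have e2: "4 * i + j \<noteq> 3" "4 * i + j \<noteq> 4 * ?l" "4 * i \<noteq> (3 :: nat)" if "j = 1 \<or> j = 2" for i j :: nat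
    using that by presburger+
  have e3: "4 * i \<noteq> (3 :: nat)" for i by presburger
  have sw: "sw ((wmem s)(3 := w, 4 * ?l := w))"
    using R SZ_ge assms(4) by (intro sw_upd) (auto simp: RR_def safe_def)
  let ?S = "s\<lparr>mem := f, wmem := (wmem s)(3 := w, 4 * ?l := w), input := xs, reads := Suc (reads s)\<rparr>"
  let ?io = "io\<lparr>polls := 0, stack := stack io @ [(u, v, w)], rest := xs\<rparr>"
  have e4: "f (120 + t) = mem s (120 + t)" if "t < 2 * k" for t
    using that by (intro f'') auto
  note R' = R[unfolded RR_def]
  have len': "reads s + length (rest io) = len" using R' assms(2) by simp
  show ?thesis unfolding RR_def
  proof (intro conjI)
    show "safe ?S" using f sw by (simp add: safe_def)
    show "\<forall>x<30. mem ?S x = vv p x \<and> vv p x < b" using R' f'' by simp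
    show "mem ?S 103 = OFF" using R' f'' by simp
    show "\<forall>j i. 2 \<le> j \<and> j < 16 \<longrightarrow> mem ?S (OFF + 16 * i + j) = aa p j i \<and> aa p j i < b"
      using R' e0 by simp
    show "\<forall>t<2 * k. mem ?S (120 + t) = outp p t \<and> outp p t < b" using R' e4 by simp
    show "\<forall>j i. j = 1 \<or> j = 2 \<longrightarrow> wmem ?S (4 * i + j) = ww p j i"
    proof (intro allI impI)
      fix j i :: nat assume j: "j = 1 \<or> j = 2"
      have "((wmem s)(3 := w, 4 * ?l := w)) (4 * i + j) = wmem s (4 * i + j)"
        using e2[OF j, of i] by (metis fun_upd_other)
      moreover have "wmem s (4 * i + j) = ww p j i" using R' j by blast
      ultimately show "wmem ?S (4 * i + j) = ww p j i" by simp
    qed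
    show "\<forall>i<length (stack ?io). (mem ?S (OFF + 16 * i), mem ?S (OFF + 16 * i + 1), wmem ?S (4 * i)) = stack ?io ! i"
    proof (intro allI impI)
      fix i assume "i < length (stack ?io)"
      then consider "i < ?l" | "i = ?l" by force
      then show "(mem ?S (OFF + 16 * i), mem ?S (OFF + 16 * i + 1), wmem ?S (4 * i)) = stack ?io ! i"
      proof cases
        case 1
        then have "(mem s (OFF + 16 * i), mem s (OFF + 16 * i + 1), wmem s (4 * i)) = stack io ! i"
          using R' by blast
        then show ?thesis using 1 e1[OF 1] e3[of i] by (simp add: nth_append)
      next
        case 2
        then show ?thesis using f' by (simp add: nth_append)
      qed
    qed
    have "\<forall>(u, v, w)\<in>set (stack io) \<union> set (rest io). u < b \<and> v < b" using R' by blast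
    then show "\<forall>(u, v, w)\<in>set (stack ?io) \<union> set (rest ?io). u < b \<and> v < b"
      using assms(3) by auto
  qed (use f' len' assms(2-4) P_ge in auto)
qed

text \<open>If nothing is read, the counter of polls grows by one and thereby pays for the
  \<open>c2\<close> steps spent since the last poll; if something is read, the clock starts afresh.
  Either way at most 20 steps are left uncovered.\<close>

lemma POLL_ev:
  assumes R: "RR p io s" and ck: "ck len (c2 * polls io + c2) g s"
    and l: "live io \<Longrightarrow> length (stack io) < SZ"
  shows "ev I (\<lambda>g s. RR p (poll P io) s \<and> ck len (c2 * polls (poll P io) + 20) g s) (POLL P) g s"
proof (cases "live io")
  case False
  have "I g s" "I (Suc g) s" using RR_dead[OF R False] R by (auto simp: I_def RR_safe)
  then show ?thesis
    unfolding POLL_def using R False RR_dead[OF R False]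
    by (intro ev_If) (auto simp: poll_def RR_def intro!: ev_done)
next
  case True
  let ?l = "length (stack io)" let ?c = "polls io"
  let ?m = "c2 * ?c + c2"
  have c: "?c < P" "mem s 101 = ?c" "mem s 102 = ?l" "mem s 103 = OFF" "mem s 100 = 1"
    "input s = rest io" "sm (mem s)" "sw (wmem s)" "reads s + length (rest io) = len"
    using R True by (auto simp: RR_def safe_def)
  have m: "?m \<le> c2 * P"
  proof -
    have "?m = c2 * Suc ?c" by simp
    also have "\<dots> \<le> c2 * P" using c(1) by (intro mult_left_mono) auto
    finally show ?thesis .
  qed
  have PW: "Suc ?c < W" "P < W" "1 < W" "16 < W" "4 < W" "3 < W" "0 < W" "?l < W"
    using c(1) P_le lb_less b_le_W b_ge l[OF True] by linarith+
  have lW: "?l * 16 < W" "?l * 16 + OFF < W" "Suc (?l * 16 + OFF) < W" "?l * 4 < W"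
    using l[OF True] b_large b_le_W by linarith+
  have [simp]: "I g s" "I (Suc g) s" "ck len (Suc ?m) (Suc g) s"
    using ck ck_Suc[OF ck] m by (auto intro!: I_intro[OF RR_safe[OF R]])
  let ?Q1 = "\<lambda>s'. \<exists>f. s' = s\<lparr>mem := f\<rparr> \<and> sm f \<and> f 101 = Suc ?c \<and> f 105 = of_bool (Suc ?c < P) \<and>
    (\<forall>a. a \<noteq> 101 \<and> (a < 104 \<or> 120 \<le> a) \<longrightarrow> f a = mem s a)"
  let ?is1 = "[Const 104 1, Op Plus 101 101 104, Const 104 P, Op Less 105 101 104]"
  have 1: "lst safe ?is1 s ?Q1"
    using c PW by (auto simp: safe_def)
  let ?A1 = "[Const 101 0, Const 104 16, Op Times 108 102 104, Op Plus 108 108 103,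
                Const 104 1, Op Plus 109 108 104, Const 104 4, Op Times 110 102 104, Const 111 3]"
  let ?A2 = "[Store 108 106, Store 109 107, WMove 110 111, Const 104 1, Op Plus 102 102 104]"
  show ?thesis unfolding POLL_def
  proof (rule ev_If)
    show "ev I (\<lambda>g s. RR p (poll P io) s \<and> ck len (c2 * polls (poll P io) + 20) g s)
      (if mem s 100 \<noteq> 0 then Seq (seqs ?is1) (If 105 Skip (Seq (seqs ?A1)
           (Seq (Instr (Read 100 106 107 3)) (If 100 (seqs ?A2) Skip)))) else Skip) (Suc g) s"
      unfolding c(5) if_P[OF one_neq_zero]
    proof (rule ev_Seq[OF ev_seqs_I[OF 1 \<open>ck len (Suc ?m) (Suc g) s\<close>]])
      fix g' s' assume I': "I g' s'" and QC: "?Q1 s' \<and> ck len (Suc ?m + 2 * length ?is1) g' s'"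
      have ck': "ck len (?m + 9) g' s'" using QC by (elim conjE ck_mono) simp
      from QC obtain f where s': "s' = s\<lparr>mem := f\<rparr>" "sm f" "f 101 = Suc ?c" "f 105 = of_bool (Suc ?c < P)"
        "\<And>a. a \<noteq> 101 \<and> (a < 104 \<or> 120 \<le> a) \<Longrightarrow> f a = mem s a"
        by blast
      have m105: "mem s' 105 = of_bool (Suc ?c < P)" using s' by simp
      have Is: "I (Suc g') s'" "I (Suc (Suc g')) s'" "ck len (Suc (Suc (?m + 9))) (Suc (Suc g')) s'"
        using I_intro[OF _ ck_Suc[OF ck']] I_intro[OF _ ck_Suc[OF ck_Suc[OF ck']]] ck_Suc[OF ck_Suc[OF ck']] I' m
        by (auto simp: I_def)
      show "ev I (\<lambda>g s. RR p (poll P io) s \<and> ck len (c2 * polls (poll P io) + 20) g s)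
        (If 105 Skip (Seq (seqs ?A1) (Seq (Instr (Read 100 106 107 3)) (If 100 (seqs ?A2) Skip)))) (Suc g') s'"
      proof (cases "Suc ?c < P")
        case less: True
        have "RR p (poll P io) s'"
          using RR_polls[OF R s'(2,3) less s'(5)] True less s'(1) by (simp add: poll_def)
        moreover have "ck len (c2 * polls (poll P io) + 20) (Suc (Suc g')) s'"
          using less True by (auto simp: poll_def intro!: ck_mono[OF \<open>ck len (Suc (Suc (?m + 9))) _ _\<close>])
        ultimately show ?thesis
          using less m105 Is by (intro ev_If) (auto intro!: ev_done)
      next
        case ge: False
        let ?Q2 = "\<lambda>s''. \<exists>f'. s'' = s\<lparr>mem := f'\<rparr> \<and> sm f' \<and> f' 101 = 0 \<and> f' 108 = OFF + 16 * ?l \<and>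
           f' 109 = OFF + 16 * ?l + 1 \<and> f' 110 = 4 * ?l \<and> f' 111 = 3 \<and>
           (\<forall>a. a \<noteq> 101 \<and> (a < 104 \<or> 120 \<le> a) \<longrightarrow> f' a = mem s a)"
        have 2: "lst safe ?A1 s' ?Q2"
          using s' c PW lW by (auto simp: safe_def)
        show ?thesis
        proof (rule ev_If, goal_cases)
          case 2
          have "ev I (\<lambda>g s. RR p (poll P io) s \<and> ck len (c2 * polls (poll P io) + 20) g s)
             (Seq (seqs ?A1) (Seq (Instr (Read 100 106 107 3)) (If 100 (seqs ?A2) Skip))) (Suc (Suc g')) s'"
          proof (rule ev_Seq[OF ev_seqs_I[OF \<open>lst safe ?A1 s' ?Q2\<close> \<open>ck len (Suc (Suc (?m + 9))) _ _\<close>]])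
            show "Suc (Suc (?m + 9)) + 2 * length ?A1 \<le> c2 * P + c2 + 100" using m by simp
            fix g1 s1 assume I1: "I g1 s1" and QC: "?Q2 s1 \<and> ck len (Suc (Suc (?m + 9)) + 2 * length ?A1) g1 s1"
            have ck1: "ck len (?m + 29) g1 s1" using QC by (elim conjE ck_mono) simp
            from QC obtain f where s1: "s1 = s\<lparr>mem := f\<rparr>" "sm f" "f 101 = 0" "f 108 = OFF + 16 * ?l"
              "f 109 = OFF + 16 * ?l + 1" "f 110 = 4 * ?l" "f 111 = 3"
              "\<And>a. a \<noteq> 101 \<and> (a < 104 \<or> 120 \<le> a) \<Longrightarrow> f a = mem s a"
              by blast
            have I1': "I (Suc g1) s1" using I_intro[OF _ ck_Suc[OF ck1]] I1 m by (auto simp: I_def)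
            let ?R = "\<lambda>g s'. g = 0 \<and> (case rest io of
                [] \<Rightarrow> s' = s\<lparr>mem := f(100 := 0), reads := Suc (reads s)\<rparr>
              | (u, v, w) # xs \<Rightarrow> s' = s\<lparr>mem := f(100 := 1, 106 := u, 107 := v), wmem := (wmem s)(3 := w),
                  input := xs, reads := Suc (reads s)\<rparr>)"
            have uv: "u < W" "v < W" if "rest io = (u, v, w) # xs" for u v w xs
              using R that b_le_W by (auto simp: RR_def)
            show "ev I (\<lambda>g s. RR p (poll P io) s \<and> ck len (c2 * polls (poll P io) + 20) g s)
              (Seq (Instr (Read 100 106 107 3)) (If 100 (seqs ?A2) Skip)) (Suc g1) s1"
            proof (rule ev_Seq[OF ev_Instr[where Q="?R"]])
              show "I (Suc g1) s1" by fact
              fix s2 assume "s2 \<in> set_pmf (exec_instr (Read 100 106 107 3) s1)"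
              then show "I (tick (Suc g1) s1 s2) s2 \<and> ?R (tick (Suc g1) s1 s2) s2"
                using s1 c PW SZ_ge uv by (auto split: list.splits simp: tick_def I_def ck_def safe_def)
            next
              fix g2 s2 assume I2: "I g2 s2" and R2: "?R g2 s2"
              show "ev I (\<lambda>g s. RR p (poll P io) s \<and> ck len (c2 * polls (poll P io) + 20) g s)
                (If 100 (seqs ?A2) Skip) (Suc g2) s2"
              proof (cases "rest io")
                case Nil
                have "RR p (poll P io) s2"
                proof -
                  have "RR p (io\<lparr>polls := 0, live := False\<rparr>) (s\<lparr>mem := f(100 := 0), reads := Suc (reads s)\<rparr>)"
                    by (rule RR_eof[OF R True Nil]) (use s1 PW in auto)
                  then show ?thesis using R2 Nil True ge by (simp add: poll_def)
                qed
                moreover have "ck len m g s2" for m g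
                  using R2 Nil c by (auto simp: ck_def)
                ultimately show ?thesis using R2 Nil I2
                  by (intro ev_If) (auto intro!: ev_done simp: I_def)
              next
                case (Cons x xs)
                obtain u v w where x: "x = (u, v, w)" by (cases x)
                have s2: "s2 = s\<lparr>mem := f(100 := 1, 106 := u, 107 := v), wmem := (wmem s)(3 := w),
                  input := xs, reads := Suc (reads s)\<rparr>" "g2 = 0" using R2 Cons x by auto
                have "lst safe ?A2 s2 (\<lambda>s'. RR p (poll P io) s')"
                proof -
                  have *: "poll P io = io\<lparr>polls := 0, stack := stack io @ [(u, v, w)], rest := xs\<rparr>"
                    using True ge Cons x by (simp add: poll_def)
                  show ?thesis
                  proof (rule lst_mono[where Q="\<lambda>s'. wmem s' = (wmem s)(3 := w, 4 * ?l := w) \<and> input s' = xs \<and>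
                      reads s' = Suc (reads s) \<and> sm (mem s') \<and> mem s' 100 = 1 \<and> mem s' 101 = 0 \<and>
                      mem s' 102 = Suc ?l \<and> mem s' (OFF + 16 * ?l) = u \<and> mem s' (OFF + 16 * ?l + 1) = v \<and>
                      (\<forall>a. (a < 100 \<or> a = 103 \<or> 120 \<le> a) \<and> a \<noteq> OFF + 16 * ?l \<and> a \<noteq> OFF + 16 * ?l + 1 \<longrightarrow>
                        mem s' a = mem s a)"], goal_cases)
                    case 1
                    show ?case unfolding s2
                      using s1 c PW lW uv[OF Cons[unfolded x]] l[OF True] SZ_ge
                      by (auto simp: safe_def)
                  next
                    case (2 s')
                    then have s': "s' = s\<lparr>mem := mem s', wmem := (wmem s)(3 := w, 4 * ?l := w),
                        input := xs, reads := Suc (reads s)\<rparr>"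
                      by (intro state.equality) auto
                    show ?case unfolding *
                      by (subst s', rule RR_push[OF R True Cons[unfolded x] l[OF True]]) (use 2 in auto)
                  qed
                qed
                moreover have "ck len 2 (Suc (Suc g2)) s2" using s2 by (auto simp: ck_def)
                ultimately have "ev I (\<lambda>g s. RR p (poll P io) s \<and> ck len (2 + 2 * length ?A2) g s) (seqs ?A2) (Suc (Suc g2)) s2"
                  by (intro ev_seqs_I) auto
                then have "ev I (\<lambda>g s. RR p (poll P io) s \<and> ck len (c2 * polls (poll P io) + 20) g s) (seqs ?A2) (Suc (Suc g2)) s2"
                  by (rule ev_mono) (auto elim: ck_mono)
                moreover have "I (Suc g2) s2" using I2 s2 by (auto simp: I_def ck_def)
                ultimately show ?thesis using s2 by (intro ev_If) auto
              qed
            qed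
          qed
          then show ?case using ge m105 by simp
        qed (rule Is)
      qed
    next
      show "Suc ?m + 2 * length ?is1 \<le> c2 * P + c2 + 100" using m by simp
    qed
  qed simp
qed

end

section \<open>Popping elements and the simulation theorem for commands\<close>

context machine
begin

definition popped :: "pst \<Rightarrow> element \<Rightarrow> pst" where
  "popped p x = p\<lparr>vv := (vv p)(6 := Suc (vv p 6)),
     aa := (aa p)(2 := (aa p 2)(vv p 6 := fst x), 3 := (aa p 3)(vv p 6 := fst (snd x))),
     ww := (ww p)(1 := (ww p 1)(vv p 6 := snd (snd x)))\<rparr>"

lemma RR_stack:
  assumes R: "RR p io s" and st: "stack io = S @ [x]" and f: "sm f" "f 102 = length S"
    and f': "\<And>a. a < 102 \<or> a = 103 \<or> 120 \<le> a \<Longrightarrow> f a = mem s a"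
  shows "RR p (io\<lparr>stack := S\<rparr>) (s\<lparr>mem := f\<rparr>)"
proof -
  note R' = R[unfolded RR_def]
  have "\<forall>i<length (stack io).
        (mem s (OFF + 16 * i), mem s (OFF + 16 * i + 1), wmem s (4 * i)) = stack io ! i"
    using R' by blast
  then have 1: "\<forall>i<length S. (f (OFF + 16 * i), f (OFF + 16 * i + 1), wmem s (4 * i)) = S ! i"
    using st f' by (simp add: nth_append)
  have 2: "\<forall>(u, v, w)\<in>set S \<union> set (rest io). u < b \<and> v < b"
    using R' st by auto
  have 3: "\<forall>j i. 2 \<le> j \<and> j < 16 \<longrightarrow> f (OFF + 16 * i + j) = aa p j i \<and> aa p j i < b"
    using R' f' by simp
  have 4: "\<forall>t<2 * k. f (120 + t) = outp p t \<and> outp p t < b" using R' f' by simp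
  have 5: "\<forall>j i. j = 1 \<or> j = 2 \<longrightarrow> wmem s (4 * i + j) = ww p j i" using R' by blast
  have 6: "\<forall>x<30. f x = vv p x \<and> vv p x < b" using R' f' by simp
  have 7: "sw (wmem s)" "mem s 103 = OFF" "mem s 100 = of_bool (live io)" "mem s 101 = polls io"
     "polls io < P" "length (stack io) \<le> SZ" "input s = rest io"
     "if live io then reads s + length (rest io) = len else reads s = Suc len \<and> rest io = []"
    using R' unfolding safe_def by blast+
  show ?thesis
    unfolding RR_def safe_def
    using 1 2 3 4 5 6 7 f f' st by simp
qed

lemma POP_lst:
  assumes R: "RR p io s" and st: "stack io = S @ [x]" and c: "vv p 6 < SZ"
  shows "lst safe POP s (RR (popped p x) (io\<lparr>stack := S\<rparr>))"
proof -
  let ?l = "length S" and ?c = "vv p 6"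
  obtain u v w where x: "x = (u, v, w)" by (cases x)
  note R' = R[unfolded RR_def]
  have "(mem s (OFF + 16 * ?l), mem s (OFF + 16 * ?l + 1), wmem s (4 * ?l)) = stack io ! ?l"
    using R' st by (metis length_append_singleton lessI)
  then have a: "mem s (OFF + 16 * ?l) = u" "mem s (OFF + 16 * ?l + 1) = v" "wmem s (4 * ?l) = w"
    using st x by (auto simp: nth_append)
  have "\<forall>(u, v, w)\<in>set (stack io) \<union> set (rest io). u < b \<and> v < b" using R' by blast
  then have uv: "u < b" "v < b" using st x by auto
  have m: "mem s 6 = ?c" "mem s 102 = Suc ?l" "mem s 103 = OFF" "sm (mem s)" "sw (wmem s)" "Suc ?l \<le> SZ"
    using R' st unfolding safe_def by auto
  have bs: "u < W" "v < W" "16 < W" "2 < W" "4 < W" "1 < W" "?l < W" "?l * 16 < W" "?l * 16 + OFF < W"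
     "?c * 16 < W" "?c * 16 + OFF < W" "?c * 16 + OFF + 2 < W" "?c * 16 + OFF + 3 < W" "?c * 4 < W"
     "?c * 4 + 1 < W" "?l * 4 < W" "?l * 16 + OFF + 1 < W" "Suc ?c < W"
    using uv m(6) c b_large b_le_W by linarith+
  have lt: "?c * 16 + OFF + 2 < SM" "?c * 16 + OFF + 3 < SM" "?c * 4 + 1 < SW" using c by auto
  have ne: "?c * 16 + 2 \<noteq> ?l * 16" "?c * 16 + 2 \<noteq> ?l * 16 + 1" "?c * 16 + 3 \<noteq> ?l * 16" "?c * 16 + 3 \<noteq> ?l * 16 + 1"
    by presburger+
  define F where "F = OFF"
  let ?Q = "\<lambda>s'. wmem s' = (wmem s)(?c * 4 + 1 := w) \<and> input s' = input s \<and> reads s' = reads s \<and> sm (mem s') \<and>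
     mem s' 6 = Suc ?c \<and> mem s' 102 = ?l \<and> mem s' (?c * 16 + F + 2) = u \<and> mem s' (?c * 16 + F + 3) = v \<and>
     (\<forall>a. (a < 102 \<or> a = 103 \<or> 120 \<le> a) \<and> a \<noteq> 6 \<and> a \<noteq> ?c * 16 + F + 2 \<and> a \<noteq> ?c * 16 + F + 3 \<longrightarrow>
       mem s' a = mem s a)"
  have F: "120 \<le> F" unfolding F_def by simp
  have a': "mem s (?l * 16 + F) = u" "mem s (?l * 16 + F + 1) = v" "wmem s (?l * 4) = w"
    using a by (simp_all add: F_def add.commute mult.commute)
  have ne: "?c * 16 + F + 2 \<noteq> ?l * 16 + F" "?c * 16 + F + 2 \<noteq> ?l * 16 + F + 1"
     "?c * 16 + F + 3 \<noteq> ?l * 16 + F" "?c * 16 + F + 3 \<noteq> ?l * 16 + F + 1"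
    using ne by auto
  note FF = m[folded F_def] a' bs[folded F_def] lt[folded F_def] ne
  have lst: "lst safe POP s ?Q"
  proof -
    let ?K = "\<lambda>f. sm f \<and> f 6 = ?c \<and> f 102 = ?l \<and> f 103 = F \<and> f 106 = u \<and> f 107 = v"
    let ?U = "\<lambda>f. \<forall>a. a < 102 \<or> a = 103 \<or> 120 \<le> a \<longrightarrow> f a = mem s a"
    let ?is1 = "[Const 104 1, Op Minus 102 102 104, Const 104 16, Op Times 108 102 104, Op Plus 108 108 103,
      Const 104 1, Op Plus 109 108 104, Load 106 108, Load 107 109]"
    let ?is2 = "[Const 104 16, Op Times 112 6 104, Op Plus 112 112 103, Const 104 2, Op Plus 112 112 104]"
    let ?is3 = "[Store 112 106, Const 104 1, Op Plus 112 112 104, Store 112 107]"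
    let ?is4 = "[Const 104 4, Op Times 110 102 104, Op Times 112 6 104, Const 104 1, Op Plus 112 112 104,
      WMove 112 110, Op Plus 6 6 104]"
    obtain A B where AB: "?c * 16 + F + 2 = A" "?l * 16 + F = B" by simp
    have A1: "120 \<le> A" "120 \<le> B" using AB F by linarith+
    have A2: "A < SM" "Suc A < SM" using lt(1,2) AB(1) unfolding F_def by linarith+
    have A3: "A < W" "Suc A < W" "B < W" "Suc B < W" using bs AB unfolding F_def by linarith+
    note A = A1 A2 A3
    have mF: "mem s 103 = F" using m(3) by (simp add: F_def)
    have 1: "lst safe ?is1 s (\<lambda>s'. s' = s\<lparr>mem := mem s'\<rparr> \<and> ?K (mem s') \<and> ?U (mem s'))"
    proof -
      have "mem s B = u" "mem s (Suc B) = v" using AB a' by auto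
      moreover have "B \<noteq> n" "Suc B \<noteq> n" if "n < 120" for n using A that by auto
      ultimately show ?thesis
        using A m(1,2,4,5) mF bs[folded F_def] AB(2) by (simp add: safe_def)
    qed
    have 2: "lst safe ?is2 (s\<lparr>mem := f\<rparr>) (\<lambda>s'. s' = s\<lparr>mem := mem s'\<rparr> \<and> ?K (mem s') \<and> mem s' 112 = A \<and> ?U (mem s'))"
      if "?K f" "?U f" for f
      using that A m(5) bs[folded F_def] AB(1) by (simp add: safe_def)
    have 3: "lst safe ?is3 (s\<lparr>mem := f\<rparr>) (\<lambda>s'. s' = s\<lparr>mem := mem s'\<rparr> \<and> ?K (mem s') \<and> mem s' A = u \<and> mem s' (Suc A) = v \<and>
        (\<forall>a. (a < 102 \<or> a = 103 \<or> 120 \<le> a) \<and> a \<noteq> A \<and> a \<noteq> Suc A \<longrightarrow> mem s' a = mem s a))"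
      if "?K f" "?U f" "f 112 = A" for f
    proof -
      have "A \<noteq> n" "Suc A \<noteq> n" if "n < 120" for n using A that by auto
      then show ?thesis
        using that A m(5) bs by (simp add: safe_def) auto
    qed
    have 4: "lst safe ?is4 (s\<lparr>mem := f\<rparr>) ?Q"
      if "?K f" "f A = u" "f (Suc A) = v"
        "\<forall>a. (a < 102 \<or> a = 103 \<or> 120 \<le> a) \<and> a \<noteq> A \<and> a \<noteq> Suc A \<longrightarrow> f a = mem s a" for f
    proof -
      have "A \<noteq> n" "Suc A \<noteq> n" if "n < 120" for n using A that by auto
      moreover have A3: "?c * 16 + F + 3 = Suc A" using AB by simp
      ultimately show ?thesis
        using that A m(5) bs lt(3) AB(1) a'(3) by (simp add: safe_def A3)
    qed
    have POP: "POP = ?is1 @ ?is2 @ ?is3 @ ?is4" by (simp add: POP_def)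
    show ?thesis unfolding POP
    proof (rule lst_chain[OF 1])
      fix s1 assume Q1: "s1 = s\<lparr>mem := mem s1\<rparr> \<and> ?K (mem s1) \<and> ?U (mem s1)"
      show "lst safe (?is2 @ ?is3 @ ?is4) s1 ?Q"
      proof (subst conjunct1[OF Q1], rule lst_chain[OF 2])
        fix s2 assume Q2: "s2 = s\<lparr>mem := mem s2\<rparr> \<and> ?K (mem s2) \<and> mem s2 112 = A \<and> ?U (mem s2)"
        show "lst safe (?is3 @ ?is4) s2 ?Q"
        proof (subst conjunct1[OF Q2], rule lst_chain[OF 3])
          fix s3 assume Q3: "s3 = s\<lparr>mem := mem s3\<rparr> \<and> ?K (mem s3) \<and> mem s3 A = u \<and> mem s3 (Suc A) = v \<and>
            (\<forall>a. (a < 102 \<or> a = 103 \<or> 120 \<le> a) \<and> a \<noteq> A \<and> a \<noteq> Suc A \<longrightarrow> mem s3 a = mem s a)"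
          show "lst safe ?is4 s3 ?Q"
            by (subst conjunct1[OF Q3], rule 4) (use Q3 in blast)+
        qed (use Q2 in blast)+
      qed (use Q1 in blast)+
    qed
  qed
  have "lst safe POP s (\<lambda>s'. wmem s' = (wmem s)(4 * ?c + 1 := w) \<and> input s' = input s \<and> reads s' = reads s \<and> sm (mem s') \<and>
     mem s' 6 = Suc ?c \<and> mem s' 102 = ?l \<and> mem s' (OFF + 16 * ?c + 2) = u \<and> mem s' (OFF + 16 * ?c + 3) = v \<and>
     (\<forall>a. (a < 102 \<or> a = 103 \<or> 120 \<le> a) \<and> a \<noteq> 6 \<and> a \<noteq> OFF + 16 * ?c + 2 \<and> a \<noteq> OFF + 16 * ?c + 3 \<longrightarrow>
       mem s' a = mem s a))" (is "lst _ _ _ ?Q'")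
    using lst by (simp add: F_def add.commute add.left_commute mult.commute)
  then show ?thesis
  proof (rule lst_mono)
    fix s' assume Q: "?Q' s'"
    \<comment> \<open>\<open>f\<close> undoes the three writes to program data. What remains only
      shortens the stack; the writes are then replayed by the lemmas on single assignments.\<close>
    define f where "f a = (if a \<in> {6, OFF + 16 * ?c + 2, OFF + 16 * ?c + 3} then mem s a else mem s' a)" for a
    have "sm f" using Q m(4) by (auto simp: f_def sm_def)
    then have "RR p (io\<lparr>stack := S\<rparr>) (s\<lparr>mem := f\<rparr>)"
      by (intro RR_stack[OF R st]) (use Q in \<open>auto simp: f_def\<close>)
    from RR_arr[OF this, of 2 ?c u] c uv(1)
    have "RR (p\<lparr>aa := (aa p)(2 := (aa p 2)(?c := u))\<rparr>) (io\<lparr>stack := S\<rparr>)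
       (s\<lparr>mem := f(OFF + 16 * ?c + 2 := u)\<rparr>)" by simp
    from RR_arr[OF this, of 3 ?c v] c uv(2)
    have "RR (p\<lparr>aa := (aa p)(2 := (aa p 2)(?c := u), 3 := (aa p 3)(?c := v))\<rparr>) (io\<lparr>stack := S\<rparr>)
       (s\<lparr>mem := f(OFF + 16 * ?c + 2 := u, OFF + 16 * ?c + 3 := v)\<rparr>)" by simp
    from RR_w[OF this, of 1 ?c w] c
    have "RR (p\<lparr>aa := (aa p)(2 := (aa p 2)(?c := u), 3 := (aa p 3)(?c := v)), ww := (ww p)(1 := (ww p 1)(?c := w))\<rparr>)
       (io\<lparr>stack := S\<rparr>)
       (s\<lparr>mem := f(OFF + 16 * ?c + 2 := u, OFF + 16 * ?c + 3 := v), wmem := (wmem s)(4 * ?c + 1 := w)\<rparr>)" by simp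
    from RR_var[OF this, of 6 "Suc ?c"] c b_ge(3)
    have RR: "RR (p\<lparr>aa := (aa p)(2 := (aa p 2)(?c := u), 3 := (aa p 3)(?c := v)), ww := (ww p)(1 := (ww p 1)(?c := w)),
         vv := (vv p)(6 := Suc ?c)\<rparr>) (io\<lparr>stack := S\<rparr>)
       (s\<lparr>wmem := (wmem s)(4 * ?c + 1 := w), mem := f(OFF + 16 * ?c + 2 := u, OFF + 16 * ?c + 3 := v, 6 := Suc ?c)\<rparr>)"
      by simp
    have "mem s' = f(OFF + 16 * ?c + 2 := u, OFF + 16 * ?c + 3 := v, 6 := Suc ?c)"
      using Q by (auto simp: f_def fun_eq_iff)
    then have "s' = s\<lparr>wmem := (wmem s)(4 * ?c + 1 := w), mem := f(OFF + 16 * ?c + 2 := u, OFF + 16 * ?c + 3 := v, 6 := Suc ?c)\<rparr>"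
      using Q by (intro state.equality) auto
    moreover have "popped p x = p\<lparr>aa := (aa p)(2 := (aa p 2)(?c := u), 3 := (aa p 3)(?c := v)), ww := (ww p)(1 := (ww p 1)(?c := w)),
         vv := (vv p)(6 := Suc ?c)\<rparr>"
      using x by (intro pst.equality) (auto simp: popped_def)
    ultimately show "RR (popped p x) (io\<lparr>stack := S\<rparr>) s'" using RR by simp
  qed
qed

text \<open>Counts polls: it grows by at most one per poll, and bounds \<open>P\<close> times the stack height.\<close>

definition psi :: "iost \<Rightarrow> nat" where
  "psi io = P * length (stack io) + polls io"

text \<open>A push turns the \<open>P - 1\<close> polls counted so far and the present one into a
  stack element worth \<open>P\<close>; the end of the stream only lowers the sum.\<close>

lemma psi_poll: "polls io < P \<Longrightarrow> psi (poll P io) \<le> Suc (psi io)"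
  by (auto simp: psi_def poll_def split: list.splits)

lemma polls_poll: "polls io < P \<Longrightarrow> polls (poll P io) < P"
  using P_ge by (auto simp: poll_def split: list.splits)

lemma live_poll: "live (poll P io) \<Longrightarrow> live io"
  by (auto simp: poll_def split: if_splits)

lemma live_polls: "live ((poll P ^^ m) io) \<Longrightarrow> live io"
  by (induction m) (auto dest: live_poll)

lemma polls_polls: "polls io < P \<Longrightarrow> polls ((poll P ^^ m) io) < P"
  by (induction m) (auto intro: polls_poll)

lemma psi_polls: "polls io < P \<Longrightarrow> psi ((poll P ^^ m) io) \<le> psi io + m"
  by (induction m) (auto intro: order_trans[OF psi_poll] polls_polls)

lemma psi_stack: "psi io < P * SZ \<Longrightarrow> length (stack io) < SZ"
  unfolding psi_def by (metis add_lessD1 mult_less_cancel1)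

lemma RR_bnd: "RR p io s \<Longrightarrow> polls io < P"
  by (simp add: RR_def)

lemma ev_cexp:
  assumes R: "RR p io s" and "wfx e" and ck: "ck len (c2 * polls io + h) g s" and "h + 2 * length (cexp e 30) \<le> c2"
  shows "ev I (\<lambda>g s. (RR p io s \<and> mem s 30 = val e p) \<and> ck len (c2 * polls io + h + 2 * length (cexp e 30)) g s)
    (seqs (cexp e 30)) g s"
proof (rule ev_seqs_I)
  show "lst safe (cexp e 30) s (\<lambda>s. RR p io s \<and> mem s 30 = val e p)"
    using cexp_lst'[OF R \<open>wfx e\<close>, of 30] tmp_RR[OF _ R] by (auto elim!: lst_mono)
  have "c2 * polls io \<le> c2 * P" using RR_bnd[OF R] by (intro mult_left_mono) auto
  then show "c2 * polls io + h + 2 * length (cexp e 30) \<le> c2 * P + c2 + 100" using assms(4) by linarith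
qed (rule ck)

lemma RR_I: "RR p io s \<Longrightarrow> ck len (c2 * polls io + h) g s \<Longrightarrow> h \<le> c2 + 100 \<Longrightarrow> I g s"
proof (rule I_intro)
  assume R: "RR p io s" and "h \<le> c2 + 100"
  moreover have "c2 * polls io \<le> c2 * P" using RR_bnd[OF R] by (intro mult_left_mono) auto
  ultimately show "c2 * polls io + h \<le> c2 * P + c2 + 100" by linarith
qed (auto dest: RR_safe)

text \<open>\<open>h\<close> is the allowance for the steps since the last poll, and 30 exceeds the
  20 steps that a poll may leave over. The premise \<open>h + sz c \<le> c2\<close> keeps every
  stretch between polls affordable. Overflow of the stack is an issue only while the stream is
  live.\<close>

lemma comp_ev:
  assumes "bs c p m p'" "wfc c"
  shows "\<And>io s g h. RR p io s \<Longrightarrow> ck len (c2 * polls io + h) g s \<Longrightarrow> 30 \<le> h \<Longrightarrow> h + sz c \<le> c2 \<Longrightarrow>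
      (live io \<longrightarrow> psi io + m \<le> P * SZ) \<Longrightarrow>
      ev I (\<lambda>g s. RR p' ((poll P ^^ m) io) s \<and> ck len (c2 * polls ((poll P ^^ m) io) + h + sz c) g s) (comp P c) g s"
    (is "\<And>io s g h. _ \<Longrightarrow> _ \<Longrightarrow> _ \<Longrightarrow> _ \<Longrightarrow> _ \<Longrightarrow> ?C c m p' io h g s")
proof -
  \<comment> \<open>The second conjunct speaks of the machine loop entered with its condition
    already evaluated into cell 30; only in this form can the induction return to the head of the
    loop.\<close>
  have "(\<forall>io s g h. RR p io s \<longrightarrow> ck len (c2 * polls io + h) g s \<longrightarrow> 30 \<le> h \<longrightarrow> h + sz c \<le> c2 \<longrightarrow>
      (live io \<longrightarrow> psi io + m \<le> P * SZ) \<longrightarrow> ?C c m p' io h g s) \<and>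
    (\<forall>e d io s g h. c = Whl e d \<longrightarrow> RR p io s \<longrightarrow> mem s 30 = val e p \<longrightarrow>
      ck len (c2 * polls io + h) g s \<longrightarrow> 30 + 2 * length (cexp e 30) \<le> h \<longrightarrow> h + sz d + 2 \<le> c2 \<longrightarrow>
      (live io \<longrightarrow> psi io + m \<le> P * SZ) \<longrightarrow>
      ev I (\<lambda>g s. RR p' ((poll P ^^ m) io) s \<and> ck len (c2 * polls ((poll P ^^ m) io) + Suc h) g s)
        (While 30 (Seq (comp P d) (Seq (POLL P) (seqs (cexp e 30))))) g s)"
    using assms
  proof (induction rule: bs.induct)
    case (bs_Skp p)
    then show ?case by (auto intro!: ev_done intro: RR_I)
  next
    case (bs_At a p)
    have "ev I (\<lambda>g s. RR (eff a p) io s \<and> ck len (c2 * polls io + h + 2 * length (catom a)) g s)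
        (seqs (catom a)) g s"
      if R: "RR p io s" "ck len (c2 * polls io + h) g s" "h + sz (At a) \<le> c2" for io s g h
    proof (rule ev_seqs_I[OF catom_lst[OF R(1)] R(2)])
      have "c2 * polls io \<le> c2 * P" using RR_bnd[OF R(1)] by (intro mult_left_mono) auto
      moreover have "h + 2 * length (catom a) \<le> c2" using R(3) by simp
      ultimately show "c2 * polls io + h + 2 * length (catom a) \<le> c2 * P + c2 + 100" by linarith
    qed (use bs_At in auto)
    then show ?case by simp
  next
    case (bs_Sq c p m p' d m' p'')
    from bs_Sq.IH(2) bs_Sq.prems have IHd: "\<And>io s g h. RR p' io s \<Longrightarrow> ck len (c2 * polls io + h) g s \<Longrightarrow>
        30 \<le> h \<Longrightarrow> h + sz d \<le> c2 \<Longrightarrow> (live io \<longrightarrow> psi io + m' \<le> P * SZ) \<Longrightarrow> ?C d m' p'' io h g s"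
      by simp
    have "?C (Sq c d) (m + m') p'' io h g s"
      if R: "RR p io s" "ck len (c2 * polls io + h) g s" "30 \<le> h" "h + sz (Sq c d) \<le> c2"
        "live io \<longrightarrow> psi io + (m + m') \<le> P * SZ" for io s g h
      unfolding comp.simps
    proof (rule ev_Seq)
      show "?C c m p' io h g s" using bs_Sq that by auto
      fix g1 s1 assume I1: "I g1 s1" "RR p' ((poll P ^^ m) io) s1 \<and>
        ck len (c2 * polls ((poll P ^^ m) io) + h + sz c) g1 s1"
      have e: "(poll P ^^ (m + m')) io = (poll P ^^ m') ((poll P ^^ m) io)"
        by (simp add: funpow_add add.commute[of m])
      have "psi ((poll P ^^ m) io) \<le> psi io + m" using R RR_bnd by (intro psi_polls) auto
      then have l: "live ((poll P ^^ m) io) \<longrightarrow> psi ((poll P ^^ m) io) + m' \<le> P * SZ"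
        using R(5) live_polls[of m io] by auto
      have ck: "ck len (c2 * polls ((poll P ^^ m) io) + (h + sz c + 1)) (Suc g1) s1"
        using ck_Suc I1 by (auto simp: add.assoc)
      have "?C d m' p'' ((poll P ^^ m) io) (h + sz c + 1) (Suc g1) s1"
        by (rule IHd) (use I1 R l ck in auto)
      then show "ev I (\<lambda>g s. RR p'' ((poll P ^^ (m + m')) io) s \<and>
        ck len (c2 * polls ((poll P ^^ (m + m')) io) + h + sz (Sq c d)) g s) (comp P d) (Suc g1) s1"
        unfolding e by (rule ev_mono) (auto elim!: ck_mono)
    qed
    then show ?case by simp
  next
    case (bs_Cnd e p c d m p')
    from bs_Cnd.IH bs_Cnd.prems have IHd: "\<And>io s g h. RR p io s \<Longrightarrow> ck len (c2 * polls io + h) g s \<Longrightarrow>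
        30 \<le> h \<Longrightarrow> h + sz (if val e p \<noteq> 0 then c else d) \<le> c2 \<Longrightarrow> (live io \<longrightarrow> psi io + m \<le> P * SZ) \<Longrightarrow>
        ?C (if val e p \<noteq> 0 then c else d) m p' io h g s"
      by (simp split del: if_split) (simp split: if_split)
    have "?C (Cnd e c d) m p' io h g s"
      if R: "RR p io s" "ck len (c2 * polls io + h) g s" "30 \<le> h" "h + sz (Cnd e c d) \<le> c2"
        "live io \<longrightarrow> psi io + m \<le> P * SZ" for io s g h
      unfolding comp.simps
    proof (rule ev_Seq)
      let ?L = "2 * length (cexp e 30)"
      show "ev I (\<lambda>g s. (RR p io s \<and> mem s 30 = val e p) \<and> ck len (c2 * polls io + h + ?L) g s) (seqs (cexp e 30)) g s"
        using R bs_Cnd.prems by (intro ev_cexp) auto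
      fix g1 s1 assume I1: "I g1 s1" "(RR p io s1 \<and> mem s1 30 = val e p) \<and> ck len (c2 * polls io + h + ?L) g1 s1"
      then have ck1: "ck len (c2 * polls io + (h + ?L + 1)) (Suc g1) s1" using ck_Suc by (auto simp: add.assoc)
      then have ck2: "ck len (c2 * polls io + (h + ?L + 2)) (Suc (Suc g1)) s1" using ck_Suc by fastforce
      show "ev I (\<lambda>g s. RR p' ((poll P ^^ m) io) s \<and> ck len (c2 * polls ((poll P ^^ m) io) + h + sz (Cnd e c d)) g s)
        (If 30 (comp P c) (comp P d)) (Suc g1) s1"
      proof (rule ev_If)
        show "I (Suc g1) s1" using RR_I[OF _ ck1] I1 R(4) by auto
        have "?C (if val e p \<noteq> 0 then c else d) m p' io (h + ?L + 2) (Suc (Suc g1)) s1"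
          by (rule IHd) (use R ck2 I1 in auto)
        moreover have "comp P (if val e p \<noteq> 0 then c else d) = (if mem s1 30 \<noteq> 0 then comp P c else comp P d)"
          using I1 by auto
        ultimately have "ev I (\<lambda>g s. RR p' ((poll P ^^ m) io) s \<and>
            ck len (c2 * polls ((poll P ^^ m) io) + (h + ?L + 2) + sz (if val e p \<noteq> 0 then c else d)) g s)
          (if mem s1 30 \<noteq> 0 then comp P c else comp P d) (Suc (Suc g1)) s1" by simp
        then show "ev I (\<lambda>g s. RR p' ((poll P ^^ m) io) s \<and> ck len (c2 * polls ((poll P ^^ m) io) + h + sz (Cnd e c d)) g s)
          (if mem s1 30 \<noteq> 0 then comp P c else comp P d) (Suc (Suc g1)) s1"
          by (rule ev_mono) (auto elim!: ck_mono)
      qed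
    qed
    then show ?case by simp
  next
    case (bs_Whl_exit e p c)
    have W: "ev I (\<lambda>g s. RR p io s \<and> ck len (c2 * polls io + Suc h) g s)
        (While 30 (Seq (comp P c) (Seq (POLL P) (seqs (cexp e 30))))) g s"
      if R: "RR p io s" "mem s 30 = val e p" "ck len (c2 * polls io + h) g s" "h + sz c + 2 \<le> c2" for io s g h
      using R bs_Whl_exit ck_Suc[OF R(3)]
      by (intro ev_While_exit) (auto intro: RR_I[OF R(1), of "Suc h"] RR_I[OF R(1,3)])
    have "?C (Whl e c) 0 p io h g s"
      if R: "RR p io s" "ck len (c2 * polls io + h) g s" "30 \<le> h" "h + sz (Whl e c) \<le> c2" for io s g h
      unfolding comp.simps
    proof (rule ev_Seq)
      let ?L = "2 * length (cexp e 30)"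
      show "ev I (\<lambda>g s. (RR p io s \<and> mem s 30 = val e p) \<and> ck len (c2 * polls io + h + ?L) g s) (seqs (cexp e 30)) g s"
        using R bs_Whl_exit.prems by (intro ev_cexp) auto
      fix g1 s1 assume I1: "I g1 s1" "(RR p io s1 \<and> mem s1 30 = val e p) \<and> ck len (c2 * polls io + h + ?L) g1 s1"
      then have ck1: "ck len (c2 * polls io + (h + ?L + 1)) (Suc g1) s1" using ck_Suc by (auto simp: add.assoc)
      have "ev I (\<lambda>g s. RR p io s \<and> ck len (c2 * polls io + Suc (h + ?L + 1)) g s)
        (While 30 (Seq (comp P c) (Seq (POLL P) (seqs (cexp e 30))))) (Suc g1) s1"
        using I1 R ck1 by (intro W) auto
      then show "ev I (\<lambda>g s. RR p ((poll P ^^ 0) io) s \<and> ck len (c2 * polls ((poll P ^^ 0) io) + h + sz (Whl e c)) g s)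
        (While 30 (Seq (comp P c) (Seq (POLL P) (seqs (cexp e 30))))) (Suc g1) s1"
        by (rule ev_mono) (auto elim!: ck_mono)
    qed
    then show ?case using W by auto
  next
    case (bs_Whl e p c m p' m' p'')
    from bs_Whl.IH(1) bs_Whl.prems have IH1: "\<And>io s g h. RR p io s \<Longrightarrow> ck len (c2 * polls io + h) g s \<Longrightarrow>
        30 \<le> h \<Longrightarrow> h + sz c \<le> c2 \<Longrightarrow> (live io \<longrightarrow> psi io + m \<le> P * SZ) \<Longrightarrow> ?C c m p' io h g s"
      by simp
    from bs_Whl.IH(2) bs_Whl.prems have IH2: "\<And>io s g h. RR p' io s \<Longrightarrow> mem s 30 = val e p' \<Longrightarrow>
        ck len (c2 * polls io + h) g s \<Longrightarrow> 30 + 2 * length (cexp e 30) \<le> h \<Longrightarrow> h + sz c + 2 \<le> c2 \<Longrightarrow>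
        (live io \<longrightarrow> psi io + m' \<le> P * SZ) \<Longrightarrow>
        ev I (\<lambda>g s. RR p'' ((poll P ^^ m') io) s \<and> ck len (c2 * polls ((poll P ^^ m') io) + Suc h) g s)
          (While 30 (Seq (comp P c) (Seq (POLL P) (seqs (cexp e 30))))) g s"
      by simp
    let ?L = "2 * length (cexp e 30)"
    let ?body = "Seq (comp P c) (Seq (POLL P) (seqs (cexp e 30)))"
    have W: "ev I (\<lambda>g s. RR p'' ((poll P ^^ Suc (m + m')) io) s \<and> ck len (c2 * polls ((poll P ^^ Suc (m + m')) io) + Suc h) g s)
        (While 30 ?body) g s"
      if R: "RR p io s" "mem s 30 = val e p" "ck len (c2 * polls io + h) g s" "30 + ?L \<le> h" "h + sz c + 2 \<le> c2"
        "live io \<longrightarrow> psi io + Suc (m + m') \<le> P * SZ" for io s g h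
    proof (rule ev_While_enter)
      have ck1: "ck len (c2 * polls io + (h + 1)) (Suc g) s" using ck_Suc[OF R(3)] by simp
      let ?io1 = "(poll P ^^ m) io" and ?io2 = "(poll P ^^ Suc m) io"
      have io2: "?io2 = poll P ?io1" by simp
      have e: "(poll P ^^ Suc (m + m')) io = (poll P ^^ m') ?io2"
        by (metis add.commute add_Suc comp_apply funpow_add)
      have psi1: "psi ?io1 \<le> psi io + m" "psi ?io2 \<le> psi io + Suc m"
        using psi_polls[of io m] psi_polls[of io "Suc m"] RR_bnd[OF R(1)] by auto
      have l1: "length (stack ?io1) < SZ" if "live ?io1"
        using psi1 R(6) live_polls[OF that] by (intro psi_stack) auto
      have l2: "live ?io2 \<longrightarrow> psi ?io2 + m' \<le> P * SZ"
        using psi1 R(6) live_polls[of "Suc m" io] by auto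
      show "I g s" using RR_I[OF R(1,3)] R(5) by auto
      show "mem s 30 \<noteq> 0" using R bs_Whl by simp
      show "ev I (\<lambda>g s. ev I (\<lambda>g s. RR p'' ((poll P ^^ Suc (m + m')) io) s \<and>
          ck len (c2 * polls ((poll P ^^ Suc (m + m')) io) + Suc h) g s) (While 30 ?body) (Suc g) s) ?body (Suc g) s"
      proof (rule ev_Seq)
        show "?C c m p' io (h + 1) (Suc g) s"
          by (rule IH1) (use R ck1 in auto)
        fix g1 s1 assume I1: "I g1 s1" "RR p' ?io1 s1 \<and> ck len (c2 * polls ?io1 + (h + 1) + sz c) g1 s1"
        have ck2: "ck len (c2 * polls ?io1 + c2) (Suc g1) s1"
          using ck_Suc[OF conjunct2[OF I1(2)]] R(5) by (auto elim!: ck_mono)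
        show "ev I (\<lambda>g s. ev I (\<lambda>g s. RR p'' ((poll P ^^ Suc (m + m')) io) s \<and>
          ck len (c2 * polls ((poll P ^^ Suc (m + m')) io) + Suc h) g s) (While 30 ?body) (Suc g) s)
          (Seq (POLL P) (seqs (cexp e 30))) (Suc g1) s1"
        proof (rule ev_Seq[OF POLL_ev[OF conjunct1[OF I1(2)] ck2 l1]])
          fix g2 s2 assume I2: "I g2 s2" "RR p' (poll P ?io1) s2 \<and> ck len (c2 * polls (poll P ?io1) + 20) g2 s2"
          then have R2: "RR p' ?io2 s2" "ck len (c2 * polls ?io2 + 21) (Suc g2) s2"
            using I2(2) ck_mono[OF ck_Suc[OF conjunct2[OF I2(2)]], of "c2 * polls (poll P ?io1) + 21"]
            unfolding io2 by auto
          show "ev I (\<lambda>g s. ev I (\<lambda>g s. RR p'' ((poll P ^^ Suc (m + m')) io) s \<and>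
            ck len (c2 * polls ((poll P ^^ Suc (m + m')) io) + Suc h) g s) (While 30 ?body) (Suc g) s)
            (seqs (cexp e 30)) (Suc g2) s2"
          proof (rule ev_mono[OF ev_cexp[OF R2(1) _ R2(2)]])
            show "wfx e" "21 + ?L \<le> c2" using bs_Whl.prems R(4,5) by auto
            fix g3 s3 assume I3: "I g3 s3" "(RR p' ?io2 s3 \<and> mem s3 30 = val e p') \<and> ck len (c2 * polls ?io2 + 21 + ?L) g3 s3"
            \<comment> \<open>The poll left at most 20 steps, so after evaluation of the condition
              the account is again at most \<open>h\<close>: all iterations start alike, however
              many there are.\<close>
            have ck3: "ck len (c2 * polls ?io2 + h) (Suc g3) s3"
              using ck_Suc[OF conjunct2[OF I3(2)]] R(4) by (auto elim!: ck_mono)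
            show "ev I (\<lambda>g s. RR p'' ((poll P ^^ Suc (m + m')) io) s \<and>
              ck len (c2 * polls ((poll P ^^ Suc (m + m')) io) + Suc h) g s) (While 30 ?body) (Suc g3) s3"
              unfolding e by (rule IH2) (use I3 R l2 ck3 in auto)
          qed
        qed
      qed
    qed
    have "?C (Whl e c) (Suc (m + m')) p'' io h g s"
      if R: "RR p io s" "ck len (c2 * polls io + h) g s" "30 \<le> h" "h + sz (Whl e c) \<le> c2"
        "live io \<longrightarrow> psi io + Suc (m + m') \<le> P * SZ" for io s g h
      unfolding comp.simps
    proof (rule ev_Seq)
      show "ev I (\<lambda>g s. (RR p io s \<and> mem s 30 = val e p) \<and> ck len (c2 * polls io + h + ?L) g s) (seqs (cexp e 30)) g s"
        using R bs_Whl.prems by (intro ev_cexp) auto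
      fix g1 s1 assume I1: "I g1 s1" "(RR p io s1 \<and> mem s1 30 = val e p) \<and> ck len (c2 * polls io + h + ?L) g1 s1"
      then have ck1: "ck len (c2 * polls io + (h + ?L + 1)) (Suc g1) s1" using ck_Suc by (auto simp: add.assoc)
      have "ev I (\<lambda>g s. RR p'' ((poll P ^^ Suc (m + m')) io) s \<and>
          ck len (c2 * polls ((poll P ^^ Suc (m + m')) io) + Suc (h + ?L + 1)) g s) (While 30 ?body) (Suc g1) s1"
        using I1 R ck1 by (intro W) auto
      then show "ev I (\<lambda>g s. RR p'' ((poll P ^^ Suc (m + m')) io) s \<and>
          ck len (c2 * polls ((poll P ^^ Suc (m + m')) io) + h + sz (Whl e c)) g s) (While 30 ?body) (Suc g1) s1"
        by (rule ev_mono) (auto elim!: ck_mono)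
    qed
    then show ?case using W by auto
  qed
  then show "\<And>io s g h. RR p io s \<Longrightarrow> ck len (c2 * polls io + h) g s \<Longrightarrow> 30 \<le> h \<Longrightarrow> h + sz c \<le> c2 \<Longrightarrow>
      (live io \<longrightarrow> psi io + m \<le> P * SZ) \<Longrightarrow> ?C c m p' io h g s"
    by blast
qed

subsection \<open>Weakest preconditions with credits\<close>

text \<open>Every loop iteration consumes one of the \<open>n\<close> credits, so no separate termination argument is needed.\<close>

definition wpc :: "com \<Rightarrow> (nat \<Rightarrow> pst \<Rightarrow> bool) \<Rightarrow> nat \<Rightarrow> pst \<Rightarrow> bool" where
  "wpc c Q n p \<longleftrightarrow> (\<exists>m p'. bs c p m p' \<and> m \<le> n \<and> Q (n - m) p')"

lemma bs_Skp_iff: "bs Skp p m p' \<longleftrightarrow> m = 0 \<and> p' = p"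
  by (auto elim: bs.cases intro: bs_Skp)

lemma bs_At_iff: "bs (At a) p m p' \<longleftrightarrow> cond a p \<and> m = 0 \<and> p' = eff a p"
  by (auto elim: bs.cases intro: bs_At)

lemma bs_Cnd_iff: "bs (Cnd e c d) p m p' \<longleftrightarrow> bs (if val e p \<noteq> 0 then c else d) p m p'"
  by (auto elim: bs.cases intro: bs_Cnd)

lemma wpc_Skp [simp]: "wpc Skp Q n p \<longleftrightarrow> Q n p"
  by (simp add: wpc_def bs_Skp_iff)

lemma wpc_At [simp]: "wpc (At a) Q n p \<longleftrightarrow> cond a p \<and> Q n (eff a p)"
  by (simp add: wpc_def bs_At_iff)

lemma wpc_Sq [simp]: "wpc (Sq c d) Q n p \<longleftrightarrow> wpc c (wpc d Q) n p"
proof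
  assume "wpc (Sq c d) Q n p"
  then obtain m p' where "bs (Sq c d) p m p'" "m \<le> n" "Q (n - m) p'" by (auto simp: wpc_def)
  then obtain m1 m2 p1 where "bs c p m1 p1" "bs d p1 m2 p'" "m1 + m2 \<le> n" "Q (n - (m1 + m2)) p'"
    by (auto elim: bs.cases)
  then show "wpc c (wpc d Q) n p"
    unfolding wpc_def by (intro exI[of _ m1] exI[of _ p1] conjI exI[of _ m2] exI[of _ p']) auto
next
  assume "wpc c (wpc d Q) n p"
  then obtain m1 p1 m2 p2 where "bs c p m1 p1" "m1 \<le> n" "bs d p1 m2 p2" "m2 \<le> n - m1" "Q (n - m1 - m2) p2"
    by (auto simp: wpc_def)
  then show "wpc (Sq c d) Q n p"
    unfolding wpc_def by (intro exI[of _ "m1 + m2"] exI[of _ p2]) (auto intro: bs_Sq)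
qed

lemma wpc_Cnd [simp]: "wpc (Cnd e c d) Q n p \<longleftrightarrow> (if val e p \<noteq> 0 then wpc c Q n p else wpc d Q n p)"
  by (simp add: wpc_def bs_Cnd_iff)

lemma wpc_mono: "wpc c Q n p \<Longrightarrow> (\<And>n' p. n' \<le> n \<Longrightarrow> Q n' p \<Longrightarrow> Q' n' p) \<Longrightarrow> wpc c Q' n p"
  unfolding wpc_def by (meson diff_le_self)

lemma wpc_Whl:
  assumes "J n p"
    and body: "\<And>n p. J n p \<Longrightarrow> val e p \<noteq> 0 \<Longrightarrow> wpc c (\<lambda>n p. 1 \<le> n \<and> J (n - 1) p) n p"
    and exit: "\<And>n p. J n p \<Longrightarrow> val e p = 0 \<Longrightarrow> Q n p"
  shows "wpc (Whl e c) Q n p"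
  using assms(1)
proof (induction n arbitrary: p rule: less_induct)
  case (less n)
  show ?case
  proof (cases "val e p = 0")
    case True
    then show ?thesis
      unfolding wpc_def using less.prems exit by (intro exI[of _ 0] exI[of _ p]) (auto intro: bs_Whl_exit)
  next
    case False
    then obtain m p1 where 1: "bs c p m p1" "m \<le> n" "1 \<le> n - m" "J (n - m - 1) p1"
      using body[OF less.prems False] by (auto simp: wpc_def)
    then obtain m' p2 where "bs (Whl e c) p1 m' p2" "m' \<le> n - m - 1" "Q (n - m - 1 - m') p2"
      using less.IH[of "n - m - 1" p1] by (auto simp: wpc_def)
    with 1 False show ?thesis
      unfolding wpc_def by (intro exI[of _ "Suc (m + m')"] exI[of _ p2]) (auto intro: bs_Whl)
  qed
qed

end

section \<open>Approximate median by decimated merge sort\<close>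

text \<open>Ties in weight are broken by the index, so the order is strict and total and ranks are
  unambiguous.\<close>

definition gt :: "(nat \<Rightarrow> real) \<Rightarrow> nat \<Rightarrow> nat \<Rightarrow> bool" where
  "gt w x y \<longleftrightarrow> w y < w x \<or> w x = w y \<and> y < x"

definition ge :: "(nat \<Rightarrow> real) \<Rightarrow> nat \<Rightarrow> nat \<Rightarrow> bool" where
  "ge w x y \<longleftrightarrow> x = y \<or> gt w x y"

lemma gt_irrefl [simp]: "\<not> gt w x x"
  by (simp add: gt_def)

lemma gt_trans: "gt w x y \<Longrightarrow> gt w y z \<Longrightarrow> gt w x z"
  by (auto simp: gt_def)

lemma gt_total: "x \<noteq> y \<Longrightarrow> gt w x y \<or> gt w y x"
  by (auto simp: gt_def)

lemma not_gt: "\<not> gt w x y \<longleftrightarrow> ge w y x"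
  by (auto simp: gt_def ge_def)

lemma gt_ge_trans: "gt w x y \<Longrightarrow> ge w y z \<Longrightarrow> ge w x z"
  by (auto simp: ge_def intro: gt_trans)

lemma gt_weight: "gt w x y \<Longrightarrow> w y \<le> w x"
  by (auto simp: gt_def)

text \<open>The rank of \<open>x\<close> from the heavy end, also for \<open>x\<close> outside
  \<open>A\<close>.\<close>

definition cnt :: "(nat \<Rightarrow> real) \<Rightarrow> nat \<Rightarrow> nat set \<Rightarrow> nat" where
  "cnt w x A = card {e \<in> A. ge w e x}"

definition bsorted :: "(nat \<Rightarrow> real) \<Rightarrow> (nat \<Rightarrow> nat) \<Rightarrow> nat \<Rightarrow> nat \<Rightarrow> bool" where
  "bsorted w S s r \<longleftrightarrow> (\<forall>a<r. \<forall>x y. x < y \<and> y < s \<longrightarrow> gt w (S (a * s + x)) (S (a * s + y)))"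

text \<open>The last conjunct places everything merged so far before both remaining heads; this is
  what lets the larger head be appended.\<close>

definition mrg :: "(nat \<Rightarrow> real) \<Rightarrow> (nat \<Rightarrow> nat) \<Rightarrow> nat \<Rightarrow> nat \<Rightarrow> nat \<Rightarrow> nat \<Rightarrow> nat list \<Rightarrow> bool" where
  "mrg w S base s i j ms \<longleftrightarrow> length ms = i + j \<and> sorted_wrt (gt w) ms \<and>
     set ms = S ` ({base..<base + i} \<union> {base + s..<base + s + j}) \<and>
     (\<forall>x\<in>set ms. (i < s \<longrightarrow> gt w x (S (base + i))) \<and> (j < s \<longrightarrow> gt w x (S (base + s + j))))"

lemma mrg_left:
  assumes m: "mrg w S base s i j ms" and "i < s" "j = s \<or> gt w (S (base + i)) (S (base + s + j))" "j \<le> s"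
    and srt: "\<And>x y. x < y \<Longrightarrow> y < s \<Longrightarrow> gt w (S (base + x)) (S (base + y))"
  shows "mrg w S base s (Suc i) j (ms @ [S (base + i)])"
proof -
  have "{base..<base + Suc i} = insert (base + i) {base..<base + i}" by auto
  moreover have "gt w x (S (base + Suc i))" if "x \<in> set ms" "Suc i < s" for x
    using m that assms(2) srt[of i "Suc i"] by (auto simp: mrg_def intro: gt_trans)
  ultimately show ?thesis
    using m assms(2-4) srt[of i "Suc i"] by (auto simp: mrg_def sorted_wrt_append)
qed

lemma mrg_right:
  assumes m: "mrg w S base s i j ms" and "j < s" "i = s \<or> gt w (S (base + s + j)) (S (base + i))" "i \<le> s"
    and srt: "\<And>x y. x < y \<Longrightarrow> y < s \<Longrightarrow> gt w (S (base + s + x)) (S (base + s + y))"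
  shows "mrg w S base s i (Suc j) (ms @ [S (base + s + j)])"
proof -
  have "{base + s..<base + s + Suc j} = insert (base + s + j) {base + s..<base + s + j}" by auto
  moreover have "gt w x (S (base + s + Suc j))" if "x \<in> set ms" "Suc j < s" for x
    using m that assms(2) srt[of j "Suc j"] by (auto simp: mrg_def intro: gt_trans)
  ultimately show ?thesis
    using m assms(2-4) srt[of j "Suc j"] by (auto simp: mrg_def sorted_wrt_append)
qed

lemma downset_eq:
  assumes "finite A" "\<And>i j :: nat. i < j \<Longrightarrow> j \<in> A \<Longrightarrow> i \<in> A"
  shows "A = {..<card A}"
proof (cases "A = {}")
  case False
  define m where "m = Max A"
  have "m \<in> A" using assms(1) False by (simp add: m_def)
  have "A = {..m}"
  proof (intro set_eqI iffI)
    fix x assume "x \<in> {..m}"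
    then show "x \<in> A" using assms(2)[of x m] \<open>m \<in> A\<close> by (cases "x = m") auto
  qed (use assms(1) in \<open>auto simp: m_def\<close>)
  then show ?thesis by (metis card_atMost lessThan_Suc_atMost)
qed simp

lemma sorted_gt_distinct: "sorted_wrt (gt w) ms \<Longrightarrow> distinct ms"
  by (induction ms) auto

text \<open>In a decreasing list the entries that are at least \<open>x\<close> form a prefix, whose
  length is the rank of \<open>x\<close>.\<close>

lemma cnt_sorted:
  assumes "sorted_wrt (gt w) ms" "i < length ms"
  shows "ge w (ms ! i) x \<longleftrightarrow> i < cnt w x (set ms)"
proof -
  let ?A = "{i. i < length ms \<and> ge w (ms ! i) x}"
  have inj: "inj_on ((!) ms) ?A"
    using sorted_gt_distinct[OF assms(1)] by (auto simp: inj_on_def nth_eq_iff_index_eq)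
  have "(!) ms ` ?A = {e \<in> set ms. ge w e x}" by (auto simp: in_set_conv_nth)
  then have c: "cnt w x (set ms) = card ?A"
    using card_image[OF inj] by (simp add: cnt_def)
  have "?A = {..<card ?A}"
  proof (rule downset_eq)
    fix i j assume "i < j" "j \<in> ?A"
    then show "i \<in> ?A"
      using sorted_wrt_nth_less[OF assms(1), of i j] by (auto intro: gt_ge_trans)
  qed simp
  then have "i \<in> ?A \<longleftrightarrow> i < card ?A" by (metis lessThan_iff)
  then show ?thesis using assms(2) c by simp
qed

lemma cnt_le: "finite A \<Longrightarrow> cnt w x A \<le> card A"
  by (auto simp: cnt_def intro: card_mono)

lemma cnt_Un: "finite A \<Longrightarrow> finite B \<Longrightarrow> A \<inter> B = {} \<Longrightarrow> cnt w x (A \<union> B) = cnt w x A + cnt w x B"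
  unfolding cnt_def by (subst card_Un_disjoint[symmetric]) (auto intro: arg_cong[where f=card])

text \<open>The survivor of each group of \<open>st\<close> consecutive entries is the last and
  smallest one. It is at least \<open>x\<close> exactly if its whole group is, so ranks are divided
  by \<open>st\<close> and rounded down.\<close>

lemma cnt_decimate:
  assumes ms: "sorted_wrt (gt w) ms" "length ms = st * l" and st: "1 \<le> (st :: nat)"
    and T: "\<And>t. t < l \<Longrightarrow> T t = ms ! (st * Suc t - 1)"
  shows "cnt w x (T ` {..<l}) = cnt w x (set ms) div st" "inj_on T {..<l}" "T ` {..<l} \<subseteq> set ms"
    "\<And>a b. a < b \<Longrightarrow> b < l \<Longrightarrow> gt w (T a) (T b)"
proof -
  have lt: "st * Suc t - 1 < length ms" if "t < l" for t
  proof -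
    have "st * Suc t \<le> st * l" using that by (intro mult_left_mono) auto
    then show ?thesis using ms st by (cases st) auto
  qed
  show srt: "gt w (T a) (T b)" if "a < b" "b < l" for a b
  proof -
    have "st * Suc a < st * Suc b" using that st by simp
    then have "st * Suc a - 1 < st * Suc b - 1" using st by (cases st) auto
    then show ?thesis
      using sorted_wrt_nth_less[OF ms(1) _ lt[OF that(2)]] T that by simp
  qed
  show inj: "inj_on T {..<l}"
    by (rule linorder_inj_onI) (use srt in \<open>force+\<close>)
  show "T ` {..<l} \<subseteq> set ms" using T lt by auto
  let ?c = "cnt w x (set ms)"
  have "?c \<le> length ms"
    using cnt_le[of "set ms" w x] card_length[of ms] by simp
  then have cl: "?c div st \<le> l" using ms(2) st by (metis div_le_mono nonzero_mult_div_cancel_left not_one_le_zero)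
  have "{e \<in> T ` {..<l}. ge w e x} = T ` {..<?c div st}"
  proof -
    have "ge w (T t) x \<longleftrightarrow> t < ?c div st" if "t < l" for t
    proof -
      have "ge w (T t) x \<longleftrightarrow> st * Suc t - 1 < ?c" using T[OF that] cnt_sorted[OF ms(1) lt[OF that]] by simp
      also have "\<dots> \<longleftrightarrow> Suc t * st \<le> ?c" using st by (cases st) (auto simp: algebra_simps)
      also have "\<dots> \<longleftrightarrow> Suc t \<le> ?c div st" using st by (simp add: less_eq_div_iff_mult_less_eq)
      finally show ?thesis by auto
    qed
    then show ?thesis using cl by auto
  qed
  then show "cnt w x (T ` {..<l}) = ?c div st"
    unfolding cnt_def[of _ _ "T ` _"] using inj_on_subset[OF inj, of "{..<?c div st}"] cl
    by (simp add: card_image)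
qed

text \<open>Invariant of a pass after \<open>u\<close> merged runs of length \<open>m\<close>, each
  thinned to every \<open>st\<close>-th entry. Rounding costs up to \<open>st - 1\<close> ranks per
  merged run, and these errors add up.\<close>

definition pass :: "(nat \<Rightarrow> real) \<Rightarrow> (nat \<Rightarrow> nat) \<Rightarrow> nat \<Rightarrow> nat \<Rightarrow> nat \<Rightarrow> (nat \<Rightarrow> nat) \<Rightarrow> bool" where
  "pass w S m st u T \<longleftrightarrow> inj_on T {..<m div st * u} \<and> T ` {..<m div st * u} \<subseteq> S ` {..<m * u} \<and>
     bsorted w T (m div st) u \<and>
     (\<forall>x. st * cnt w x (T ` {..<m div st * u}) \<le> cnt w x (S ` {..<m * u}) \<and>
       cnt w x (S ` {..<m * u}) \<le> st * cnt w x (T ` {..<m div st * u}) + (st - 1) * u)"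

lemma pass_0: "pass w S m st 0 T"
  by (simp add: pass_def bsorted_def cnt_def)

lemma pass_cong: "(\<And>t. t < m div st * u \<Longrightarrow> T' t = T t) \<Longrightarrow> pass w S m st u T \<Longrightarrow> pass w S m st u T'"
proof -
  assume T: "\<And>t. t < m div st * u \<Longrightarrow> T' t = T t" and p: "pass w S m st u T"
  have "T' ` {..<m div st * u} = T ` {..<m div st * u}" using T by auto
  moreover have "inj_on T' {..<m div st * u} = inj_on T {..<m div st * u}" using T by (intro inj_on_cong) auto
  moreover have "bsorted w T' (m div st) u" if "bsorted w T (m div st) u"
  proof -
    have "a * (m div st) + x < m div st * u" if "a < u" "x < m div st" for a x
    proof -
      have "a * (m div st) + x < Suc a * (m div st)" using that by simp
      also have "\<dots> \<le> u * (m div st)" using that by (intro mult_right_mono) auto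
      finally show ?thesis by (simp add: mult.commute)
    qed
    then have "T' (a * (m div st) + x) = T (a * (m div st) + x)" if "a < u" "x < m div st" for a x
      using that T by blast
    then show ?thesis using that unfolding bsorted_def by simp
  qed
  ultimately show ?thesis using p by (simp add: pass_def)
qed

lemma pass_Suc:
  assumes p: "pass w S m st u T" and st: "1 \<le> st" "st dvd m" and inj: "inj_on S {..<m * Suc u}"
    and ms: "sorted_wrt (gt w) ms" "length ms = m" "set ms = S ` {m * u..<m * Suc u}"
    and T': "\<And>t. t < m div st * u \<Longrightarrow> T' t = T t" "\<And>t. t < m div st \<Longrightarrow> T' (m div st * u + t) = ms ! (st * Suc t - 1)"
  shows "pass w S m st (Suc u) T'"
proof -
  let ?l = "m div st"
  note p = pass_cong[OF T'(1) p]
  have len: "length ms = st * ?l" using ms st by simp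
  note dec = cnt_decimate[OF ms(1) len st(1), of "\<lambda>t. T' (?l * u + t)", OF T'(2)]
  have im: "T' ` {?l * u..<?l * Suc u} = (\<lambda>t. T' (?l * u + t)) ` {..<?l}"
  proof -
    have "{?l * u..<?l * Suc u} = (+) (?l * u) ` {..<?l}"
      by (simp add: lessThan_atLeast0)
    then show ?thesis by (simp add: image_image)
  qed
  have sT: "{..<?l * Suc u} = {..<?l * u} \<union> {?l * u..<?l * Suc u}" by auto
  have sS: "{..<m * Suc u} = {..<m * u} \<union> {m * u..<m * Suc u}" by auto
  have disj: "S ` {..<m * u} \<inter> S ` {m * u..<m * Suc u} = {}"
    using inj by (subst inj_on_image_Int[symmetric, OF inj]) auto
  have sub: "T' ` {..<?l * u} \<subseteq> S ` {..<m * u}" "T' ` {?l * u..<?l * Suc u} \<subseteq> S ` {m * u..<m * Suc u}"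
    using p dec(3) im ms(3) by (auto simp: pass_def)
  then have disj': "T' ` {..<?l * u} \<inter> T' ` {?l * u..<?l * Suc u} = {}" using disj by blast
  have injT: "inj_on T' {?l * u..<?l * Suc u}"
  proof (rule inj_onI)
    fix a b assume "a \<in> {?l * u..<?l * Suc u}" "b \<in> {?l * u..<?l * Suc u}" "T' a = T' b"
    then have "a - ?l * u = b - ?l * u" "?l * u \<le> a" "?l * u \<le> b"
      using inj_onD[OF dec(2), of "a - ?l * u" "b - ?l * u"] by auto
    then show "a = b" by simp
  qed
  have 1: "inj_on T' {..<?l * Suc u}"
    unfolding sT inj_on_Un using injT disj' p by (auto simp: pass_def)
  have 2: "T' ` {..<?l * Suc u} \<subseteq> S ` {..<m * Suc u}"
    unfolding sT sS using sub by blast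
  have 3: "bsorted w T' ?l (Suc u)"
    unfolding bsorted_def
  proof (intro allI impI)
    fix a x y assume a: "a < Suc u" "x < y \<and> y < ?l"
    show "gt w (T' (a * ?l + x)) (T' (a * ?l + y))"
    proof (cases "a = u")
      case True
      then show ?thesis using a dec(4)[of x y] by (simp add: mult.commute)
    next
      case False
      then show ?thesis using a p by (auto simp: pass_def bsorted_def)
    qed
  qed
  have 4: "st * cnt w x (T' ` {..<?l * Suc u}) \<le> cnt w x (S ` {..<m * Suc u})"
    "cnt w x (S ` {..<m * Suc u}) \<le> st * cnt w x (T' ` {..<?l * Suc u}) + (st - 1) * Suc u" for x
  proof -
    let ?c = "cnt w x (set ms)"
    have e1: "cnt w x (T' ` {..<?l * Suc u}) = cnt w x (T' ` {..<?l * u}) + ?c div st"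
      unfolding sT image_Un using disj' im dec(1) by (simp add: cnt_Un)
    have e2: "cnt w x (S ` {..<m * Suc u}) = cnt w x (S ` {..<m * u}) + ?c"
      unfolding sS image_Un using disj ms(3) by (simp add: cnt_Un)
    have "st * (?c div st) \<le> ?c" by (rule times_div_less_eq_dividend)
    moreover have "?c \<le> st * (?c div st) + (st - 1)"
    proof -
      have "?c = st * (?c div st) + ?c mod st" by simp
      moreover have "?c mod st < st" using st by simp
      ultimately show ?thesis by linarith
    qed
    moreover have "st * cnt w x (T' ` {..<?l * u}) \<le> cnt w x (S ` {..<m * u})"
       "cnt w x (S ` {..<m * u}) \<le> st * cnt w x (T' ` {..<?l * u}) + (st - 1) * u"
      using p by (auto simp: pass_def)
    ultimately show "st * cnt w x (T' ` {..<?l * Suc u}) \<le> cnt w x (S ` {..<m * Suc u})"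
      "cnt w x (S ` {..<m * Suc u}) \<le> st * cnt w x (T' ` {..<?l * Suc u}) + (st - 1) * Suc u"
      unfolding e1 e2 unfolding mult_Suc_right add_mult_distrib2 by linarith+
  qed
  show ?thesis unfolding pass_def using 1 2 3 4 by blast
qed

text \<open>State between two passes: \<open>r\<close> sorted runs of length \<open>s\<close> that represent \<open>\<mu>\<close> times as many
  of the elements \<open>U\<close>. The last conjunct is the rank error; it telescopes because the number of
  runs drops by the factor 4 while \<open>\<mu>\<close> only doubles.\<close>

definition runs :: "(nat \<Rightarrow> real) \<Rightarrow> nat set \<Rightarrow> nat \<Rightarrow> (nat \<Rightarrow> nat) \<Rightarrow> nat \<Rightarrow> nat \<Rightarrow> nat \<Rightarrow> bool" where
  "runs w U q S s tot st \<longleftrightarrow> (\<exists>x r \<mu>. (st = 1 \<and> r = 4 ^ x \<or> st = 2 \<and> r = 2 * 4 ^ x) \<and> (\<exists>a. s = 2 ^ a) \<and>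
     tot = s * r \<and> s * tot = st * q \<and> \<mu> * tot = q \<and> inj_on S {..<tot} \<and> S ` {..<tot} \<subseteq> U \<and>
     bsorted w S s r \<and> (\<forall>x. \<mu> * cnt w x (S ` {..<tot}) \<le> cnt w x U \<and>
       2 * cnt w x U + st * \<mu> * r \<le> 2 * \<mu> * cnt w x (S ` {..<tot}) + q))"

lemma runs_init:
  assumes "q = 4 ^ J" "inj_on S {..<q}" "U = S ` {..<q}"
  shows "runs w U q S 1 q 1"
  unfolding runs_def
  by (intro exI[of _ J] exI[of _ q] exI[of _ 1]) (use assms in \<open>auto simp: bsorted_def intro: exI[of _ 0]\<close>)

text \<open>Without decimation ranks and \<open>\<mu>\<close> persist, the number of runs is halved
  and \<open>st\<close> doubles, so \<open>st * \<mu> * r\<close> is unchanged. With decimation the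
  \<open>4 ^ x\<close> merged runs lose together at most \<open>\<mu> * 4 ^ x\<close> in rank, while
  \<open>st * \<mu> * r\<close> drops from \<open>4 * \<mu> * 4 ^ x\<close> to
  \<open>2 * \<mu> * 4 ^ x\<close>; the difference is exactly twice that loss.\<close>

lemma runs_step:
  assumes R: "runs w U q S s tot st" and "s < tot" and r: "tot = s * r"
    and p: "pass w S (2 * s) st (r div 2) T" and T: "\<And>t. t < tot div st \<Longrightarrow> T' t = T t"
  shows "runs w U q T' (2 * s div st) (tot div st) (3 - st)"
proof -
  obtain x r' \<mu> where 1: "st = 1 \<and> r' = 4 ^ x \<or> st = 2 \<and> r' = 2 * 4 ^ x" "\<exists>a. s = 2 ^ a"
     "tot = s * r'" "s * tot = st * q" "\<mu> * tot = q" "inj_on S {..<tot}" "S ` {..<tot} \<subseteq> U"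
     "bsorted w S s r'" and c: "\<And>x. \<mu> * cnt w x (S ` {..<tot}) \<le> cnt w x U"
       "\<And>x. 2 * cnt w x U + st * \<mu> * r' \<le> 2 * \<mu> * cnt w x (S ` {..<tot}) + q"
    using R unfolding runs_def by blast
  have "0 < s" using 1(2) by auto
  then have rr: "r' = r" using 1(3) r by simp
  have x: "x \<noteq> 0" if "st = 1"
    using that 1(1) assms(2) 1(3) by (cases x) auto
  have ev: "even r" using 1(1) rr x by auto
  have m: "2 * s * (r div 2) = tot" "2 * s div st * (r div 2) = tot div st"
    using ev r 1(1) by (auto elim!: evenE)
  have p': "pass w S (2 * s) st (r div 2) T'"
    by (rule pass_cong[OF _ p]) (use T m in auto)
  have cc: "st * cnt w y (T' ` {..<tot div st}) \<le> cnt w y (S ` {..<tot})"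
     "cnt w y (S ` {..<tot}) \<le> st * cnt w y (T' ` {..<tot div st}) + (st - 1) * (r div 2)" for y
    using p' unfolding pass_def m by auto
  have T': "inj_on T' {..<tot div st}" "T' ` {..<tot div st} \<subseteq> U" "bsorted w T' (2 * s div st) (r div 2)"
    using p' 1(7) unfolding pass_def m by blast+
  show ?thesis
  proof (cases "st = 1")
    case True
    obtain y where y: "x = Suc y" using x[OF True] by (cases x) auto
    obtain a where a: "s = 2 ^ a" using 1(2) by blast
    have r2: "r = 2 * (2 * 4 ^ y)" using True 1(1) rr y by auto
    show ?thesis
      unfolding runs_def True
    proof (rule exI[of _ y], rule exI[of _ "2 * 4 ^ y"], rule exI[of _ \<mu>], intro conjI allI)
      show "\<exists>b. 2 * s div 1 = 2 ^ b" using a by (auto intro: exI[of _ "Suc a"])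
      show "tot div 1 = 2 * s div 1 * (2 * 4 ^ y)" using r r2 by simp
      show "2 * s div 1 * (tot div 1) = (3 - 1) * q" using 1(4) True by simp
      show "\<mu> * (tot div 1) = q" using 1(5) by simp
      fix x show "\<mu> * cnt w x (T' ` {..<tot div 1}) \<le> cnt w x U"
        using cc(1)[of x] c(1)[of x] True by (auto intro: order_trans[OF mult_left_mono])
      have "cnt w x (S ` {..<tot}) = cnt w x (T' ` {..<tot})" using cc[of x] True by auto
      then show "2 * cnt w x U + (3 - 1) * \<mu> * (2 * 4 ^ y) \<le> 2 * \<mu> * cnt w x (T' ` {..<tot div 1}) + q"
        using c(2)[of x] True rr r2 by (simp add: algebra_simps)
    qed (use T' True r2 in auto)
  next
    case False
    then have st: "st = 2" using 1(1) by auto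
    have r2: "r = 2 * 4 ^ x" using st 1(1) rr by auto
    have t2: "tot = 2 * (tot div 2)" using r r2 by simp
    show ?thesis
      unfolding runs_def st
    proof (rule exI[of _ x], rule exI[of _ "4 ^ x"], rule exI[of _ "2 * \<mu>"], intro conjI allI)
      show "\<exists>b. 2 * s div 2 = 2 ^ b" using 1(2) by simp
      show "tot div 2 = 2 * s div 2 * 4 ^ x" using r r2 by simp
      have "2 * (s * (tot div 2)) = s * tot" by (subst (2) t2) simp
      then show "2 * s div 2 * (tot div 2) = (3 - 2) * q" using 1(4) st by simp
      show "2 * \<mu> * (tot div 2) = q" using 1(5) by (subst (asm) t2) (simp add: ac_simps)
      fix y
      have "\<mu> * (2 * cnt w y (T' ` {..<tot div 2})) \<le> \<mu> * cnt w y (S ` {..<tot})"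
        using cc(1)[of y] st by (intro mult_left_mono) auto
      from order_trans[OF this c(1)] show "2 * \<mu> * cnt w y (T' ` {..<tot div 2}) \<le> cnt w y U"
        by (simp only: ac_simps)
      have "\<mu> * cnt w y (S ` {..<tot}) \<le> \<mu> * (2 * cnt w y (T' ` {..<tot div 2}) + 4 ^ x)"
        using cc(2)[of y] st r2 by (intro mult_left_mono) auto
      then have "\<mu> * cnt w y (S ` {..<tot}) \<le> 2 * (\<mu> * cnt w y (T' ` {..<tot div 2})) + \<mu> * 4 ^ x"
        by (simp only: distrib_left mult.left_commute)
      moreover have "2 * cnt w y U + 4 * (\<mu> * 4 ^ x) \<le> 2 * (\<mu> * cnt w y (S ` {..<tot})) + q"
        using c(2)[of y] st rr r2 by (simp add: algebra_simps)
      moreover have "(3 - 2) * (2 * \<mu>) * 4 ^ x = 2 * (\<mu> * 4 ^ x)"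
        "2 * (2 * \<mu>) * cnt w y (T' ` {..<tot div 2}) = 4 * (\<mu> * cnt w y (T' ` {..<tot div 2}))" by simp_all
      ultimately show "2 * cnt w y U + (3 - 2) * (2 * \<mu>) * 4 ^ x \<le> 2 * (2 * \<mu>) * cnt w y (T' ` {..<tot div 2}) + q"
        by linarith
    qed (use T' st r2 in auto)
  qed
qed

lemma runs_div:
  assumes "runs w U q S s tot st" "s < tot"
  shows "\<exists>r. tot = s * r \<and> even r \<and> bsorted w S s r \<and> inj_on S {..<tot} \<and> (st = 1 \<or> st = 2) \<and> 1 \<le> s"
proof -
  obtain x r \<mu> where 1: "st = 1 \<and> r = 4 ^ x \<or> st = 2 \<and> r = 2 * 4 ^ x" "\<exists>a. s = 2 ^ a"
     "tot = s * r" "inj_on S {..<tot}" "bsorted w S s r"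
    using assms unfolding runs_def by blast
  have "x \<noteq> 0" if "st = 1"
    using that 1(1) assms(2) 1(3) by (cases x) auto
  then have "even r" using 1(1) by auto
  then show ?thesis using 1 by auto
qed

lemma runs_tot_le: "runs w U q S s tot st \<Longrightarrow> tot \<le> q \<and> s \<le> tot \<and> (st = 1 \<or> st = 2)"
proof -
  assume "runs w U q S s tot st"
  then obtain x r \<mu> where 1: "st = 1 \<and> r = 4 ^ x \<or> st = 2 \<and> r = 2 * 4 ^ x" "\<exists>a. s = 2 ^ a"
     "tot = s * r" "\<mu> * tot = q" "s * tot = st * q"
    unfolding runs_def by blast
  have "1 \<le> r" using 1(1) by auto
  moreover have "1 \<le> s" using 1(2) by auto
  ultimately have "1 \<le> r" "1 \<le> s" .
  then have "tot \<noteq> 0" using 1 by auto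
  then have "\<mu> \<noteq> 0" using 1(1,4,5) \<open>1 \<le> s\<close> by auto
  then show ?thesis using 1 \<open>1 \<le> r\<close> by auto
qed

text \<open>A single run is left and \<open>s * s = q\<close>, so each entry stands for
  \<open>s\<close> elements. The entry at one quarter of the run has rank at least
  \<open>q / 4\<close>, and the accumulated error of at most \<open>q / 2\<close> keeps its rank at
  most \<open>3 * q / 4\<close>.\<close>

lemma runs_pivot:
  assumes R: "runs w U q S s tot st" and "tot \<le> s" and q: "q = 4 ^ J" "2 \<le> J"
  defines "pv \<equiv> S (s div 4 - 1)"
  shows "pv \<in> U" "q \<le> 4 * cnt w pv U" "4 * cnt w pv U \<le> 3 * q"
proof -
  obtain x r \<mu> where 1: "st = 1 \<and> r = 4 ^ x \<or> st = 2 \<and> r = 2 * 4 ^ x" "\<exists>a. s = 2 ^ a"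
     "tot = s * r" "s * tot = st * q" "\<mu> * tot = q" "inj_on S {..<tot}" "S ` {..<tot} \<subseteq> U"
     "bsorted w S s r" and c: "\<And>x. \<mu> * cnt w x (S ` {..<tot}) \<le> cnt w x U"
       "\<And>x. 2 * cnt w x U + st * \<mu> * r \<le> 2 * \<mu> * cnt w x (S ` {..<tot}) + q"
    using R unfolding runs_def by blast
  have "1 \<le> r" using 1(1) by auto
  moreover have "1 \<le> s" using 1(2) by auto
  ultimately have "1 \<le> r" "1 \<le> s" .
  then have r: "r = 1" using assms(2) 1(3) by (metis le_antisym mult.right_neutral mult_le_cancel1 not_one_le_zero neq0_conv)
  then have st: "st = 1" using 1(1) by auto
  have tot: "tot = s" using 1(3) r by simp
  obtain a where a: "s = 2 ^ a" using 1(2) by blast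
  have "(2 :: nat) ^ (a + a) = 2 ^ (2 * J)" using 1(4) st tot a q by (simp add: power_add power_mult)
  then have "a = J" using power_inject_exp[of "2 :: nat" "a + a" "2 * J"] by simp
  then obtain b where b: "a = Suc (Suc b)" using q(2) by (metis Suc_diff_Suc Suc_le_eq add_2_eq_Suc le_Suc_ex)
  define d where "d = s div 4"
  have s4: "s = 4 * d" "1 \<le> d" using a b by (auto simp: d_def)
  have ms: "sorted_wrt (gt w) (map S [0..<s])"
    using 1(8) r by (auto simp: bsorted_def sorted_wrt_iff_nth_less)
  have cs: "cnt w pv (S ` {..<tot}) = d"
  proof -
    have "ge w (S i) pv \<longleftrightarrow> i < d" if "i < s" for i
    proof (cases "i < d")
      case True
      then have "i = d - 1 \<or> i < d - 1" by auto
      then show ?thesis using True 1(8) r s4 by (auto simp: pv_def ge_def bsorted_def d_def[symmetric])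
    next
      case False
      then have "gt w pv (S i)" using that 1(8) r s4 by (auto simp: pv_def bsorted_def d_def[symmetric])
      then show ?thesis using False not_gt by blast
    qed
    then have "{e \<in> S ` {..<tot}. ge w e pv} = S ` {..<d}" using tot s4 by auto
    then show ?thesis using inj_on_subset[OF 1(6), of "{..<d}"] tot s4 by (simp add: cnt_def card_image)
  qed
  have "\<mu> * s = s * s" using 1(4,5) st tot by simp
  then have "\<mu> = s" using \<open>1 \<le> s\<close> by simp
  then have "4 * \<mu> * d = q" using 1(5) tot s4 by simp
  then show "q \<le> 4 * cnt w pv U" "4 * cnt w pv U \<le> 3 * q"
    using c[of pv] cs by (auto simp: algebra_simps)
  show "pv \<in> U" using 1(7) tot s4 by (auto simp: pv_def d_def[symmetric])
qed

section \<open>Filtering a buffer\<close>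

abbreviation "Pl \<equiv> Bin Plus"
abbreviation "Mi \<equiv> Bin Minus"
abbreviation "Ti \<equiv> Bin Times"
abbreviation "Di \<equiv> Bin Div"
abbreviation "Mo \<equiv> Bin Mod"
abbreviation "Le \<equiv> Bin Less"
abbreviation "Eq \<equiv> Bin Equal"
abbreviation "asg x e \<equiv> At (Asg x e)"
abbreviation "sto j e f \<equiv> At (Sto j e f)"
abbreviation "inc x \<equiv> At (Asg x (Pl (Var x) (Num 1)))"

fun blk :: "com list \<Rightarrow> com" where
  "blk [] = Skp"
| "blk [c] = c"
| "blk (c # d # cs) = Sq c (blk (d # cs))"

definition FOR :: "nat \<Rightarrow> exp \<Rightarrow> com \<Rightarrow> com" where
  "FOR x e c = Sq (asg x (Num 0)) (Whl (Le (Var x) e) (Sq c (inc x)))"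

text \<open>Weights can be compared but not tested for equality, so a tie is recognised by the
  failure of both strict comparisons.\<close>

definition gtc :: "nat \<Rightarrow> nat \<Rightarrow> com" where
  "gtc x y = blk [At (WLs 26 1 (Var y) 1 (Var x)), At (WLs 27 1 (Var x) 1 (Var y)),
     asg 26 (Le (Num 0) (Pl (Var 26) (Ti (Eq (Var 27) (Num 0)) (Le (Var y) (Var x)))))]"

definition mstep :: com where
  "mstep = blk [asg 23 (Arr 11 (Pl (Var 21) (Var 16))), asg 24 (Arr 11 (Pl (Pl (Var 21) (Var 18)) (Var 17))),
     gtc 23 24,
     Cnd (Pl (Eq (Var 17) (Var 18)) (Ti (Le (Var 16) (Var 18)) (Var 26)))
       (blk [asg 25 (Var 23), inc 16]) (blk [asg 25 (Var 24), inc 17]),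
     Cnd (Eq (Mo (Pl (Var 16) (Var 17)) (Var 20)) (Num 0))
       (blk [sto 12 (Var 22) (Var 25), inc 22]) Skp]"

definition mpair :: com where
  "mpair = blk [asg 16 (Num 0), asg 17 (Num 0),
     Whl (Le (Pl (Var 16) (Var 17)) (Pl (Var 18) (Var 18))) mstep,
     asg 21 (Pl (Var 21) (Pl (Var 18) (Var 18)))]"

definition mpass :: com where
  "mpass = blk [asg 22 (Num 0), asg 21 (Num 0), Whl (Le (Var 21) (Var 19)) mpair,
     asg 19 (Di (Var 19) (Var 20)), asg 18 (Di (Pl (Var 18) (Var 18)) (Var 20)),
     asg 20 (Mi (Num 3) (Var 20)), FOR 16 (Var 19) (sto 11 (Var 16) (Arr 12 (Var 16)))]"

definition filt :: com where
  "filt = blk [FOR 16 (Var 14) (sto 11 (Var 16) (Arr 10 (Var 16))),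
     asg 18 (Num 1), asg 19 (Var 14), asg 20 (Num 1), Whl (Le (Var 18) (Var 19)) mpass,
     asg 28 (Arr 11 (Mi (Di (Var 18) (Num 4)) (Num 1))), asg 15 (Num 0),
     FOR 16 (Var 14) (blk [asg 23 (Arr 10 (Var 16)), gtc 28 23,
       Cnd (Var 26) (sto 5 (Var 23) (Num 0)) (blk [sto 10 (Var 15) (Var 23), inc 15])])]"

definition agree :: "nat set \<Rightarrow> nat set \<Rightarrow> pst \<Rightarrow> pst \<Rightarrow> bool" where
  "agree V A p p' \<longleftrightarrow> (\<forall>x. x \<notin> V \<longrightarrow> vv p' x = vv p x) \<and> (\<forall>j. j \<notin> A \<longrightarrow> aa p' j = aa p j) \<and>
     ww p' = ww p \<and> outp p' = outp p"

lemma agree_refl [simp]: "agree V A p p"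
  by (simp add: agree_def)

lemma agree_trans: "agree V A p p' \<Longrightarrow> agree V' A' p' p'' \<Longrightarrow> V \<subseteq> X \<Longrightarrow> V' \<subseteq> X \<Longrightarrow> A \<subseteq> Y \<Longrightarrow> A' \<subseteq> Y \<Longrightarrow> agree X Y p p''"
  unfolding agree_def by (metis subsetD)

lemma agree_mono: "agree V A p p' \<Longrightarrow> V \<subseteq> X \<Longrightarrow> A \<subseteq> Y \<Longrightarrow> agree X Y p p'"
  by (auto simp: agree_def)

lemma agreeD: "agree V A p p' \<Longrightarrow> x \<notin> V \<Longrightarrow> vv p' x = vv p x"
  "agree V A p p' \<Longrightarrow> j \<notin> A \<Longrightarrow> aa p' j = aa p j" "agree V A p p' \<Longrightarrow> ww p' = ww p"
  by (auto simp: agree_def)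

section \<open>Verification of merge sort and filter\<close>

context machine
begin

lemma wpc_gtc [simp]:
  assumes "x \<noteq> 26" "y \<noteq> 26" "x \<noteq> 27" "y \<noteq> 27"
  shows "wpc (gtc x y) Q n p \<longleftrightarrow> Q n (p\<lparr>vv := (vv p)(27 := of_bool (ww p 1 (vv p x) < ww p 1 (vv p y)),
    26 := of_bool (gt (ww p 1) (vv p x) (vv p y)))\<rparr>)"
proof -
  have "(0 < (of_bool (ww p 1 (vv p y) < ww p 1 (vv p x)) :: nat) +
      of_bool (of_bool (ww p 1 (vv p x) < ww p 1 (vv p y)) = (0 :: nat)) * of_bool (vv p y < vv p x)) =
    gt (ww p 1) (vv p x) (vv p y)"
    by (auto simp: gt_def)
  then show ?thesis
    using assms by (simp add: gtc_def fun_upd_twist)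
qed

lemma wpc_FOR:
  assumes J0: "J 0 n (p\<lparr>vv := (vv p)(x := 0)\<rparr>)"
    and step: "\<And>i n p. J i n p \<Longrightarrow> vv p x = i \<Longrightarrow> i < val e p \<Longrightarrow>
      wpc c (\<lambda>n p. vv p x = i \<and> 1 \<le> n \<and> Suc i < b \<and> J (Suc i) (n - 1) (p\<lparr>vv := (vv p)(x := Suc i)\<rparr>)) n p"
    and exit: "\<And>i n p. J i n p \<Longrightarrow> vv p x = i \<Longrightarrow> val e p \<le> i \<Longrightarrow> Q n p"
  shows "wpc (FOR x e c) Q n p"
proof -
  have "wpc (Whl (Le (Var x) e) (Sq c (inc x))) Q n (p\<lparr>vv := (vv p)(x := 0)\<rparr>)"
  proof (rule wpc_Whl[where J="\<lambda>n p. J (vv p x) n p"], goal_cases)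
    case 1
    then show ?case using J0 by simp
  next
    case (2 n p)
    then have "wpc c (\<lambda>n p'. vv p' x = vv p x \<and> 1 \<le> n \<and> Suc (vv p x) < b \<and>
        J (Suc (vv p x)) (n - 1) (p'\<lparr>vv := (vv p')(x := Suc (vv p x))\<rparr>)) n p"
      by (intro step) auto
    then have "wpc c (wpc (inc x) (\<lambda>n p. 1 \<le> n \<and> J (vv p x) (n - 1) p)) n p"
      by (rule wpc_mono) auto
    then show ?case by simp
  next
    case (3 n p)
    then show ?case by (intro exit) (auto split: if_splits)
  qed
  then show ?thesis using b_ge(1) by (simp add: FOR_def)
qed

lemma wpc_copy:
  assumes "j \<noteq> j'" "y \<noteq> 16" "vv p y = m" "m \<le> SZ" "m \<le> n"
    and Q: "\<And>n' p'. n \<le> n' + m \<Longrightarrow> agree {16} {j} p p' \<Longrightarrow> (\<And>t. t < m \<Longrightarrow> aa p' j t = aa p j' t) \<Longrightarrow> Q n' p'"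
  shows "wpc (FOR 16 (Var y) (sto j (Var 16) (Arr j' (Var 16)))) Q n p"
proof (rule wpc_FOR[where J="\<lambda>i n' p'. n \<le> n' + i \<and> i \<le> m \<and> agree {16} {j} p p' \<and> (\<forall>t<i. aa p' j t = aa p j' t)"],
    goal_cases)
  case 1
  then show ?case by (simp add: agree_def)
next
  case (2 i n' p')
  then have "vv p' y = m" "aa p' j' = aa p j'" using assms agreeD by auto
  then show ?case
    using 2 assms b_ge(4) by (auto simp: agree_def less_Suc_eq)
next
  case (3 i n' p')
  then have "vv p' y = m" using assms agreeD by auto
  then show ?case using 3 by (intro Q) auto
qed

lemma dec_step:
  fixes st m :: nat
  assumes "st = 1 \<or> st = 2"
  shows "Suc m mod st = 0 \<Longrightarrow> Suc m div st = Suc (m div st)" "Suc m mod st = 0 \<Longrightarrow> st * Suc (m div st) - 1 = m"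
    "Suc m mod st \<noteq> 0 \<Longrightarrow> Suc m div st = m div st"
  using assms by (auto, presburger+)

lemma dec_lt: "1 \<le> st \<Longrightarrow> t < m div st \<Longrightarrow> st * Suc t - 1 < (m :: nat)"
proof -
  assume a: "1 \<le> st" "t < m div st"
  then have "st * Suc t \<le> st * (m div st)" by (intro mult_left_mono) auto
  also have "\<dots> \<le> m" by (rule times_div_less_eq_dividend)
  finally show ?thesis using a by (cases st) auto
qed

definition MJ :: "nat \<Rightarrow> pst \<Rightarrow> nat \<Rightarrow> nat \<Rightarrow> nat list \<Rightarrow> nat \<Rightarrow> pst \<Rightarrow> bool" where
  "MJ n p i j ms n' p' \<longleftrightarrow> n \<le> n' + (i + j) \<and> vv p' 16 = i \<and> vv p' 17 = j \<and> i \<le> vv p 18 \<and> j \<le> vv p 18 \<and>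
     agree {16, 17, 22, 23, 24, 25, 26, 27} {12} p p' \<and> vv p' 22 = vv p 22 + (i + j) div vv p 20 \<and>
     mrg (ww p 1) (aa p 11) (vv p 21) (vv p 18) i j ms \<and>
     (\<forall>t<(i + j) div vv p 20. aa p' 12 (vv p 22 + t) = ms ! (vv p 20 * Suc t - 1)) \<and>
     (\<forall>t<vv p 22. aa p' 12 t = aa p 12 t)"

lemma MJ_step:
  assumes J: "MJ n p i j ms n' p'" and st: "vv p 20 = 1 \<or> vv p 20 = 2" and n': "n' \<le> n'' + 1"
    and ij: "i' + j' = Suc (i + j)" "i' \<le> vv p 18" "j' \<le> vv p 18"
    and mrg: "mrg (ww p 1) (aa p 11) (vv p 21) (vv p 18) i' j' (ms @ [z])"
    and p'': "agree {16, 17, 22, 23, 24, 25, 26, 27} {12} p' p''" "vv p'' 16 = i'" "vv p'' 17 = j'"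
    and o: "vv p'' 22 = (if Suc (i + j) mod vv p 20 = 0 then Suc (vv p' 22) else vv p' 22)"
    and T: "aa p'' 12 = (if Suc (i + j) mod vv p 20 = 0 then (aa p' 12)(vv p' 22 := z) else aa p' 12)"
  shows "MJ n p i' j' (ms @ [z]) n'' p''"
proof -
  let ?st = "vv p 20"
  have len: "length ms = i + j" using J by (auto simp: MJ_def mrg_def)
  have 1: "agree {16, 17, 22, 23, 24, 25, 26, 27} {12} p p''"
    using J p''(1) by (auto simp: MJ_def intro: agree_trans)
  have 2: "vv p'' 22 = vv p 22 + (i' + j') div ?st"
    using J o dec_step[OF st, of "i + j"] unfolding ij by (auto simp: MJ_def)
  have 3: "aa p'' 12 (vv p 22 + t) = (ms @ [z]) ! (?st * Suc t - 1)" if "t < (i' + j') div ?st" for t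
  proof (cases "t < (i + j) div ?st")
    case True
    then have "?st * Suc t - 1 < length ms" using dec_lt[of ?st t "i + j"] st len by auto
    then show ?thesis using True J T by (auto simp: MJ_def nth_append)
  next
    case False
    then have "Suc (i + j) mod ?st = 0" "t = (i + j) div ?st"
      using that dec_step[OF st, of "i + j"] unfolding ij by (cases "Suc (i + j) mod ?st = 0"; simp)+
    then show ?thesis using J T dec_step(2)[OF st, of "i + j"] len by (auto simp: MJ_def nth_append)
  qed
  have 4: "aa p'' 12 t = aa p 12 t" if "t < vv p 22" for t
    using that J T by (auto simp: MJ_def)
  show ?thesis unfolding MJ_def
    using 1 2 3 4 mrg ij p'' J n' by (auto simp: MJ_def)
qed

lemma wpc_mpair:
  assumes st: "vv p 20 = 1 \<or> vv p 20 = 2" and s: "1 \<le> vv p 18" "vv p 21 + 2 * vv p 18 \<le> SZ" "vv p 22 + 2 * vv p 18 \<le> SZ"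
    and n: "2 * vv p 18 \<le> n"
    and srt: "\<And>x y. x < y \<Longrightarrow> y < vv p 18 \<Longrightarrow> gt (ww p 1) (aa p 11 (vv p 21 + x)) (aa p 11 (vv p 21 + y))"
      "\<And>x y. x < y \<Longrightarrow> y < vv p 18 \<Longrightarrow> gt (ww p 1) (aa p 11 (vv p 21 + vv p 18 + x)) (aa p 11 (vv p 21 + vv p 18 + y))"
    and inj: "inj_on (aa p 11) {vv p 21..<vv p 21 + 2 * vv p 18}"
    and Q: "\<And>n' p' ms. n \<le> n' + 2 * vv p 18 \<Longrightarrow> agree {16, 17, 21, 22, 23, 24, 25, 26, 27} {12} p p' \<Longrightarrow>
      vv p' 21 = vv p 21 + 2 * vv p 18 \<Longrightarrow> vv p' 22 = vv p 22 + 2 * vv p 18 div vv p 20 \<Longrightarrow>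
      (\<And>t. t < vv p 22 \<Longrightarrow> aa p' 12 t = aa p 12 t) \<Longrightarrow> sorted_wrt (gt (ww p 1)) ms \<Longrightarrow> length ms = 2 * vv p 18 \<Longrightarrow>
      set ms = aa p 11 ` {vv p 21..<vv p 21 + 2 * vv p 18} \<Longrightarrow>
      (\<And>t. t < 2 * vv p 18 div vv p 20 \<Longrightarrow> aa p' 12 (vv p 22 + t) = ms ! (vv p 20 * Suc t - 1)) \<Longrightarrow> Q n' p'"
  shows "wpc mpair Q n p"
proof -
  let ?s = "vv p 18" and ?base = "vv p 21" and ?S = "aa p 11" and ?w = "ww p 1"
  have "wpc (Whl (Le (Pl (Var 16) (Var 17)) (Pl (Var 18) (Var 18))) mstep)
     (wpc (asg 21 (Pl (Var 21) (Pl (Var 18) (Var 18)))) Q) n (p\<lparr>vv := (vv p)(16 := 0, 17 := 0)\<rparr>)"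
  proof (rule wpc_Whl[where J="\<lambda>n' p'. \<exists>i j ms. MJ n p i j ms n' p'"], goal_cases)
    case 1
    have "MJ n p 0 0 [] n (p\<lparr>vv := (vv p)(16 := 0, 17 := 0)\<rparr>)"
      by (simp add: MJ_def mrg_def agree_def)
    then show ?case by blast
  next
    case (2 n' p')
    then obtain i j ms where J: "MJ n p i j ms n' p'" by blast
    have v: "vv p' 16 = i" "vv p' 17 = j" "vv p' 18 = ?s" "vv p' 20 = vv p 20" "vv p' 21 = ?base"
      "aa p' 11 = ?S" "ww p' = ww p" and ij: "i \<le> ?s" "j \<le> ?s" and o: "vv p' 22 = vv p 22 + (i + j) div vv p 20"
      and mrg: "mrg ?w ?S ?base ?s i j ms"
      using J by (auto simp: MJ_def agree_def)
    have lt: "i + j < 2 * ?s" using 2(2) v by auto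
    have n': "1 \<le> n'" using J lt n by (auto simp: MJ_def)
    have "(i + j) div vv p 20 \<le> i + j" by simp
    then have oS: "vv p' 22 < SZ" "Suc (vv p' 22) < b" "Suc i < b" "Suc j < b"
      using o lt s b_ge(3) SZ_ge ij by linarith+
    define C where "C \<longleftrightarrow> j = ?s \<or> i < ?s \<and> gt ?w (?S (?base + i)) (?S (?base + ?s + j))"
    have CC: "(j = ?s \<longrightarrow> \<not> (i < ?s \<and> gt ?w (?S (?base + i)) (?S (?base + ?s + j)))) \<longrightarrow> True" by simp
    show ?case
    proof (cases C)
      case True
      have i: "i < ?s" using True lt ij by (auto simp: C_def)
      let ?z = "?S (?base + i)"
      have m: "mrg ?w ?S ?base ?s (Suc i) j (ms @ [?z])"
        by (rule mrg_left[OF mrg i]) (use True ij srt(1) in \<open>auto simp: C_def\<close>)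
      have "\<exists>i j ms. MJ n p i j ms (n' - 1) p''"
        if "agree {16, 17, 22, 23, 24, 25, 26, 27} {12} p' p''" "vv p'' 16 = Suc i" "vv p'' 17 = j"
          "vv p'' 22 = (if Suc (i + j) mod vv p 20 = 0 then Suc (vv p' 22) else vv p' 22)"
          "aa p'' 12 = (if Suc (i + j) mod vv p 20 = 0 then (aa p' 12)(vv p' 22 := ?z) else aa p' 12)" for p''
      proof -
        have "MJ n p (Suc i) j (ms @ [?z]) (n' - 1) p''"
          by (rule MJ_step[OF J st _ _ _ _ m that]) (use i ij in auto)
        then show ?thesis by blast
      qed
      then show ?thesis
        unfolding mstep_def using True v oS n' i
        by (auto simp: C_def agree_def)
    next
      case False
      have j: "j < ?s" using False ij by (auto simp: C_def)
      \<comment> \<open>Totality of the order needs distinct entries, which the injectivity of array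
        11 on the two runs supplies.\<close>
      have i: "i = ?s \<or> gt ?w (?S (?base + ?s + j)) (?S (?base + i))"
      proof (cases "i = ?s")
        case ne: False
        then have "?S (?base + i) \<noteq> ?S (?base + ?s + j)"
          using inj_on_contraD[OF inj, of "?base + i" "?base + ?s + j"] ij j by auto
        then show ?thesis using gt_total False ne ij by (auto simp: C_def)
      qed simp
      let ?z = "?S (?base + ?s + j)"
      have m: "mrg ?w ?S ?base ?s i (Suc j) (ms @ [?z])"
        by (rule mrg_right[OF mrg j i ij(1)]) (use srt(2) in auto)
      have "\<exists>i j ms. MJ n p i j ms (n' - 1) p''"
        if "agree {16, 17, 22, 23, 24, 25, 26, 27} {12} p' p''" "vv p'' 16 = i" "vv p'' 17 = Suc j"
          "vv p'' 22 = (if Suc (i + j) mod vv p 20 = 0 then Suc (vv p' 22) else vv p' 22)"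
          "aa p'' 12 = (if Suc (i + j) mod vv p 20 = 0 then (aa p' 12)(vv p' 22 := ?z) else aa p' 12)" for p''
      proof -
        have "MJ n p i (Suc j) (ms @ [?z]) (n' - 1) p''"
          by (rule MJ_step[OF J st _ _ _ _ m that]) (use j ij in auto)
        then show ?thesis by blast
      qed
      then show ?thesis
        unfolding mstep_def using False v oS n' j
        by (auto simp: C_def agree_def)
    qed
  next
    case (3 n' p')
    then obtain i j ms where J: "MJ n p i j ms n' p'" by blast
    have v: "vv p' 16 = i" "vv p' 17 = j" "vv p' 18 = ?s" "vv p' 21 = ?base" "i \<le> ?s" "j \<le> ?s"
      using J by (auto simp: MJ_def agree_def)
    then have ij: "i = ?s" "j = ?s" using 3(2) by (auto split: if_splits)
    have "{?base..<?base + ?s} \<union> {?base + ?s..<?base + ?s + ?s} = {?base..<?base + 2 * ?s}" by auto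
    then have "Q n' (p'\<lparr>vv := (vv p')(21 := ?base + 2 * ?s)\<rparr>)"
      using J ij by (intro Q[of n' _ ms]) (auto simp: MJ_def mrg_def agree_def mult_2)
    then show ?case using v s b_ge(3) SZ_ge by (simp add: mult_2)
  qed
  then show ?thesis by (simp add: mpair_def)
qed

text \<open>The three shares of the cost are merging, the loop over pairs of runs, and copying back;
  each is at most the current total length.\<close>

lemma wpc_mpass:
  assumes R: "runs (ww p 1) U q (aa p 11) (vv p 18) (vv p 19) (vv p 20)" and lt: "vv p 18 < vv p 19"
    and q: "q \<le> SZ" and n: "3 * vv p 19 \<le> n"
    and Q: "\<And>n' p'. n \<le> n' + 3 * vv p 19 \<Longrightarrow> agree {16, 17, 18, 19, 20, 21, 22, 23, 24, 25, 26, 27} {11, 12} p p' \<Longrightarrow>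
      runs (ww p 1) U q (aa p' 11) (vv p' 18) (vv p' 19) (vv p' 20) \<Longrightarrow>
      vv p' 19 = vv p 19 div vv p 20 \<Longrightarrow> vv p' 20 = 3 - vv p 20 \<Longrightarrow> Q n' p'"
  shows "wpc mpass Q n p"
proof -
  let ?s = "vv p 18" and ?tot = "vv p 19" and ?st = "vv p 20" and ?S = "aa p 11" and ?w = "ww p 1"
  obtain r where r: "?tot = ?s * r" "even r" "bsorted ?w ?S ?s r" "inj_on ?S {..<?tot}" "?st = 1 \<or> ?st = 2" "1 \<le> ?s"
    using runs_div[OF R lt] by blast
  have tot: "?tot \<le> SZ" "?tot < b" using runs_tot_le[OF R] q b_ge(4) by auto
  define h where "h = r div 2"
  have h: "?tot = 2 * ?s * h" "r = 2 * h" using r by (auto simp: h_def)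
  have dvd: "?st dvd 2 * ?s" "1 \<le> ?st" using r(5) by auto
  have htot: "h \<le> ?tot" using h r(6) by simp
  let ?l = "2 * ?s div ?st"
  have l: "?l \<le> 2 * ?s" by simp
  have l2: "?l * h = ?tot div ?st" using h r(5) by auto
  let ?rest = "blk [asg 19 (Di (Var 19) (Var 20)), asg 18 (Di (Pl (Var 18) (Var 18)) (Var 20)),
     asg 20 (Mi (Num 3) (Var 20)), FOR 16 (Var 19) (sto 11 (Var 16) (Arr 12 (Var 16)))]"
  have fin: "wpc ?rest Q n1 p1"
    if p1: "n \<le> n1 + 2 * ?tot" "agree {16, 17, 21, 22, 23, 24, 25, 26, 27} {12} p p1" "pass ?w ?S (2 * ?s) ?st h (aa p1 12)" for n1 p1
  proof -
    have v: "vv p1 18 = ?s" "vv p1 19 = ?tot" "vv p1 20 = ?st" using p1(2) by (auto simp: agree_def)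
    have "?tot div ?st \<le> ?tot" by simp
    then have ts: "?tot div ?st \<le> SZ" "?tot div ?st \<le> n1" using tot p1(1) n by linarith+
    have "2 * ?s \<le> ?tot" using h lt r(6) by (cases h) auto
    then have sb: "(?s + ?s) div ?st < b" using tot(2) div_le_dividend[of "?s + ?s" ?st] by linarith
    let ?p2 = "p1\<lparr>vv := (vv p1)(19 := ?tot div ?st, 18 := (?s + ?s) div ?st, 20 := 3 - ?st)\<rparr>"
    have "wpc (FOR 16 (Var 19) (sto 11 (Var 16) (Arr 12 (Var 16)))) Q n1 ?p2"
    proof (rule wpc_copy[where m="?tot div ?st"])
      fix n' p' assume a: "n1 \<le> n' + ?tot div ?st" "agree {16} {11} ?p2 p'"
        "\<And>t. t < ?tot div ?st \<Longrightarrow> aa p' 11 t = aa ?p2 12 t"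
      have v': "vv p' 18 = ?l" "vv p' 19 = ?tot div ?st" "vv p' 20 = 3 - ?st"
        using a(2) by (auto simp: agree_def mult_2)
      have "runs ?w U q (aa p' 11) ?l (?tot div ?st) (3 - ?st)"
        by (rule runs_step[OF R lt r(1), where T="aa p1 12"]) (use p1(3) h a(3) in auto)
      moreover have "?tot div ?st \<le> ?tot" by simp
      then have "n \<le> n' + 3 * ?tot" using a(1) p1(1) by linarith
      moreover have "agree {16, 17, 18, 19, 20, 21, 22, 23, 24, 25, 26, 27} {11, 12} p p'"
        using p1(2) a(2) by (auto simp: agree_def)
      ultimately show "Q n' p'" using v' by (intro Q) auto
    qed (use ts in auto)
    then show ?thesis using v sb by simp
  qed
  have "wpc (Whl (Le (Var 21) (Var 19)) mpair) (wpc ?rest Q) n (p\<lparr>vv := (vv p)(22 := 0, 21 := 0)\<rparr>)"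
  proof (rule wpc_Whl[where J="\<lambda>n' p'. \<exists>u. vv p' 21 = 2 * ?s * u \<and> u \<le> h \<and> vv p' 22 = ?l * u \<and>
      pass ?w ?S (2 * ?s) ?st u (aa p' 12) \<and> agree {16, 17, 21, 22, 23, 24, 25, 26, 27} {12} p p' \<and>
      n \<le> n' + 2 * ?s * u + u"], goal_cases)
    case 1
    show ?case by (intro exI[of _ 0]) (auto simp: pass_0 agree_def)
  next
    case (2 n' p')
    then obtain u where u: "vv p' 21 = 2 * ?s * u" "u \<le> h" "vv p' 22 = ?l * u"
      "pass ?w ?S (2 * ?s) ?st u (aa p' 12)" "agree {16, 17, 21, 22, 23, 24, 25, 26, 27} {12} p p'"
      "n \<le> n' + 2 * ?s * u + u" by blast
    have v: "vv p' 18 = ?s" "vv p' 19 = ?tot" "vv p' 20 = ?st" "aa p' 11 = ?S" "ww p' = ww p"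
      using u(5) by (auto simp: agree_def)
    have uh: "u < h" using 2(2) u(1) v h by (auto split: if_splits)
    then have le: "2 * ?s * Suc u \<le> ?tot" unfolding h by (intro mult_le_mono) auto
    have lu: "?l * u \<le> 2 * ?s * u" by (intro mult_le_mono) auto
    have n': "2 * ?s + 1 \<le> n'"
    proof -
      have "2 * ?s * u + u + 2 * ?s + 1 = 2 * ?s * Suc u + Suc u" by simp
      also have "\<dots> \<le> ?tot + ?tot" using le uh htot by linarith
      finally show ?thesis using u(6) n lt by linarith
    qed
    have srt: "gt ?w (?S (?s * a + x)) (?S (?s * a + y))" if "x < y" "y < ?s" "a < r" for x y a
      using r(3) that by (auto simp: bsorted_def mult.commute)
    show ?case
    proof (rule wpc_mpair, goal_cases)
      case 1 show ?case using v r by simp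
    next
      case 2 show ?case using v r by simp
    next
      case 3 show ?case using u(1) v le tot by simp
    next
      case 4
      have "2 * ?s * Suc u = 2 * ?s * u + 2 * ?s" by simp
      then have "?l * u + 2 * ?s \<le> SZ" using lu le tot by linarith
      then show ?case using u(3) v by simp
    next
      case 5 show ?case using n' v by simp
    next
      case (6 x y)
      then show ?case using srt[of x y "2 * u"] uh h v u(1) by (simp add: ac_simps)
    next
      case (7 x y)
      then show ?case using srt[of x y "2 * u + 1"] uh h v u(1) by (simp add: algebra_simps)
    next
      case 8
      show ?case using inj_on_subset[OF r(4)] le v u(1) by (auto simp: subset_iff)
    next
      case (9 n2 p2 ms)
      have "pass ?w ?S (2 * ?s) ?st (Suc u) (aa p2 12)"
        by (rule pass_Suc[OF u(4) dvd(2,1) inj_on_subset[OF r(4)], of ms])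
          (use 9 v u le in \<open>auto simp: algebra_simps\<close>)
      moreover have "agree {16, 17, 21, 22, 23, 24, 25, 26, 27} {12} p p2"
        using agree_trans[OF u(5) 9(2)] by auto
      ultimately have "vv p2 21 = 2 * ?s * Suc u \<and> Suc u \<le> h \<and> vv p2 22 = ?l * Suc u \<and>
        pass ?w ?S (2 * ?s) ?st (Suc u) (aa p2 12) \<and> agree {16, 17, 21, 22, 23, 24, 25, 26, 27} {12} p p2 \<and>
        n \<le> (n2 - 1) + 2 * ?s * Suc u + Suc u"
        using 9(1,3,4) u v uh by auto
      moreover have "1 \<le> n2" using 9(1) n' v by simp
      ultimately show ?case by blast
    qed
  next
    case (3 n' p')
    then obtain u where u: "vv p' 21 = 2 * ?s * u" "u \<le> h" "vv p' 22 = ?l * u"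
      "pass ?w ?S (2 * ?s) ?st u (aa p' 12)" "agree {16, 17, 21, 22, 23, 24, 25, 26, 27} {12} p p'"
      "n \<le> n' + 2 * ?s * u + u" by blast
    have "vv p' 19 = ?tot" using u(5) by (auto simp: agree_def)
    then have "2 * ?s * h \<le> 2 * ?s * u" using 3(2) u(1) h by (auto split: if_splits)
    then have uh: "u = h" using u(2) r(6) by auto
    have "n \<le> n' + ?tot + h" using u(6) unfolding uh h(1)[symmetric] .
    then have "n \<le> n' + 2 * ?tot" using htot by linarith
    then show ?case using fin u uh by blast
  qed
  then show ?thesis using b_ge(1) by (simp add: mpass_def)
qed

text \<open>Of the \<open>18 * q\<close> credits, \<open>q\<close> pay for the copy,
  \<open>16 * q\<close> for all passes and \<open>q\<close> for the partition. The pivot is only an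
  approximate median, but the partition by it is exact, so no dropped element is heavier than a kept
  one.\<close>

lemma wpc_filt:
  assumes q: "vv p 14 = q" "q = 4 ^ J" "2 \<le> J" "q \<le> SZ"
    and inj: "inj_on (aa p 10) {..<q}" and U: "U = aa p 10 ` {..<q}" "\<And>e. e \<in> U \<Longrightarrow> e < SZ" and n: "18 * q \<le> n"
    and Q: "\<And>n' p' c K. n \<le> n' + 18 * q \<Longrightarrow>
      agree {15, 16, 17, 18, 19, 20, 21, 22, 23, 24, 25, 26, 27, 28} {5, 10, 11, 12} p p' \<Longrightarrow> vv p' 15 = c \<Longrightarrow>
      q \<le> 4 * c \<Longrightarrow> 4 * c \<le> 3 * q \<Longrightarrow> inj_on (aa p' 10) {..<c} \<Longrightarrow> K = aa p' 10 ` {..<c} \<Longrightarrow> K \<subseteq> U \<Longrightarrow>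
      (\<And>e. aa p' 5 e = (if e \<in> U - K then 0 else aa p 5 e)) \<Longrightarrow>
      (\<And>e f. e \<in> U - K \<Longrightarrow> f \<in> K \<Longrightarrow> ww p 1 e \<le> ww p 1 f) \<Longrightarrow> Q n' p'"
  shows "wpc filt Q n p"
proof -
  let ?w = "ww p 1" and ?bf = "aa p 10"
  let ?V = "{15, 16, 17, 18, 19, 20, 21, 22, 23, 24, 25, 26, 27, 28} :: nat set"
  let ?V1 = "{16, 17, 18, 19, 20, 21, 22, 23, 24, 25, 26, 27} :: nat set"
  have q16: "16 \<le> q" using power_increasing[OF q(3), of "4 :: nat"] q(2) by simp
  define part where "part = FOR 16 (Var 14) (blk [asg 23 (Arr 10 (Var 16)), gtc 28 23,
       Cnd (Var 26) (sto 5 (Var 23) (Num 0)) (blk [sto 10 (Var 15) (Var 23), inc 15])])"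
  have part: "wpc part Q n1 p1"
    if n1: "n \<le> n1 + 17 * q" and p1: "agree ?V {11, 12} p p1" and c0: "vv p1 15 = 0"
      and pv: "vv p1 28 = pv" "pv \<in> U" "q \<le> 4 * cnt ?w pv U" "4 * cnt ?w pv U \<le> 3 * q" for n1 p1 pv
    unfolding part_def
  \<comment> \<open>The buffer is partitioned in place: the write position never passes the read
    position \<open>i\<close>, so the entries from \<open>i\<close> on are still the original
    ones.\<close>
  proof (rule wpc_FOR[where J="\<lambda>i n' p'. n1 \<le> n' + i \<and> i \<le> q \<and> agree ?V {5, 10, 11, 12} p p' \<and> vv p' 28 = pv \<and>
      vv p' 15 \<le> i \<and> inj_on (aa p' 10) {..<vv p' 15} \<and> aa p' 10 ` {..<vv p' 15} = {e \<in> ?bf ` {..<i}. ge ?w e pv} \<and>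
      (\<forall>t\<ge>i. aa p' 10 t = ?bf t) \<and>
      (\<forall>e. aa p' 5 e = (if e \<in> ?bf ` {..<i} \<and> \<not> ge ?w e pv then 0 else aa p 5 e))"], goal_cases)
    case 1
    then show ?case using p1 c0 pv by (auto simp: agree_def)
  next
    case (2 i n' p')
    let ?e = "?bf i" and ?c = "vv p' 15"
    have v: "vv p' 14 = q" "ww p' = ww p" "aa p' 10 i = ?e" using 2 q by (auto simp: agree_def)
    then have i: "i < q" using 2 by simp
    have eU: "?e \<in> U" "?e < SZ" using U i by auto
    have new: "?e \<notin> ?bf ` {..<i}" 
    proof
      assume "?e \<in> ?bf ` {..<i}"
      then obtain t where "t < i" "?bf i = ?bf t" by auto
      then show False using inj_onD[OF inj, of i t] i by auto
    qed
    have lS: "{..<Suc i} = insert i {..<i}" by auto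
    have n': "1 \<le> n'" "Suc i < b" "?c < SZ" "Suc ?c < b" using 2 i n1 n q(4) b_ge(3) SZ_ge by linarith+
    show ?case
    proof (cases "gt ?w pv ?e")
      case True
      then have nge: "\<not> ge ?w ?e pv" using not_gt by blast
      have "{e \<in> ?bf ` {..<Suc i}. ge ?w e pv} = {e \<in> ?bf ` {..<i}. ge ?w e pv}"
        unfolding lS using nge by auto
      then show ?thesis
        using 2 v n' eU True nge i
        by (auto simp: agree_def lS)
    next
      case False
      then have ge: "ge ?w ?e pv" using not_gt by blast
      have cS: "{..<Suc ?c} = insert ?c {..<?c}" by auto
      have im: "((aa p' 10)(?c := ?e)) ` {..<?c} = aa p' 10 ` {..<?c}" by auto
      have nin: "?e \<notin> aa p' 10 ` {..<?c}" using 2 new by simp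
      have "inj_on (aa p' 10) {..<?c}" using 2 by simp
      then have "inj_on ((aa p' 10)(?c := ?e)) {..<?c}" using nin by (rule inj_on_fun_updI)
      then have "inj_on ((aa p' 10)(?c := ?e)) {..<Suc ?c}"
        unfolding cS inj_on_insert using nin im by auto
      moreover have "((aa p' 10)(?c := ?e)) ` {..<Suc ?c} = {e \<in> ?bf ` {..<Suc i}. ge ?w e pv}"
        unfolding cS lS using im 2 ge by auto
      ultimately show ?thesis
        using 2 v n' eU False ge i new
        by (auto simp: agree_def lS)
    qed
  next
    case (3 i n' p')
    then have i: "i = q" using q by (auto simp: agree_def)
    let ?K = "aa p' 10 ` {..<vv p' 15}"
    have K: "?K = {e \<in> U. ge ?w e pv}" using 3 i U by simp
    then have c: "vv p' 15 = cnt ?w pv U" using 3 card_image[of "aa p' 10" "{..<vv p' 15}"] by (simp add: cnt_def)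
    show ?case
    proof (rule Q[of n' p' "vv p' 15" ?K])
      show "n \<le> n' + 18 * q" using 3 n1 i by linarith
      show "aa p' 5 e = (if e \<in> U - ?K then 0 else aa p 5 e)" for e
        using 3 i U(1) K by auto
      show "?w e \<le> ?w f" if "e \<in> U - ?K" "f \<in> ?K" for e f
      proof -
        have "gt ?w pv e" "ge ?w f pv" using that K not_gt by auto
        then show ?thesis unfolding ge_def using gt_weight gt_trans by (metis)
      qed
    qed (use 3 c pv K in auto)
  qed
  define mid where "mid = blk [asg 28 (Arr 11 (Mi (Di (Var 18) (Num 4)) (Num 1))), asg 15 (Num 0), part]"
  have loop: "wpc (Whl (Le (Var 18) (Var 19)) mpass) (wpc mid Q) n0 p0"
    if n0: "n \<le> n0 + q" and p0: "agree ?V1 {11, 12} p p0" "vv p0 18 = 1" "vv p0 19 = q" "vv p0 20 = 1"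
      "\<And>t. t < q \<Longrightarrow> aa p0 11 t = ?bf t" for n0 p0
  \<comment> \<open>A pass with its iteration costs at most 4 times the total length
    \<open>tot\<close>. This is the fall from \<open>16 * tot\<close> to \<open>12 * tot\<close> if
    nothing is decimated, and from \<open>12 * tot\<close> to \<open>16 * (tot / 2)\<close> if half
    is dropped.\<close>
  proof (rule wpc_Whl[where J="\<lambda>n' p'. runs ?w U q (aa p' 11) (vv p' 18) (vv p' 19) (vv p' 20) \<and> agree ?V1 {11, 12} p p' \<and>
      n + (if vv p' 20 = 1 then 16 * vv p' 19 else 12 * vv p' 19) \<le> n' + 17 * q"], goal_cases)
    case 1
    have "inj_on (aa p0 11) {..<q} = inj_on ?bf {..<q}" using p0(5) by (intro inj_on_cong) auto
    moreover have "aa p0 11 ` {..<q} = ?bf ` {..<q}" using p0(5) by auto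
    ultimately have "runs ?w U q (aa p0 11) 1 q 1"
      using inj U by (intro runs_init[OF q(2)]) auto
    then show ?case using p0 n0 by simp
  next
    case (2 n' p')
    have ww: "ww p' = ww p" using 2 by (auto simp: agree_def)
    have R: "runs (ww p' 1) U q (aa p' 11) (vv p' 18) (vv p' 19) (vv p' 20)" using 2 ww by simp
    have lt: "vv p' 18 < vv p' 19" using 2(2) by (auto split: if_splits)
    have st: "vv p' 20 = 1 \<or> vv p' 20 = 2" using runs_tot_le[OF R] by simp
    have n': "4 * vv p' 19 \<le> n'" using 2(1) n st by (auto split: if_splits)
    show ?case
    proof (rule wpc_mpass[OF R lt q(4)])
      show "3 * vv p' 19 \<le> n'" using n' by simp
      fix n2 p2 assume a: "n' \<le> n2 + 3 * vv p' 19" "agree ?V1 {11, 12} p' p2"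
        "runs (ww p' 1) U q (aa p2 11) (vv p2 18) (vv p2 19) (vv p2 20)"
        "vv p2 19 = vv p' 19 div vv p' 20" "vv p2 20 = 3 - vv p' 20"
      have "1 \<le> n2" using a(1) n' lt by linarith
      moreover have "agree ?V1 {11, 12} p p2" using 2(1) a(2) by (auto intro: agree_trans)
      moreover have "n + (if vv p2 20 = 1 then 16 * vv p2 19 else 12 * vv p2 19) \<le> (n2 - 1) + 17 * q"
        using 2(1) a(1,4,5) st n' lt \<open>1 \<le> n2\<close> by (auto split: if_splits)
      ultimately show "1 \<le> n2 \<and> runs ?w U q (aa p2 11) (vv p2 18) (vv p2 19) (vv p2 20) \<and> agree ?V1 {11, 12} p p2 \<and>
          n + (if vv p2 20 = 1 then 16 * vv p2 19 else 12 * vv p2 19) \<le> n2 - 1 + 17 * q"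
        using a(3) ww by simp
    qed
  next
    case (3 n' p')
    have lt: "vv p' 19 \<le> vv p' 18" using 3(2) by (auto split: if_splits)
    note pv = runs_pivot[OF conjunct1[OF 3(1)] lt q(2,3)]
    let ?pv = "aa p' 11 (vv p' 18 div 4 - 1)"
    have "wpc part Q n' (p'\<lparr>vv := (vv p')(28 := ?pv, 15 := 0)\<rparr>)"
      by (rule part[OF _ _ _ _ pv]) (use 3 in \<open>auto simp: agree_def\<close>)
    then show ?case by (simp add: mid_def)
  qed
  have "wpc (FOR 16 (Var 14) (sto 11 (Var 16) (Arr 10 (Var 16))))
     (wpc (blk [asg 18 (Num 1), asg 19 (Var 14), asg 20 (Num 1), Whl (Le (Var 18) (Var 19)) mpass, mid]) Q) n p"
  proof (rule wpc_copy[where m=q])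
    fix n' p' assume a: "n \<le> n' + q" "agree {16} {11} p p'" "\<And>t. t < q \<Longrightarrow> aa p' 11 t = aa p 10 t"
    have "wpc (Whl (Le (Var 18) (Var 19)) mpass) (wpc mid Q) n' (p'\<lparr>vv := (vv p')(18 := 1, 19 := q, 20 := 1)\<rparr>)"
      by (rule loop) (use a q in \<open>auto simp: agree_def\<close>)
    then show "wpc (blk [asg 18 (Num 1), asg 19 (Var 14), asg 20 (Num 1), Whl (Le (Var 18) (Var 19)) mpass, mid]) Q n' p'"
      using a(2) q by (simp add: agree_def)
  qed (use q n in auto)
  then show ?thesis by (simp add: filt_def mid_def part_def)
qed

end

section \<open>One round of compression\<close>

fun chain :: "(nat \<Rightarrow> nat) \<Rightarrow> nat \<Rightarrow> nat list \<Rightarrow> bool" where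
  "chain nx h [] \<longleftrightarrow> h = 0"
| "chain nx h (y # ys) \<longleftrightarrow> h = Suc y \<and> chain nx (nx y) ys"

lemma chain_cong: "(\<And>y. y \<in> set ys \<Longrightarrow> nx' y = nx y) \<Longrightarrow> chain nx' h ys = chain nx h ys"
  by (induction ys arbitrary: h) auto

lemma sum_length_filter:
  assumes "finite B"
  shows "(\<Sum>b\<in>B. length (filter (\<lambda>x. f x = b \<and> Q x) xs)) \<le> length xs"
proof (induction xs)
  case (Cons x xs)
  have "(\<Sum>b\<in>B. length (filter (\<lambda>x. f x = b \<and> Q x) (x # xs))) =
    (\<Sum>b\<in>B. length (filter (\<lambda>x. f x = b \<and> Q x) xs) + (if f x = b \<and> Q x then 1 else 0))"
    by (intro sum.cong) auto
  also have "\<dots> = (\<Sum>b\<in>B. length (filter (\<lambda>x. f x = b \<and> Q x) xs)) + (\<Sum>b\<in>B. if f x = b \<and> Q x then 1 else 0)"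
    by (rule sum.distrib)
  also have "(\<Sum>b\<in>B. if f x = b \<and> Q x then 1 else (0::nat)) \<le> (\<Sum>b\<in>B. if f x = b then 1 else 0)"
    by (intro sum_mono) auto
  also have "\<dots> \<le> 1" using assms by (simp add: sum.delta)
  finally show ?case using Cons.IH by simp
qed simp

definition hsh :: "exp \<Rightarrow> exp" where
  "hsh x = Di (Mo (Ti (Arr 13 (Var 8)) x) (Var 2)) (Var 0)"

abbreviation "node t \<equiv> Pl (Ti (Num 3) (Var 7)) (Num t)"

definition pushc :: "nat \<Rightarrow> nat \<Rightarrow> com" where
  "pushc t y = blk [sto 7 (node t) (Arr 6 (Var y)), sto 6 (Var y) (node (Suc t))]"

definition buildc :: com where
  "buildc = FOR 7 (Var 6) (blk [asg 11 (hsh (Arr 2 (Var 7))), asg 12 (hsh (Arr 3 (Var 7))),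
     sto 8 (node 0) (Var 11), sto 8 (node 1) (Var 12), sto 8 (node 2) (Var 3),
     Cnd (Eq (Var 11) (Var 12)) (sto 5 (Var 7) (Num 0))
       (blk [sto 5 (Var 7) (Num 1), pushc 0 11, pushc 1 12, pushc 2 3])])"

text \<open>Array 9 is never cleared, so its entry may be left over from another bucket or point
  nowhere. Each factor guards against one way of being stale; a live edge other than the current one
  with the same two buckets is truly parallel.\<close>

definition paralc :: exp where
  "paralc = Ti (Le (Var 13) (Var 6)) (Ti (Eq (Eq (Var 13) (Var 7)) (Num 0)) (Ti (Arr 5 (Var 13))
     (Pl (Ti (Eq (Arr 8 (Ti (Num 3) (Var 13))) (Var 9)) (Eq (Arr 8 (Pl (Ti (Num 3) (Var 13)) (Num 1))) (Var 12)))
        (Ti (Eq (Arr 8 (Ti (Num 3) (Var 13))) (Var 12)) (Eq (Arr 8 (Pl (Ti (Num 3) (Var 13)) (Num 1))) (Var 9))))))"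

text \<open>Residues 0 and 1 of a node belong to the endpoints, and
  \<open>Mi (Num 1) (Var 11)\<close> selects the other one. In the list of all edges the residue is
  2 and truncated subtraction gives 0. This is harmless: no edge has \<open>R\<close> among its
  buckets, so \<open>paralc\<close> fails there.\<close>

definition dedupstep :: com where
  "dedupstep = blk [asg 7 (Di (Mi (Var 10) (Num 1)) (Num 3)), asg 11 (Mo (Mi (Var 10) (Num 1)) (Num 3)),
     asg 12 (Arr 8 (Pl (Ti (Num 3) (Var 7)) (Mi (Num 1) (Var 11)))),
     Cnd (Arr 5 (Var 7)) (blk [asg 13 (Arr 9 (Var 12)),
       Cnd paralc
         (blk [At (WLs 26 1 (Var 13) 1 (Var 7)),
            Cnd (Var 26) (blk [sto 5 (Var 13) (Num 0), sto 9 (Var 12) (Var 7)]) (sto 5 (Var 7) (Num 0))])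
         (sto 9 (Var 12) (Var 7))]) Skp,
     asg 10 (Arr 7 (Mi (Var 10) (Num 1)))]"

definition dedupc :: com where
  "dedupc = blk [asg 10 (Arr 6 (Var 9)), Whl (Var 10) dedupstep]"

definition thinstep :: com where
  "thinstep = blk [asg 7 (Di (Mi (Var 10) (Num 1)) (Num 3)),
     Cnd (Arr 5 (Var 7)) (blk [sto 10 (Var 15) (Var 7), inc 15, Cnd (Eq (Var 15) (Var 14)) filt Skp]) Skp,
     asg 10 (Arr 7 (Mi (Var 10) (Num 1)))]"

definition thinc :: com where
  "thinc = blk [Cnd (Le (Var 9) (Var 3)) (asg 14 (Var 4)) (asg 14 (Var 5)), asg 15 (Num 0),
     asg 10 (Arr 6 (Var 9)), Whl (Var 10) thinstep]"

text \<open>Bucket \<open>R\<close>, the list of all edges, comes last, when the degrees of all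
  other buckets are already bounded; its thinning relies on that.\<close>

definition copyc :: com where
  "copyc = blk [FOR 9 (Pl (Var 3) (Num 1)) (sto 6 (Var 9) (Num 0)), buildc,
     FOR 9 (Pl (Var 3) (Num 1)) (blk [dedupc, thinc]),
     FOR 7 (Var 6) (Cnd (Arr 5 (Var 7)) (sto 4 (Var 7) (Num 1)) Skp)]"

definition compactc :: com where
  "compactc = blk [asg 16 (Num 0),
     FOR 7 (Var 6) (Cnd (Arr 4 (Var 7)) (blk [sto 2 (Var 16) (Arr 2 (Var 7)), sto 3 (Var 16) (Arr 3 (Var 7)),
       At (WMv 1 (Var 16) 1 (Var 7)), inc 16]) Skp),
     asg 6 (Var 16)]"

definition roundc :: "nat \<Rightarrow> com" where
  "roundc L = blk [FOR 7 (Var 6) (sto 4 (Var 7) (Num 0)), FOR 8 (Num L) copyc, compactc]"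

section \<open>Buckets, their lists, and domination\<close>

definition bkt :: "(nat \<Rightarrow> nat) \<Rightarrow> (nat \<Rightarrow> nat) \<Rightarrow> nat \<Rightarrow> nat \<Rightarrow> nat" where
  "bkt al be R h = (if h mod 3 = 0 then al (h div 3) else if h mod 3 = 1 then be (h div 3) else R)"

text \<open>Insertion at the head puts the newest node first, hence \<open>rev\<close>.\<close>

definition nodes :: "(nat \<Rightarrow> nat) \<Rightarrow> (nat \<Rightarrow> nat) \<Rightarrow> nat \<Rightarrow> nat \<Rightarrow> nat \<Rightarrow> nat list" where
  "nodes al be R e b = rev (filter (\<lambda>h. bkt al be R h = b \<and> al (h div 3) \<noteq> be (h div 3)) [0..<3 * e])"

lemma bkt_node [simp]:
  "bkt al be R (3 * e) = al e" "bkt al be R (Suc (3 * e)) = be e" "bkt al be R (Suc (Suc (3 * e))) = R"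
  unfolding bkt_def by (simp_all add: mod_Suc div_Suc)

lemma nodes_0 [simp]: "nodes al be R 0 b = []"
  by (simp add: nodes_def)

lemma nodes_Suc:
  "nodes al be R (Suc e) b = (if al e \<noteq> be e then (if R = b then [Suc (Suc (3 * e))] else []) @
     (if be e = b then [Suc (3 * e)] else []) @ (if al e = b then [3 * e] else []) else []) @ nodes al be R e b"
proof -
  have "[0..<3 * Suc e] = [0..<3 * e] @ [3 * e, Suc (3 * e), Suc (Suc (3 * e))]"
  proof -
    have "[3 * e..<3 * e + 3] = [3 * e, Suc (3 * e), Suc (Suc (3 * e))]" by (simp add: numeral_3_eq_3)
    then show ?thesis using upt_add_eq_append[of 0 "3 * e" 3] by (simp add: add.commute)
  qed
  moreover have "Suc (3 * e) div 3 = e" "Suc (Suc (3 * e)) div 3 = e" by auto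
  ultimately show ?thesis by (simp add: nodes_def)
qed

lemma nodes_less: "h \<in> set (nodes al be R e b) \<Longrightarrow> h < 3 * e"
  by (auto simp: nodes_def)

lemma distinct_nodes: "distinct (nodes al be R e b)"
  by (simp add: nodes_def)

lemma sum_nodes: "(\<Sum>b\<le>R'. length (nodes al be R m b)) \<le> 3 * m"
  using sum_length_filter[of "{..R'}" "bkt al be R" "\<lambda>h. al (h div 3) \<noteq> be (h div 3)" "[0..<3 * m]"]
  by (simp add: nodes_def)

locale buckets = machine +
  fixes al be :: "nat \<Rightarrow> nat" and R m kk :: nat and w :: "nat \<Rightarrow> real"
  assumes al_less: "\<And>e. al e < R" and be_less: "\<And>e. be e < R"
    and m_le: "3 * m \<le> SZ" and R_less: "R < SZ"
begin

abbreviation "ns \<equiv> nodes al be R m"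

definition ends :: "nat \<Rightarrow> nat set" where "ends e = {al e, be e}"

definition proper :: "nat set" where "proper = {e. e < m \<and> al e \<noteq> be e}"

text \<open>The edges of the list of bucket \<open>c\<close>; bucket \<open>R\<close> collects all of them.\<close>

definition star :: "nat \<Rightarrow> nat set" where
  "star c = {e \<in> proper. c = R \<or> c \<in> ends e}"

definition edg :: "nat list \<Rightarrow> nat set" where "edg hs = (\<lambda>h. h div 3) ` set hs"

text \<open>The weighted representation property that survives composition: whatever \<open>2 * kk - 2\<close> buckets
  the rest of a matching occupies, a dropped edge can be replaced.\<close>

definition dom :: "nat set \<Rightarrow> nat set \<Rightarrow> bool" where
  "dom Y Z \<longleftrightarrow> Z \<subseteq> Y \<and> (\<forall>S e. finite S \<and> card S \<le> 2 * kk - 2 \<and> e \<in> Y \<and> ends e \<inter> S = {} \<longrightarrow>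
     (\<exists>f\<in>Z. ends f \<inter> S = {} \<and> w e \<le> w f))"

lemma dom_refl: "dom Y Y"
  by (auto simp: dom_def)

lemma dom_trans: "dom X Y \<Longrightarrow> dom Y Z \<Longrightarrow> dom X Z"
  unfolding dom_def by (meson order_trans)

lemma star_subset: "star c \<subseteq> proper"
  by (auto simp: star_def)

lemma finite_proper: "finite proper"
  unfolding proper_def by simp

lemma finite_star: "finite (star c)"
  using finite_subset[OF star_subset finite_proper] .

lemma node_in:
  assumes "h \<in> set (ns c)"
  shows "h < 3 * m" "bkt al be R h = c" "h div 3 \<in> proper" "h div 3 < m"
  using assms by (auto simp: nodes_def proper_def)

lemma edg_ns: "c \<le> R \<Longrightarrow> edg (ns c) = star c"
proof (intro set_eqI iffI)
  fix e assume "e \<in> edg (ns c)"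
  then obtain h where h: "h \<in> set (ns c)" "e = h div 3" by (auto simp: edg_def)
  then show "e \<in> star c" using node_in[OF h(1)] by (auto simp: star_def ends_def bkt_def split: if_splits)
next
  fix e assume c: "c \<le> R" and "e \<in> star c"
  then have e: "e < m" "al e \<noteq> be e" "c = R \<or> c = al e \<or> c = be e" by (auto simp: star_def proper_def ends_def)
  have d: "Suc (3 * e) div 3 = e" "Suc (Suc (3 * e)) div 3 = e" by auto
  have "3 * e < 3 * m" "Suc (3 * e) < 3 * m" "Suc (Suc (3 * e)) < 3 * m" using e(1) by auto
  then have "c = al e \<Longrightarrow> 3 * e \<in> set (ns c)" "c = be e \<Longrightarrow> Suc (3 * e) \<in> set (ns c)"
    "c = R \<Longrightarrow> Suc (Suc (3 * e)) \<in> set (ns c)"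
    using e d by (auto simp: nodes_def)
  then show "e \<in> edg (ns c)" using e(3) d unfolding edg_def by (metis image_eqI nonzero_mult_div_cancel_left zero_neq_numeral)
qed

text \<open>An edge has a single node in each list, because its endpoints lie in different buckets
  and \<open>R\<close> is the bucket of no endpoint.\<close>

lemma node_inj:
  assumes "h \<in> set (ns c)" "h' \<in> set (ns c)" "h div 3 = h' div 3"
  shows "h = h'"
proof -
  have "al (h div 3) \<noteq> be (h div 3)" using node_in(3)[OF assms(1)] by (simp add: proper_def)
  moreover have "bkt al be R h = bkt al be R h'"
    using node_in(2)[OF assms(1)] node_in(2)[OF assms(2)] by simp
  moreover have "al (h div 3) \<noteq> R" "be (h div 3) \<noteq> R" using al_less be_less by (simp_all add: less_imp_neq)
  moreover have "h mod 3 = 0 \<or> h mod 3 = 1 \<or> h mod 3 = 2" "h' mod 3 = 0 \<or> h' mod 3 = 1 \<or> h' mod 3 = 2"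
    by linarith+
  ultimately have "h mod 3 = h' mod 3"
    by (elim disjE) (simp_all add: bkt_def assms(3))
  then show ?thesis using assms(3) by (metis mult_div_mod_eq)
qed

lemma not_in_edg:
  assumes "ns c = ds @ y # rs"
  shows "y div 3 \<notin> edg ds"
proof
  assume "y div 3 \<in> edg ds"
  then obtain h where h: "h \<in> set ds" "h div 3 = y div 3" by (auto simp: edg_def)
  then have "h = y" using node_inj[of h c y] assms by auto
  then show False using h(1) distinct_nodes[of al be R m c] assms by auto
qed

definition BK :: "pst \<Rightarrow> bool" where
  "BK p \<longleftrightarrow> (\<forall>t<3 * m. aa p 8 t = bkt al be R t) \<and> (\<forall>c\<le>R. chain (aa p 7) (aa p 6 c) (ns c)) \<and>
     vv p 6 = m \<and> vv p 3 = R \<and> ww p 1 = w"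

lemma BK_agree: "BK p \<Longrightarrow> agree V A p p' \<Longrightarrow> 6 \<notin> V \<Longrightarrow> 3 \<notin> V \<Longrightarrow> 6 \<notin> A \<Longrightarrow> 7 \<notin> A \<Longrightarrow> 8 \<notin> A \<Longrightarrow> BK p'"
  by (auto simp: BK_def agree_def)

definition alive :: "pst \<Rightarrow> nat set \<Rightarrow> bool" where
  "alive p Y \<longleftrightarrow> Y \<subseteq> proper \<and> (\<forall>e<m. aa p 5 e \<noteq> 0 \<longleftrightarrow> e \<in> Y)"

text \<open>The last conjunct excludes parallel edges implicitly: two live scanned edges with the
  same ends would both have to be the one entry of array 9.\<close>

definition DJ :: "pst \<Rightarrow> nat set \<Rightarrow> nat \<Rightarrow> nat list \<Rightarrow> nat list \<Rightarrow> nat set \<Rightarrow> nat \<Rightarrow> nat \<Rightarrow> pst \<Rightarrow> bool" where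
  "DJ p Y c ds rs Z n n' p' \<longleftrightarrow> ns c = ds @ rs \<and> chain (aa p 7) (vv p' 10) rs \<and> n \<le> n' + length ds \<and>
     agree {7, 10, 11, 12, 13, 26} {5, 9} p p' \<and> alive p' Z \<and> dom Y Z \<and>
     (c < R \<longrightarrow> (\<forall>e\<in>Z \<inter> edg ds. \<forall>z. ends e = {c, z} \<longrightarrow> aa p' 9 z = e))"

text \<open>Edges with equal ends avoid the same sets \<open>S\<close>, so \<open>e\<close>, being
  at least as heavy, stands in for \<open>f\<close>.\<close>

lemma dom_remove:
  assumes "dom Y Z" "f \<in> Z" "e \<in> Z" "e \<noteq> f" "ends e = ends f" "w f \<le> w e"
  shows "dom Y (Z - {f})"
proof (rule dom_trans[OF assms(1)])
  show "dom Z (Z - {f})"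
    unfolding dom_def
  proof (intro conjI allI impI)
    fix S g assume "finite S \<and> card S \<le> 2 * kk - 2 \<and> g \<in> Z \<and> ends g \<inter> S = {}"
    then show "\<exists>f\<in>Z - {f}. ends f \<inter> S = {} \<and> w g \<le> w f"
      using assms(2-6) by (cases "g = f") auto
  qed auto
qed

lemma ends_eq:
  assumes "f < m" "BK p"
  shows "(aa p 8 (3 * f) = c \<and> aa p 8 (3 * f + 1) = z \<or> aa p 8 (3 * f) = z \<and> aa p 8 (3 * f + 1) = c) \<longleftrightarrow> ends f = {c, z}"
proof -
  have "3 * f < 3 * m" "3 * f + 1 < 3 * m" using assms(1) by auto
  then have "aa p 8 (3 * f) = al f" "aa p 8 (3 * f + 1) = be f" using assms(2) unfolding BK_def by auto
  then show ?thesis by (auto simp: ends_def doubleton_eq_iff)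
qed

lemma wpc_dedup:
  assumes BK: "BK p" and c: "vv p 9 = c" "c \<le> R" and Y: "alive p Y" and n: "length (ns c) \<le> n"
    and Q: "\<And>n' p' Z. n \<le> n' + length (ns c) \<Longrightarrow> agree {7, 10, 11, 12, 13, 26} {5, 9} p p' \<Longrightarrow> alive p' Z \<Longrightarrow>
      dom Y Z \<Longrightarrow> (c < R \<Longrightarrow> inj_on ends (Z \<inter> star c)) \<Longrightarrow> Q n' p'"
  shows "wpc dedupc Q n p"
proof -
  have ch: "chain (aa p 7) (aa p 6 c) (ns c)" using BK c by (simp add: BK_def)
  have "wpc (Whl (Var 10) dedupstep) Q n (p\<lparr>vv := (vv p)(10 := aa p 6 c)\<rparr>)"
  proof (rule wpc_Whl[where J="\<lambda>n' p'. \<exists>ds rs Z. DJ p Y c ds rs Z n n' p'"], goal_cases)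
    case 1
    have "DJ p Y c [] (ns c) Y n n (p\<lparr>vv := (vv p)(10 := aa p 6 c)\<rparr>)"
      using ch Y by (auto simp: DJ_def agree_def alive_def dom_refl edg_def)
    then show ?case by blast
  next
    case (2 n' p')
    then obtain ds rs0 Z where J: "DJ p Y c ds rs0 Z n n' p'" by blast
    have ag: "agree {7, 10, 11, 12, 13, 26} {5, 9} p p'" using J by (simp add: DJ_def)
    have BK': "BK p'" by (rule BK_agree[OF BK ag]) auto
    have "vv p' 10 \<noteq> 0" using 2(2) by simp
    then obtain y rs where rs: "rs0 = y # rs" "vv p' 10 = Suc y" "chain (aa p 7) (aa p 7 y) rs"
      using J by (cases rs0) (auto simp: DJ_def)
    have spl: "ns c = ds @ y # rs" "ns c = (ds @ [y]) @ rs" using J rs by (auto simp: DJ_def)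
    have y: "y \<in> set (ns c)" using spl by simp
    let ?e = "y div 3"
    define z where "z = bkt al be R (3 * ?e + (1 - y mod 3))"
    have e: "?e < m" "?e \<in> proper" "?e \<notin> edg ds" "al ?e \<noteq> be ?e"
      using node_in[OF y] not_in_edg[OF spl(1)] by (auto simp: proper_def)
    have y3: "y mod 3 < 3" by simp
    have zR: "z < R"
      using al_less[of ?e] be_less[of ?e] by (cases "y mod 3") (auto simp: z_def)
    have ez: "ends ?e = {c, z}" if "c < R"
      using node_in(2)[OF y] that unfolding z_def ends_def
      by (cases "y mod 3 = 0"; cases "y mod 3 = 1") (auto simp: bkt_def[of _ _ _ y])
    have edg: "edg (ds @ [y]) = insert ?e (edg ds)" by (simp add: edg_def)
    have n': "1 \<le> n'" "n \<le> (n' - 1) + length (ds @ [y])"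
      using J n spl by (auto simp: DJ_def)
    have v: "vv p' 6 = m" "vv p' 9 = c" "aa p' 7 = aa p 7" "ww p' 1 = w"
      using BK BK' ag c by (auto simp: BK_def agree_def)
    have "3 * ?e + (1 - y mod 3) < 3 * m" using e(1) by auto
    then have b8: "aa p' 8 (3 * ?e + (1 - y mod 3)) = z" using BK' by (auto simp: BK_def z_def)
    have aZ: "aa p' 5 g \<noteq> 0 \<longleftrightarrow> g \<in> Z" if "g < m" for g using J that by (auto simp: DJ_def alive_def)
    have Zp: "Z \<subseteq> proper" using J by (auto simp: DJ_def alive_def)
    have domZ: "dom Y Z" using J by (auto simp: DJ_def)
    have last: "aa p' 9 z' = g" if "c < R" "g \<in> Z" "g \<in> edg ds" "ends g = {c, z'}" for g z'
      using J that by (auto simp: DJ_def)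
    have eSZ: "?e < SZ" "z < SZ" using e(1) m_le zR R_less by auto
    let ?f = "aa p' 9 z"
    have next_: "DJ p Y c (ds @ [y]) rs Z' n (n' - 1) p''"
      if "agree {7, 10, 11, 12, 13, 26} {5, 9} p' p''" "vv p'' 10 = aa p 7 y" "alive p'' Z'" "dom Y Z'"
        "c < R \<Longrightarrow> (\<forall>g\<in>Z' \<inter> insert ?e (edg ds). \<forall>z'. ends g = {c, z'} \<longrightarrow> aa p'' 9 z' = g)" for p'' Z'
      using that rs(3) spl(2) n' agree_trans[OF ag that(1)] by (auto simp: DJ_def edg)
    have par: "val paralc (p'\<lparr>vv := (vv p')(7 := ?e, 11 := y mod 3, 12 := z, 13 := ?f)\<rparr>) \<noteq> 0 \<longleftrightarrow>
       ?f < m \<and> ?f \<noteq> ?e \<and> ?f \<in> Z \<and> ends ?f = {c, z}"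
      using ends_eq[OF _ BK', of ?f c z] aZ[of ?f] v by (auto simp: paralc_def)
    let ?ag = "agree {7, 10, 11, 12, 13, 26} {5, 9} p'"
    show ?case
    proof (cases "?e \<in> Z")
      case False
      have fin: "\<exists>ds rs Z. DJ p Y c ds rs Z n (n' - 1) p''"
        if "?ag p''" "vv p'' 10 = aa p 7 y" "aa p'' 5 = aa p' 5" "aa p'' 9 = aa p' 9" for p''
      proof -
        have "DJ p Y c (ds @ [y]) rs Z n (n' - 1) p''"
          by (rule next_) (use that J False last in \<open>auto simp: DJ_def alive_def\<close>)
        then show ?thesis by blast
      qed
      then show ?thesis
        using False aZ[OF e(1)] n' rs(2) v b8 by (simp add: dedupstep_def agree_def)
    next
      case True
      then have alv: "0 < aa p' 5 ?e" using aZ[OF e(1)] by auto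
      show ?thesis
      proof (cases "?f < m \<and> ?f \<noteq> ?e \<and> ?f \<in> Z \<and> ends ?f = {c, z}")
        case par_True: True
        have bR: "c < R" using par_True al_less[of ?f] be_less[of ?f] by (auto simp: ends_def doubleton_eq_iff)
        have ee: "ends ?e = ends ?f" using ez[OF bR] par_True by simp
        have par0: "val paralc (p'\<lparr>vv := (vv p')(7 := ?e, 11 := y mod 3, 12 := z, 13 := ?f)\<rparr>) > 0"
          using par par_True by blast
        have fSZ: "?f < SZ" using par_True m_le by auto
        show ?thesis
        proof (cases "w ?f < w ?e")
          case less: True
          have fin: "\<exists>ds rs Z. DJ p Y c ds rs Z n (n' - 1) p''"
            if p'': "?ag p''" "vv p'' 10 = aa p 7 y" "aa p'' 5 = (aa p' 5)(?f := 0)" "aa p'' 9 = (aa p' 9)(z := ?e)" for p''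
          proof -
            have "DJ p Y c (ds @ [y]) rs (Z - {?f}) n (n' - 1) p''"
            proof (rule next_)
              show "dom Y (Z - {?f})"
                using par_True True less ee by (intro dom_remove[OF domZ]) auto
              show "alive p'' (Z - {?f})" using aZ Zp p'' by (auto simp: alive_def)
              show "\<forall>g\<in>(Z - {?f}) \<inter> insert ?e (edg ds). \<forall>z'. ends g = {c, z'} \<longrightarrow> aa p'' 9 z' = g"
              proof (intro ballI allI impI)
                fix g z' assume g: "g \<in> (Z - {?f}) \<inter> insert ?e (edg ds)" "ends g = {c, z'}"
                show "aa p'' 9 z' = g"
                proof (cases "g = ?e")
                  case True
                  then have "z' = z" using g(2) ez[OF bR] by (auto simp: doubleton_eq_iff)
                  then show ?thesis using True p'' by simp
                next
                  case False
                  then have "aa p' 9 z' = g" using last[OF bR] g by auto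
                  then show ?thesis using g p'' by auto
                qed
              qed
            qed (use p'' in auto)
            then show ?thesis by blast
          qed
          show ?thesis
            using alv n' rs(2) v b8 par0 less eSZ fSZ fin by (simp add: dedupstep_def agree_def)
        next
          case ge: False
          have fin: "\<exists>ds rs Z. DJ p Y c ds rs Z n (n' - 1) p''"
            if p'': "?ag p''" "vv p'' 10 = aa p 7 y" "aa p'' 5 = (aa p' 5)(?e := 0)" "aa p'' 9 = aa p' 9" for p''
          proof -
            have "DJ p Y c (ds @ [y]) rs (Z - {?e}) n (n' - 1) p''"
            proof (rule next_)
              show "dom Y (Z - {?e})"
                using par_True True ge ee by (intro dom_remove[OF domZ, of _ ?f]) auto
              show "alive p'' (Z - {?e})" using aZ Zp p'' by (auto simp: alive_def)
              show "\<forall>g\<in>(Z - {?e}) \<inter> insert ?e (edg ds). \<forall>z'. ends g = {c, z'} \<longrightarrow> aa p'' 9 z' = g"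
                using last[OF bR] p'' by auto
            qed (use p'' in auto)
            then show ?thesis by blast
          qed
          show ?thesis
            using alv n' rs(2) v b8 par0 ge eSZ fin by (simp add: dedupstep_def agree_def)
        qed
      next
        case par_False: False
        then have par0: "val paralc (p'\<lparr>vv := (vv p')(7 := ?e, 11 := y mod 3, 12 := z, 13 := ?f)\<rparr>) = 0"
          using par by blast
        have fin: "\<exists>ds rs Z. DJ p Y c ds rs Z n (n' - 1) p''"
          if p'': "?ag p''" "vv p'' 10 = aa p 7 y" "aa p'' 5 = aa p' 5" "aa p'' 9 = (aa p' 9)(z := ?e)" for p''
        proof -
          have "DJ p Y c (ds @ [y]) rs Z n (n' - 1) p''"
          proof (rule next_)
            show "alive p'' Z" using aZ Zp p'' by (auto simp: alive_def)
            assume bR: "c < R"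
            show "\<forall>g\<in>Z \<inter> insert ?e (edg ds). \<forall>z'. ends g = {c, z'} \<longrightarrow> aa p'' 9 z' = g"
            proof (intro ballI allI impI)
              fix g z' assume g: "g \<in> Z \<inter> insert ?e (edg ds)" "ends g = {c, z'}"
              show "aa p'' 9 z' = g"
              proof (cases "g = ?e")
                case True
                then have "z' = z" using g(2) ez[OF bR] by (auto simp: doubleton_eq_iff)
                then show ?thesis using True p'' by simp
              next
                case False
                then have l: "aa p' 9 z' = g" using last[OF bR] g by auto
                \<comment> \<open>With \<open>z' = z\<close> the entry of array 9 would be
                  \<open>g\<close>, live and parallel to the current edge, and the test would have
                  succeeded.\<close>
                have "z' \<noteq> z"
                proof
                  assume "z' = z"
                  then have "?f = g" using l by simp
                  moreover have "g < m" using g Zp by (auto simp: proper_def)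
                  ultimately show False using par_False g False \<open>z' = z\<close> by auto
                qed
                then show ?thesis using l p'' by simp
              qed
            qed
          qed (use domZ p'' in auto)
          then show ?thesis by blast
        qed
        show ?thesis
          using alv n' rs(2) v b8 par0 eSZ fin by (simp add: dedupstep_def agree_def)
      qed
    qed
  next
    case (3 n' p')
    then obtain ds rs Z where J: "DJ p Y c ds rs Z n n' p'" by blast
    have rs: "rs = []" using J 3(2) by (cases rs) (auto simp: DJ_def)
    have ds: "ns c = ds" using J rs by (simp add: DJ_def)
    show ?case
    proof (rule Q[of n' p' Z])
      assume bR: "c < R"
      have "edg ds = star c" using edg_ns[OF c(2)] ds by simp
      then have *: "aa p' 9 z = e" if "e \<in> Z \<inter> star c" "ends e = {c, z}" for e z
        using J that bR by (auto simp: DJ_def)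
      show "inj_on ends (Z \<inter> star c)"
      proof (rule inj_onI)
        fix e f assume e: "e \<in> Z \<inter> star c" "f \<in> Z \<inter> star c" "ends e = ends f"
        then obtain z where "ends e = {c, z}" using bR by (auto simp: star_def ends_def)
        then show "e = f" using *[OF e(1)] *[OF e(2)] e(3) by metis
      qed
    qed (use J ds in \<open>auto simp: DJ_def\<close>)
  qed
  then show ?thesis using c by (simp add: dedupc_def)
qed

text \<open>Every buffered edge holds 72 credits in reserve. Filtering a full buffer removes at
  least \<open>q / 4\<close> edges, which releases the \<open>18 * q\<close> credits that the filter
  costs.\<close>

definition TJ :: "pst \<Rightarrow> nat set \<Rightarrow> nat \<Rightarrow> nat \<Rightarrow> nat list \<Rightarrow> nat list \<Rightarrow> nat set \<Rightarrow> nat \<Rightarrow> nat \<Rightarrow> pst \<Rightarrow> bool" where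
  "TJ p Y c q ds rs Z n n' p' \<longleftrightarrow> ns c = ds @ rs \<and> chain (aa p 7) (vv p' 10) rs \<and>
     n + 72 * vv p' 15 \<le> n' + 73 * length ds \<and>
     agree {7, 10, 14, 15, 16, 17, 18, 19, 20, 21, 22, 23, 24, 25, 26, 27, 28} {5, 10, 11, 12} p p' \<and>
     alive p' Z \<and> dom Y Z \<and> vv p' 14 = q \<and> vv p' 15 < q \<and>
     inj_on (aa p' 10) {..<vv p' 15} \<and> aa p' 10 ` {..<vv p' 15} = Z \<inter> edg ds"

text \<open>\<open>H\<close> isolates the combinatorics: a filter keeps at least
  \<open>q / 4\<close> of the heaviest buffered edges, and among so many one avoids
  \<open>S\<close>. That edge is at least as heavy as every edge dropped at that moment.\<close>

lemma wpc_thin: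
  assumes BK: "BK p" and c: "vv p 9 = c" "c \<le> R" and Y: "alive p Y" and n: "73 * length (ns c) \<le> n"
    and q: "q = (if c < R then vv p 4 else vv p 5)" "q = 4 ^ J" "2 \<le> J" "q \<le> SZ"
    and H: "\<And>K e S. K \<subseteq> Y \<inter> star c \<Longrightarrow> q \<le> 4 * card K \<Longrightarrow> e \<in> Y \<inter> star c \<Longrightarrow> finite S \<Longrightarrow> card S \<le> 2 * kk - 2 \<Longrightarrow>
      ends e \<inter> S = {} \<Longrightarrow> \<exists>f\<in>K. ends f \<inter> S = {}"
    and Q: "\<And>n' p' Z. n \<le> n' + 73 * length (ns c) \<Longrightarrow>
      agree {7, 10, 14, 15, 16, 17, 18, 19, 20, 21, 22, 23, 24, 25, 26, 27, 28} {5, 10, 11, 12} p p' \<Longrightarrow> alive p' Z \<Longrightarrow>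
      dom Y Z \<Longrightarrow> card (Z \<inter> star c) < q \<Longrightarrow> Q n' p'"
  shows "wpc thinc Q n p"
proof -
  let ?V = "{7, 10, 14, 15, 16, 17, 18, 19, 20, 21, 22, 23, 24, 25, 26, 27, 28} :: nat set"
  have ch: "chain (aa p 7) (aa p 6 c) (ns c)" using BK c by (simp add: BK_def)
  have q16: "16 \<le> q" using power_increasing[OF q(3), of "4 :: nat"] q(2) by simp
  have loop: "wpc (Whl (Var 10) thinstep) Q n p0"
    if p0: "agree ?V {5, 10, 11, 12} p p0" "vv p0 10 = aa p 6 c" "vv p0 14 = q" "vv p0 15 = 0" "aa p0 5 = aa p 5" for p0
  proof (rule wpc_Whl[where J="\<lambda>n' p'. \<exists>ds rs Z. TJ p Y c q ds rs Z n n' p'"], goal_cases)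
    case 1
    have "TJ p Y c q [] (ns c) Y n n p0"
      using ch Y p0 q16 by (auto simp: TJ_def alive_def dom_refl edg_def)
    then show ?case by blast
  next
    case (2 n' p')
    then obtain ds rs0 Z where J: "TJ p Y c q ds rs0 Z n n' p'" by blast
    have ag: "agree ?V {5, 10, 11, 12} p p'" using J by (simp add: TJ_def)
    have BK': "BK p'" by (rule BK_agree[OF BK ag]) auto
    have "vv p' 10 \<noteq> 0" using 2(2) by simp
    then obtain y rs where rs: "rs0 = y # rs" "vv p' 10 = Suc y" "chain (aa p 7) (aa p 7 y) rs"
      using J by (cases rs0) (auto simp: TJ_def)
    have spl: "ns c = ds @ y # rs" "ns c = (ds @ [y]) @ rs" using J rs by (auto simp: TJ_def)
    have y: "y \<in> set (ns c)" using spl by simp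
    let ?e = "y div 3" and ?k = "vv p' 15"
    have e: "?e < m" "?e \<in> proper" "?e \<notin> edg ds"
      using node_in[OF y] not_in_edg[OF spl(1)] by auto
    have edg: "edg (ds @ [y]) = insert ?e (edg ds)" by (simp add: edg_def)
    have "edg (ds @ [y]) \<subseteq> edg (ns c)" using spl(2) by (auto simp: edg_def)
    then have edg_star: "edg (ds @ [y]) \<subseteq> star c" using edg_ns[OF c(2)] by simp
    have cost: "n + 72 * ?k \<le> n' + 73 * length ds" "length ds + 1 \<le> length (ns c)" and kq: "?k < q"
      using J spl by (auto simp: TJ_def)
    then have n': "72 * ?k + 73 \<le> n'" using n by linarith
    have v: "aa p' 7 = aa p 7" "ww p' = ww p" "ww p 1 = w" "vv p' 14 = q"
      using BK ag J by (auto simp: BK_def agree_def TJ_def)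
    have aZ: "aa p' 5 g \<noteq> 0 \<longleftrightarrow> g \<in> Z" if "g < m" for g using J that by (auto simp: TJ_def alive_def)
    have Zp: "Z \<subseteq> proper" using J by (auto simp: TJ_def alive_def)
    have domZ: "dom Y Z" using J by (auto simp: TJ_def)
    have buf: "inj_on (aa p' 10) {..<?k}" "aa p' 10 ` {..<?k} = Z \<inter> edg ds" using J by (auto simp: TJ_def)
    have eSZ: "?e < SZ" "?k < SZ" "Suc ?k < b" using e(1) m_le kq q(4) b_ge(3) SZ_ge by linarith+
    show ?case
    proof (cases "?e \<in> Z")
      case False
      have "\<exists>ds rs Z. TJ p Y c q ds rs Z n (n' - 1) p''"
        if "agree {7, 10} {} p' p''" "vv p'' 10 = aa p 7 y" for p''
      proof -
        have a: "agree ?V {5, 10, 11, 12} p p''" by (rule agree_trans[OF ag that(1)]) auto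
        have "TJ p Y c q (ds @ [y]) rs Z n (n' - 1) p''"
          using a that rs(3) spl(2) cost n' J False unfolding TJ_def edg alive_def by (auto simp: agree_def)
        then show ?thesis by blast
      qed
      then show ?thesis
        using False aZ[OF e(1)] n' rs(2) v by (simp add: thinstep_def agree_def)
    next
      case True
      then have alv: "0 < aa p' 5 ?e" using aZ[OF e(1)] by auto
      let ?b = "(aa p' 10)(?k := ?e)"
      have kS: "{..<Suc ?k} = insert ?k {..<?k}" by auto
      have "?b ` {..<?k} = aa p' 10 ` {..<?k}" by auto
      then have im: "?b ` {..<Suc ?k} = Z \<inter> edg (ds @ [y])"
        unfolding kS edg using buf(2) True by auto
      have nin: "?e \<notin> aa p' 10 ` {..<?k}" using buf(2) e(3) by simp
      have injb: "inj_on ?b {..<Suc ?k}"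
        unfolding kS inj_on_insert using inj_on_fun_updI[OF buf(1) nin] nin by auto
      let ?p1 = "p'\<lparr>aa := (aa p')(10 := ?b), vv := (vv p')(7 := ?e, 15 := Suc ?k)\<rparr>"
      show ?thesis
      proof (cases "Suc ?k = q")
        case no: False
        have "\<exists>ds rs Z. TJ p Y c q ds rs Z n (n' - 1) p''"
          if "agree {7, 10, 15} {10} p' p''" "vv p'' 10 = aa p 7 y" "vv p'' 15 = Suc ?k" "aa p'' 10 = ?b" for p''
        proof -
          have a: "agree ?V {5, 10, 11, 12} p p''" by (rule agree_trans[OF ag that(1)]) auto
          have "alive p'' Z" using aZ Zp that(1) by (auto simp: alive_def agree_def)
          moreover have "vv p'' 14 = q" using that(1) v by (simp add: agree_def)
          moreover have "n + 72 * Suc ?k \<le> (n' - 1) + 73 * length (ds @ [y])" using cost(1) n' by simp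
          ultimately have "TJ p Y c q (ds @ [y]) rs Z n (n' - 1) p''"
            using a that rs(3) spl(2) kq no injb im domZ unfolding TJ_def by auto
          then show ?thesis by blast
        qed
        then show ?thesis
          using alv n' rs(2) v eSZ no by (simp add: thinstep_def agree_def)
      next
        case full: True
        let ?U = "Z \<inter> edg (ds @ [y])"
        have fl: "wpc filt (wpc (asg 10 (Arr 7 (Mi (Var 10) (Num 1))))
            (\<lambda>n2 p2. 1 \<le> n2 \<and> (\<exists>ds rs Z. TJ p Y c q ds rs Z n (n2 - 1) p2))) n' p1"
          if p1: "agree {7, 15} {10} p' p1" "vv p1 15 = q" "aa p1 10 = ?b" for p1
        proof (rule wpc_filt[where U="?U" and p=p1, OF _ q(2,3,4)])
          show "vv p1 14 = q" using p1 v by (simp add: agree_def)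
          show "inj_on (aa p1 10) {..<q}" using p1 injb full by simp
          show "?U = aa p1 10 ` {..<q}" using p1 im full by simp
          show "e < SZ" if "e \<in> ?U" for e using that Zp m_le by (auto simp: proper_def)
          show "18 * q \<le> n'" using n' full by linarith
        next
          fix n2 p2 c2 K
          assume n2: "n' \<le> n2 + 18 * q"
            and ag2: "agree {15, 16, 17, 18, 19, 20, 21, 22, 23, 24, 25, 26, 27, 28} {5, 10, 11, 12} p1 p2"
            and c2: "vv p2 15 = c2" "q \<le> 4 * c2" "4 * c2 \<le> 3 * q" "inj_on (aa p2 10) {..<c2}" "K = aa p2 10 ` {..<c2}"
            and K: "K \<subseteq> ?U" and al2: "\<And>e. aa p2 5 e = (if e \<in> ?U - K then 0 else aa p1 5 e)"
            and wK: "\<And>e f. e \<in> ?U - K \<Longrightarrow> f \<in> K \<Longrightarrow> ww p1 1 e \<le> ww p1 1 f"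
          let ?Z = "Z - (?U - K)"
          let ?p3 = "p2\<lparr>vv := (vv p2)(10 := aa p 7 y)\<rparr>"
          have ww: "ww p1 1 = w" using p1 v by (simp add: agree_def)
          have cK: "card K = c2" using c2 by (simp add: card_image)
          have "dom Z ?Z"
            unfolding dom_def
          proof (intro conjI allI impI)
            fix S g assume g: "finite S \<and> card S \<le> 2 * kk - 2 \<and> g \<in> Z \<and> ends g \<inter> S = {}"
            show "\<exists>f\<in>?Z. ends f \<inter> S = {} \<and> w g \<le> w f"
            proof (cases "g \<in> ?U - K")
              case gU: True
              have ZY: "Z \<subseteq> Y" using domZ by (simp add: dom_def)
              have "\<exists>f\<in>K. ends f \<inter> S = {}"
                by (rule H[of K g]) (use K edg_star ZY c2 cK g gU in auto)
              then obtain f where "f \<in> K" "ends f \<inter> S = {}" by blast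
              then show ?thesis using wK[OF gU] ww K by auto
            qed (use g in auto)
          qed auto
          then have domZ': "dom Y ?Z" using domZ dom_trans by blast
          have a3: "agree ?V {5, 10, 11, 12} p ?p3"
            using ag p1(1) ag2 by (auto simp: agree_def)
          have "alive ?p3 ?Z"
            using al2 aZ Zp p1(1) by (auto simp: alive_def agree_def)
          moreover have "?Z \<inter> edg (ds @ [y]) = K" using K by auto
          moreover have "vv ?p3 14 = q" using ag2 p1(1) v by (auto simp: agree_def)
          moreover have "n + 72 * c2 \<le> (n2 - 1) + 73 * length (ds @ [y])"
          proof -
            have "n + 72 * q \<le> n2 + 18 * q + 73 * length ds + 72" using cost(1) n2 full by linarith
            moreover have "72 * c2 \<le> 54 * q" using c2(3) by linarith
            ultimately have "n + 72 * c2 \<le> n2 + 73 * length ds + 72" by linarith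
            moreover have "1 \<le> n2" using n' n2 full q16 by linarith
            ultimately show ?thesis by simp
          qed
          ultimately have "TJ p Y c q (ds @ [y]) rs ?Z n (n2 - 1) ?p3"
            using a3 rs(3) spl(2) c2 domZ' q16 unfolding TJ_def by simp
          moreover have "1 \<le> n2" using n' n2 full q16 by linarith
          moreover have "vv p2 10 = Suc y" "aa p2 7 = aa p 7" using ag2 p1(1) rs(2) v by (auto simp: agree_def)
          ultimately show "wpc (asg 10 (Arr 7 (Mi (Var 10) (Num 1))))
            (\<lambda>n2 p2. 1 \<le> n2 \<and> (\<exists>ds rs Z. TJ p Y c q ds rs Z n (n2 - 1) p2)) n2 p2"
            by auto
        qed
        have "wpc filt (wpc (asg 10 (Arr 7 (Mi (Var 10) (Num 1))))
            (\<lambda>n2 p2. 1 \<le> n2 \<and> (\<exists>ds rs Z. TJ p Y c q ds rs Z n (n2 - 1) p2))) n' ?p1"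
          by (rule fl) (use full in \<open>auto simp: agree_def\<close>)
        then show ?thesis
          using alv rs(2) v eSZ full by (simp add: thinstep_def)
      qed
    qed
  next
    case (3 n' p')
    then obtain ds rs Z where J: "TJ p Y c q ds rs Z n n' p'" by blast
    have rs: "rs = []" using J 3(2) by (cases rs) (auto simp: TJ_def)
    have ds: "ns c = ds" using J rs by (simp add: TJ_def)
    have "Z \<inter> star c = aa p' 10 ` {..<vv p' 15}" using J edg_ns[OF c(2)] ds by (simp add: TJ_def)
    moreover have "inj_on (aa p' 10) {..<vv p' 15}" using J by (simp add: TJ_def)
    ultimately have "card (Z \<inter> star c) = vv p' 15" by (simp add: card_image)
    then show ?case
      using J ds by (intro Q[of n' p' Z]) (auto simp: TJ_def)
  qed
  have v: "vv p 3 = R" using BK by (simp add: BK_def)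
  let ?p0 = "p\<lparr>vv := (vv p)(14 := q, 15 := 0, 10 := aa p 6 c)\<rparr>"
  have "wpc (Whl (Var 10) thinstep) Q n ?p0"
    by (rule loop) (auto simp: agree_def)
  then show ?thesis using c v q(1) by (auto simp: thinc_def)
qed

text \<open>All edges of \<open>K\<close> share the bucket \<open>c\<close>, which is outside
  \<open>S\<close>, so an edge meets \<open>S\<close> only in its other bucket. As the ends are
  distinct, each element of \<open>S\<close> excludes at most one edge.\<close>

lemma disjoint_ends_star:
  assumes K: "K \<subseteq> proper" "\<And>f. f \<in> K \<Longrightarrow> c \<in> ends f" "inj_on ends K" and S: "finite S" "card S < card K" "c \<notin> S"
  shows "\<exists>f\<in>K. ends f \<inter> S = {}"
proof (rule ccontr)
  assume "\<not> ?thesis"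
  then have hit: "ends f \<inter> S \<noteq> {}" if "f \<in> K" for f using that by blast
  have "ends ` K \<subseteq> (\<lambda>z. {c, z}) ` S"
  proof
    fix E assume "E \<in> ends ` K"
    then obtain f where f: "f \<in> K" "E = ends f" by blast
    then obtain z where "z \<in> ends f" "z \<in> S" using hit by blast
    then have "E = {c, z}" using K(2)[OF f(1)] S(3) f(2) by (auto simp: ends_def)
    then show "E \<in> (\<lambda>z. {c, z}) ` S" using \<open>z \<in> S\<close> by blast
  qed
  then have "card (ends ` K) \<le> card S"
    using S(1) by (meson card_image_le card_mono finite_imageI order_trans)
  then show False using card_image[OF K(3)] S(2) by simp
qed

text \<open>Each bucket in \<open>S\<close> excludes fewer than \<open>D\<close> edges of
  \<open>K\<close>, too few in total.\<close>

lemma disjoint_ends_deg: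
  assumes K: "K \<subseteq> proper" and deg: "\<And>z. z < R \<Longrightarrow> card (K \<inter> star z) < D" and S: "finite S" "card S * D < card K"
  shows "\<exists>f\<in>K. ends f \<inter> S = {}"
proof (rule ccontr)
  assume "\<not> ?thesis"
  then have "K \<subseteq> (\<Union>z\<in>S \<inter> {..<R}. K \<inter> star z)"
    using K al_less be_less by (fastforce simp: star_def ends_def)
  then have "card K \<le> card (\<Union>z\<in>S \<inter> {..<R}. K \<inter> star z)"
    using S(1) by (intro card_mono) (auto simp: finite_star)
  also have "\<dots> \<le> (\<Sum>z\<in>S \<inter> {..<R}. card (K \<inter> star z))"
    using S(1) by (intro card_UN_le) auto
  also have "\<dots> \<le> (\<Sum>z\<in>S \<inter> {..<R}. D)"
    using deg by (intro sum_mono) (auto simp: less_imp_le)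
  also have "\<dots> \<le> card S * D"
    using S(1) by (simp add: card_mono)
  finally show False using S(2) by simp
qed

text \<open>Per node 1 credit for the removal of parallel edges and 73 for thinning, and 1 for each
  bucket. An edge has at most three nodes, so the node costs are at most \<open>222 = 3 * 74\<close>
  credits per edge.\<close>

definition cst :: "nat \<Rightarrow> nat" where
  "cst i = (\<Sum>z<i. 74 * length (ns z) + 1)"

lemma cst_bound: "cst (Suc R) \<le> 222 * m + Suc R"
proof -
  have "cst (Suc R) = 74 * (\<Sum>z\<le>R. length (ns z)) + Suc R"
    unfolding cst_def lessThan_Suc_atMost sum.distrib sum_distrib_left[symmetric] by simp
  then show ?thesis using sum_nodes[of al be R m R] by simp
qed

lemma cst_mono: "i \<le> i' \<Longrightarrow> cst i \<le> cst i'"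
  unfolding cst_def by (intro sum_mono2) auto

definition BJ :: "pst \<Rightarrow> nat \<Rightarrow> nat \<Rightarrow> nat \<Rightarrow> pst \<Rightarrow> bool" where
  "BJ p n e n' p' \<longleftrightarrow> n \<le> n' + e \<and> e \<le> m \<and> agree {7, 11, 12} {5, 6, 7, 8} p p' \<and>
    (\<forall>t<3 * e. aa p' 8 t = bkt al be R t) \<and> (\<forall>z\<le>R. chain (aa p' 7) (aa p' 6 z) (nodes al be R e z)) \<and>
    (\<forall>i<e. aa p' 5 i = of_bool (al i \<noteq> be i))"

lemma wpc_build:
  assumes v: "vv p 6 = m" "vv p 3 = R" "ww p 1 = w" and heads: "\<And>z. z \<le> R \<Longrightarrow> aa p 6 z = 0" and n: "m \<le> n"
    and al: "\<And>e. e < m \<Longrightarrow> (aa p 13 (vv p 8) * aa p 2 e) mod vv p 2 div vv p 0 = al e"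
      "\<And>e. e < m \<Longrightarrow> (aa p 13 (vv p 8) * aa p 3 e) mod vv p 2 div vv p 0 = be e"
    and Q: "\<And>n' p'. n \<le> n' + m \<Longrightarrow> agree {7, 11, 12} {5, 6, 7, 8} p p' \<Longrightarrow> BK p' \<Longrightarrow> alive p' proper \<Longrightarrow> Q n' p'"
  shows "wpc buildc Q n p"
  unfolding buildc_def
proof (rule wpc_FOR[where J="BJ p n"], goal_cases)
  case 1
  then show ?case using heads by (auto simp: agree_def BJ_def)
next
  case (2 e n' p')
  note J = 2(1)[unfolded BJ_def]
  have V: "vv p' 6 = m" "vv p' 3 = R" "vv p' 8 = vv p 8" "vv p' 2 = vv p 2" "vv p' 0 = vv p 0"
    "aa p' 13 = aa p 13" "aa p' 2 = aa p 2" "aa p' 3 = aa p 3"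
    using J v by (auto simp: agree_def)
  have e: "e < m" using 2(3) V by simp
  then have e3: "3 * e < SZ" "Suc (3 * e) < SZ" "Suc (Suc (3 * e)) < SZ" "e < SZ" using m_le by auto
  then have eb: "Suc (3 * e) < b" "Suc (Suc (3 * e)) < b" "Suc (Suc (Suc (3 * e))) < b" "Suc e < b"
    "al e < b" "be e < b" "al e < SZ" "be e < SZ"
    using b_ge(3) SZ_ge al_less[of e] be_less[of e] R_less by linarith+
  have n': "1 \<le> n'" using J n e by linarith
  have ne: "al e \<noteq> R" "be e \<noteq> R" using al_less be_less by (simp_all add: less_imp_neq)
  let ?b8 = "(aa p' 8)(3 * e := al e, Suc (3 * e) := be e, Suc (Suc (3 * e)) := R)"
  have b8: "?b8 t = bkt al be R t" if "t < 3 * Suc e" for t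
  proof -
    have "t < 3 * e \<or> t = 3 * e \<or> t = Suc (3 * e) \<or> t = Suc (Suc (3 * e))" using that by arith
    then show ?thesis using J by auto
  qed
  show ?case
  proof (cases "al e = be e")
    case True
    have fin: "BJ p n (Suc e) (n' - Suc 0) p''"
      if "agree {7, 11, 12} {5, 6, 7, 8} p' p''" "aa p'' 8 = ?b8" "aa p'' 5 = (aa p' 5)(e := 0)" "aa p'' 7 = aa p' 7" "aa p'' 6 = aa p' 6" for p''
      proof -
      have "agree {7, 11, 12} {5, 6, 7, 8} p p''" using J that(1) by (auto simp: agree_def)
      moreover have "\<forall>i<Suc e. aa p'' 5 i = of_bool (al i \<noteq> be i)" using J that(3) True by (auto simp: less_Suc_eq)
      moreover have "n \<le> n' - Suc 0 + Suc e" using J n' by simp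
      moreover have "\<forall>z\<le>R. chain (aa p'' 7) (aa p'' 6 z) (nodes al be R (Suc e) z)" using J that(4,5) True by (simp add: nodes_Suc)
      ultimately show ?thesis using that(2) b8 e by (simp add: BJ_def)
    qed
    show ?thesis
      using 2(2) V al[OF e] True e3 eb n' by (simp add: hsh_def fin agree_def)
  next
    case False
    let ?nx = "(aa p' 7)(3 * e := aa p' 6 (al e), Suc (3 * e) := aa p' 6 (be e), Suc (Suc (3 * e)) := aa p' 6 R)"
    let ?hd = "(aa p' 6)(al e := Suc (3 * e), be e := Suc (Suc (3 * e)), R := 3 * e + 3)"
    have ch: "chain ?nx (?hd z) (nodes al be R (Suc e) z)" if "z \<le> R" for z
    proof -
      have "chain ?nx h (nodes al be R e z') = chain (aa p' 7) h (nodes al be R e z')" for h z'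
        by (rule chain_cong) (auto dest: nodes_less)
      moreover have "chain (aa p' 7) (aa p' 6 z) (nodes al be R e z)" using J that by blast
      ultimately show ?thesis using False ne by (auto simp: nodes_Suc)
    qed
    have fin: "BJ p n (Suc e) (n' - Suc 0) p''"
      if "agree {7, 11, 12} {5, 6, 7, 8} p' p''" "aa p'' 8 = ?b8" "aa p'' 5 = (aa p' 5)(e := 1)" "aa p'' 7 = ?nx" "aa p'' 6 = ?hd" for p''
    proof -
      have "agree {7, 11, 12} {5, 6, 7, 8} p p''" using J that(1) by (auto simp: agree_def)
      moreover have "\<forall>i<Suc e. aa p'' 5 i = of_bool (al i \<noteq> be i)" using J that(3) False by (auto simp: less_Suc_eq)
      moreover have "n \<le> n' - Suc 0 + Suc e" using J n' by simp
      ultimately show ?thesis using that(2,4,5) b8 ch e by (simp add: BJ_def)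
    qed
    show ?thesis
      using 2(2) V al[OF e] False e3 eb n' ne R_less
      by (simp add: hsh_def pushc_def fin agree_def)
  qed
next
  case (3 e n' p')
  note J = 3(1)[unfolded BJ_def]
  have "e = m" using J 3(3) v by (auto simp: agree_def)
  then show ?case using J v by (intro Q) (auto simp: BK_def alive_def agree_def proper_def)
qed

text \<open>\<open>8 * kk \<le> D\<close> serves both thinnings: a quarter of \<open>D\<close>
  exceeds \<open>2 * kk - 2\<close>, and a quarter of \<open>D * D\<close> exceeds
  \<open>(2 * kk - 2) * D\<close>.\<close>

lemma wpc_copyc:
  assumes v: "vv p 6 = m" "vv p 3 = R" "vv p 4 = D" "vv p 5 = D * D" "ww p 1 = w"
    and D: "D = 4 ^ J" "2 \<le> J" "8 * kk \<le> D" "1 \<le> kk" "D * D \<le> SZ" and n: "230 * (m + R + 1) \<le> n"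
    and al: "\<And>e. e < m \<Longrightarrow> (aa p 13 (vv p 8) * aa p 2 e) mod vv p 2 div vv p 0 = al e"
      "\<And>e. e < m \<Longrightarrow> (aa p 13 (vv p 8) * aa p 3 e) mod vv p 2 div vv p 0 = be e"
    and Q: "\<And>n' p' Z. n \<le> n' + 230 * (m + R + 1) \<Longrightarrow>
      agree {7, 9, 10, 11, 12, 13, 14, 15, 16, 17, 18, 19, 20, 21, 22, 23, 24, 25, 26, 27, 28} {4, 5, 6, 7, 8, 9, 10, 11, 12} p p' \<Longrightarrow>
      dom proper Z \<Longrightarrow> card Z < D * D \<Longrightarrow> (\<And>e. e < m \<Longrightarrow> aa p' 4 e \<noteq> 0 \<longleftrightarrow> aa p 4 e \<noteq> 0 \<or> e \<in> Z) \<Longrightarrow> Q n' p'"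
  shows "wpc copyc Q n p"
proof -
  let ?V = "{7, 9, 10, 11, 12, 13, 14, 15, 16, 17, 18, 19, 20, 21, 22, 23, 24, 25, 26, 27, 28} :: nat set"
  let ?A = "{5, 6, 7, 8, 9, 10, 11, 12} :: nat set"
  have n230: "230 * m + 230 * R + 230 \<le> n" using n by simp
  have Rb: "R + 1 < b" using R_less b_ge(4) by simp
  define fin where "fin = FOR 7 (Var 6) (Cnd (Arr 5 (Var 7)) (sto 4 (Var 7) (Num 1)) Skp)"
  define main where "main = FOR 9 (Pl (Var 3) (Num 1)) (blk [dedupc, thinc])"
  define init where "init = FOR 9 (Pl (Var 3) (Num 1)) (sto 6 (Var 9) (Num 0))"
  have copyc: "copyc = blk [init, buildc, main, fin]" by (simp add: copyc_def init_def main_def fin_def)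
  have q: "D * D = 4 ^ (2 * J)" using D(1) by (simp add: power_add mult_2)
  have D1: "1 \<le> D" using D(1) by simp
  have fin: "wpc fin Q n1 p1"
    if n1: "n \<le> n1 + 222 * m + 2 * (R + 1) + m" and p1: "agree ?V ?A p p1" "alive p1 Z" and Z: "dom proper Z" "card Z < D * D" for n1 p1 Z
    unfolding fin_def
  proof (rule wpc_FOR[where J="\<lambda>i n' p'. n1 \<le> n' + i \<and> i \<le> m \<and> agree {7} {4} p1 p' \<and>
      (\<forall>e<m. aa p' 4 e \<noteq> 0 \<longleftrightarrow> aa p 4 e \<noteq> 0 \<or> e \<in> Z \<and> e < i)"], goal_cases)
    case 1
    then show ?case using p1 by (auto simp: agree_def)
  next
    case (2 i n' p')
    have V: "vv p' 6 = m" "aa p' 5 = aa p1 5" using 2(1) p1(1) v by (auto simp: agree_def)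
    have i: "i < m" "i < SZ" "Suc i < b" using 2 V m_le b_ge(4) by auto
    have n': "1 \<le> n'" using conjunct1[OF 2(1)] n1 n230 i(1) by (simp add: algebra_simps)
    have iZ: "aa p' 5 i \<noteq> 0 \<longleftrightarrow> i \<in> Z" using p1(2) V i by (simp add: alive_def)
    show ?case
      using 2 V i n' iZ by (auto simp: agree_def less_Suc_eq)
  next
    case (3 i n' p')
    have i: "i = m" using 3 p1(1) v by (auto simp: agree_def)
    have a: "agree ?V {4, 5, 6, 7, 8, 9, 10, 11, 12} p p'"
      by (rule agree_trans[OF p1(1)]) (use 3 in auto)
    show ?case
      by (rule Q[of n' p' Z]) (use 3 i n1 a Z in auto)
  qed
  \<comment> \<open>A bound on a degree, once reached, persists, because later buckets only remove
    edges.\<close>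
  define MI where "MI n0 i n' p' \<longleftrightarrow> n0 \<le> n' + cst i \<and> i \<le> Suc R \<and> agree ?V ?A p p' \<and> BK p' \<and>
      (\<exists>Z. alive p' Z \<and> dom proper Z \<and> (\<forall>z<i. card (Z \<inter> star z) < (if z < R then D else D * D)))" for n0 i n' p'
  have main: "wpc main (wpc fin Q) n0 p0"
    if n0: "n \<le> n0 + (R + 1) + m" and p0: "agree ?V ?A p p0" "BK p0" "alive p0 proper" for n0 p0
    unfolding main_def
  proof (rule wpc_FOR[where J="MI n0"], goal_cases)
    case 1
    have "BK (p0\<lparr>vv := (vv p0)(9 := 0)\<rparr>)" using p0(2) by (simp add: BK_def)
    then show ?case using p0 dom_refl by (auto simp: MI_def agree_def alive_def)
  next
    case (2 i n' p')
    note J = 2(1)[unfolded MI_def]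
    obtain Y where Y: "alive p' Y" "dom proper Y" "\<And>z. z < i \<Longrightarrow> card (Y \<inter> star z) < (if z < R then D else D * D)"
      using J by blast
    have V: "vv p' 3 = R" "vv p' 4 = D" "vv p' 5 = D * D" using J v by (auto simp: agree_def)
    have iR: "i \<le> R" using 2(3) V by simp
    have "cst (Suc i) \<le> cst (Suc R)" using iR by (intro cst_mono) simp
    then have "cst (Suc i) \<le> 222 * m + Suc R" using cst_bound by linarith
    then have cst: "cst i + 74 * length (ns i) + 1 \<le> 222 * m + Suc R" by (simp add: cst_def)
    then have n': "74 * length (ns i) + 1 \<le> n'" using conjunct1[OF J] n0 n230 by (simp add: algebra_simps)
    have len: "n0 \<le> n' + cst i" using J by simp
    show ?case
    proof (simp only: blk.simps wpc_Sq, rule wpc_dedup[OF _ 2(2) iR Y(1)], goal_cases)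
      case 1 show ?case using J by simp
    next
      case 2 show ?case using n' by simp
    next
      case (3 n1 p1 Y1)
      have ag1: "agree ?V ?A p p1" by (rule agree_trans[OF _ 3(2)]) (use J in auto)
      have BK1: "BK p1" by (rule BK_agree[OF _ 3(2)]) (use J in auto)
      have V1: "vv p1 9 = i" "vv p1 4 = D" "vv p1 5 = D * D" using 3(2) 2(2) V by (auto simp: agree_def)
      have dom1: "dom proper Y1" using Y(2) 3(4) dom_trans by blast
      have sub1: "Y1 \<subseteq> Y" "Y1 \<subseteq> proper" using 3(3,4) by (auto simp: dom_def alive_def)
      have deg1: "card (Y1 \<inter> star z) < (if z < R then D else D * D)" if "z < i" for z
      proof -
        have "card (Y1 \<inter> star z) \<le> card (Y \<inter> star z)"
          using sub1 finite_star by (intro card_mono) auto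
        then show ?thesis using Y(3)[OF that] by linarith
      qed
      show ?case
      proof (rule wpc_thin[OF BK1 V1(1) iR 3(3), where q="if i < R then D else D * D" and J="if i < R then J else 2 * J"], goal_cases)
        case 1 show ?case using n' 3(1) by linarith
      next
        case 2 show ?case using V1 by simp
      next
        case 3 show ?case using D(1) q by simp
      next
        case 4 show ?case using D(2) by simp
      next
        case 5 show ?case using D(5) D1 by (cases "i < R") (auto intro: order_trans[of _ "D * D"])
      next
        case (6 K e S)
        show ?case
        proof (cases "i < R")
          case True
          have "D \<le> 4 * card K" using 6(2) True by simp
          then have "card S < card K" using 6(5) D(3,4) by linarith
          moreover have "i \<in> ends e" using 6(3) True by (auto simp: star_def)
          then have "i \<notin> S" using 6(6) by auto
          moreover have "inj_on ends K"
            using inj_on_subset[OF 3(5)[OF True] 6(1)] .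
          moreover have "K \<subseteq> proper" "\<And>f. f \<in> K \<Longrightarrow> i \<in> ends f" using 6(1) True by (auto simp: star_def)
          ultimately show ?thesis using 6(4) by (intro disjoint_ends_star[of K i]) auto
        next
          case False
          then have iR': "i = R" using iR by simp
          have K: "K \<subseteq> Y1" "K \<subseteq> proper" using 6(1) star_subset by auto
          have "card (K \<inter> star z) < D" if "z < R" for z
          proof -
            have "card (K \<inter> star z) \<le> card (Y1 \<inter> star z)"
              using K finite_star by (intro card_mono) auto
            then show ?thesis using deg1[of z] that iR' by simp
          qed
          moreover have "card S * D < card K"
          proof -
            \<comment> \<open>The slack \<open>8 * D\<close> comes from the 2 subtracted in
              \<open>2 * kk - 2\<close> and makes the final inequality strict.\<close>
            have "4 * (card S * D) + 8 * D \<le> 4 * ((2 * kk) * D)"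
            proof -
              have "card S + 2 \<le> 2 * kk" using 6(5) D(4) by linarith
              then have "(card S + 2) * D \<le> (2 * kk) * D" by (rule mult_right_mono) simp
              then show ?thesis by (simp add: algebra_simps)
            qed
            also have "\<dots> = (8 * kk) * D" by simp
            also have "\<dots> \<le> D * D" using D(3) by (rule mult_right_mono) simp
            also have "\<dots> \<le> 4 * card K" using 6(2) iR' by simp
            finally show ?thesis using D1 by linarith
          qed
          ultimately show ?thesis using K(2) 6(4) by (intro disjoint_ends_deg) auto
        qed
      next
        case (7 n2 p2 Z)
        have ag2: "agree ?V ?A p p2" by (rule agree_trans[OF ag1 7(2)]) auto
        have BK2: "BK p2" by (rule BK_agree[OF BK1 7(2)]) auto
        let ?p3 = "p2\<lparr>vv := (vv p2)(9 := Suc i)\<rparr>"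
        have sub: "Z \<subseteq> Y1" using 7(4) by (simp add: dom_def)
        have "card (Z \<inter> star z) < (if z < R then D else D * D)" if "z < Suc i" for z
        proof (cases "z = i")
          case False
          then have "z < i" using that by simp
          have "card (Z \<inter> star z) \<le> card (Y1 \<inter> star z)"
            using sub finite_star by (intro card_mono) auto
          then show ?thesis using deg1[OF \<open>z < i\<close>] by linarith
        qed (use 7(5) in simp)
        moreover have "alive ?p3 Z" using 7(3) by (simp add: alive_def)
        moreover have "dom proper Z" using dom1 7(4) dom_trans by blast
        moreover have "agree ?V ?A p ?p3" using ag2 by (auto simp: agree_def)
        moreover have "BK ?p3" using BK2 by (simp add: BK_def)
        moreover have "n0 \<le> (n2 - 1) + cst (Suc i)" "1 \<le> n2"
        proof -
          have *: "n' \<le> n2 + 74 * length (ns i)" using 3(1) 7(1) by linarith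
          show "1 \<le> n2" using * n' by linarith
          have "cst (Suc i) = cst i + 74 * length (ns i) + 1" by (simp add: cst_def)
          then show "n0 \<le> (n2 - 1) + cst (Suc i)" using * len n' by linarith
        qed
        ultimately have "MI n0 (Suc i) (n2 - 1) ?p3" "1 \<le> n2" using iR unfolding MI_def by blast+
        moreover have "vv p2 9 = i" using 7(2) V1 by (auto simp: agree_def)
        ultimately show ?case using iR Rb by simp
      qed
    qed
  next
    case (3 i n' p')
    note J = 3(1)[unfolded MI_def]
    have iR: "i = Suc R" using J 3(3) v by (auto simp: agree_def)
    obtain Z where Z: "alive p' Z" "dom proper Z" "card (Z \<inter> star R) < D * D"
      using J iR by force
    have "Z \<inter> star R = Z" using Z(1) by (auto simp: alive_def star_def)
    moreover have "n0 \<le> n' + (222 * m + Suc R)" using conjunct1[OF J] cst_bound iR by simp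
    ultimately show ?case using Z J n0 by (intro fin[of n' p' Z]) auto
  qed
  have "wpc init (wpc (blk [buildc, main, fin]) Q) n p"
    unfolding init_def
  proof (rule wpc_FOR[where J="\<lambda>i n' p'. n \<le> n' + i \<and> i \<le> Suc R \<and> agree {9} {6} p p' \<and> (\<forall>z<i. aa p' 6 z = 0)"], goal_cases)
    case 1
    then show ?case by (simp add: agree_def)
  next
    case (2 i n' p')
    have i: "i \<le> R" using 2 v by (auto simp: agree_def)
    then have "1 \<le> n'" "i < SZ" "Suc i < b" using conjunct1[OF 2(1)] n230 R_less Rb by linarith+
    then show ?case using 2 i by (auto simp: agree_def less_Suc_eq)
  next
    case (3 i n' p')
    have i: "i = Suc R" using 3 v by (auto simp: agree_def)
    have "wpc buildc (wpc main (wpc fin Q)) n' p'"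
    proof (rule wpc_build, goal_cases)
      case (8 n1 p1)
      have "agree ?V ?A p p1" by (rule agree_trans[OF _ 8(2), of "{9}" "{6}"]) (use 3 in auto)
      then show ?case using 8 3(1) i by (intro main) auto
    qed (use 3 i v al n in \<open>auto simp: agree_def\<close>)
    moreover have "wpc (Sq main fin) Q = wpc main (wpc fin Q)" by (intro ext) simp
    ultimately show ?case by simp
  qed
  then show ?thesis by (simp add: copyc)
qed

end

section \<open>Representation of stream elements, and the code of the search\<close>

definition elt :: "pst \<Rightarrow> nat \<Rightarrow> element" where
  "elt p i = (aa p 2 i, aa p 3 i, ww p 1 i)"

definition XE :: "pst \<Rightarrow> element set" where
  "XE p = elt p ` {..<vv p 6}"

text \<open>\<open>Z\<close> represents \<open>Y\<close> for matchings of \<open>k\<close> edges whose endpoints have distinct buckets under \<open>h\<close>.\<close>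

definition rep :: "(nat \<Rightarrow> nat) \<Rightarrow> nat \<Rightarrow> element set \<Rightarrow> element set \<Rightarrow> bool" where
  "rep h k Y Z \<longleftrightarrow> Z \<subseteq> Y \<and> (\<forall>S u v x. finite S \<and> card S \<le> 2 * k - 2 \<and> (u, v, x) \<in> Y \<and> h u \<noteq> h v \<and> h u \<notin> S \<and> h v \<notin> S \<longrightarrow>
     (\<exists>u' v' x'. (u', v', x') \<in> Z \<and> h u' \<noteq> h v' \<and> h u' \<notin> S \<and> h v' \<notin> S \<and> x \<le> x'))"

lemma rep_trans:
  assumes XY: "rep h k X Y" and YZ: "rep h k Y Z"
  shows "rep h k X Z"
  unfolding rep_def
proof (intro conjI allI impI)
  show "Z \<subseteq> X" using assms by (auto simp: rep_def)
  fix S u v x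
  assume a: "finite S \<and> card S \<le> 2 * k - 2 \<and> (u, v, x) \<in> X \<and> h u \<noteq> h v \<and> h u \<notin> S \<and> h v \<notin> S"
  obtain u' v' x' where 1: "(u', v', x') \<in> Y" "h u' \<noteq> h v'" "h u' \<notin> S" "h v' \<notin> S" "x \<le> x'"
    using XY[unfolded rep_def, THEN conjunct2, rule_format, OF a] by blast
  have "finite S \<and> card S \<le> 2 * k - 2 \<and> (u', v', x') \<in> Y \<and> h u' \<noteq> h v' \<and> h u' \<notin> S \<and> h v' \<notin> S" using a 1 by blast
  from YZ[unfolded rep_def, THEN conjunct2, rule_format, OF this]
  obtain u'' v'' x'' where 2: "(u'', v'', x'') \<in> Z" "h u'' \<noteq> h v''" "h u'' \<notin> S" "h v'' \<notin> S" "x' \<le> x''"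
    by blast
  have "x \<le> x''" using 1(5) 2(5) by simp
  with 2 show "\<exists>u' v' x'. (u', v', x') \<in> Z \<and> h u' \<noteq> h v' \<and> h u' \<notin> S \<and> h v' \<notin> S \<and> x \<le> x'" by blast
qed

lemma rep_mono: "rep h k Y Z \<Longrightarrow> Z \<subseteq> Z' \<Longrightarrow> Z' \<subseteq> Y \<Longrightarrow> rep h k Y Z'"
  unfolding rep_def by blast

text \<open>Uncompressed elements represent themselves, so what is read after a compression can be
  added on both sides.\<close>

lemma rep_Un: "rep h k Y Z \<Longrightarrow> rep h k (Y \<union> X) (Z \<union> X)"
proof -
  assume r: "rep h k Y Z"
  have "\<exists>u' v' x'. (u', v', x') \<in> Z \<union> X \<and> h u' \<noteq> h v' \<and> h u' \<notin> S \<and> h v' \<notin> S \<and> x \<le> x'"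
    if a: "finite S \<and> card S \<le> 2 * k - 2 \<and> (u, v, x) \<in> Y \<union> X \<and> h u \<noteq> h v \<and> h u \<notin> S \<and> h v \<notin> S" for S u v x
  proof (cases "(u, v, x) \<in> Y")
    case True
    then show ?thesis using r a unfolding rep_def by blast
  next
    case False
    then show ?thesis using a by (intro exI[of _ u] exI[of _ v] exI[of _ x]) auto
  qed
  moreover have "Z \<union> X \<subseteq> Y \<union> X" using r by (auto simp: rep_def)
  ultimately show ?thesis unfolding rep_def by blast
qed

text \<open>Edges inside one bucket are not \<open>proper\<close>, but \<open>rep\<close> asks
  nothing about them. \<open>K\<close> may exceed \<open>Z\<close>, as the edges kept for other hash
  functions are stored as well.\<close>

lemma (in buckets) dom_rep:
  assumes d: "dom proper Z" and al: "\<And>e. e < m \<Longrightarrow> al e = h (aa p 2 e)" "\<And>e. e < m \<Longrightarrow> be e = h (aa p 3 e)"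
    and w: "ww p 1 = w" and K: "Z \<subseteq> K" "K \<subseteq> {..<m}"
  shows "rep h kk (elt p ` {..<m}) (elt p ` K)"
  unfolding rep_def
proof (intro conjI allI impI)
  show "elt p ` K \<subseteq> elt p ` {..<m}" using K by auto
  fix S u v x assume a: "finite S \<and> card S \<le> 2 * kk - 2 \<and> (u, v, x) \<in> elt p ` {..<m} \<and> h u \<noteq> h v \<and> h u \<notin> S \<and> h v \<notin> S"
  then obtain e where e: "e < m" "u = aa p 2 e" "v = aa p 3 e" "x = ww p 1 e" by (auto simp: elt_def)
  then have "e \<in> proper" "ends e \<inter> S = {}" using a al by (auto simp: proper_def ends_def)
  then obtain f where f: "f \<in> Z" "ends f \<inter> S = {}" "w e \<le> w f" using d a unfolding dom_def by blast
  have fp: "f < m" "al f \<noteq> be f" using f(1) d by (auto simp: dom_def proper_def)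
  have "(aa p 2 f, aa p 3 f, ww p 1 f) \<in> elt p ` K" using f(1) K by (auto simp: elt_def)
  then show "\<exists>u' v' x'. (u', v', x') \<in> elt p ` K \<and> h u' \<noteq> h v' \<and> h u' \<notin> S \<and> h v' \<notin> S \<and> x \<le> x'"
    using f(2,3) fp al e w by (intro exI[of _ "aa p 2 f"] exI[of _ "aa p 3 f"] exI[of _ "ww p 1 f"]) (auto simp: ends_def)
qed

text \<open>There are no weight literals; entry 2 of weight array 2 is never written and supplies
  the zero that starts the sum.\<close>

definition checkc :: com where
  "checkc = blk [asg 20 (Num 1), At (WMv 2 (Num 0) 2 (Num 2)), FOR 16 (Var 1) (blk [asg 22 (Arr 14 (Var 16)),
     At (WAd 2 (Num 0) 2 (Num 0) 1 (Var 22)),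
     FOR 17 (Var 16) (blk [asg 23 (Arr 14 (Var 17)),
       Cnd (Pl (Pl (Eq (Arr 2 (Var 22)) (Arr 2 (Var 23))) (Eq (Arr 2 (Var 22)) (Arr 3 (Var 23))))
               (Pl (Eq (Arr 3 (Var 22)) (Arr 2 (Var 23))) (Eq (Arr 3 (Var 22)) (Arr 3 (Var 23)))))
         (asg 20 (Num 0)) Skp])])]"

definition updc :: com where
  "updc = Cnd (Var 20) (blk [asg 26 (Num 1), Cnd (Var 18) (At (WLs 26 2 (Num 1) 2 (Num 0))) Skp,
     Cnd (Var 26) (blk [asg 18 (Num 1), At (WMv 2 (Num 1) 2 (Num 0)), FOR 16 (Var 1) (sto 15 (Var 16) (Arr 14 (Var 16)))]) Skp]) Skp"

text \<open>Variable 21 is a pending carry. If it is still pending after the last digit, all tuples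
  have been seen, and variable 19 ends the enumeration.\<close>

definition incc :: com where
  "incc = blk [asg 16 (Num 0), asg 21 (Num 1),
     Whl (Ti (Var 21) (Le (Var 16) (Var 1))) (Cnd (Le (Pl (Arr 14 (Var 16)) (Num 1)) (Var 6))
       (blk [sto 14 (Var 16) (Pl (Arr 14 (Var 16)) (Num 1)), asg 21 (Num 0)])
       (blk [sto 14 (Var 16) (Num 0), inc 16])),
     Cnd (Var 21) (asg 19 (Num 0)) Skp]"

definition enumc :: com where
  "enumc = blk [FOR 16 (Var 1) (sto 14 (Var 16) (Num 0)), asg 19 (Num 1), Whl (Var 19) (blk [checkc, updc, incc])]"

text \<open>Cell 1 is overwritten last, since \<open>k\<close> is needed until then; 120 is the
  first cell of the output region.\<close>

definition outc :: com where
  "outc = blk [Cnd (Var 18) (blk [FOR 16 (Var 1) (blk [asg 22 (Arr 15 (Var 16)),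
     At (Out (Ti (Num 2) (Var 16)) (Arr 2 (Var 22))), At (Out (Pl (Ti (Num 2) (Var 16)) (Num 1)) (Arr 3 (Var 22)))]),
     asg 0 (Var 1)]) (asg 0 (Num 0)), asg 1 (Num 120)]"

text \<open>Without stored edges there are no digits to count with; the flag 18 of a found tuple
  then simply stays 0.\<close>

definition finalc :: com where
  "finalc = blk [asg 18 (Num 0), Cnd (Var 6) enumc Skp, outc]"

text \<open>The capacity is a power of 4 because sorting \<open>q\<close> elements ends with a
  single run whose length is the square root of \<open>q\<close>.\<close>

definition initc :: com where
  "initc = blk [asg 4 (Num 16), Whl (Le (Var 4) (Ti (Num 8) (Var 1))) (asg 4 (Ti (Num 4) (Var 4))),
     asg 5 (Ti (Var 4) (Var 4)), asg 6 (Num 0)]"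

section \<open>Enumeration of tuples by counting in base \<open>c\<close>\<close>

definition dig :: "nat \<Rightarrow> nat \<Rightarrow> nat \<Rightarrow> nat" where
  "dig c t i = t div c ^ i mod c"

lemma dig_less: "0 < c \<Longrightarrow> dig c t i < c"
  by (simp add: dig_def)

text \<open>\<open>c ^ i dvd Suc t\<close> says that in passing from \<open>t\<close> to
  \<open>Suc t\<close> the carry runs through the lowest \<open>i\<close> digits.\<close>

lemma dig_Suc_low: "c ^ i dvd Suc t \<Longrightarrow> j < i \<Longrightarrow> 0 < c \<Longrightarrow> dig c (Suc t) j = 0"
proof -
  assume a: "c ^ i dvd Suc t" "j < i" "0 < c"
  then obtain q where q: "Suc t = c ^ i * q" by (auto elim: dvdE)
  have "c ^ i = c ^ j * (c * c ^ (i - j - 1))"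
    using a(2) by (metis Suc_diff_Suc diff_Suc_1 diff_Suc_eq_diff_pred le_add_diff_inverse less_imp_le power_Suc power_add)
  then have "Suc t div c ^ j = c * c ^ (i - j - 1) * q" using q a(3) by simp
  then show ?thesis by (simp add: dig_def mult.assoc)
qed

lemma Suc_div_pow:
  assumes "c ^ i dvd Suc t" "0 < (c :: nat)"
  shows "Suc t div c ^ i = Suc (t div c ^ i)"
  using assms by (simp add: div_Suc dvd_eq_mod_eq_0)

lemma dig_Suc_high:
  assumes d: "c ^ i dvd Suc t" and lt: "Suc (dig c t i) < c" and "i \<le> j"
  shows "dig c (Suc t) j = (if j = i then Suc (dig c t i) else dig c t j)"
proof -
  let ?r = "t div c ^ i"
  have c: "0 < c" using lt by simp
  obtain f where j: "j = i + f" using assms(3) le_Suc_ex by blast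
  have e: "x div c ^ j = x div c ^ i div c ^ f" for x
    unfolding j power_add by (rule div_mult2_eq)
  have m: "Suc ?r mod c = Suc (?r mod c)" using lt by (simp add: dig_def mod_Suc)
  show ?thesis
  proof (cases f)
    case 0
    then show ?thesis using j Suc_div_pow[OF d c] m by (simp add: dig_def)
  next
    case (Suc g)
    have "Suc ?r div c = ?r div c" using m by (simp add: div_Suc)
    then show ?thesis
      using j Suc e[of "Suc t"] e[of t] Suc_div_pow[OF d c] by (simp add: dig_def div_mult2_eq)
  qed
qed

lemma dvd_Suc_pow:
  assumes d: "c ^ i dvd Suc t" and "\<not> Suc (dig c t i) < c" "0 < c"
  shows "c ^ Suc i dvd Suc t"
proof -
  have "Suc (t div c ^ i) mod c = 0"
    using assms(2) dig_less[OF assms(3), of t i] by (simp add: dig_def mod_Suc)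
  then obtain q where "Suc t div c ^ i = c * q" using Suc_div_pow[OF d assms(3)] by (metis dvdE mod_eq_0_iff_dvd)
  moreover have "Suc t = c ^ i * (Suc t div c ^ i)" using d by simp
  ultimately have "Suc t = c ^ Suc i * q" by (metis mult.assoc mult.commute power_Suc)
  then show ?thesis by simp
qed

lemma dig_surj: "(\<And>i. i < k \<Longrightarrow> f i < c) \<Longrightarrow> \<exists>t<c ^ k. \<forall>i<k. dig c t i = f i"
proof (induction k)
  case (Suc k)
  obtain t where t: "t < c ^ k" "\<And>i. i < k \<Longrightarrow> dig c t i = f i" using Suc.IH Suc.prems by auto
  let ?t = "f k * c ^ k + t"
  have fk: "f k < c" using Suc.prems by simp
  then have "?t < Suc (f k) * c ^ k" using t(1) by simp
  also have "\<dots> \<le> c * c ^ k" using fk by (intro mult_right_mono) auto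
  finally have 1: "?t < c ^ Suc k" by simp
  have "dig c ?t i = f i" if "i < Suc k" for i
  proof (cases "i = k")
    case True
    then show ?thesis using t(1) fk by (simp add: dig_def)
  next
    case False
    then have i: "i < k" using that by simp
    have "c ^ k = c ^ i * (c * c ^ (k - i - 1))"
      using i by (metis Suc_diff_Suc diff_Suc_1 diff_Suc_eq_diff_pred le_add_diff_inverse less_imp_le power_Suc power_add)
    then have "?t = c ^ i * (c * (f k * c ^ (k - i - 1))) + t" by simp
    moreover have "(c ^ i * (c * (f k * c ^ (k - i - 1))) + t) div c ^ i = c * (f k * c ^ (k - i - 1)) + t div c ^ i"
      using fk by simp
    ultimately have "?t div c ^ i = c * (f k * c ^ (k - i - 1)) + t div c ^ i" by (simp only:)
    then show ?thesis using t(2)[OF i] by (simp add: dig_def)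
  qed
  with 1 show ?case by blast
qed simp

definition disj :: "pst \<Rightarrow> nat \<Rightarrow> nat \<Rightarrow> bool" where
  "disj p e f \<longleftrightarrow> {aa p 2 e, aa p 3 e} \<inter> {aa p 2 f, aa p 3 f} = {}"

definition okt :: "pst \<Rightarrow> nat \<Rightarrow> (nat \<Rightarrow> nat) \<Rightarrow> bool" where
  "okt p k f \<longleftrightarrow> (\<forall>i<k. \<forall>j<i. disj p (f i) (f j))"

definition wgt :: "pst \<Rightarrow> nat \<Rightarrow> (nat \<Rightarrow> nat) \<Rightarrow> real" where
  "wgt p k f = (\<Sum>i<k. ww p 1 (f i))"

lemma okt_cong: "(\<And>i. i < k \<Longrightarrow> f i = g i) \<Longrightarrow> okt p k f = okt p k g"
  unfolding okt_def by (metis less_trans)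

lemma wgt_cong: "(\<And>i. i < k \<Longrightarrow> f i = g i) \<Longrightarrow> wgt p k f = wgt p k g"
  unfolding wgt_def by (intro sum.cong) auto

section \<open>Initialisation, compaction and a complete round\<close>

context machine
begin

lemma wpc_init:
  assumes "1 \<le> vv p 1" "vv p 1 = k" "4096 * k * k \<le> SZ" "32 * k \<le> n"
    and Q: "\<And>n' p' J. n \<le> n' + 32 * k \<Longrightarrow> agree {4, 5, 6} {} p p' \<Longrightarrow> vv p' 4 = 4 ^ J \<Longrightarrow> 2 \<le> J \<Longrightarrow> 8 * k \<le> vv p' 4 \<Longrightarrow>
      vv p' 4 \<le> 32 * k \<Longrightarrow> vv p' 5 = vv p' 4 * vv p' 4 \<Longrightarrow> vv p' 6 = 0 \<Longrightarrow> Q n' p'"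
  shows "wpc initc Q n p"
proof -
  have k2: "k \<le> k * k" using assms by simp
  define rest where "rest = blk [asg 5 (Ti (Var 4) (Var 4)), asg 6 (Num 0)]"
  have "wpc (Whl (Le (Var 4) (Ti (Num 8) (Var 1))) (asg 4 (Ti (Num 4) (Var 4)))) (wpc rest Q) n (p\<lparr>vv := (vv p)(4 := 16)\<rparr>)"
  proof (rule wpc_Whl[where J="\<lambda>n' p'. (\<exists>J. vv p' 4 = 4 ^ J \<and> 2 \<le> J) \<and> agree {4} {} p p' \<and> vv p' 4 \<le> 32 * k \<and>
      n + 16 \<le> n' + vv p' 4"], goal_cases)
    case 1
    then show ?case using assms by (auto simp: agree_def intro!: exI[of _ 2])
  next
    case (2 n' p')
    then obtain J where J: "vv p' 4 = 4 ^ J" "2 \<le> J" by blast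
    have lt: "vv p' 4 < 8 * k" using 2 assms by (auto simp: agree_def split: if_splits)
    have "1 \<le> vv p' 4" using J by simp
    moreover have "4 * vv p' 4 < b" using lt assms(3) k2 b_ge(3) by linarith
    moreover have "1 \<le> n'" using 2(1) lt assms(4) by linarith
    moreover have "n + 16 \<le> (n' - 1) + 4 * vv p' 4" using 2(1) calculation(1,3) by linarith
    ultimately show ?case
      using 2 J lt by (auto simp: agree_def intro!: exI[of _ "Suc J"])
  next
    case (3 n' p')
    then obtain J where J: "vv p' 4 = 4 ^ J" "2 \<le> J" by blast
    have D: "8 * k \<le> vv p' 4" "vv p' 4 \<le> 32 * k" using 3 assms by (auto simp: agree_def split: if_splits)
    have "vv p' 4 * vv p' 4 \<le> (32 * k) * (32 * k)" using D(2) by (intro mult_mono) auto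
    then have DD: "vv p' 4 * vv p' 4 < b" using assms(3) b_ge(4) by linarith
    have "Q n' (p'\<lparr>vv := (vv p')(5 := vv p' 4 * vv p' 4, 6 := 0)\<rparr>)"
      by (rule Q[of _ _ J]) (use 3 J D in \<open>auto simp: agree_def\<close>)
    then show ?case using DD by (simp add: rest_def)
  qed
  then show ?thesis by (simp add: initc_def rest_def)
qed

abbreviation bucket :: "pst \<Rightarrow> nat \<Rightarrow> nat \<Rightarrow> nat" where
  "bucket p l x \<equiv> aa p 13 l * x mod vv p 2 div vv p 0"

definition kept :: "pst \<Rightarrow> nat \<Rightarrow> nat set" where
  "kept p i = {e. e < i \<and> aa p 4 e \<noteq> 0}"

lemma finite_kept: "finite (kept p i)"
  unfolding kept_def by simp

lemma kept_Suc: "kept p (Suc i) = (if aa p 4 i \<noteq> 0 then insert i (kept p i) else kept p i)"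
  by (auto simp: kept_def less_Suc_eq)

lemma card_kept: "card (kept p i) \<le> i"
proof -
  have "kept p i \<subseteq> {..<i}" by (auto simp: kept_def)
  then have "card (kept p i) \<le> card {..<i}" by (intro card_mono) auto
  then show ?thesis by simp
qed

lemma wpc_compact:
  assumes m: "vv p 6 = m" "m \<le> SZ" "m \<le> n"
    and Q: "\<And>n' p'. n \<le> n' + m \<Longrightarrow> (\<And>x. x \<notin> {6, 7, 16} \<Longrightarrow> vv p' x = vv p x) \<Longrightarrow>
      (\<And>j. j \<notin> {2, 3} \<Longrightarrow> aa p' j = aa p j) \<Longrightarrow> (\<And>j. j \<noteq> 1 \<Longrightarrow> ww p' j = ww p j) \<Longrightarrow> outp p' = outp p \<Longrightarrow>
      vv p' 6 = card (kept p m) \<Longrightarrow> XE p' = elt p ` kept p m \<Longrightarrow> Q n' p'"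
  shows "wpc compactc Q n p"
proof -
  \<comment> \<open>At most \<open>i\<close> of the first \<open>i\<close> edges are kept, so the
    in-place copy never overwrites an edge that is still to be read.\<close>
  define JJ where "JJ i n' p' \<longleftrightarrow> n \<le> n' + i \<and> i \<le> m \<and> (\<forall>x. x \<notin> {7, 16} \<longrightarrow> vv p' x = vv p x) \<and>
      (\<forall>j. j \<notin> {2, 3} \<longrightarrow> aa p' j = aa p j) \<and> (\<forall>j. j \<noteq> 1 \<longrightarrow> ww p' j = ww p j) \<and> outp p' = outp p \<and>
      vv p' 16 = card (kept p i) \<and> elt p' ` {..<vv p' 16} = elt p ` kept p i \<and> (\<forall>t\<ge>i. elt p' t = elt p t)" for i n' p'
  have "wpc (FOR 7 (Var 6) (Cnd (Arr 4 (Var 7)) (blk [sto 2 (Var 16) (Arr 2 (Var 7)), sto 3 (Var 16) (Arr 3 (Var 7)),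
       At (WMv 1 (Var 16) 1 (Var 7)), inc 16]) Skp)) (wpc (asg 6 (Var 16)) Q) n (p\<lparr>vv := (vv p)(16 := 0)\<rparr>)"
  proof (rule wpc_FOR[where J=JJ], goal_cases)
    case 1
    then show ?case by (simp add: JJ_def kept_def elt_def)
  next
    case (2 i n' p')
    note J = 2(1)[unfolded JJ_def]
    have V: "vv p' 6 = m" "aa p' 4 = aa p 4" using J m by auto
    have i: "i < m" "i < SZ" "Suc i < b" using 2(3) V m b_ge(3) SZ_ge by auto
    have n': "1 \<le> n'" using conjunct1[OF J] m i by linarith
    let ?c = "vv p' 16"
    have c: "?c \<le> i" using J card_kept[of p i] by simp
    show ?case
    proof (cases "aa p 4 i = 0")
      case True
      have "elt (p'\<lparr>vv := f\<rparr>) = elt p'" for f by (simp add: elt_def fun_eq_iff)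
      moreover have "elt p' ` {..<card (kept p i)} = elt p ` kept p i" using J by metis
      ultimately show ?thesis using J V i n' 2(2) True by (simp add: JJ_def kept_Suc)
    next
      case False
      have cS: "?c < SZ" "Suc ?c < b" using c i b_ge(3) SZ_ge by linarith+
      have ei: "elt p' i = elt p i" using J by simp
      have fin: "JJ (Suc i) (n' - Suc 0) p''"
        if p'': "\<And>x. x \<notin> {7, 16} \<Longrightarrow> vv p'' x = vv p' x" "vv p'' 16 = Suc ?c" "aa p'' 2 = (aa p' 2)(?c := aa p' 2 i)"
          "aa p'' 3 = (aa p' 3)(?c := aa p' 3 i)" "\<And>j. j \<notin> {2, 3} \<Longrightarrow> aa p'' j = aa p' j"
          "ww p'' 1 = (ww p' 1)(?c := ww p' 1 i)" "\<And>j. j \<noteq> 1 \<Longrightarrow> ww p'' j = ww p' j" "outp p'' = outp p'" for p''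
      proof -
        have e: "elt p'' t = (if t = ?c then elt p' i else elt p' t)" for t
          using p'' by (simp add: elt_def)
        have cS: "{..<Suc ?c} = insert ?c {..<?c}" by auto
        have "elt p'' ` {..<?c} = elt p' ` {..<?c}" using e by auto
        also have "\<dots> = elt p ` kept p i" using J by blast
        finally have "elt p'' ` {..<Suc ?c} = elt p ` kept p (Suc i)"
          unfolding cS image_insert using e[of ?c] ei False by (simp add: kept_Suc)
        moreover have "elt p'' t = elt p t" if "Suc i \<le> t" for t
          using e[of t] that c J by auto
        moreover have "Suc ?c = card (kept p (Suc i))"
        proof -
          have "i \<notin> kept p i" by (simp add: kept_def)
          then show ?thesis using J False finite_kept[of p i] by (simp add: kept_Suc)
        qed
        moreover have "n \<le> (n' - Suc 0) + Suc i" using J n' by simp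
        ultimately show ?thesis
          using p'' J i unfolding JJ_def by auto
      qed
      show ?thesis
        using False V i n' 2(2) cS by simp (rule fin; auto)
    qed
  next
    case (3 i n' p')
    note J = 3(1)[unfolded JJ_def]
    have i: "i = m" using J 3(3) m by auto
    let ?p = "p'\<lparr>vv := (vv p')(6 := vv p' 16)\<rparr>"
    have "XE ?p = elt p' ` {..<vv p' 16}" by (auto simp: XE_def elt_def)
    then have "Q n' ?p" using J i by (intro Q) auto
    then show ?case by simp
  qed
  then show ?thesis by (simp add: compactc_def)
qed

text \<open>Each hash function costs \<open>230 * M + 1\<close> credits with
  \<open>M = m + R + 1\<close>; clearing the marks and compaction cost \<open>m\<close> each. The
  factor 240 absorbs these extras.\<close>

lemma wpc_round:
  assumes v: "vv p 6 = m" "vv p 3 = R" "vv p 4 = D" "vv p 5 = D * D" "vv p 2 = R * vv p 0" "1 \<le> R"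
    and D: "D = 4 ^ J" "2 \<le> J" "8 * kk \<le> D" "1 \<le> kk" "D * D \<le> SZ" and sz: "3 * m \<le> SZ" "R < SZ"
    and L: "1 \<le> L" "L < b" and n: "240 * L * (m + R + 1) \<le> n"
    and Q: "\<And>n' p'. n \<le> n' + 240 * L * (m + R + 1) \<Longrightarrow> (\<And>x. x < 6 \<Longrightarrow> vv p' x = vv p x) \<Longrightarrow> aa p' 13 = aa p 13 \<Longrightarrow>
      (\<And>j. j \<noteq> 1 \<Longrightarrow> ww p' j = ww p j) \<Longrightarrow> vv p' 6 \<le> L * (D * D) \<Longrightarrow> 
      (\<And>l. l < L \<Longrightarrow> rep (bucket p l) kk (XE p) (XE p')) \<Longrightarrow> Q n' p'"
  shows "wpc (roundc L) Q n p"
proof -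
  let ?V = "{7, 8, 9, 10, 11, 12, 13, 14, 15, 16, 17, 18, 19, 20, 21, 22, 23, 24, 25, 26, 27, 28} :: nat set"
  let ?A = "{4, 5, 6, 7, 8, 9, 10, 11, 12} :: nat set"
  define M where "M = m + R + 1"
  have M1: "1 \<le> M" "m \<le> M" by (auto simp: M_def)
  have LM: "M \<le> L * M" "L \<le> L * M" using L M1 by auto
  have n240: "240 * (L * M) \<le> n" using n by (simp add: M_def mult.assoc)
  have less: "bucket p l x < R" for l x
  \<comment> \<open>For \<open>n = 0\<close> the hash value is 0, because division by zero yields
    0.\<close>
  proof (cases "vv p 0 = 0")
    case False
    then have "aa p 13 l * x mod (R * vv p 0) < R * vv p 0" using v(6) by (intro mod_less_divisor) auto
    then show ?thesis using v(5) by (simp add: less_mult_imp_div_less)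
  qed (use v(6) in simp)
  let ?body = "FOR 8 (Num L) copyc"
  have main: "wpc ?body (wpc compactc Q) n0 p0"
    if n0: "n \<le> n0 + m" and p0: "agree ?V ?A p p0" "kept p0 m = {}" for n0 p0
  proof (rule wpc_FOR[where J="\<lambda>l n' p'. n0 \<le> n' + l * (230 * M + 1) \<and> l \<le> L \<and> agree ?V ?A p p' \<and> card (kept p' m) \<le> l * (D * D) \<and>
      (\<forall>l'<l. rep (bucket p l') kk (XE p) (elt p ` kept p' m))"], goal_cases)
    case 1
    then show ?case using p0 by (auto simp: agree_def kept_def)
  next
    case (2 l n' p')
    have J: "n0 \<le> n' + l * (230 * M + 1)" "agree ?V ?A p p'" "card (kept p' m) \<le> l * (D * D)"
      "\<And>l'. l' < l \<Longrightarrow> rep (bucket p l') kk (XE p) (elt p ` kept p' m)" using 2(1) by auto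
    have l: "l < L" "Suc l < b" using 2(3) L by auto
    have "Suc l * (230 * M + 1) \<le> L * (230 * M + 1)" using l(1) by (intro mult_right_mono) auto
    also have "\<dots> = 230 * (L * M) + L" by (simp add: algebra_simps)
    finally have "(230 * M + 1) + l * (230 * M + 1) \<le> 230 * (L * M) + L" by simp
    then have n': "230 * M + 1 \<le> n'" using J(1) n0 n240 LM M1 by linarith
    interpret B: buckets k b lb SZ P len c2 "\<lambda>e. bucket p l (aa p 2 e)" "\<lambda>e. bucket p l (aa p 3 e)" R m kk "ww p 1"
      by unfold_locales (use less sz in auto)
    have V: "vv p' 6 = m" "vv p' 3 = R" "vv p' 4 = D" "vv p' 5 = D * D" "ww p' 1 = ww p 1" "aa p' 13 = aa p 13" "vv p' 2 = vv p 2"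
      "vv p' 0 = vv p 0" "aa p' 2 = aa p 2" "aa p' 3 = aa p 3"
      using J(2) v by (auto simp: agree_def)
    show ?case
    proof (rule B.wpc_copyc[OF V(1-5) D], goal_cases)
      case 1
      then show ?case using n' by (simp add: M_def)
    next
      case (2 e)
      then show ?case using V \<open>vv p' 8 = l\<close> by simp
    next
      case (3 e)
      then show ?case using V \<open>vv p' 8 = l\<close> by simp
    next
      case (4 n1 p1 Z)
      have ag: "agree ?V ?A p p1" by (rule agree_trans[OF J(2) 4(2)]) auto
      have "Z \<subseteq> B.proper" using 4(3) unfolding B.dom_def by blast
      then have Zm: "Z \<subseteq> {..<m}" unfolding B.proper_def by auto
      have kp: "kept p1 m = kept p' m \<union> Z" using 4(5) Zm by (auto simp: kept_def)
      let ?p2 = "p1\<lparr>vv := (vv p1)(8 := Suc l)\<rparr>"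
      have k2: "kept ?p2 m = kept p1 m" by (simp add: kept_def)
      have "card (kept p1 m) \<le> card (kept p' m) + card Z" unfolding kp by (rule card_Un_le)
      then have card: "card (kept p1 m) \<le> Suc l * (D * D)" using J(3) 4(4) by simp
      have XE: "XE p = elt p ` {..<m}" using v by (simp add: XE_def)
      have new: "rep (bucket p l) kk (XE p) (elt p ` kept p1 m)"
        unfolding XE by (rule B.dom_rep[OF 4(3)]) (use kp in \<open>auto simp: kept_def\<close>)
      \<comment> \<open>Marks set for earlier functions are not erased, and their guarantee survives
        additional edges.\<close>
      have old: "rep (bucket p l') kk (XE p) (elt p ` kept p1 m)" if "l' < l" for l'
        by (rule rep_mono[OF J(4)[OF that]]) (use kp Zm in \<open>auto simp: XE kept_def\<close>)
      have "\<forall>l'<Suc l. rep (bucket p l') kk (XE p) (elt p ` kept ?p2 m)"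
        unfolding k2 using new old by (auto simp: less_Suc_eq)
      moreover have "n0 \<le> (n1 - 1) + Suc l * (230 * M + 1)" "1 \<le> n1"
        using 4(1) J(1) n' by (auto simp: M_def)
      moreover have "agree ?V ?A p ?p2" using ag by (auto simp: agree_def)
      moreover have "vv p1 8 = l" using 4(2) \<open>vv p' 8 = l\<close> by (auto simp: agree_def)
      ultimately show ?case using l card k2 by auto
    qed
  next
    case (3 l n' p')
    have lL: "l = L" using 3 by auto
    have J: "n0 \<le> n' + L * (230 * M + 1)" "agree ?V ?A p p'" "card (kept p' m) \<le> L * (D * D)"
      "\<And>l'. l' < L \<Longrightarrow> rep (bucket p l') kk (XE p) (elt p ` kept p' m)" using 3 lL by auto
    have e: "elt p' = elt p" using J(2) by (auto simp: agree_def elt_def)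
    have L2: "L * (230 * M + 1) = 230 * (L * M) + L" by (simp add: algebra_simps)
    show ?case
    proof (rule wpc_compact[of _ m], goal_cases)
      case 1 show ?case using J(2) v by (auto simp: agree_def)
    next
      case 2 show ?case using sz by simp
    next
      case 3 show ?case using J(1) n0 n240 LM M1 unfolding L2 by linarith
    next
      case (4 n1 p1)
      have "n \<le> n1 + 240 * (L * M)" using 4(1) J(1) n0 LM M1 unfolding L2 by linarith
      then show ?case
        using 4 J e by (intro Q) (auto simp: agree_def M_def mult.assoc)
    qed
  qed
  have "wpc (FOR 7 (Var 6) (sto 4 (Var 7) (Num 0))) (wpc ?body (wpc compactc Q)) n p"
  proof (rule wpc_FOR[where J="\<lambda>i n' p'. n \<le> n' + i \<and> i \<le> m \<and> agree {7} {4} p p' \<and> (\<forall>e<i. aa p' 4 e = 0)"], goal_cases)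
    case 1
    then show ?case by (simp add: agree_def)
  next
    case (2 i n' p')
    have i: "i < m" "i < SZ" "Suc i < b" using 2 v sz b_ge(3) SZ_ge by (auto simp: agree_def)
    then have "1 \<le> n'" using conjunct1[OF 2(1)] n240 LM M1 by linarith
    then show ?case using 2 i by (auto simp: agree_def less_Suc_eq)
  next
    case (3 i n' p')
    have "i = m" using 3 v by (auto simp: agree_def)
    then show ?case using 3 by (intro main) (auto simp: kept_def elim: agree_mono)
  qed
  moreover have "wpc (Sq ?body compactc) Q = wpc ?body (wpc compactc Q)" by (intro ext) simp
  ultimately show ?thesis by (simp add: roundc_def)
qed

end

section \<open>Exhaustive search\<close>

lemma okt_Suc: "okt p (Suc i) f \<longleftrightarrow> okt p i f \<and> (\<forall>j<i. disj p (f i) (f j))"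
  by (auto simp: okt_def less_Suc_eq)

lemma disj_iff: "disj p e f \<longleftrightarrow> aa p 2 e \<noteq> aa p 2 f \<and> aa p 2 e \<noteq> aa p 3 f \<and> aa p 3 e \<noteq> aa p 2 f \<and> aa p 3 e \<noteq> aa p 3 f"
  by (auto simp: disj_def)

text \<open>Here \<open>T\<close> tuples have been examined. Variable 18 tells whether one of them
  was a matching; entry 1 of weight array 2 has no meaning before.\<close>

definition best :: "pst \<Rightarrow> nat \<Rightarrow> nat \<Rightarrow> nat \<Rightarrow> pst \<Rightarrow> bool" where
  "best p0 k c T p \<longleftrightarrow> (if vv p 18 = 0 then \<forall>t<T. \<not> okt p0 k (dig c t) else
     (\<exists>t<T. (\<forall>i<k. aa p 15 i = dig c t i) \<and> okt p0 k (dig c t) \<and> ww p 2 1 = wgt p0 k (dig c t)) \<and>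
     (\<forall>t<T. okt p0 k (dig c t) \<longrightarrow> wgt p0 k (dig c t) \<le> ww p 2 1))"

definition static :: "pst \<Rightarrow> pst \<Rightarrow> bool" where
  "static p p' \<longleftrightarrow> (\<forall>j<4. aa p' j = aa p j) \<and> ww p' 1 = ww p 1 \<and> ww p' 2 2 = ww p 2 2 \<and> (\<forall>x<16. vv p' x = vv p x)"

lemma static_okt: "static p p' \<Longrightarrow> okt p' = okt p"
  by (simp add: static_def okt_def disj_iff fun_eq_iff)

lemma static_wgt: "static p p' \<Longrightarrow> wgt p' = wgt p"
  by (simp add: static_def wgt_def fun_eq_iff)

context machine
begin

lemma wpc_check:
  assumes v: "vv p 1 = k" "ww p 2 2 = 0" and n: "k * k + k \<le> n"
    and Q: "\<And>n' p'. n \<le> n' + (k * k + k) \<Longrightarrow> (\<And>x. x \<notin> {16, 17, 20, 22, 23} \<Longrightarrow> vv p' x = vv p x) \<Longrightarrow> aa p' = aa p \<Longrightarrow>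
      ww p' = (ww p)(2 := (ww p 2)(0 := wgt p k (aa p 14))) \<Longrightarrow> outp p' = outp p \<Longrightarrow>
      vv p' 20 = of_bool (okt p k (aa p 14)) \<Longrightarrow> Q n' p'"
  shows "wpc checkc Q n p"
proof -
  let ?f = "aa p 14" and ?X = "{16, 17, 20, 22, 23} :: nat set"
  let ?p = "p\<lparr>vv := (vv p)(20 := 1), ww := (ww p)(2 := (ww p 2)(0 := 0))\<rparr>"
  define body where "body = FOR 17 (Var 16) (blk [asg 23 (Arr 14 (Var 17)),
       Cnd (Pl (Pl (Eq (Arr 2 (Var 22)) (Arr 2 (Var 23))) (Eq (Arr 2 (Var 22)) (Arr 3 (Var 23))))
               (Pl (Eq (Arr 3 (Var 22)) (Arr 2 (Var 23))) (Eq (Arr 3 (Var 22)) (Arr 3 (Var 23)))))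
         (asg 20 (Num 0)) Skp])"
  define J where "J i n' p' \<longleftrightarrow> n \<le> n' + i * (k + 1) \<and> i \<le> k \<and> (\<forall>x. x \<notin> ?X \<longrightarrow> vv p' x = vv p x) \<and> aa p' = aa p \<and>
      ww p' = (ww p)(2 := (ww p 2)(0 := wgt p i ?f)) \<and> outp p' = outp p \<and> vv p' 20 = of_bool (okt p i ?f)" for i n' and p' :: pst
  have body: "wpc body Q' n1 p1"
    if 1: "vv p1 16 = i" "vv p1 22 = ?f i" "aa p1 = aa p" "i < k" "i \<le> n1" "vv p1 20 = of_bool (okt p i ?f)"
    and Q': "\<And>n' p'. n1 \<le> n' + i \<Longrightarrow> agree {17, 20, 23} {} p1 p' \<Longrightarrow> vv p' 20 = of_bool (okt p (Suc i) ?f) \<Longrightarrow> Q' n' p'" for Q' n1 p1 i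
    unfolding body_def
  proof (rule wpc_FOR[where J="\<lambda>j n' p'. n1 \<le> n' + j \<and> j \<le> i \<and> agree {17, 20, 23} {} p1 p' \<and>
      vv p' 20 = of_bool (okt p i ?f \<and> (\<forall>t<j. disj p (?f i) (?f t)))"], goal_cases)
    case 1
    then show ?case using that by (simp add: agree_def)
  next
    case (2 j n' p')
    have V: "vv p' 16 = i" "vv p' 22 = ?f i" "aa p' = aa p" using 2(1) 1 by (auto simp: agree_def)
    have j: "j < i" "Suc j < b" using 2(3) V 1 b_ge(2) by auto
    have "1 \<le> n'" using conjunct1[OF 2(1)] j 1 by linarith
    then show ?case
      using 2 V j by (auto simp: agree_def less_Suc_eq disj_iff)
  next
    case (3 j n' p')
    have "j = i" using 3 1 by (auto simp: agree_def)
    then show ?case using 3 by (intro Q') (auto simp: okt_Suc)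
  qed
  have "wpc (FOR 16 (Var 1) (blk [asg 22 (Arr 14 (Var 16)), At (WAd 2 (Num 0) 2 (Num 0) 1 (Var 22)), body])) Q n ?p"
  proof (rule wpc_FOR[where J=J], goal_cases)
    case 1
    then show ?case by (simp add: J_def okt_def wgt_def)
  next
    case (2 i n' p')
    note J = 2(1)[unfolded J_def]
    have i: "i < k" "Suc i < b" using 2(3) J v b_ge(2) by auto
    have "i * (k + 1) + (k + 1) \<le> k * (k + 1)" using i(1) mult_le_mono1[of "Suc i" k "k + 1"] by simp
    then have n': "k + 1 \<le> n'" using conjunct1[OF J] n by (simp add: algebra_simps)
    let ?p1 = "p'\<lparr>vv := (vv p')(22 := aa p' 14 i), ww := (ww p')(2 := (ww p' 2)(0 := ww p' 2 0 + ww p' 1 (aa p' 14 i)))\<rparr>"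
    have "wpc body (\<lambda>n p. vv p 16 = i \<and> 1 \<le> n \<and> Suc i < b \<and> J (Suc i) (n - 1) (p\<lparr>vv := (vv p)(16 := Suc i)\<rparr>)) n' ?p1"
    proof (rule body[of _ i], goal_cases)
      case (7 n1 p1)
      have w: "wgt p (Suc i) ?f = wgt p i ?f + ww p 1 (?f i)" by (simp add: wgt_def)
      have "n \<le> n1 - 1 + Suc i * (k + 1)" "1 \<le> n1" using 7(1) n' conjunct1[OF J] i(1) by auto
      then show ?case using 7 J 2(2) i w by (auto simp: J_def agree_def)
    qed (use J 2(2) i n' in auto)
    then show ?case using 2(2) SZ_ge by simp
  next
    case (3 i n' p')
    note J = 3(1)[unfolded J_def]
    have i: "i = k" using 3(3) J v by auto
    then show ?case using J by (intro Q) (auto simp: algebra_simps)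
  qed
  then show ?thesis using v SZ_ge by (simp add: checkc_def body_def)
qed

lemma wpc_upd:
  assumes v: "vv p 1 = k" "k \<le> SZ" and SZ2: "2 \<le> SZ" and n: "k \<le> n"
    and Q: "\<And>n' p'. n \<le> n' + k \<Longrightarrow> (\<And>x. x \<notin> {16, 18, 26} \<Longrightarrow> vv p' x = vv p x) \<Longrightarrow> (\<And>j. j \<noteq> 15 \<Longrightarrow> aa p' j = aa p j) \<Longrightarrow>
      (\<And>j. j \<noteq> 2 \<Longrightarrow> ww p' j = ww p j) \<Longrightarrow> (\<And>j. j \<noteq> 1 \<Longrightarrow> ww p' 2 j = ww p 2 j) \<Longrightarrow> outp p' = outp p \<Longrightarrow>
      (if vv p 20 \<noteq> 0 \<and> (vv p 18 = 0 \<or> ww p 2 1 < ww p 2 0)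
       then vv p' 18 = 1 \<and> ww p' 2 1 = ww p 2 0 \<and> (\<forall>i<k. aa p' 15 i = aa p 14 i)
       else vv p' 18 = vv p 18 \<and> ww p' 2 1 = ww p 2 1 \<and> aa p' 15 = aa p 15) \<Longrightarrow> Q n' p'"
  shows "wpc updc Q n p"
proof -
  have copy: "wpc (FOR 16 (Var 1) (sto 15 (Var 16) (Arr 14 (Var 16)))) Q n p1"
    if 1: "vv p1 1 = k" "\<forall>x. x \<notin> {16, 18, 26} \<longrightarrow> vv p1 x = vv p x" "aa p1 = aa p" "ww p1 = (ww p)(2 := (ww p 2)(1 := ww p 2 0))"
      "outp p1 = outp p" "vv p1 18 = 1" "vv p 20 \<noteq> 0" "vv p 18 = 0 \<or> ww p 2 1 < ww p 2 0" for p1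
    by (rule wpc_copy[where m=k]) (use 1 v n in \<open>auto simp: agree_def intro!: Q\<close>)
  show ?thesis
  proof (cases "vv p 20 = 0")
    case True
    then show ?thesis by (simp add: updc_def) (rule Q; simp)
  next
    case False
    show ?thesis
    proof (cases "vv p 18 = 0 \<or> ww p 2 1 < ww p 2 0")
      case True
      let ?c = "FOR 16 (Var 1) (sto 15 (Var 16) (Arr 14 (Var 16)))"
      have "wpc ?c Q n (p\<lparr>vv := (vv p)(26 := x, 18 := 1), ww := (ww p)(2 := (ww p 2)(1 := ww p 2 0))\<rparr>)" for x
        by (rule copy) (use v True False in auto)
      then show ?thesis
        using False True SZ2 by (auto simp: updc_def)
    next
      case F2: False
      have "Q n (p\<lparr>vv := (vv p)(26 := 0)\<rparr>)" by (rule Q) (use False F2 in auto)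
      then show ?thesis using False F2 SZ_ge by (auto simp: updc_def)
    qed
  qed
qed

lemma wpc_inc:
  assumes v: "vv p 1 = k" "k \<le> SZ" "vv p 6 = c" "0 < c" "c \<le> SZ" and n: "k \<le> n" and t: "t < c ^ k"
    and ix: "\<And>i. i < k \<Longrightarrow> aa p 14 i = dig c t i"
    and Q: "\<And>n' p'. n \<le> n' + k \<Longrightarrow> agree {16, 19, 21} {14} p p' \<Longrightarrow>
      (if Suc t < c ^ k then vv p' 19 = vv p 19 \<and> (\<forall>i<k. aa p' 14 i = dig c (Suc t) i) else vv p' 19 = 0) \<Longrightarrow> Q n' p'"
  shows "wpc incc Q n p"
proof -
  have cb: "c < b" using v b_ge(4) by simp
  let ?p = "p\<lparr>vv := (vv p)(16 := 0, 21 := 1)\<rparr>"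
  define rest where "rest = Cnd (Var 21) (asg 19 (Num 0)) Skp"
  \<comment> \<open>Variable 21 at 0 means that the increment is complete; otherwise the first
    \<open>vv p' 16\<close> digits have been reset and the carry is pending.\<close>
  define J where "J n' p' \<longleftrightarrow> agree {16, 21} {14} p p' \<and>
    (if vv p' 21 = 0 then vv p' 16 < k \<and> n \<le> n' + Suc (vv p' 16) \<and> (\<forall>j<k. aa p' 14 j = dig c (Suc t) j) \<and> Suc t < c ^ k
     else vv p' 16 \<le> k \<and> n \<le> n' + vv p' 16 \<and> c ^ vv p' 16 dvd Suc t \<and>
       (\<forall>j<k. aa p' 14 j = (if j < vv p' 16 then 0 else dig c t j)))" for n' p'
  have "wpc (Whl (Ti (Var 21) (Le (Var 16) (Var 1))) (Cnd (Le (Pl (Arr 14 (Var 16)) (Num 1)) (Var 6))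
       (blk [sto 14 (Var 16) (Pl (Arr 14 (Var 16)) (Num 1)), asg 21 (Num 0)])
       (blk [sto 14 (Var 16) (Num 0), inc 16]))) (wpc rest Q) n ?p"
  proof (rule wpc_Whl[where J=J], goal_cases)
    case 1
    then show ?case using ix by (simp add: J_def agree_def)
  next
    case (2 n' p')
    let ?i = "vv p' 16"
    have V: "vv p' 1 = k" "vv p' 6 = c" using 2(1) v by (auto simp: J_def agree_def)
    have i: "?i < k" "vv p' 21 \<noteq> 0" using 2(2) V by auto
    have ag: "agree {16, 21} {14} p p'" using 2(1) by (simp add: J_def)
    have J: "n \<le> n' + ?i" "c ^ ?i dvd Suc t" "\<And>j. j < k \<Longrightarrow> aa p' 14 j = (if j < ?i then 0 else dig c t j)"
      using 2(1) i by (auto simp: J_def)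
    have a: "aa p' 14 ?i = dig c t ?i" using J(3)[OF i(1)] by simp
    have n': "1 \<le> n'" using J(1) i n by linarith
    have iS: "?i < SZ" "Suc ?i < b" using i v b_ge(4) by linarith+
    show ?case
    proof (cases "Suc (dig c t ?i) < c")
      case True
      have d: "(if j = ?i then Suc (dig c t ?i) else aa p' 14 j) = dig c (Suc t) j" if "j < k" for j
      proof (cases "j < ?i")
        case True
        then show ?thesis using J(3)[OF that] dig_Suc_low[OF J(2) True v(4)] by simp
      next
        case False
        then show ?thesis using dig_Suc_high[OF J(2) True, of j] J(3)[OF that] by simp
      qed
      \<comment> \<open>The new digit is positive, whereas \<open>c ^ k\<close> has only zeros below
        position \<open>k\<close>.\<close>
      have "Suc t \<noteq> c ^ k"
      proof
        assume "Suc t = c ^ k"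
        then have "dig c (Suc t) ?i = 0" using i(1) v(4) by (intro dig_Suc_low[of c k]) auto
        then show False using d[OF i(1)] by simp
      qed
      then have "Suc t < c ^ k" using t by simp
      moreover have "agree {16, 21} {14} p (p'\<lparr>aa := (aa p')(14 := (aa p' 14)(?i := Suc (dig c t ?i))), vv := (vv p')(21 := 0)\<rparr>)"
        using ag by (auto simp: agree_def)
      moreover have "n \<le> n' - 1 + Suc ?i" using J(1) n' by simp
      ultimately show ?thesis
        using True a V iS i n' cb d by (simp add: J_def)
    next
      case False
      have "c ^ Suc ?i dvd Suc t" by (rule dvd_Suc_pow[OF J(2) False v(4)])
      moreover have "agree {16, 21} {14} p (p'\<lparr>aa := (aa p')(14 := (aa p' 14)(?i := 0)), vv := (vv p')(16 := Suc ?i)\<rparr>)"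
        using ag by (auto simp: agree_def)
      moreover have "n \<le> n' - 1 + Suc ?i" using J(1) n' by simp
      ultimately show ?thesis
        using False a V iS i n' J(3) by (auto simp: J_def)
    qed
  next
    case (3 n' p')
    have V: "vv p' 1 = k" using 3(1) v by (auto simp: J_def agree_def)
    show ?case
    proof (cases "vv p' 21 = 0")
      case True
      have "Q n' p'" using 3(1) True by (intro Q) (auto simp: J_def agree_def)
      then show ?thesis using True by (simp add: rest_def)
    next
      case False
      then have "vv p' 16 = k" "c ^ k dvd Suc t" "n \<le> n' + k" using 3 V by (auto simp: J_def)
      moreover from this(2) have "\<not> Suc t < c ^ k" using dvd_imp_le by fastforce
      ultimately have "Q n' (p'\<lparr>vv := (vv p')(19 := 0)\<rparr>)"
        using 3(1) False by (intro Q) (auto simp: J_def agree_def)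
      then show ?thesis using False by (simp add: rest_def)
    qed
  qed
  then show ?thesis using b_ge(1) by (simp add: incc_def rest_def)
qed

lemma wpc_add: "wpc c Q n p \<Longrightarrow> wpc c (\<lambda>n' p'. d \<le> n' \<and> Q (n' - d) p') (n + d) p"
  unfolding wpc_def by (elim exE conjE, intro exI conjI) auto

lemma best_cong: "vv p 18 = vv p' 18 \<Longrightarrow> aa p 15 = aa p' 15 \<Longrightarrow> ww p 2 1 = ww p' 2 1 \<Longrightarrow> best p0 k c T p = best p0 k c T p'"
  by (simp add: best_def)

lemma best_step:
  assumes b: "best p0 k c T p" and ix: "\<And>i. i < k \<Longrightarrow> aa p 14 i = dig c T i"
    and v: "vv p 20 = of_bool (okt p0 k (dig c T))" "ww p 2 0 = wgt p0 k (dig c T)"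
    and u: "if vv p 20 \<noteq> 0 \<and> (vv p 18 = 0 \<or> ww p 2 1 < ww p 2 0)
       then vv p' 18 = 1 \<and> ww p' 2 1 = ww p 2 0 \<and> (\<forall>i<k. aa p' 15 i = aa p 14 i)
       else vv p' 18 = vv p 18 \<and> ww p' 2 1 = ww p 2 1 \<and> aa p' 15 = aa p 15"
  shows "best p0 k c (Suc T) p'"
proof (cases "vv p 20 \<noteq> 0 \<and> (vv p 18 = 0 \<or> ww p 2 1 < ww p 2 0)")
  case True
  then have ok: "okt p0 k (dig c T)" using v by simp
  have 1: "vv p' 18 = 1" "ww p' 2 1 = wgt p0 k (dig c T)" "\<forall>i<k. aa p' 15 i = dig c T i" using u True v ix by auto
  have "wgt p0 k (dig c t) \<le> wgt p0 k (dig c T)" if "t < T" "okt p0 k (dig c t)" for t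
  proof (cases "vv p 18 = 0")
    case True
    then show ?thesis using b that by (simp add: best_def)
  next
    case False
    then have "wgt p0 k (dig c t) \<le> ww p 2 1" using b that by (simp add: best_def)
    also have "\<dots> < ww p 2 0" using True False by simp
    finally show ?thesis using v by simp
  qed
  then show ?thesis using 1 ok by (auto simp: best_def less_Suc_eq)
next
  case False
  then have 1: "vv p' 18 = vv p 18" "ww p' 2 1 = ww p 2 1" "aa p' 15 = aa p 15" using u by (auto split: if_splits)
  have "best p0 k c T p'" using b best_cong[OF 1(1,3,2)] by simp
  moreover have "\<not> okt p0 k (dig c T) \<or> (vv p 18 \<noteq> 0 \<and> wgt p0 k (dig c T) \<le> ww p' 2 1)" using False v 1 by auto
  ultimately show ?thesis using 1(1) by (auto simp: best_def less_Suc_eq)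
qed

lemma wpc_enum:
  assumes v: "vv p 1 = k" "k \<le> SZ" "vv p 6 = c" "0 < c" "c \<le> SZ" "ww p 2 2 = 0" "vv p 18 = 0" and SZ2: "2 \<le> SZ"
    and n: "k + c ^ k * (k * k + 3 * k + 1) \<le> n"
    and Q: "\<And>n' p'. static p p' \<Longrightarrow> best p k c (c ^ k) p' \<Longrightarrow> Q n' p'"
  shows "wpc enumc Q n p"
proof -
  \<comment> \<open>Credits per tuple: \<open>k * k + k\<close> for the test, \<open>k\<close> for
    recording, \<open>k\<close> for the increment and 1 for the loop.\<close>
  let ?K = "k * k + 3 * k + 1"
  define E where "E n' p' \<longleftrightarrow> static p p' \<and> (if vv p' 19 = 0 then best p k c (c ^ k) p' else
    (\<exists>t<c ^ k. (\<forall>i<k. aa p' 14 i = dig c t i) \<and> best p k c t p' \<and> (c ^ k - t) * ?K \<le> n'))" for n' and p' :: pst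
  have loop: "wpc (Whl (Var 19) (blk [checkc, updc, incc])) Q n1 p1" if "E n1 p1" for n1 p1
  proof (rule wpc_Whl[where J=E], goal_cases)
    case 1
    then show ?case using that .
  next
    case (2 n1 p1)
    have st: "static p p1" using 2 by (simp add: E_def)
    obtain t where t: "t < c ^ k" "\<And>i. i < k \<Longrightarrow> aa p1 14 i = dig c t i" "best p k c t p1" "(c ^ k - t) * ?K \<le> n1"
      using 2 by (auto simp: E_def)
    have "(c ^ k - t) * ?K = (c ^ k - Suc t) * ?K + ?K" using t(1) by (metis Suc_diff_Suc add.commute mult_Suc)
    then have n1: "(c ^ k - Suc t) * ?K + ?K \<le> n1" using t(4) by simp
    have V1: "vv p1 1 = k" "ww p1 2 2 = 0" "vv p1 6 = c" using st v by (auto simp: static_def)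
    have "wpc checkc (wpc updc (wpc incc (\<lambda>n p. 1 \<le> n \<and> E (n - 1) p))) n1 p1"
    proof (rule wpc_check[OF V1(1,2)], goal_cases)
      case 1
      then show ?case using n1 by simp
    next
      case (2 n2 p2)
      have V2: "vv p2 1 = k" "vv p2 6 = c" using 2(2) V1 by auto
      have ok2: "vv p2 20 = of_bool (okt p k (dig c t))" "ww p2 2 0 = wgt p k (dig c t)"
        using 2(4,6) okt_cong[OF t(2)] wgt_cong[OF t(2)] static_okt[OF st] static_wgt[OF st] by auto
      have st2: "static p p2" using st 2(2-5) by (simp add: static_def)
      have b2: "best p k c t p2" using t(3) 2 best_cong[of p1 p2] by simp
      have n2: "(c ^ k - Suc t) * ?K + 2 * k + 1 \<le> n2" using 2(1) n1 by simp
      show ?case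
      proof (rule wpc_upd[OF V2(1) v(2) SZ2], goal_cases)
        case 1
        then show ?case using n2 by simp
      next
        case (2 n3 p3)
        have V3: "vv p3 1 = k" "vv p3 6 = c" "vv p3 19 = vv p1 19" using 2(2) V2 \<open>\<And>x. x \<notin> {16, 17, 20, 22, 23} \<Longrightarrow> vv p2 x = vv p1 x\<close> by auto
        have st3: "static p p3" using st2 2 by (simp add: static_def)
        have i2: "aa p2 14 i = dig c t i" if "i < k" for i using that t(2) \<open>aa p2 = aa p1\<close> by simp
        have b3: "best p k c (Suc t) p3" by (rule best_step[OF b2 i2 ok2 2(7)])
        have i3: "aa p3 14 i = dig c t i" if "i < k" for i using i2[OF that] 2(3) by simp
        have n3: "(c ^ k - Suc t) * ?K + k + 1 \<le> n3" using 2(1) n2 by simp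
        show ?case
        proof (rule wpc_inc[OF V3(1) v(2) V3(2) v(4,5) _ t(1) i3], goal_cases)
          case 1
          then show ?case using n3 by simp
        next
          case (3 n4 p4)
          have n4: "(c ^ k - Suc t) * ?K + 1 \<le> n4" using 3(1) n3 by simp
          have st4: "static p p4" using st3 3(2) by (simp add: static_def agree_def)
          have b4: "best p k c (Suc t) p4" using b3 3(2) best_cong[of p3 p4] by (simp add: agree_def)
          have "E (n4 - 1) p4"
          proof (cases "Suc t < c ^ k")
            case True
            then show ?thesis using st4 b4 n4 3(3) V3(3) \<open>val (Var 19) p1 \<noteq> 0\<close> unfolding E_def
              by (auto intro!: exI[of _ "Suc t"])
          next
            case False
            then have "Suc t = c ^ k" using t(1) by simp
            then show ?thesis using st4 b4 3(3) by (simp add: E_def)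
          qed
          then show ?case using n4 by simp
        qed auto
      qed
    qed
    moreover have "wpc (Sq updc incc) X = wpc updc (wpc incc X)" for X by (intro ext) simp
    ultimately show ?case by simp
  next
    case (3 n1 p1)
    then show ?case by (intro Q) (auto simp: E_def)
  qed
  define rest where "rest = Sq (asg 19 (Num 1)) (Whl (Var 19) (blk [checkc, updc, incc]))"
  have "wpc (FOR 16 (Var 1) (sto 14 (Var 16) (Num 0))) (wpc rest Q) n p"
  proof (rule wpc_FOR[where J="\<lambda>i n' p'. n \<le> n' + i \<and> i \<le> k \<and> agree {16} {14} p p' \<and> (\<forall>e<i. aa p' 14 e = 0)"], goal_cases)
    case 1
    then show ?case by (simp add: agree_def)
  next
    case (2 i n' p')
    have i: "i < k" "i < SZ" "Suc i < b" using 2 v b_ge(4) by (auto simp: agree_def)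
    then have "1 \<le> n'" using conjunct1[OF 2(1)] n by linarith
    then show ?case using 2 i by (auto simp: agree_def less_Suc_eq)
  next
    case (3 i n' p')
    have i: "i = k" using 3 v by (auto simp: agree_def)
    have "1 \<le> c ^ k" using v(4) by simp
    then have "E n' (p'\<lparr>vv := (vv p')(19 := 1)\<rparr>)"
      using 3(1) i n v unfolding E_def
      by (auto simp: agree_def static_def best_def dig_def intro!: exI[of _ 0])
    then have "wpc (Whl (Var 19) (blk [checkc, updc, incc])) Q n' (p'\<lparr>vv := (vv p')(19 := 1)\<rparr>)" by (rule loop)
    then show ?case using b_ge(1) by (simp add: rest_def)
  qed
  then show ?thesis by (simp add: enumc_def rest_def)
qed

definition final_post :: "pst \<Rightarrow> nat \<Rightarrow> nat \<Rightarrow> pst \<Rightarrow> bool" where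
  "final_post p kk c p' \<longleftrightarrow> vv p' 1 = 120 \<and>
     (if vv p' 0 = 0 then \<forall>f. (\<forall>i<kk. f i < c) \<longrightarrow> \<not> okt p kk f
      else vv p' 0 = kk \<and> (\<exists>f. (\<forall>i<kk. f i < c) \<and> okt p kk f \<and>
        (\<forall>i<kk. outp p' (2 * i) = aa p 2 (f i) \<and> outp p' (2 * i + 1) = aa p 3 (f i)) \<and>
        (\<forall>f'. (\<forall>i<kk. f' i < c) \<longrightarrow> okt p kk f' \<longrightarrow> wgt p kk f' \<le> wgt p kk f)))"

lemma wpc_out:
  assumes v: "vv p 1 = k" "1 \<le> k" "k \<le> n" and st: "static p0 p" and best: "best p0 k c (c ^ k) p" and c: "0 < c"
  shows "wpc outc (\<lambda>n' p'. final_post p0 k c p') n p"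
proof (cases "vv p 18 = 0")
  case True
  have "\<not> okt p0 k f" if f: "\<forall>i<k. f i < c" for f
  proof -
    obtain t where t: "t < c ^ k" "\<And>i. i < k \<Longrightarrow> dig c t i = f i" using dig_surj[of k f c] f by blast
    then show ?thesis using best True okt_cong[of k "dig c t" f p0] by (auto simp: best_def)
  qed
  then show ?thesis using True b_ge(1) by (simp add: outc_def final_post_def)
next
  case False
  then obtain t where t: "t < c ^ k" "\<And>i. i < k \<Longrightarrow> aa p 15 i = dig c t i" "okt p0 k (dig c t)" "ww p 2 1 = wgt p0 k (dig c t)"
     "\<forall>t<c ^ k. okt p0 k (dig c t) \<longrightarrow> wgt p0 k (dig c t) \<le> ww p 2 1" using best by (auto simp: best_def)
  have max: "wgt p0 k f' \<le> wgt p0 k (dig c t)" if f: "\<forall>i<k. f' i < c" "okt p0 k f'" for f'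
  proof -
    obtain t' where t': "t' < c ^ k" "\<And>i. i < k \<Longrightarrow> dig c t' i = f' i" using dig_surj[of k f' c] f by blast
    have "okt p0 k (dig c t')" "wgt p0 k (dig c t') = wgt p0 k f'"
      using f okt_cong[OF t'(2)] wgt_cong[OF t'(2)] by auto
    then show ?thesis using t(4,5) t'(1) by auto
  qed
  define rest where "rest = Sq (asg 0 (Var 1)) (asg 1 (Num 120))"
  have "wpc (FOR 16 (Var 1) (blk [asg 22 (Arr 15 (Var 16)), At (Out (Ti (Num 2) (Var 16)) (Arr 2 (Var 22))),
     At (Out (Pl (Ti (Num 2) (Var 16)) (Num 1)) (Arr 3 (Var 22)))])) (wpc rest (\<lambda>n' p'. final_post p0 k c p')) n p"
  proof (rule wpc_FOR[where J="\<lambda>i n' p'. n \<le> n' + i \<and> i \<le> k \<and> vv p' 1 = k \<and> aa p' = aa p \<and>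
      (\<forall>j<i. outp p' (2 * j) = aa p 2 (dig c t j) \<and> outp p' (2 * j + 1) = aa p 3 (dig c t j))"], goal_cases)
    case 1
    then show ?case using v by simp
  next
    case (2 i n' p')
    have i: "i < k" "2 * i + 1 < 2 * k" "Suc i < b" using 2 v b_ge(2) by auto
    then have "1 \<le> n'" using conjunct1[OF 2(1)] v by linarith
    moreover have "2 * i \<noteq> 2 * j + 1" "Suc (2 * i) \<noteq> 2 * j" for j by presburger+
    ultimately show ?case using 2 i t(2)[OF i(1)] by (auto simp: less_Suc_eq)
  next
    case (3 i n' p')
    have i: "i = k" using 3 v by auto
    have "\<exists>f. (\<forall>i<k. f i < c) \<and> okt p0 k f \<and>
        (\<forall>i<k. outp p' (2 * i) = aa p0 2 (f i) \<and> outp p' (2 * i + 1) = aa p0 3 (f i)) \<and>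
        (\<forall>f'. (\<forall>i<k. f' i < c) \<longrightarrow> okt p0 k f' \<longrightarrow> wgt p0 k f' \<le> wgt p0 k f)"
      using 3(1) i t(3) max dig_less[OF c] st by (intro exI[of _ "dig c t"]) (auto simp: static_def)
    then show ?case using 3(1) v b_ge(1) by (simp add: rest_def final_post_def)
  qed
  moreover have "wpc (Sq c d) X = wpc c (wpc d X)" for c d X by (intro ext) simp
  ultimately show ?thesis using False by (simp add: outc_def rest_def)
qed

text \<open>Any number of credits will do, since the computation after the end of the stream is
  charged only for space; exponentially many tuples are therefore affordable.\<close>

lemma wpc_final:
  assumes v: "vv p 1 = k" "1 \<le> k" "k \<le> SZ" "vv p 6 = c" "c \<le> SZ" "ww p 2 2 = 0" and SZ2: "2 \<le> SZ"
  shows "\<exists>n. wpc finalc (\<lambda>n' p'. final_post p k c p') n p"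
proof (cases "c = 0")
  case True
  then have "\<not> (\<forall>i<k. f i < c)" for f using v(2) by (auto intro!: exI[of _ 0])
  then have "final_post p k c (p\<lparr>vv := (vv p)(18 := 0, 0 := 0, 1 := 120)\<rparr>)" by (auto simp: final_post_def)
  then have "wpc finalc (\<lambda>n' p'. final_post p k c p') 0 p" using True v b_ge(1) by (simp add: finalc_def outc_def)
  then show ?thesis ..
next
  case False
  let ?p = "p\<lparr>vv := (vv p)(18 := 0)\<rparr>"
  have "wpc enumc (\<lambda>n' p'. static ?p p' \<and> best ?p k c (c ^ k) p') (k + c ^ k * (k * k + 3 * k + 1)) ?p"
    by (rule wpc_enum[where c=c]) (use v False SZ2 in auto)
  from wpc_add[OF this, of k]
  have "wpc enumc (wpc outc (\<lambda>n' p'. final_post p k c p')) (k + c ^ k * (k * k + 3 * k + 1) + k) ?p"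
  proof (rule wpc_mono, goal_cases)
    case (1 n' p')
    have "final_post ?p k c = final_post p k c"
      by (simp add: final_post_def okt_def disj_iff wgt_def fun_eq_iff)
    then show ?case using wpc_out[of p' n' ?p c] 1 False v by (auto simp: static_def)
  qed
  then show ?thesis using False v b_ge(1) by (intro exI) (simp add: finalc_def)
qed

end

section \<open>Exchange argument and hashing\<close>

definition buckets_of :: "(nat \<Rightarrow> nat) \<Rightarrow> element \<Rightarrow> nat set" where
  "buckets_of h e = {h (fst e), h (fst (snd e))}"

definition separated :: "(nat \<Rightarrow> nat) \<Rightarrow> element set \<Rightarrow> bool" where
  "separated h M \<longleftrightarrow> (\<forall>e\<in>M. h (fst e) \<noteq> h (fst (snd e))) \<and> (\<forall>e\<in>M. \<forall>f\<in>M. e \<noteq> f \<longrightarrow> buckets_of h e \<inter> buckets_of h f = {})"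

text \<open>The elements of \<open>M\<close> outside \<open>Z\<close> are exchanged one at a time.
  The other elements occupy at most \<open>2 * k - 2\<close> buckets, which play the role of
  \<open>S\<close>; the substitute avoids them, so separation is kept and the weight does not
  fall.\<close>

lemma rep_exchange:
  assumes r: "rep h k Y Z" and "finite M" "separated h M" "M \<subseteq> Y" "card M = k"
  shows "\<exists>M'. finite M' \<and> separated h M' \<and> M' \<subseteq> Z \<and> card M' = k \<and> (\<Sum>e\<in>M. snd (snd e)) \<le> (\<Sum>e\<in>M'. snd (snd e))"
  using assms(2-)
proof (induction "card (M - Z)" arbitrary: M)
  case 0
  then have "M \<subseteq> Z" by auto
  then show ?case using 0 by blast
next
  case (Suc d)
  obtain e where e: "e \<in> M" "e \<notin> Z" using Suc.hyps(2) by (metis DiffE card.empty ex_in_conv nat.distinct(1))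
  let ?M = "M - {e}"
  define S where "S = \<Union> (buckets_of h ` ?M)"
  have cM: "card ?M = k - 1" using Suc.prems e by simp
  have "card S \<le> (\<Sum>f\<in>?M. card (buckets_of h f))" unfolding S_def using Suc.prems by (intro card_UN_le) auto
  also have "\<dots> \<le> (\<Sum>f\<in>?M. 2)" by (intro sum_mono) (simp add: buckets_of_def card_insert_if)
  also have "\<dots> = 2 * k - 2" using cM by simp
  finally have S: "card S \<le> 2 * k - 2" "finite S" using Suc.prems by (auto simp: S_def buckets_of_def)
  have "buckets_of h e \<inter> S = {}" using Suc.prems(2) e unfolding separated_def S_def by blast
  then have "h (fst e) \<noteq> h (fst (snd e))" "h (fst e) \<notin> S" "h (fst (snd e)) \<notin> S"
    using Suc.prems(2) e by (auto simp: buckets_of_def separated_def)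
  moreover have "(fst e, fst (snd e), snd (snd e)) \<in> Y" using Suc.prems(3) e by auto
  ultimately obtain u v x where f: "(u, v, x) \<in> Z" "h u \<noteq> h v" "h u \<notin> S" "h v \<notin> S" "snd (snd e) \<le> x"
    using r S unfolding rep_def by blast
  let ?f = "(u, v, x)"
  let ?N = "insert ?f ?M"
  have dj: "buckets_of h ?f \<inter> buckets_of h g = {}" if "g \<in> ?M" for g
    using f(3,4) that unfolding S_def buckets_of_def by auto
  have nf: "?f \<notin> ?M" using dj[of ?f] by (auto simp: buckets_of_def)
  have sep: "separated h ?N"
    unfolding separated_def
  proof (intro conjI ballI impI)
    fix a assume "a \<in> ?N"
    then show "h (fst a) \<noteq> h (fst (snd a))" using f(2) Suc.prems(2) by (auto simp: separated_def)
  next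
    fix a c assume "a \<in> ?N" "c \<in> ?N" "a \<noteq> c"
    then consider "a \<in> ?M" "c \<in> ?M" | "a = ?f" "c \<in> ?M" | "a \<in> ?M" "c = ?f" by blast
    then show "buckets_of h a \<inter> buckets_of h c = {}"
    proof cases
      case 1
      then show ?thesis using \<open>a \<noteq> c\<close> Suc.prems(2) unfolding separated_def by blast
    next
      case 2
      then show ?thesis using dj by blast
    next
      case 3
      then show ?thesis using dj[of a] by (simp only: Int_commute)
    qed
  qed
  have "?N - Z = (M - Z) - {e}" using f(1) by auto
  then have d: "d = card (?N - Z)" using Suc.hyps(2) Suc.prems(1) e by simp
  have card: "card ?N = k" using nf cM Suc.prems(1,4) e by (metis card_Suc_Diff1 card_insert_disjoint finite_Diff)
  have sub: "?N \<subseteq> Y" using f(1) r Suc.prems(3) by (auto simp: rep_def)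
  have fin: "finite ?N" using Suc.prems(1) by simp
  obtain M' where M': "finite M'" "separated h M'" "M' \<subseteq> Z" "card M' = k"
     "(\<Sum>e\<in>?N. snd (snd e)) \<le> (\<Sum>e\<in>M'. snd (snd e))"
    using Suc.hyps(1)[OF d fin sep sub card] by blast
  have "(\<Sum>e\<in>M. snd (snd e)) = snd (snd e) + (\<Sum>e\<in>?M. snd (snd e))" using Suc.prems(1) e by (simp add: sum.remove)
  also have "\<dots> \<le> (\<Sum>e\<in>?N. snd (snd e))" using f(5) nf Suc.prems(1) by simp
  finally show ?case using M' by (intro exI[of _ M']) auto
qed

section \<open>Collisions of the hash functions\<close>

lemma card_multiples:
  fixes z n l :: nat
  assumes "1 \<le> z"
  shows "card {a. l \<le> a * z \<and> a * z < l + n} * z \<le> n + z" "finite {a. l \<le> a * z \<and> a * z < l + n}"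
proof -
  let ?S = "{a. l \<le> a * z \<and> a * z < l + n}"
  have "a < l + n" if "a \<in> ?S" for a
  proof -
    have "a \<le> a * z" using assms by simp
    also have "a * z < l + n" using that by blast
    finally show ?thesis .
  qed
  then have "?S \<subseteq> {..<l + n}" by blast
  then show fin: "finite ?S" using finite_subset by blast
  show "card ?S * z \<le> n + z"
  proof (cases "?S = {}")
    case False
    let ?a = "Min ?S" and ?c = "Max ?S"
    have ac: "?a \<in> ?S" "?c \<in> ?S" using fin False Min_in Max_in by blast+
    have "?S \<subseteq> {?a..?c}" using fin by auto
    then have "card ?S \<le> Suc ?c - ?a" using card_mono[of "{?a..?c}" ?S] by simp
    also have "\<dots> \<le> (?c - ?a) + 1" by simp
    finally have "card ?S * z \<le> ((?c - ?a) + 1) * z" by (rule mult_right_mono) simp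
    also have "\<dots> = (?c * z - ?a * z) + z" by (simp add: diff_mult_distrib)
    also have "\<dots> \<le> n + z" using ac by auto
    finally show ?thesis .
  next
    case True
    show ?thesis unfolding True by simp
  qed
qed

lemma div_eq_diff:
  fixes u v n :: nat
  assumes "u div n = v div n" "0 < n"
  shows "v - u < n"
proof -
  have "v = u div n * n + v mod n" using assms(1) by (simp add: div_mult_mod_eq)
  moreover have "u div n * n \<le> u" by simp
  moreover have "v mod n < n" using assms(2) by simp
  ultimately show ?thesis by linarith
qed

text \<open>With \<open>z = x - y\<close>, a collision forces \<open>a * z\<close> to lie within
  about \<open>n\<close> of a multiple of \<open>N = R * n\<close>. For \<open>a < N\<close> the
  product stays within \<open>z\<close> periods with two windows of length \<open>n\<close> each,
  and a window contains at most \<open>n / z + 1\<close> multiples of \<open>z\<close>; in total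
  these are at most \<open>2 * (n + z)\<close>.\<close>

lemma card_collisions:
  fixes x y n R :: nat
  assumes "y < x" "x < n" "1 \<le> R"
  shows "card {a. a < R * n \<and> a * x mod (R * n) div n = a * y mod (R * n) div n} \<le> 4 * n"
proof -
  define N where "N = R * n"
  define z where "z = x - y"
  have z: "1 \<le> z" "z \<le> n" "0 < N" "n \<le> N" using assms by (auto simp: z_def N_def)
  define S where "S l = {a. l \<le> a * z \<and> a * z < l + n}" for l
  define K where "K = (n + z) div z"
  have S: "finite (S l)" "card (S l) \<le> K" for l
  proof -
    show "finite (S l)" unfolding S_def by (rule card_multiples[OF z(1)])
    have "card (S l) * z \<le> n + z" unfolding S_def by (rule card_multiples[OF z(1)])
    then have "card (S l) * z div z \<le> K" unfolding K_def by (rule div_le_mono)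
    then show "card (S l) \<le> K" using z(1) by simp
  qed
  have sub: "{a. a < N \<and> a * x mod N div n = a * y mod N div n} \<subseteq> (\<Union>q<z. S (q * N) \<union> S (Suc q * N - n))"
  proof
    fix a assume "a \<in> {a. a < N \<and> a * x mod N div n = a * y mod N div n}"
    then have a: "a < N" "a * x mod N div n = a * y mod N div n" by auto
    let ?u = "a * x mod N" and ?v = "a * y mod N" and ?r = "a * z mod N" and ?q = "a * z div N"
    have x: "x = y + z" using assms by (simp add: z_def)
    have "?u = (?v + ?r) mod N" unfolding x distrib_left by (rule mod_add_eq[symmetric])
    have vr: "?v < N" "?r < N" using z(3) by simp_all
    have "(v + r) mod N = (if v + r < N then v + r else v + r - N)" if "v < N" "r < N" for v r
      using that by (simp add: le_mod_geq)
    with vr have u: "?u = (if ?v + ?r < N then ?v + ?r else ?v + ?r - N)" unfolding \<open>?u = (?v + ?r) mod N\<close> by blast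
    have n0: "0 < n" using assms by simp
    \<comment> \<open>Equal quotients leave a difference below \<open>n\<close>, which is
      \<open>?r\<close> if \<open>?v + ?r\<close> does not wrap around and \<open>N - ?r\<close> if
      it does.\<close>
    have r: "?r < n \<or> N - n \<le> ?r"
    proof (cases "?v + ?r < N")
      case True
      then show ?thesis using u div_eq_diff[OF a(2)[symmetric] n0] by simp
    next
      case False
      have "v - u = N - r" if "u = v + r - N" "\<not> v + r < N" "v < N" "r < N" for u v r using that by linarith
      from this[OF _ False vr] have "?v - ?u = N - ?r" using u False by (simp only: if_False)
      then show ?thesis using div_eq_diff[OF a(2) n0] by linarith
    qed
    have "a * z < z * N" using a(1) z(1) by (simp add: mult.commute)
    then have q: "?q < z" by (rule less_mult_imp_div_less)
    have az: "a * z = ?q * N + ?r" by (simp add: div_mult_mod_eq)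
    have "a \<in> S (?q * N) \<union> S (Suc ?q * N - n)"
    proof (cases "?r < n")
      case True
      then have "?q * N \<le> a * z" "a * z < ?q * N + n" using az by linarith+
      then show ?thesis unfolding S_def by blast
    next
      case False
      then have "N - n \<le> ?r" using r by simp
      moreover have "?r < N" using z by simp
      ultimately have "Suc ?q * N - n \<le> a * z" "a * z < Suc ?q * N - n + n"
        using az z(4) by (simp_all only: mult_Suc)
      then show ?thesis by (simp add: S_def)
    qed
    then show "a \<in> (\<Union>q<z. S (q * N) \<union> S (Suc q * N - n))" using q by blast
  qed
  have "card {a. a < N \<and> a * x mod N div n = a * y mod N div n} \<le> card (\<Union>q<z. S (q * N) \<union> S (Suc q * N - n))"
    using S by (intro card_mono[OF _ sub]) auto
  also have "\<dots> \<le> (\<Sum>q<z. card (S (q * N) \<union> S (Suc q * N - n)))" by (rule card_UN_le) simp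
  also have "\<dots> \<le> (\<Sum>q<z. K + K)" using S(2) by (intro sum_mono order_trans[OF card_Un_le] add_mono)
  also have "\<dots> = 2 * (K * z)" by simp
  also have "\<dots> \<le> 2 * (n + z)" unfolding K_def by (intro mult_left_mono div_times_less_eq_dividend) simp
  also have "\<dots> \<le> 4 * n" using z by simp
  finally show ?thesis unfolding N_def .
qed

text \<open>Union bound over the at most \<open>4 * k * k\<close> ordered pairs of vertices:
  \<open>4 * k * k * 4 * n\<close> is half of \<open>R * n\<close>, which is the origin of the
  factor 32 in \<open>R\<close>.\<close>

lemma card_not_inj_hash:
  fixes n k :: nat
  assumes V: "finite V" "V \<subseteq> {..<n}" "card V \<le> 2 * k" and R: "R = 32 * (k * k)" "1 \<le> k"
  shows "2 * card {a. a < R * n \<and> \<not> inj_on (\<lambda>x. a * x mod (R * n) div n) V} \<le> R * n"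
proof -
  let ?h = "\<lambda>a x. a * x mod (R * n) div n"
  define A where "A e = {a. a < R * n \<and> snd e < fst e \<and> ?h a (fst e) = ?h a (snd e)}" for e :: "nat \<times> nat"
  have A: "card (A e) \<le> 4 * n" "finite (A e)" if "e \<in> V \<times> V" for e
  proof -
    show "card (A e) \<le> 4 * n"
    proof (cases "snd e < fst e")
      case True
      then show ?thesis using card_collisions[of "snd e" "fst e" n R] that V(2) R unfolding A_def by auto
    qed (simp add: A_def)
    have "A e \<subseteq> {..<R * n}" by (auto simp: A_def)
    then show "finite (A e)" using finite_subset by blast
  qed
  have sub: "{a. a < R * n \<and> \<not> inj_on (?h a) V} \<subseteq> (\<Union>e\<in>V \<times> V. A e)"
  proof
    fix a assume "a \<in> {a. a < R * n \<and> \<not> inj_on (?h a) V}"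
    then obtain x y where xy: "a < R * n" "x \<in> V" "y \<in> V" "x \<noteq> y" "?h a x = ?h a y" unfolding inj_on_def by blast
    show "a \<in> (\<Union>e\<in>V \<times> V. A e)"
    proof (cases "y < x")
      case True
      then show ?thesis using xy by (intro UN_I[of "(x, y)"]) (auto simp: A_def)
    next
      case False
      then show ?thesis using xy by (intro UN_I[of "(y, x)"]) (auto simp: A_def)
    qed
  qed
  have "card {a. a < R * n \<and> \<not> inj_on (?h a) V} \<le> card (\<Union>e\<in>V \<times> V. A e)"
    using A V by (intro card_mono[OF _ sub]) auto
  also have "\<dots> \<le> (\<Sum>e\<in>V \<times> V. card (A e))" using V by (intro card_UN_le) auto
  also have "\<dots> \<le> (\<Sum>e\<in>V \<times> V. 4 * n)" using A by (intro sum_mono) auto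
  also have "\<dots> = card V * card V * (4 * n)" by (simp add: card_cartesian_product)
  also have "\<dots> \<le> (2 * k) * (2 * k) * (4 * n)" using V(3) by (intro mult_mono) auto
  finally show ?thesis using R by simp
qed

section \<open>The streaming algorithm\<close>

text \<open>It polls while it pops, so the stack may be refilled meanwhile; since only one poll in
  \<open>P\<close> reads, popping wins.\<close>

definition DRAIN :: "nat \<Rightarrow> prog" where
  "DRAIN P = While 102 (Seq (seqs POP) (POLL P))"

definition LOOP :: "nat \<Rightarrow> nat \<Rightarrow> prog" where
  "LOOP P L = While 100 (Seq (DRAIN P) (Seq (comp P (roundc L)) (POLL P)))"

definition MAIN :: "nat \<Rightarrow> nat \<Rightarrow> prog" where
  "MAIN P L = Seq (comp P initc) (Seq (LOOP P L) (Seq (DRAIN P) (comp P finalc)))"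

text \<open>The draws are unrolled in front of the rest \<open>M\<close> of the program, because
  \<open>Random\<close> is outside the structured language.\<close>

fun draws :: "nat \<Rightarrow> nat \<Rightarrow> nat \<Rightarrow> prog \<Rightarrow> prog" where
  "draws P l 0 M = M"
| "draws P l (Suc m) M = Seq (Instr (Random 29 2)) (Seq (comp P (sto 13 (Num l) (Var 29))) (draws P (Suc l) m M))"

definition BOOT :: "instr list" where
  "BOOT = [Const 100 1, Const 104 120, Op Plus 103 1 1, Op Plus 103 103 104, Const 104 32, Op Times 3 1 1,
     Op Times 3 3 104, Op Times 2 3 0]"

definition alg :: "nat \<Rightarrow> prog" where
  "alg L = Seq (seqs BOOT) (draws (961 * L) 0 L (MAIN (961 * L) L))"

definition code_size :: nat where
  "code_size = sz initc + sz (roundc 0) + sz finalc + 400"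

text \<open>\<open>L\<close> enters the code of a round only as a literal, so
  \<open>code_size\<close>, and with it the constant of the update time, does not depend on
  \<open>\<delta>\<close>.\<close>

lemma sz_roundc: "sz (roundc L) = sz (roundc 0)"
  by (simp add: roundc_def FOR_def)

section \<open>Invariants of the streaming loop\<close>

context machine
begin

lemma XE_popped: "XE (popped p x) = insert x (XE p)"
proof -
  have e: "elt (popped p x) i = (if i = vv p 6 then x else elt p i)" for i
    by (simp add: elt_def popped_def)
  have "{..<Suc (vv p 6)} = insert (vv p 6) {..<vv p 6}" by auto
  moreover have "elt (popped p x) ` {..<vv p 6} = elt p ` {..<vv p 6}" using e by auto
  moreover have "XE (popped p x) = elt (popped p x) ` {..<Suc (vv p 6)}" by (simp add: XE_def popped_def)
  ultimately show ?thesis using e[of "vv p 6"] by (simp add: XE_def)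
qed

end

text \<open>A round leaves at most \<open>L * D * D\<close> edges with
  \<open>D \<le> 32 * k\<close>, whence \<open>B\<close>. Up to \<open>3 * B\<close> edges are
  stored when a round starts; their \<open>9 * B\<close> list nodes fit into
  \<open>SZ = 16 * B\<close>, and so does the stack, which stays below \<open>2 * B\<close> elements
  while it is drained.\<close>

locale streaming = machine k b lb SZ P len c2 for k b lb SZ P len c2 :: nat +
  fixes n L B R :: nat and xs :: "element list"
  assumes k1: "1 \<le> k" and L1: "1 \<le> L" and P_eq: "P = 961 * L" and lb_eq: "lb = P" and B_eq: "B = 1024 * L * (k * k)"
    and SZ_eq: "SZ = 16 * B" and R_eq: "R = 32 * (k * k)" and len_eq: "len = length xs" and c2_eq: "c2 = code_size"
    and Rn: "R * n < b" and nb: "n < b" and xsb: "\<forall>(u, v, w)\<in>set xs. u < b \<and> v < b"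
begin

definition CON :: "pst \<Rightarrow> element set \<Rightarrow> iost \<Rightarrow> bool" where
  "CON p X io \<longleftrightarrow> (\<exists>ys. xs = ys @ rest io \<and> (\<forall>l<L. rep (bucket p l) k (set ys) (X \<union> set (stack io))))"

lemma CON_poll: "CON p X io \<Longrightarrow> CON p X (poll P io)"
proof -
  assume "CON p X io"
  then obtain ys where ys: "xs = ys @ rest io" "\<And>l. l < L \<Longrightarrow> rep (bucket p l) k (set ys) (X \<union> set (stack io))"
    by (auto simp: CON_def)
  show ?thesis
  proof (cases "live io \<and> \<not> Suc (polls io) < P \<and> rest io \<noteq> []")
    case True
    then obtain x zs where r: "rest io = x # zs" by (auto simp: neq_Nil_conv)
    have "rep (bucket p l) k (set (ys @ [x])) (X \<union> set (stack io @ [x]))" if "l < L" for l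
      using rep_Un[OF ys(2)[OF that], of "{x}"] by (simp add: Un_assoc)
    moreover have "poll P io = io\<lparr>polls := 0, stack := stack io @ [x], rest := zs\<rparr>" using True r by (simp add: poll_def)
    ultimately show ?thesis unfolding CON_def using r ys(1) by (intro exI[of _ "ys @ [x]"]) simp
  next
    case False
    then have "stack (poll P io) = stack io \<and> rest (poll P io) = rest io" by (auto simp: poll_def split: list.splits)
    then show ?thesis unfolding CON_def using ys by (intro exI[of _ ys]) simp
  qed
qed

lemma CON_polls: "CON p X io \<Longrightarrow> CON p X ((poll P ^^ m) io)"
  by (induction m) (auto intro: CON_poll)

lemma CON_rep:
  assumes "CON p X io" and r: "\<And>l. l < L \<Longrightarrow> rep (bucket p l) k X Z"
  shows "CON p Z io"
proof -
  obtain ys where ys: "xs = ys @ rest io" "\<And>l. l < L \<Longrightarrow> rep (bucket p l) k (set ys) (X \<union> set (stack io))"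
    using assms(1) by (auto simp: CON_def)
  have "rep (bucket p l) k (set ys) (Z \<union> set (stack io))" if "l < L" for l
    using rep_trans[OF ys(2)[OF that] rep_Un[OF r[OF that]]] .
  then show ?thesis unfolding CON_def using ys(1) by blast
qed

text \<open>Falls with each poll until the end is detected; the \<open>Suc\<close> separates every
  live state from the value 0.\<close>

definition mu :: "iost \<Rightarrow> nat" where
  "mu io = (if live io then Suc (length (rest io) * P + (P - polls io)) else 0)"

lemma mu_poll: "polls io < P \<Longrightarrow> mu (poll P io) \<le> mu io"
  "polls io < P \<Longrightarrow> live io \<Longrightarrow> mu (poll P io) < mu io"
  by (auto simp: mu_def poll_def split: list.splits)

lemma mu_polls: "polls io < P \<Longrightarrow> mu ((poll P ^^ m) io) \<le> mu io"
  by (induction m) (auto intro: order_trans[OF mu_poll(1)] polls_polls)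

definition fixed :: "pst \<Rightarrow> pst \<Rightarrow> bool" where
  "fixed p p' \<longleftrightarrow> (\<forall>x<6. vv p' x = vv p x) \<and> aa p' 13 = aa p 13 \<and> ww p' 2 = ww p 2"

text \<open>Popping lowers \<open>psi\<close> by \<open>P\<close>; the stored edge takes back
  \<open>P - 1\<close> and the poll at most 1, so the sum does not grow during draining. Its bound
  stands for the end of a round: \<open>B\<close> stored edges and \<open>P * B\<close> counted
  polls.\<close>

definition INV :: "pst \<Rightarrow> pst \<Rightarrow> iost \<Rightarrow> bool" where
  "INV p p' io \<longleftrightarrow> fixed p p' \<and> vv p' 6 * (P - 1) + psi io \<le> B * (P - 1) + P * B \<and> CON p (XE p') io"

lemma B_ge: "1024 \<le> B" "1024 * (k * k) \<le> B" "k * k \<le> B" "k \<le> B" "L \<le> B"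
proof -
  have "1 \<le> k * k" "k \<le> k * k" using k1 by auto
  moreover have "1 * (k * k) \<le> L * (k * k)" "L * 1 \<le> L * (k * k)" using L1 k1 by (intro mult_mono; simp)+
  ultimately show "1024 \<le> B" "1024 * (k * k) \<le> B" "k * k \<le> B" "k \<le> B" "L \<le> B" unfolding B_eq by auto
qed

lemma INV_bounds:
  assumes "INV p p' io"
  shows "vv p' 6 \<le> 3 * B" "psi io + P < P * SZ"
proof -
  have P: "961 \<le> P" using P_eq L1 by simp
  have i: "vv p' 6 * (P - 1) + psi io \<le> B * (P - 1) + P * B" using assms by (simp add: INV_def)
  have "P * B \<le> 2 * (P - 1) * B" using P by (intro mult_right_mono) auto
  then have "vv p' 6 * (P - 1) \<le> (3 * B) * (P - 1)" using i by (simp add: algebra_simps)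
  then show "vv p' 6 \<le> 3 * B" using P by (simp only: mult_le_cancel2)
  have "B * (P - 1) \<le> P * B" by (simp add: mult.commute)
  moreover have "P * 1024 \<le> P * B" "1 \<le> P * B" using B_ge P by auto
  moreover have "P * SZ = 16 * (P * B)" unfolding SZ_eq by simp
  ultimately show "psi io + P < P * SZ" using i by linarith
qed

lemma length_POP: "length POP = 25"
  by (simp add: POP_def)

text \<open>Every iteration stores one more edge, and \<open>INV\<close> caps the stored edges at
  \<open>3 * B\<close>; so the loop ends although the stack can be refilled.\<close>

lemma drain_ev:
  assumes "RR p' io s" "INV p p' io" "ck len (c2 * polls io + h) g s" "30 \<le> h" "h + 60 \<le> c2"
  shows "ev I (\<lambda>g s. \<exists>p'' io'. RR p'' io' s \<and> INV p p'' io' \<and> stack io' = [] \<and> mu io' \<le> mu io \<and>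
     ck len (c2 * polls io' + Suc h) g s) (DRAIN P) g s"
  using assms
proof (induction "3 * B - vv p' 6" arbitrary: p' io s g rule: less_induct)
  case less
  let ?Q = "\<lambda>io g s. \<exists>p'' io'. RR p'' io' s \<and> INV p p'' io' \<and> stack io' = [] \<and> mu io' \<le> mu io \<and>
     ck len (c2 * polls io' + Suc h) g s"
  note R = less.prems(1) and inv = less.prems(2) and ck = less.prems(3)
  have st: "mem s 102 = length (stack io)" using R by (simp add: RR_def)
  have I0: "I g s" using RR_I[OF R ck] less.prems by simp
  have ck1: "ck len (c2 * polls io + Suc h) (Suc g) s" using ck_Suc[OF ck] by simp
  have I1: "I (Suc g) s" using RR_I[OF R ck1] less.prems by simp
  show ?case
  proof (cases "stack io = []")
    case True
    then show ?thesis unfolding DRAIN_def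
      using st I0 I1 R inv ck1 by (intro ev_While_exit) auto
  next
    case False
    then obtain S x where x: "stack io = S @ [x]" by (metis rev_exhaust)
    let ?p = "popped p' x" and ?io = "io\<lparr>stack := S\<rparr>"
    have c: "vv p' 6 \<le> 3 * B" "psi io + P < P * SZ" using INV_bounds[OF inv] .
    have c6: "vv p' 6 < SZ" using c(1) B_ge(1) unfolding SZ_eq by linarith
    have psi: "psi io = psi ?io + P" by (simp add: psi_def x)
    have con: "CON p (XE ?p) ?io"
      using inv x by (simp add: INV_def CON_def XE_popped insert_commute)
    have fx: "fixed p ?p" using inv by (simp add: INV_def fixed_def popped_def)
    have "(vv p' 6 + 1) * (P - 1) + (psi ?io + 1) \<le> B * (P - 1) + P * B"
      using inv psi P_ge unfolding INV_def distrib_right by linarith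
    then have sm: "vv ?p 6 * (P - 1) + (psi ?io + 1) \<le> B * (P - 1) + P * B" by (simp add: popped_def)
    have P1: "polls ?io < P" using RR_bnd[OF R] by simp
    have inv': "INV p ?p (poll P ?io)"
      using fx sm CON_poll[OF con] psi_poll[OF P1] unfolding INV_def by linarith
    have "mu ?io = mu io" by (simp add: mu_def)
    then have mu: "mu (poll P ?io) \<le> mu io" using mu_poll(1)[OF P1] by simp
    have pop: "ev I (\<lambda>g s. RR ?p ?io s \<and> ck len (c2 * polls io + Suc h + 2 * length POP) g s) (seqs POP) (Suc g) s"
    proof (rule ev_seqs_I[OF POP_lst[OF R x c6] ck1])
      have "c2 * polls io \<le> c2 * P" using RR_bnd[OF R] by (intro mult_left_mono) auto
      then show "c2 * polls io + Suc h + 2 * length POP \<le> c2 * P + c2 + 100" using less.prems(5) unfolding length_POP by linarith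
    qed
    have "ev I (\<lambda>g s. ev I (?Q io) (DRAIN P) (Suc g) s) (Seq (seqs POP) (POLL P)) (Suc g) s"
    proof (rule ev_Seq[OF pop])
      fix g1 s1 assume "I g1 s1" and a: "RR ?p ?io s1 \<and> ck len (c2 * polls io + Suc h + 2 * length POP) g1 s1"
      have ck2: "ck len (c2 * polls ?io + c2) (Suc g1) s1"
        using ck_Suc[OF conjunct2[OF a]] less.prems(5) by (auto intro: ck_mono simp: length_POP)
      have sl: "length (stack ?io) < SZ" using psi_stack[of ?io] c(2) psi by simp
      show "ev I (\<lambda>g s. ev I (?Q io) (DRAIN P) (Suc g) s) (POLL P) (Suc g1) s1"
      proof (rule ev_mono[OF POLL_ev[OF conjunct1[OF a] ck2 sl]])
        fix g2 s2 assume b: "RR ?p (poll P ?io) s2 \<and> ck len (c2 * polls (poll P ?io) + 20) g2 s2"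
        have ck3: "ck len (c2 * polls (poll P ?io) + h) (Suc g2) s2"
          using ck_Suc[OF conjunct2[OF b]] less.prems(4) by (auto intro: ck_mono)
        have "vv ?p 6 = Suc (vv p' 6)" by (simp add: popped_def)
        moreover have "vv ?p 6 \<le> 3 * B" using INV_bounds(1)[OF inv'] .
        ultimately have "3 * B - vv ?p 6 < 3 * B - vv p' 6" by linarith
        from less.hyps[OF this conjunct1[OF b] inv' ck3 less.prems(4,5)]
        show "ev I (?Q io) (DRAIN P) (Suc g2) s2"
          by (rule ev_mono) (use mu in \<open>auto intro: order_trans\<close>)
      qed
    qed
    then show ?thesis unfolding DRAIN_def
      using st x by (intro ev_While_enter[where I=I and g=g and s=s, OF I0]) auto
  qed
qed

lemma wf_progs: "wfc initc" "wfc (roundc L)" "wfc finalc"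
proof -
  have "961 \<le> lb" "L \<le> lb" using lb_eq P_eq L1 by auto
  then show "wfc initc" "wfc (roundc L)" "wfc finalc"
    by (simp_all add: initc_def roundc_def finalc_def copyc_def compactc_def thinc_def thinstep_def dedupc_def dedupstep_def
      paralc_def buildc_def pushc_def hsh_def filt_def mpass_def mpair_def mstep_def gtc_def enumc_def outc_def checkc_def updc_def
      incc_def FOR_def wfx_def)
qed

definition params :: "pst \<Rightarrow> bool" where
  "params p \<longleftrightarrow> vv p 0 = n \<and> vv p 1 = k \<and> vv p 2 = R * n \<and> vv p 3 = R \<and> ww p 2 2 = 0"

definition sized :: "pst \<Rightarrow> bool" where
  "sized p \<longleftrightarrow> (\<exists>J. vv p 4 = 4 ^ J \<and> 2 \<le> J) \<and> 8 * k \<le> vv p 4 \<and> vv p 4 \<le> 32 * k \<and> vv p 5 = vv p 4 * vv p 4"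

text \<open>A round on at most \<open>3 * B\<close> edges makes at most
  \<open>240 * L * (4 * B) = 960 * L * B\<close> polls. The remaining \<open>L * B\<close> in
  \<open>P * B\<close> covers the polls already counted at its start, fewer than
  \<open>P\<close>.\<close>

lemma round_ev:
  assumes R: "RR p' io s" and inv: "INV p p' io" and st: "stack io = []" and par: "params p" "sized p"
    and ck: "ck len (c2 * polls io + h) g s" "30 \<le> h" "h + sz (roundc 0) \<le> c2"
  shows "ev I (\<lambda>g s. \<exists>p'' io'. RR p'' io' s \<and> fixed p p'' \<and> vv p'' 6 \<le> B \<and> Suc (psi io') \<le> P * B \<and> CON p (XE p'') io' \<and> mu io' \<le> mu io \<and>
     ck len (c2 * polls io' + (h + sz (roundc 0))) g s) (comp P (roundc L)) g s"
proof -
  let ?m = "vv p' 6"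
  have m: "?m \<le> 3 * B" using INV_bounds(1)[OF inv] .
  have fx: "fixed p p'" and con: "CON p (XE p') io" using inv by (auto simp: INV_def)
  have V: "vv p' 0 = n" "vv p' 1 = k" "vv p' 2 = R * n" "vv p' 3 = R" "vv p' 4 = vv p 4" "vv p' 5 = vv p' 4 * vv p' 4" "aa p' 13 = aa p 13"
    using fx par by (auto simp: fixed_def params_def sized_def)
  obtain J where J: "vv p' 4 = 4 ^ J" "2 \<le> J" using par V by (auto simp: sized_def)
  have D: "8 * k \<le> vv p' 4" "vv p' 4 \<le> 32 * k" using par V by (auto simp: sized_def)
  have DD: "vv p' 4 * vv p' 4 \<le> 1024 * (k * k)" using mult_mono[OF D(2) D(2)] by simp
  then have LDD: "L * (vv p' 4 * vv p' 4) \<le> B" unfolding B_eq mult.assoc mult.left_commute[of 1024] by (rule mult_left_mono) simp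
  have "1 \<le> k * k" using k1 by simp
  then have R1: "R + 1 \<le> B" "1 \<le> R" using B_ge unfolding R_eq by linarith+
  let ?c = "240 * L * (?m + R + 1)"
  have "?m + R + 1 \<le> 4 * B" using m R1 by linarith
  then have "?c \<le> 240 * L * (4 * B)" by (rule mult_left_mono) simp
  then have cost: "?c \<le> 960 * (L * B)" by simp
  have "?m + R + 1 < SZ" using m R1 unfolding SZ_eq by linarith
  have bk: "bucket p' l = bucket p l" for l using V par by (simp add: fun_eq_iff params_def)
  have SZ1: "4 ^ J * 4 ^ J \<le> SZ" "3 * ?m \<le> SZ" "R < SZ" using DD J B_ge m R1 unfolding SZ_eq by auto
  have Lb: "L < b" using B_ge(5) b_ge(4) unfolding SZ_eq by linarith
  have "wpc (roundc L) (\<lambda>n' p''. ?c \<le> n' + ?c \<and> fixed p p'' \<and> vv p'' 6 \<le> B \<and> (\<forall>l<L. rep (bucket p l) k (XE p') (XE p''))) ?c p'"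
  proof (rule wpc_round[where J=J and D="vv p' 4" and R=R and kk=k, OF refl V(4) refl V(6) _ R1(2) J D(1) k1 _ SZ1(2,3) L1 Lb order.refl], goal_cases)
    case 1
    then show ?case using V by simp
  next
    case 2
    then show ?case using SZ1 J by simp
  next
    case (3 n' p'')
    then show ?case using fx V LDD bk by (auto simp: fixed_def)
  qed
  then obtain m p'' where w: "bs (roundc L) p' m p''" "m \<le> ?c" "fixed p p''" "vv p'' 6 \<le> B"
      "\<And>l. l < L \<Longrightarrow> rep (bucket p l) k (XE p') (XE p'')" by (auto simp: wpc_def)
  let ?io = "(poll P ^^ m) io"
  have pb: "polls io < P" using RR_bnd[OF R] .
  have psi0: "psi io \<le> P - 1" using st pb by (simp add: psi_def)
  have LB: "1024 * L \<le> L * B" using B_ge(1) by simp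
  have tot: "Suc (psi io + m) \<le> P * B"
  proof -
    have "P * B = 960 * (L * B) + L * B" unfolding P_eq by simp
    moreover have "P \<le> L * B" using LB L1 unfolding P_eq by linarith
    ultimately show ?thesis using psi0 w(2) cost P_ge by linarith
  qed
  have "P * B \<le> P * SZ" unfolding SZ_eq by simp
  then have lv: "live io \<longrightarrow> psi io + m \<le> P * SZ" using tot by linarith
  have "Suc (psi ?io) \<le> P * B" using psi_polls[OF pb, of m] tot by linarith
  moreover have "CON p (XE p'') ?io" by (rule CON_rep[OF CON_polls[OF con] w(5)])
  moreover have "mu ?io \<le> mu io" by (rule mu_polls[OF pb])
  moreover have sz: "h + sz (roundc L) \<le> c2" using ck(3) unfolding sz_roundc[of L] .
  ultimately show ?thesis
    using w(3,4) unfolding sz_roundc[of L, symmetric]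
    by (intro ev_mono[OF comp_ev[OF w(1) wf_progs(2) R ck(1,2) sz lv]]) (auto simp: add.assoc)
qed

abbreviation (input) "hm \<equiv> sz initc + 40"

text \<open>The poll that closes each iteration makes \<open>mu\<close> decrease, so termination
  does not depend on how often the round itself polls.\<close>

lemma loop_ev:
  assumes "RR p' io s" "fixed p p'" "vv p' 6 \<le> B" "psi io \<le> P * B" "CON p (XE p') io" "ck len (c2 * polls io + hm) g s"
    and par: "params p" "sized p"
  shows "ev I (\<lambda>g s. \<exists>p'' io'. RR p'' io' s \<and> INV p p'' io' \<and> \<not> live io') (LOOP P L) g s"
  using assms(1-6)
proof (induction "mu io" arbitrary: p' io s g rule: less_induct)
  case less
  let ?Q = "\<lambda>g s. \<exists>p'' io'. RR p'' io' s \<and> INV p p'' io' \<and> \<not> live io'"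
  note R = less.prems(1) and ck = less.prems(6)
  have "vv p' 6 * (P - 1) \<le> B * (P - 1)" using less.prems(3) by (rule mult_right_mono) simp
  then have inv: "INV p p' io" using less.prems unfolding INV_def by linarith
  have lv: "mem s 100 = of_bool (live io)" using R by (simp add: RR_def)
  have c2: "hm + sz (roundc 0) + 300 \<le> c2" unfolding c2_eq code_size_def by simp
  have I0: "I g s" using RR_I[OF R ck] c2 by simp
  have ck1: "ck len (c2 * polls io + Suc hm) (Suc g) s" using ck_Suc[OF ck] by (simp only: add_Suc_right)
  have I1: "I (Suc g) s" using RR_I[OF R ck1] c2 by simp
  show ?case
  proof (cases "live io")
    case False
    then show ?thesis unfolding LOOP_def
      using lv I0 I1 R inv by (intro ev_While_exit) auto
  next
    case True
    let ?N = "\<lambda>g s. ev I ?Q (LOOP P L) (Suc g) s"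
    have ck2: "ck len (c2 * polls io + Suc hm) (Suc g) s" using ck1 .
    have "ev I ?N (Seq (DRAIN P) (Seq (comp P (roundc L)) (POLL P))) (Suc g) s"
    proof (rule ev_Seq[OF drain_ev[OF R inv ck2]])
      show "30 \<le> Suc hm" "Suc hm + 60 \<le> c2" using c2 by auto
      fix g1 s1 assume "\<exists>p'' io'. RR p'' io' s1 \<and> INV p p'' io' \<and> stack io' = [] \<and> mu io' \<le> mu io \<and>
          ck len (c2 * polls io' + Suc (Suc hm)) g1 s1"
      then obtain p1 io1 where 1: "RR p1 io1 s1" "INV p p1 io1" "stack io1 = []" "mu io1 \<le> mu io"
          "ck len (c2 * polls io1 + Suc (Suc hm)) g1 s1" by blast
      have ck3: "ck len (c2 * polls io1 + (hm + 3)) (Suc g1) s1" by (rule ck_mono[OF ck_Suc[OF 1(5)]]) simp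
      show "ev I ?N (Seq (comp P (roundc L)) (POLL P)) (Suc g1) s1"
      proof (rule ev_Seq[OF round_ev[OF 1(1-3) par ck3]])
        show "30 \<le> hm + 3" "hm + 3 + sz (roundc 0) \<le> c2" using c2 by auto
        fix g2 s2 assume "\<exists>p'' io'. RR p'' io' s2 \<and> fixed p p'' \<and> vv p'' 6 \<le> B \<and> Suc (psi io') \<le> P * B \<and> CON p (XE p'') io' \<and>
            mu io' \<le> mu io1 \<and> ck len (c2 * polls io' + (hm + 3 + sz (roundc 0))) g2 s2"
        then obtain p2 io2 where 2: "RR p2 io2 s2" "fixed p p2" "vv p2 6 \<le> B" "Suc (psi io2) \<le> P * B" "CON p (XE p2) io2"
            "mu io2 \<le> mu io1" "ck len (c2 * polls io2 + (hm + 3 + sz (roundc 0))) g2 s2" by blast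
        have ck4: "ck len (c2 * polls io2 + c2) (Suc g2) s2" using ck_Suc[OF 2(7)] c2 by (auto intro: ck_mono)
        have "P * B \<le> P * SZ" unfolding SZ_eq by simp
        then have sl: "length (stack io2) < SZ" using 2(4) by (intro psi_stack) linarith
        have pb: "polls io2 < P" using RR_bnd[OF 2(1)] .
        show "ev I ?N (POLL P) (Suc g2) s2"
        proof (rule ev_mono[OF POLL_ev[OF 2(1) ck4 sl]])
          fix g3 s3 assume b: "RR p2 (poll P io2) s3 \<and> ck len (c2 * polls (poll P io2) + 20) g3 s3"
          have ck5: "ck len (c2 * polls (poll P io2) + hm) (Suc g3) s3"
            using ck_Suc[OF conjunct2[OF b]] by (auto intro: ck_mono)
          have "mu (poll P io2) < mu io"
          proof (cases "live io2")
            case True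
            then show ?thesis using mu_poll(2)[OF pb] 2(6) 1(4) by linarith
          next
            case False
            then show ?thesis using \<open>live io\<close> by (simp add: mu_def poll_def)
          qed
          moreover have "psi (poll P io2) \<le> P * B" using psi_poll[OF pb] 2(4) by linarith
          ultimately show "?N g3 s3"
            using less.hyps[OF _ conjunct1[OF b] 2(2,3) _ CON_poll[OF 2(5)] ck5] by blast
        qed
      qed
    qed
    then show ?thesis unfolding LOOP_def
      using lv True by (intro ev_While_enter[where I=I and g=g and s=s, OF I0]) auto
  qed
qed

definition FQ :: "pst \<Rightarrow> state \<Rightarrow> bool" where
  "FQ p s \<longleftrightarrow> (\<exists>p1 p2 io. RR p2 io s \<and> \<not> live io \<and> final_post p1 k (vv p1 6) p2 \<and>
     (\<forall>l<L. rep (bucket p l) k (set xs) (XE p1)))"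

abbreviation "io0 \<equiv> \<lparr>live = True, polls = 0, stack = [], rest = xs\<rparr>"

lemma reads_0: "RR p io0 s \<Longrightarrow> reads s = 0"
  unfolding RR_def by (simp add: len_eq)

lemma ck_0: "RR p io0 s \<Longrightarrow> ck len m g s"
  by (simp add: reads_0 ck_def)

lemma main_ev:
  assumes R: "RR p io0 s" and par: "params p"
  shows "ev I (\<lambda>g. FQ p) (MAIN P L) g s"
proof -
  have c2: "hm + sz (roundc 0) + sz finalc + 300 \<le> c2" unfolding c2_eq code_size_def by simp
  have SZk: "4096 * k * k \<le> SZ" "k \<le> SZ" "2 \<le> SZ" using B_ge unfolding SZ_eq by auto
  have V: "vv p 1 = k" "1 \<le> vv p 1" using par k1 by (auto simp: params_def)
  let ?K = "\<lambda>p'. params p' \<and> sized p' \<and> vv p' 6 = 0 \<and> (\<forall>l. bucket p' l = bucket p l)"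
  have "wpc initc (\<lambda>n' p'. ?K p') (32 * k) p"
    by (rule wpc_init[OF V(2,1) SZk(1)]) (use par in \<open>auto simp: params_def sized_def agree_def\<close>)
  then obtain m p1 where w: "bs initc p m p1" "m \<le> 32 * k" "?K p1" by (auto simp: wpc_def)
  let ?io = "(poll P ^^ m) io0"
  have pb: "polls io0 < P" using P_ge by simp
  have psi0: "psi io0 = 0" by (simp add: psi_def)
  have "32 * k \<le> 961 * B" using B_ge(4) by linarith
  also have "\<dots> \<le> P * B" unfolding P_eq using L1 by (intro mult_right_mono) auto
  finally have mb: "m \<le> P * B" "psi ?io \<le> P * B" using w(2) psi_polls[OF pb, of m] psi0 by linarith+
  have "P * B \<le> P * SZ" unfolding SZ_eq by simp
  then have lv: "live io0 \<longrightarrow> psi io0 + m \<le> P * SZ" using mb psi0 by linarith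
  have con: "CON p1 (XE p1) ?io"
  proof (rule CON_polls)
    show "CON p1 (XE p1) io0" using w(3) by (auto simp: CON_def XE_def rep_def intro!: exI[of _ "[]"])
  qed
  have i: "ev I (\<lambda>g s. RR p1 ?io s \<and> ck len (c2 * polls ?io + 30 + sz initc) g s) (comp P initc) g s"
    using comp_ev[OF w(1) wf_progs(1) R ck_0[OF R] _ _ lv, of 30] c2 by simp
  show ?thesis
    unfolding MAIN_def
  proof (rule ev_Seq[OF i])
    fix g1 s1 assume a: "RR p1 ?io s1 \<and> ck len (c2 * polls ?io + 30 + sz initc) g1 s1"
    have ck1: "ck len (c2 * polls ?io + hm) (Suc g1) s1" using ck_Suc[OF conjunct2[OF a]] by (auto intro: ck_mono)
    have fx: "fixed p1 p1" by (simp add: fixed_def)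
    show "ev I (\<lambda>g. FQ p) (Seq (LOOP P L) (Seq (DRAIN P) (comp P finalc))) (Suc g1) s1"
    proof (rule ev_Seq[OF loop_ev[OF conjunct1[OF a] fx _ mb(2) con ck1]])
      fix g2 s2 assume "\<exists>p'' io'. RR p'' io' s2 \<and> INV p1 p'' io' \<and> \<not> live io'"
      then obtain p2 io2 where 2: "RR p2 io2 s2" "INV p1 p2 io2" "\<not> live io2" by blast
      show "ev I (\<lambda>g. FQ p) (Seq (DRAIN P) (comp P finalc)) (Suc g2) s2"
      proof (rule ev_Seq[OF drain_ev[OF 2(1,2) RR_dead[OF 2(1,3)], of 30]])
        show "30 \<le> (30 :: nat)" "30 + 60 \<le> c2" using c2 by auto
        fix g3 s3 assume "\<exists>p'' io'. RR p'' io' s3 \<and> INV p1 p'' io' \<and> stack io' = [] \<and> mu io' \<le> mu io2 \<and>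
            ck len (c2 * polls io' + Suc 30) g3 s3"
        then obtain p3 io3 where 3: "RR p3 io3 s3" "INV p1 p3 io3" "stack io3 = []" "mu io3 \<le> mu io2" by blast
        have dead: "\<not> live io3" using 3(4) 2(3) by (auto simp: mu_def split: if_splits)
        then have "rest io3 = []" using 3(1) by (simp add: RR_def)
        then have reps: "\<forall>l<L. rep (bucket p l) k (set xs) (XE p3)"
          using 3(2,3) w(3) unfolding INV_def CON_def by auto
        have V3: "vv p3 1 = k" "ww p3 2 2 = 0" using 3(2) w(3) by (auto simp: INV_def fixed_def params_def)
        have c3: "vv p3 6 \<le> SZ" using INV_bounds(1)[OF 3(2)] unfolding SZ_eq by simp
        obtain nn where "wpc finalc (\<lambda>n' p'. final_post p3 k (vv p3 6) p') nn p3"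
          using wpc_final[OF V3(1) k1 SZk(2) refl c3 V3(2) SZk(3)] by blast
        then obtain m3 p4 where 4: "bs finalc p3 m3 p4" "final_post p3 k (vv p3 6) p4" by (auto simp: wpc_def)
        have dd: "\<not> live ((poll P ^^ m3) io3)" using dead live_polls by blast
        show "ev I (\<lambda>g. FQ p) (comp P finalc) (Suc g3) s3"
          by (rule ev_mono[OF comp_ev[OF 4(1) wf_progs(3) 3(1) RR_dead[OF 3(1) dead], of 30]])
            (use c2 dead dd 4(2) reps in \<open>auto simp: FQ_def\<close>)
      qed
    qed (use w(3) in auto)
  qed
qed

end

section \<open>Random draws, space and update time\<close>

context streaming
begin

definition start :: state where
  "start = \<lparr>mem = (\<lambda>_. 0)(0 := n, 1 := k), wmem = (\<lambda>_. 0), input = xs, reads = 0\<rparr>"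

definition p0 :: pst where
  "p0 = \<lparr>vv = (\<lambda>_. 0)(0 := n, 1 := k, 2 := R * n, 3 := R), aa = (\<lambda>_ _. 0), ww = (\<lambda>_ _. 0), outp = (\<lambda>_. 0)\<rparr>"

lemma params_p0: "params p0"
  by (simp add: params_def p0_def)

lemma boot_lst: "lst safe BOOT start (RR p0 io0)"
proof -
  have Rb: "R < b" "k < b" "k * k < b" using B_ge b_ge(4) unfolding SZ_eq R_eq by linarith+
  then have W: "R < W" "k < W" "k * k < W" "n < W" "R * n < W" "120 + 2 * k < W" "120 < W" "32 < W" "0 < W"
    using b_le_W nb Rn b_ge(5) by linarith+
  have R': "k * k * 32 = R" by (simp add: R_eq)
  have s: "sm (mem start)" "sw (wmem start)" using W by (auto simp: sm_def sw_def start_def)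
  let ?f = "(mem start)(100 := 1, 103 := 120 + 2 * k, 104 := 32, 3 := R, 2 := R * n)"
  have sf: "sm ?f" using s W by (auto intro!: sm_upd)
  have RR: "RR p0 io0 (start\<lparr>mem := ?f\<rparr>)"
    unfolding RR_def using sf s(2) Rb nb Rn xsb P_ge
    by (auto simp: safe_def start_def p0_def len_eq)
  have f: "(mem start)(100 := 1, 104 := 120, 103 := k + k, 103 := k + k + 120, 104 := 32, 3 := k * k, 3 := R, 2 := R * n) = ?f"
    by (auto simp: fun_eq_iff)
  have "lst safe BOOT start (\<lambda>s. s = start\<lparr>mem := ?f\<rparr>)"
    unfolding f[symmetric] using s W R' by (simp add: BOOT_def safe_def start_def)
  then show ?thesis by (rule lst_mono) (use RR in simp)
qed

definition drawn :: "pst \<Rightarrow> nat \<Rightarrow> nat \<Rightarrow> pst" where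
  "drawn p l r = eff (Sto 13 (Num l) (Var 29)) (p\<lparr>vv := (vv p)(29 := r)\<rparr>)"

lemma drawn_params: "params p \<Longrightarrow> params (drawn p l r)"
  by (simp add: params_def drawn_def)

lemma drawn_bucket: "bucket (drawn p l r) l' x = (if l' = l then r * x mod vv p 2 div vv p 0 else bucket p l' x)"
  by (simp add: drawn_def)

lemma RR_random:
  assumes R: "RR p io s" and par: "params p" and s': "s' \<in> set_pmf (exec_instr (Random 29 2) s)"
  shows "\<exists>r. mem s' 29 = r \<and> RR (p\<lparr>vv := (vv p)(29 := r)\<rparr>) io s'"
proof -
  have m: "mem s 2 = R * n" using R par by (auto simp: RR_def params_def)
  obtain r where r: "s' = s\<lparr>mem := (mem s)(29 := r)\<rparr>" "r = 0 \<or> r < R * n"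
    using s' by (auto simp: m set_pmf_of_set split: if_splits)
  have "r < b" using r(2) Rn b_ge(1) by linarith
  then show ?thesis using RR_var[OF R, of 29 r] r(1) by simp
qed

lemma sto_ev:
  assumes R: "RR (p\<lparr>vv := (vv p)(29 := r)\<rparr>) io0 s" and l: "l < L"
  shows "ev I (\<lambda>g. RR (drawn p l r) io0) (comp P (sto 13 (Num l) (Var 29))) g s"
proof -
  have ls: "l \<le> lb" "l < SZ" using l lb_eq P_eq B_ge(5) SZ_eq by linarith+
  have wf: "wfa (Sto 13 (Num l) (Var 29))" "cond (Sto 13 (Num l) (Var 29)) (p\<lparr>vv := (vv p)(29 := r)\<rparr>)"
    using ls by (auto simp: wfx_def)
  have len: "length (catom (Sto 13 (Num l) (Var 29))) \<le> 20" by (simp add: adr_def)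
  show ?thesis
    using ev_mono[OF ev_seqs_I[OF catom_lst[OF R wf] ck_0[OF R], of 0], of "\<lambda>g. RR (drawn p l r) io0"] len
    by (simp add: drawn_def)
qed

lemma I_0: "RR p io0 s \<Longrightarrow> I g s"
  by (rule RR_I[where h=0]) (auto intro: ck_0)

definition finished :: "nat \<Rightarrow> state \<Rightarrow> bool" where
  "finished g s \<longleftrightarrow> (\<exists>p. params p \<and> FQ p s)"

lemma draws_ev:
  assumes "RR p io0 s" "params p" "l + m \<le> L"
  shows "ev I finished (draws P l m (MAIN P L)) g s"
  using assms
proof (induction m arbitrary: l p s g)
  case 0
  then show ?case by (auto intro!: ev_mono[OF main_ev] simp: finished_def)
next
  case (Suc m)
  show ?case unfolding draws.simps
  proof (rule ev_Seq[where R="\<lambda>g s'. \<exists>r. RR (p\<lparr>vv := (vv p)(29 := r)\<rparr>) io0 s'"])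
    show "ev I (\<lambda>g s'. \<exists>r. RR (p\<lparr>vv := (vv p)(29 := r)\<rparr>) io0 s') (Instr (Random 29 2)) g s"
      using RR_random[OF Suc.prems(1,2)] I_0 I_0[OF Suc.prems(1)] by (intro ev_Instr) blast+
    fix g s1 assume "\<exists>r. RR (p\<lparr>vv := (vv p)(29 := r)\<rparr>) io0 s1"
    then obtain r where r: "RR (p\<lparr>vv := (vv p)(29 := r)\<rparr>) io0 s1" ..
    have l: "l < L" using Suc.prems by simp
    show "ev I finished (Seq (comp P (sto 13 (Num l) (Var 29))) (draws P (Suc l) m (MAIN P L))) (Suc g) s1"
      by (rule ev_Seq[OF sto_ev[OF r l]]) (use Suc drawn_params in auto)
  qed
qed

lemma alg_ev: "ev I finished (alg L) 0 start"
proof -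
  have s: "lst safe BOOT start (RR p0 io0)" by (rule boot_lst)
  have "ck len 0 0 start" by (simp add: ck_def start_def)
  from ev_seqs_I[OF s this] have "ev I (\<lambda>g s. RR p0 io0 s) (seqs BOOT) 0 start"
    by (rule ev_mono) (auto simp: BOOT_def)
  then show ?thesis unfolding alg_def P_eq[symmetric]
    by (rule ev_Seq) (use params_p0 in \<open>auto intro: draws_ev\<close>)
qed

text \<open>Induction from the first draw on. As soon as one drawn function is injective on
  \<open>V\<close>, failure is impossible; until then each further draw succeeds with probability at
  least one half, whatever came before.\<close>

lemma draws_prob:
  assumes V: "finite V" "V \<subseteq> {..<n}" "card V \<le> 2 * k"
    and bad: "\<And>c. c \<in> Bad \<Longrightarrow> fst c = Skip"
    and good: "\<And>p s. params p \<Longrightarrow> FQ p s \<Longrightarrow> \<exists>l<L. inj_on (bucket p l) V \<Longrightarrow> (Skip, s) \<notin> Bad"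
  shows "RR p io0 s \<Longrightarrow> params p \<Longrightarrow> l + m = L \<Longrightarrow>
    measure_pmf.prob (run t (draws P l m (MAIN P L), s)) Bad \<le> (if \<exists>l'<l. inj_on (bucket p l') V then 0 else (1 / 2) ^ m)"
proof (induction m arbitrary: l p s t)
  case 0
  show ?case
  proof (cases "\<exists>l'<l. inj_on (bucket p l') V")
    case True
    have "measure_pmf.prob (run t (MAIN P L, s)) Bad = 0"
      by (rule prob_run_ev[OF main_ev[OF 0(1,2), of 0] _ bad]) (use good[OF 0(2)] True 0(3) in auto)
    then show ?thesis using True by simp
  next
    case False
    then show ?thesis unfolding if_not_P[OF False] by simp
  qed
next
  case (Suc m)
  let ?good = "\<lambda>p l. \<exists>l'<l. inj_on (bucket p l') V"
  define q where "q = Seq (comp P (sto 13 (Num l) (Var 29))) (draws P (Suc l) m (MAIN P L))"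
  \<comment> \<open>The bound after this draw as a function of the drawn multiplier; its average
    over all multipliers is at most the bound before the draw.\<close>
  define F :: "nat \<Rightarrow> real" where "F r = (if ?good p l \<or> inj_on (\<lambda>x. r * x mod (R * n) div n) V then 0 else (1 / 2) ^ m)" for r
  have l: "l < L" using Suc.prems by simp
  have V2: "vv p 2 = R * n" "vv p 0 = n" using Suc.prems(2) by (auto simp: params_def)
  have m2: "mem s 2 = R * n" using Suc.prems(1) V2 by (auto simp: RR_def)
  have F: "(if ?good (drawn p l r) (Suc l) then 0 else (1 / 2) ^ m) = F r" for r
  proof -
    have "?good (drawn p l r) (Suc l) \<longleftrightarrow> ?good p l \<or> inj_on (bucket (drawn p l r) l) V"
      unfolding less_Suc_eq by (auto simp: drawn_bucket)
    then show ?thesis unfolding F_def by (simp add: drawn_bucket V2)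
  qed
  have nxt: "measure_pmf.prob (run t (q, s')) Bad \<le> F (mem s' 29)" if s': "s' \<in> set_pmf (exec_instr (Random 29 2) s)" for s' t
  proof -
    obtain r where r: "mem s' 29 = r" "RR (p\<lparr>vv := (vv p)(29 := r)\<rparr>) io0 s'" using RR_random[OF Suc.prems(1,2) s'] by blast
    show ?thesis unfolding q_def
    proof (rule prob_run_Seq[OF sto_ev[OF r(2) l, of 0] _ bad])
      fix g s2 t assume "RR (drawn p l r) io0 s2"
      from Suc.IH[OF this drawn_params[OF Suc.prems(2)], of "Suc l" t] Suc.prems(3)
      show "measure_pmf.prob (run t (draws P (Suc l) m (MAIN P L), s2)) Bad \<le> F (mem s' 29)"
        unfolding F r(1) by simp
    qed (simp_all add: F_def)
  qed
  have nxt': "measure_pmf.prob (run t (Seq Skip q, s')) Bad \<le> F (mem s' 29)" if s': "s' \<in> set_pmf (exec_instr (Random 29 2) s)" for s' t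
    by (rule prob_run_Seq[where I="\<lambda>_ _. True" and R="\<lambda>_ s. s = s'" and g=0])
      (use nxt[OF s'] bad in \<open>auto intro: ev_done simp: F_def\<close>)
  show ?case unfolding draws.simps q_def[symmetric]
  proof (rule prob_run_step[where f="\<lambda>c. F (mem (snd c) 29)"])
    show "(Seq (Instr (Random 29 2)) q, s) \<notin> Bad" using bad by fastforce
    show "measure_pmf.prob (run t c') Bad \<le> F (mem (snd c') 29)"
      if "c' \<in> set_pmf (step (Seq (Instr (Random 29 2)) q, s))" for t c'
      using that nxt' by (auto simp del: exec_instr.simps)
    show "finite (set_pmf (step (Seq (Instr (Random 29 2)) q, s)))" by (rule finite_set_step)
    have E: "measure_pmf.expectation (step (Seq (Instr (Random 29 2)) q, s)) (\<lambda>c. F (mem (snd c) 29)) =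
        measure_pmf.expectation (if R * n = 0 then return_pmf 0 else pmf_of_set {0..<R * n}) F"
      by (simp add: m2 pmf.map_comp o_def case_prod_beta)
    show "measure_pmf.expectation (step (Seq (Instr (Random 29 2)) q, s)) (\<lambda>c. F (mem (snd c) 29)) \<le>
        (if ?good p l then 0 else (1 / 2) ^ Suc m)"
    \<comment> \<open>Without vertices \<open>Random\<close> returns 0 and \<open>V\<close> is
      empty, so every function is injective on it.\<close>
    proof (cases "R * n = 0")
      case True
      then have "n = 0" using k1 by (simp add: R_eq)
      then have "V = {}" using V by auto
      then have "F 0 = 0" by (simp add: F_def)
      then show ?thesis unfolding E using True by simp
    next
      case False
      show ?thesis
      proof (cases "?good p l")
        case True
        then have "F = (\<lambda>_. 0)" by (auto simp: F_def fun_eq_iff)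
        then show ?thesis unfolding E using True by simp
      next
        case ng: False
        let ?S = "{a. a < R * n \<and> \<not> inj_on (\<lambda>x. a * x mod (R * n) div n) V}"
        have "sum F {0..<R * n} = (\<Sum>a\<in>?S. (1 / 2) ^ m)"
          by (intro sum.mono_neutral_cong_right) (use ng in \<open>auto simp: F_def\<close>)
        also have "\<dots> = real (card ?S) * (1 / 2) ^ m" by simp
        finally have s: "sum F {0..<R * n} = real (card ?S) * (1 / 2) ^ m" .
        have N: "0 < real (R * n)" using False by (simp only: of_nat_0_less_iff neq0_conv)
        have "2 * card ?S \<le> R * n" by (rule card_not_inj_hash[OF V R_eq k1])
        then have "real (card ?S) \<le> real (R * n) / 2" by linarith
        then have "sum F {0..<R * n} \<le> real (R * n) / 2 * (1 / 2) ^ m"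
          unfolding s by (rule mult_right_mono) simp
        then have "sum F {0..<R * n} / real (R * n) \<le> (1 / 2) ^ Suc m"
          using N by (simp add: pos_divide_le_eq mult.commute del: of_nat_mult)
        moreover have "measure_pmf.expectation (pmf_of_set {0..<R * n}) F = sum F {0..<R * n} / real (R * n)"
          using False by (subst integral_pmf_of_set) auto
        ultimately show ?thesis unfolding E if_not_P[OF False] if_not_P[OF ng] by simp
      qed
    qed
  qed simp
qed

lemma alg_prob:
  assumes V: "finite V" "V \<subseteq> {..<n}" "card V \<le> 2 * k"
    and bad: "\<And>c. c \<in> Bad \<Longrightarrow> fst c = Skip"
    and good: "\<And>p s. params p \<Longrightarrow> FQ p s \<Longrightarrow> \<exists>l<L. inj_on (bucket p l) V \<Longrightarrow> (Skip, s) \<notin> Bad"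
  shows "measure_pmf.prob (run t (alg L, start)) Bad \<le> (1 / 2) ^ L"
proof -
  have s: "lst safe BOOT start (RR p0 io0)" by (rule boot_lst)
  have "ck len 0 0 start" by (simp add: ck_def start_def)
  from ev_seqs_I[OF s this] have e: "ev I (\<lambda>g s. RR p0 io0 s) (seqs BOOT) 0 start"
    by (rule ev_mono) (auto simp: BOOT_def)
  show ?thesis unfolding alg_def P_eq[symmetric]
  proof (rule prob_run_Seq[OF e _ bad])
    fix g s t assume R: "RR p0 io0 s"
    have "measure_pmf.prob (run t (draws P 0 L (MAIN P L), s)) Bad \<le> (if \<exists>l'<0. inj_on (bucket p0 l') V then 0 else (1 / 2) ^ L)"
      by (rule draws_prob[OF V _ _ R params_p0]) (use bad good in simp_all)
    then show "measure_pmf.prob (run t (draws P 0 L (MAIN P L), s)) Bad \<le> (1 / 2) ^ L" by simp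
  qed auto
qed

lemma alg_space: "runs_in_space W (SM + SW) (alg L, start)"
  unfolding runs_in_space_def
proof (intro exI conjI ballI)
  fix c' assume "c' \<in> reachable (alg L, start)"
  then obtain g where "I g (snd c')" using ev_reachable[OF alg_ev] by blast
  then have s: "sm (mem (snd c'))" "sw (wmem (snd c'))" by (auto simp: I_def safe_def)
  show "\<forall>a. mem (snd c') a < W" "\<forall>a\<ge>SM. mem (snd c') a = 0" "\<forall>a\<ge>SW. wmem (snd c') a = 0"
    using s by (auto simp: sm_def sw_def)
qed simp

lemma alg_time: "update_time_le (c2 * P + c2 + 101) (alg L, start)"
proof (rule ev_update_time[OF alg_ev, of start])
  fix g s assume "I g s" "1 \<le> reads s" "reads s \<le> length (input start)"
  then show "g < c2 * P + c2 + 101" unfolding I_def ck_def by (simp add: start_def len_eq)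
next
  fix g s assume "finished g s"
  then show "length (input start) < reads s" unfolding finished_def FQ_def RR_def by (auto simp: start_def len_eq)
qed simp

end

section \<open>Correctness for graphs\<close>

definition edge :: "element \<Rightarrow> nat set" where
  "edge x = {fst x, fst (snd x)}"

lemma ex_max_weight_k_matching:
  assumes "finite E" "k_matching k E N"
  shows "\<exists>M. max_weight_k_matching k E wt M"
proof -
  let ?S = "{M. k_matching k E M}"
  have "?S \<subseteq> Pow E" by (auto simp: k_matching_def matching_def)
  then have fin: "finite ?S" using assms(1) finite_subset by blast
  have ne: "?S \<noteq> {}" using assms(2) by blast
  have fin': "finite (sum wt ` ?S)" using fin by simp
  have "Max (sum wt ` ?S) \<in> sum wt ` ?S" using fin' ne by (intro Max_in) auto
  then obtain M where M: "k_matching k E M" "sum wt M = Max (sum wt ` ?S)" by auto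
  have "sum wt N \<le> sum wt M" if "k_matching k E N" for N
    unfolding M(2) using fin' that by (intro Max_ge) auto
  then show ?thesis using M(1) unfolding max_weight_k_matching_def by blast
qed

text \<open>Elements with disjoint sets of buckets have no common endpoint, so a separated set is
  among the tuples that the exhaustive search accepts.\<close>

lemma separated_tuple:
  assumes M: "finite M" "separated h M" "M \<subseteq> XE p" "card M = k"
  shows "\<exists>f. (\<forall>i<k. f i < vv p 6) \<and> okt p k f \<and> wgt p k f = (\<Sum>e\<in>M. snd (snd e))"
proof -
  obtain g where g: "bij_betw g {0..<k} M" using ex_bij_betw_nat_finite[OF M(1)] M(4) by blast
  have "\<exists>j<vv p 6. elt p j = g i" if "i < k" for i
  proof -
    have "g i \<in> XE p" using g that M(3) unfolding bij_betw_def by fastforce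
    then show ?thesis by (auto simp: XE_def)
  qed
  then obtain f where f: "\<And>i. i < k \<Longrightarrow> f i < vv p 6 \<and> elt p (f i) = g i" by metis
  have "disj p (f i) (f j)" if "i < k" "j < i" for i j
  proof -
    have ij: "j < k" "g i \<noteq> g j" "g i \<in> M" "g j \<in> M" using g that unfolding bij_betw_def inj_on_def by fastforce+
    then have "buckets_of h (g i) \<inter> buckets_of h (g j) = {}" using M(2) unfolding separated_def by blast
    then have "buckets_of h (elt p (f i)) \<inter> buckets_of h (elt p (f j)) = {}" using f that ij(1) by simp
    then show ?thesis by (auto simp: buckets_of_def disj_def elt_def)
  qed
  then have "okt p k f" by (simp add: okt_def)
  moreover have "wgt p k f = (\<Sum>i<k. snd (snd (g i)))"
    unfolding wgt_def
  proof (rule sum.cong[OF refl])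
    fix i assume "i \<in> {..<k}"
    then have "elt p (f i) = g i" using f by simp
    then show "ww p 1 (f i) = snd (snd (g i))" by (metis elt_def snd_conv)
  qed
  moreover have "\<dots> = (\<Sum>e\<in>M. snd (snd e))"
    using sum.reindex_bij_betw[OF g, of "\<lambda>e. snd (snd e)"] by (simp add: atLeast0LessThan)
  ultimately show ?thesis using f by metis
qed

locale streamed_graph = streaming k b lb SZ P len c2 n L B R xs
  for k b lb SZ P len c2 n L B R :: nat and xs :: "element list" +
  fixes E :: "nat set set" and wt :: "nat set \<Rightarrow> real"
  assumes graph: "weighted_graph n E wt" and stream: "insert_only_stream E wt xs"
begin

lemma edge_eq: "(\<lambda>(u, v, w). {u, v}) = edge"
  by (auto simp: edge_def fun_eq_iff)

lemma edges: "edge ` set xs = E" "inj_on edge (set xs)" "x \<in> set xs \<Longrightarrow> snd (snd x) = wt (edge x)"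
  using stream unfolding insert_only_stream_def edge_eq by (auto simp: distinct_map edge_def)

lemma finite_E: "finite E"
  using edges(1) by blast

lemma XE_elt:
  assumes "XE p \<subseteq> set xs" "i < vv p 6"
  shows "{aa p 2 i, aa p 3 i} \<in> E" "ww p 1 i = wt {aa p 2 i, aa p 3 i}"
proof -
  have x: "elt p i \<in> set xs" using assms by (auto simp: XE_def)
  have e: "edge (elt p i) = {aa p 2 i, aa p 3 i}" by (simp add: edge_def elt_def)
  show "{aa p 2 i, aa p 3 i} \<in> E" using x edges(1) e by blast
  show "ww p 1 i = wt {aa p 2 i, aa p 3 i}" using edges(3)[OF x] e by (simp add: elt_def)
qed

lemma tuple_matching:
  assumes X: "XE p \<subseteq> set xs" and f: "\<forall>i<k. f i < vv p 6" "okt p k f"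
  shows "k_matching k E ((\<lambda>i. {aa p 2 (f i), aa p 3 (f i)}) ` {0..<k})"
    "sum wt ((\<lambda>i. {aa p 2 (f i), aa p 3 (f i)}) ` {0..<k}) = wgt p k f"
proof -
  let ?e = "\<lambda>i. {aa p 2 (f i), aa p 3 (f i)}"
  have dj: "?e i \<inter> ?e j = {}" if "i < k" "j < k" "i \<noteq> j" for i j
  proof (cases "j < i")
    case True
    then show ?thesis using f(2) that by (simp add: okt_def disj_def)
  next
    case False
    then have "?e j \<inter> ?e i = {}" using f(2) that unfolding okt_def disj_def by (metis linorder_neqE_nat)
    then show ?thesis by (simp only: Int_commute)
  qed
  have inj: "inj_on ?e {0..<k}"
  proof (rule inj_onI)
    fix i j assume a: "i \<in> {0..<k}" "j \<in> {0..<k}" "?e i = ?e j"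
    then show "i = j" using dj[of i j] by auto
  qed
  have "matching E (?e ` {0..<k})"
    unfolding matching_def
  proof (intro conjI ballI impI)
    show "?e ` {0..<k} \<subseteq> E" using XE_elt(1)[OF X] f(1) by auto
    fix a c assume ac: "a \<in> ?e ` {0..<k}" "c \<in> ?e ` {0..<k}" "a \<noteq> c"
    obtain i where i: "a = ?e i" "i < k" using ac(1) by (elim imageE) simp
    obtain j where j: "c = ?e j" "j < k" using ac(2) by (elim imageE) simp
    note ij = i(1) j(1) i(2) j(2)
    have "i \<noteq> j" using ac(3) ij by blast
    then show "a \<inter> c = {}" unfolding i(1) j(1) by (rule dj[OF i(2) j(2)])
  qed
  then show "k_matching k E (?e ` {0..<k})"
    using card_image[OF inj] by (simp add: k_matching_def)
  have "sum wt (?e ` {0..<k}) = (\<Sum>i\<in>{0..<k}. wt (?e i))" by (simp add: sum.reindex[OF inj])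
  also have "\<dots> = wgt p k f" unfolding wgt_def atLeast0LessThan
    by (intro sum.cong) (use XE_elt(2)[OF X] f(1) in auto)
  finally show "sum wt (?e ` {0..<k}) = wgt p k f" .
qed

definition optimal :: "state \<Rightarrow> pst \<Rightarrow> bool" where
  "optimal s p1 \<longleftrightarrow> (answer (Skip, s) = {} \<and> (\<forall>f. (\<forall>i<k. f i < vv p1 6) \<longrightarrow> \<not> okt p1 k f)) \<or>
     (\<exists>f. (\<forall>i<k. f i < vv p1 6) \<and> okt p1 k f \<and> answer (Skip, s) = (\<lambda>i. {aa p1 2 (f i), aa p1 3 (f i)}) ` {0..<k} \<and>
       (\<forall>f'. (\<forall>i<k. f' i < vv p1 6) \<longrightarrow> okt p1 k f' \<longrightarrow> wgt p1 k f' \<le> wgt p1 k f))"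

lemma FQ_answer:
  assumes "FQ p s"
  obtains p1 where "XE p1 \<subseteq> set xs" "\<And>l. l < L \<Longrightarrow> rep (bucket p l) k (set xs) (XE p1)"
    "optimal s p1"
proof -
  obtain p1 p2 io where F: "RR p2 io s" "final_post p1 k (vv p1 6) p2" "\<And>l. l < L \<Longrightarrow> rep (bucket p l) k (set xs) (XE p1)"
    using assms unfolding FQ_def by blast
  have X: "XE p1 \<subseteq> set xs" using F(3)[of 0] L1 by (simp add: rep_def)
  have m: "mem s 0 = vv p2 0" "mem s 1 = 120" "\<And>t. t < 2 * k \<Longrightarrow> mem s (120 + t) = outp p2 t"
    using F(1,2) by (auto simp: RR_def final_post_def)
  have opt: "optimal s p1"
  proof (cases "vv p2 0 = 0")
    case True
    then have "answer (Skip, s) = {}" by (simp add: answer_def m)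
    then show ?thesis using F(2) True by (simp add: optimal_def final_post_def)
  next
    case False
    then obtain f where f: "vv p2 0 = k" "\<forall>i<k. f i < vv p1 6" "okt p1 k f"
        "\<forall>i<k. outp p2 (2 * i) = aa p1 2 (f i) \<and> outp p2 (2 * i + 1) = aa p1 3 (f i)"
        "\<forall>f'. (\<forall>i<k. f' i < vv p1 6) \<longrightarrow> okt p1 k f' \<longrightarrow> wgt p1 k f' \<le> wgt p1 k f"
      using F(2) by (auto simp: final_post_def)
    have "{mem s (120 + 2 * i), mem s (120 + 2 * i + 1)} = {aa p1 2 (f i), aa p1 3 (f i)}" if "i < k" for i
      using m(3)[of "2 * i"] m(3)[of "2 * i + 1"] f(4) that by (simp add: add.assoc)
    then have "answer (Skip, s) = (\<lambda>i. {aa p1 2 (f i), aa p1 3 (f i)}) ` {0..<k}"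
      unfolding answer_def using m(1,2) f(1) by (auto simp: Let_def)
    then show ?thesis unfolding optimal_def using f(2,3,5) by (intro disjI2 exI[of _ f] conjI)
  qed
  show ?thesis by (rule that[OF X _ opt]) (use F(3) in simp)
qed

text \<open>Holds in every run: stored elements come from the stream and the search compares true
  endpoints, so unlucky hashing can only make the answer lighter or empty.\<close>

lemma FQ_matching: "FQ p s \<Longrightarrow> answer (Skip, s) = {} \<or> k_matching k E (answer (Skip, s))"
  by (elim FQ_answer) (auto simp: optimal_def dest: tuple_matching(1))

text \<open>If the vertices of \<open>N\<close> lie in distinct buckets, its stream elements are
  separated. Exchange turns them into stored edges of at least the same weight, and the search does
  no worse than these.\<close>

lemma FQ_max:
  assumes F: "FQ p s" and l: "l < L" "inj_on (bucket p l) (\<Union>N)" and N: "max_weight_k_matching k E wt N"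
  shows "max_weight_k_matching k E wt (answer (Skip, s))"
proof -
  obtain p1 where X: "XE p1 \<subseteq> set xs" and r: "\<And>l. l < L \<Longrightarrow> rep (bucket p l) k (set xs) (XE p1)" and
    c: "optimal s p1"
    using FQ_answer[OF F] by blast
  have km: "N \<subseteq> E" "\<And>e f. e \<in> N \<Longrightarrow> f \<in> N \<Longrightarrow> e \<noteq> f \<Longrightarrow> e \<inter> f = {}" "finite N" "card N = k"
    using N by (auto simp: max_weight_k_matching_def k_matching_def matching_def)
  define M where "M = {x \<in> set xs. edge x \<in> N}"
  have bij: "bij_betw edge M N"
    unfolding bij_betw_def M_def using edges(1,2) km(1) by (auto simp: inj_on_def)
  have cM: "card M = k" using bij_betw_same_card[OF bij] km(4) by simp
  have "separated (bucket p l) M"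
    unfolding separated_def
  proof (intro conjI ballI impI)
    fix x assume x: "x \<in> M"
    then have "edge x \<in> E" using km(1) by (auto simp: M_def)
    then have "card (edge x) = 2" using graph by (simp add: weighted_graph_def)
    then have "fst x \<noteq> fst (snd x)" by (auto simp: edge_def)
    moreover have "fst x \<in> \<Union>N" "fst (snd x) \<in> \<Union>N" using x by (auto simp: M_def edge_def)
    ultimately show "bucket p l (fst x) \<noteq> bucket p l (fst (snd x))" using l(2) by (meson inj_onD)
  next
    fix x y assume x: "x \<in> M" and y: "y \<in> M" and xy: "x \<noteq> y"
    have N': "edge x \<in> N" "edge y \<in> N" using x y by (auto simp: M_def)
    have "edge x \<noteq> edge y" using xy x y edges(2) by (auto simp: M_def inj_on_def)
    then have d: "edge x \<inter> edge y = {}" using km(2) N' by blast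
    have b: "buckets_of (bucket p l) z = bucket p l ` edge z" for z by (simp add: buckets_of_def edge_def)
    have "edge x \<subseteq> \<Union>N" "edge y \<subseteq> \<Union>N" using N' by auto
    then show "buckets_of (bucket p l) x \<inter> buckets_of (bucket p l) y = {}"
      unfolding b using inj_on_image_Int[OF l(2)] d by (metis image_empty)
  qed
  then obtain M' where M': "finite M'" "separated (bucket p l) M'" "M' \<subseteq> XE p1" "card M' = k"
      "(\<Sum>e\<in>M. snd (snd e)) \<le> (\<Sum>e\<in>M'. snd (snd e))"
    using rep_exchange[OF r[OF l(1)], of M] cM by (auto simp: M_def)
  obtain f' where f': "\<forall>i<k. f' i < vv p1 6" "okt p1 k f'" "wgt p1 k f' = (\<Sum>e\<in>M'. snd (snd e))"
    using separated_tuple[OF M'(1-4)] by blast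
  obtain f where f: "\<forall>i<k. f i < vv p1 6" "okt p1 k f" "answer (Skip, s) = (\<lambda>i. {aa p1 2 (f i), aa p1 3 (f i)}) ` {0..<k}"
      "wgt p1 k f' \<le> wgt p1 k f"
    using c f' unfolding optimal_def by blast
  have "sum wt N = (\<Sum>e\<in>M. wt (edge e))" using sum.reindex_bij_betw[OF bij] by metis
  also have "\<dots> = (\<Sum>e\<in>M. snd (snd e))" using edges(3) by (intro sum.cong) (auto simp: M_def)
  also have "\<dots> \<le> wgt p1 k f" using M'(5) f'(3) f(4) by simp
  also have "\<dots> = sum wt (answer (Skip, s))" unfolding f(3) by (rule tuple_matching(2)[OF X f(1,2), symmetric])
  finally have le: "sum wt N \<le> sum wt (answer (Skip, s))" .
  have "k_matching k E (answer (Skip, s))" unfolding f(3) by (rule tuple_matching(1)[OF X f(1,2)])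
  then show ?thesis using N le unfolding max_weight_k_matching_def by (meson order_trans)
qed

lemma alg_solves:
  assumes "(1 / 2) ^ L \<le> \<delta>"
  shows "solves_k_matching \<delta> k E wt (alg L, start)"
proof -
  obtain t where t: "\<And>c. c \<in> set_pmf (run t (alg L, start)) \<Longrightarrow> fst c = Skip \<and> (\<exists>g. finished g (snd c))"
    using ev_halts[OF alg_ev] by blast
  let ?D = "run t (alg L, start)"
  have fin: "\<exists>p s. c = (Skip, s) \<and> params p \<and> FQ p s" if "c \<in> set_pmf ?D" for c
    using t[OF that] by (cases c) (auto simp: finished_def)
  have "halts_with (alg L, start) ?D" using t unfolding halts_with_def by blast
  moreover have "\<forall>c\<in>set_pmf ?D. matching E (answer c)"
  proof
    fix c assume "c \<in> set_pmf ?D"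
    then obtain p s where "c = (Skip, s)" "FQ p s" using fin by blast
    then show "matching E (answer c)" using FQ_matching by (fastforce simp: k_matching_def matching_def)
  qed
  moreover have "\<forall>c\<in>set_pmf ?D. answer c = {}" if "\<not> (\<exists>M. k_matching k E M)"
  proof
    fix c assume "c \<in> set_pmf ?D"
    then obtain p s where "c = (Skip, s)" "FQ p s" using fin by blast
    then show "answer c = {}" using FQ_matching that by blast
  qed
  moreover have "measure_pmf.prob ?D {c. max_weight_k_matching k E wt (answer c)} \<ge> 1 - \<delta>"
    if ex: "\<exists>M. k_matching k E M"
  proof -
    obtain N where N: "max_weight_k_matching k E wt N" using ex ex_max_weight_k_matching[OF finite_E] by blast
    have km: "N \<subseteq> E" "finite N" "card N = k"
      using N by (auto simp: max_weight_k_matching_def k_matching_def matching_def)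
    have E2: "\<And>e. e \<in> N \<Longrightarrow> e \<subseteq> {0..<n} \<and> card e = 2" using km(1) graph by (auto simp: weighted_graph_def)
    have "card (\<Union>N) \<le> (\<Sum>e\<in>N. card e)" using card_Union_le_sum_card by blast
    also have "\<dots> = 2 * k" using E2 km(3) by simp
    finally have cV: "card (\<Union>N) \<le> 2 * k" .
    have V: "\<Union>N \<subseteq> {..<n}" using E2 by fastforce
    \<comment> \<open>Restricted to halted configurations, as the general bound requires; on the
      support of \<open>?D\<close> there are no others.\<close>
    let ?Bad = "{c. fst c = Skip \<and> \<not> max_weight_k_matching k E wt (answer c)}"
    have "measure_pmf.prob ?D ?Bad \<le> (1 / 2) ^ L"
    proof (rule alg_prob[OF finite_subset[OF V] V cV])
      show "(Skip, s) \<notin> ?Bad" if "FQ p s" "\<exists>l<L. inj_on (bucket p l) (\<Union>N)" for p s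
        using that FQ_max[OF that(1) _ _ N] by blast
    qed auto
    moreover have "measure_pmf.prob ?D (- {c. max_weight_k_matching k E wt (answer c)}) \<le> measure_pmf.prob ?D ?Bad"
      by (intro measure_pmf.finite_measure_mono_AE) (auto simp: AE_measure_pmf_iff dest: t)
    moreover have "measure_pmf.prob ?D (- {c. max_weight_k_matching k E wt (answer c)}) =
        1 - measure_pmf.prob ?D {c. max_weight_k_matching k E wt (answer c)}"
      using measure_pmf.prob_compl[of "{c. max_weight_k_matching k E wt (answer c)}" ?D] by (simp add: Compl_eq_Diff_UNIV)
    ultimately show ?thesis using assms by linarith
  qed
  ultimately show ?thesis unfolding solves_k_matching_def by blast
qed

end

section \<open>Choice of the constants\<close>

lemma log_inv_pos:
  assumes "0 < \<delta>" "\<delta> < 1"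
  shows "1 \<le> log_inv \<delta>" "(1 / 2) ^ log_inv \<delta> \<le> \<delta>"
proof -
  let ?l = "log 2 (1 / \<delta>)"
  have l: "0 < ?l" using assms by (subst zero_less_log_cancel_iff) auto
  then show "1 \<le> log_inv \<delta>" unfolding log_inv_def by linarith
  have "?l \<le> real (log_inv \<delta>)" unfolding log_inv_def by linarith
  then have "2 powr ?l \<le> 2 powr real (log_inv \<delta>)" by simp
  then have "1 / \<delta> \<le> 2 ^ log_inv \<delta>" using assms by (simp add: powr_realpow)
  then show "(1 / 2) ^ log_inv \<delta> \<le> \<delta>" using assms by (simp add: field_simps power_divide)
qed

lemma runs_in_space_mono:
  assumes "runs_in_space W S c" "W \<le> W'" "S \<le> S'"
  shows "runs_in_space W' S' c"
  using assms unfolding runs_in_space_def by (meson less_le_trans order_trans)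

lemma update_time_mono:
  assumes "update_time_le T c" "T \<le> T'"
  shows "update_time_le T' c"
  unfolding update_time_le_def
proof (intro ballI impI)
  fix c' c'' assume a: "c' \<in> reachable c" "1 \<le> reads (snd c') \<and> reads (snd c') \<le> length (input (snd c))"
    "c'' \<in> set_pmf (run T' c')"
  have "c'' \<in> set_pmf (run (T + (T' - T)) c')" using a(3) assms(2) by simp
  then obtain d where d: "d \<in> set_pmf (run T c')" "c'' \<in> set_pmf (run (T' - T) d)" unfolding run_add by auto
  then have "reads (snd c') < reads (snd d)" using a assms(1) unfolding update_time_le_def by blast
  then show "reads (snd c') < reads (snd c'')" using reads_run[OF d(2)] by simp
qed

text \<open>The arrays take \<open>16 * SZ + 4 * SZ = 320 * B = 327680 * L * k ^ 2\<close> cells,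
  and \<open>120 + 2 * k\<close> adds at most \<open>122 * L * k ^ 2\<close>. For the words,
  \<open>b = X ^ 14\<close> turns \<open>b ^ 100\<close> into the exponent 1400.\<close>

lemma alg_correct:
  assumes L: "1 \<le> L" "(1 / 2) ^ L \<le> \<delta>" and k: "1 \<le> k" and g: "weighted_graph n E wt" and st: "insert_only_stream E wt xs"
  shows "solves_k_matching \<delta> k E wt (initial (alg L) n k xs)"
    "runs_in_space ((n + k + L + 2) ^ 1400) (327802 * (k ^ 2 * L)) (initial (alg L) n k xs)"
    "update_time_le ((962 * code_size + 101) * L) (initial (alg L) n k xs)"
proof -
  define X where "X = n + k + L + 2"
  define b where "b = X ^ 14"
  define B where "B = 1024 * L * (k * k)"
  have X: "4 \<le> X" "n \<le> X" "k \<le> X" "L \<le> X" using L k by (auto simp: X_def)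
  have kk: "1 \<le> k * k" "k \<le> k * k" "k * k \<le> L * (k * k)" "1 \<le> L * (k * k)" using k L by auto
  \<comment> \<open>As \<open>4 \<le> X\<close>, eleven of the fourteen factors absorb the numerical
    constants required of \<open>b\<close>; the other three cover \<open>L * k * k\<close> and
    \<open>k * k * n\<close>.\<close>
  have pow: "(4 :: nat) ^ 11 * X ^ 3 \<le> b"
  proof -
    have "(4 :: nat) ^ 11 * X ^ 3 \<le> X ^ 11 * X ^ 3" using X by (intro mult_right_mono power_mono) auto
    then show ?thesis by (simp add: b_def flip: power_add)
  qed
  have X3: "L * (k * k) \<le> X ^ 3" "k * k * n \<le> X ^ 3"
    using X by (auto simp: power3_eq_cube mult.assoc intro!: mult_mono)
  have X1: "X \<le> X ^ 3" using X by (simp add: power3_eq_cube)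
  have n: "n < b" using X(1,2) X1 pow by (simp; linarith)
  have "\<forall>(u, v, w)\<in>set xs. u < n \<and> v < n"
  proof -
    have "\<forall>x\<in>set xs. (\<lambda>(u, v, w). {u, v}) x \<subseteq> {0..<n}"
      using g st unfolding weighted_graph_def insert_only_stream_def by (metis (no_types, lifting) image_eqI list.set_map)
    then show ?thesis by auto
  qed
  then have xs: "\<forall>(u, v, w)\<in>set xs. u < b \<and> v < b" using n by (auto intro: less_trans)
  interpret A: streamed_graph k b "961 * L" "16 * B" "961 * L" "length xs" code_size n L B "32 * (k * k)" xs E wt
  proof (unfold_locales)
    show "200 + 2 * k + 100 * (16 * B) \<le> b" using pow X3(1) kk X1 X(1) unfolding B_def by (simp; linarith)
    show "961 * L < b" using pow X1 X(1,4) by (simp; linarith)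
    show "32 * (k * k) * n < b" using pow X3(2) X1 X(1) by (simp; linarith)
  qed (use L k g st n xs kk in \<open>auto simp: B_def\<close>)
  have init: "initial (alg L) n k xs = (alg L, A.start)" by (simp add: initial_def A.start_def)
  show "solves_k_matching \<delta> k E wt (initial (alg L) n k xs)"
    unfolding init by (rule A.alg_solves[OF L(2)])
  show "runs_in_space ((n + k + L + 2) ^ 1400) (327802 * (k ^ 2 * L)) (initial (alg L) n k xs)"
    unfolding init
  proof (rule runs_in_space_mono[OF A.alg_space])
    show "b ^ 100 \<le> (n + k + L + 2) ^ 1400" by (simp add: b_def X_def flip: power_mult)
    show "120 + 2 * k + 16 * (16 * B) + 4 * (16 * B) \<le> 327802 * (k ^ 2 * L)"
      using kk unfolding B_def power2_eq_square by (simp add: ac_simps; linarith)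
  qed
  show "update_time_le ((962 * code_size + 101) * L) (initial (alg L) n k xs)"
    unfolding init
  proof (rule update_time_mono[OF A.alg_time])
    have "code_size + 101 \<le> (code_size + 101) * L" using L by simp
    then show "code_size * (961 * L) + code_size + 101 \<le> (962 * code_size + 101) * L" by (simp add: algebra_simps)
  qed
qed

theorem theorem18:
  shows "\<exists>C d :: nat. \<forall>\<delta> :: real. 0 < \<delta> \<and> \<delta> < 1 \<longrightarrow>
    (\<exists>P :: prog.
       (\<forall>n k E wt xs.
          1 \<le> k \<and> weighted_graph n E wt \<and> insert_only_stream E wt xs \<longrightarrow>
            solves_k_matching \<delta> k E wt (initial P n k xs) \<and>
            runs_in_space ((n + k + log_inv \<delta> + 2) ^ d) (C * (k ^ 2 * log_inv \<delta>))
              (initial P n k xs) \<and>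
            update_time_le (C * log_inv \<delta>) (initial P n k xs)) \<and>
       (\<exists>C' d' :: nat. \<forall>n k E wt xs.
          1 \<le> k \<and> weighted_graph n E wt \<and> insert_only_stream E wt xs \<longrightarrow>
            runs_in_space ((n + k + 2) ^ d') (C' * k ^ 2) (initial P n k xs) \<and>
            update_time_le C' (initial P n k xs)))"
proof -
  define C where "C = 327802 + (962 * code_size + 101)"
  have main: "solves_k_matching \<delta> k E wt (initial (alg (log_inv \<delta>)) n k xs)"
      "runs_in_space ((n + k + log_inv \<delta> + 2) ^ 1400) (C * (k ^ 2 * log_inv \<delta>)) (initial (alg (log_inv \<delta>)) n k xs)"
      "update_time_le (C * log_inv \<delta>) (initial (alg (log_inv \<delta>)) n k xs)"
    if a: "0 < \<delta>" "\<delta> < 1" "1 \<le> k" "weighted_graph n E wt" "insert_only_stream E wt xs" for \<delta> n k E wt xs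
  proof -
    note A = alg_correct[OF log_inv_pos[OF a(1,2)] a(3-5)]
    show "solves_k_matching \<delta> k E wt (initial (alg (log_inv \<delta>)) n k xs)" by (rule A)
    show "runs_in_space ((n + k + log_inv \<delta> + 2) ^ 1400) (C * (k ^ 2 * log_inv \<delta>)) (initial (alg (log_inv \<delta>)) n k xs)"
      by (rule runs_in_space_mono[OF A(2)]) (auto simp: C_def intro: mult_right_mono)
    show "update_time_le (C * log_inv \<delta>) (initial (alg (log_inv \<delta>)) n k xs)"
      by (rule update_time_mono[OF A(3)]) (auto simp: C_def intro: mult_right_mono)
  qed
  \<comment> \<open>For fixed \<open>\<delta>\<close> the summand \<open>log_inv \<delta>\<close>
    has to leave the base of the word bound. Since \<open>n + k + 2\<close> is at least 2, its power
    with exponent \<open>log_inv \<delta>\<close> is at least \<open>log_inv \<delta> + 1\<close>,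
    and one more factor makes it dominate the whole base.\<close>
  have const: "runs_in_space ((n + k + 2) ^ (1400 * (log_inv \<delta> + 1))) (C * log_inv \<delta> * k ^ 2) (initial (alg (log_inv \<delta>)) n k xs)"
    if a: "0 < \<delta>" "\<delta> < 1" "1 \<le> k" "weighted_graph n E wt" "insert_only_stream E wt xs" for \<delta> n k E wt xs
  proof (rule runs_in_space_mono[OF main(2)[OF a]])
    let ?L = "log_inv \<delta>" and ?X = "n + k + 2"
    have "Suc ?L \<le> 2 ^ ?L" by (simp add: Suc_le_eq less_exp)
    also have "\<dots> \<le> ?X ^ ?L" by (intro power_mono) auto
    finally have "?X * Suc ?L \<le> ?X * ?X ^ ?L" by (rule mult_left_mono) simp
    then have "n + k + ?L + 2 \<le> ?X ^ (?L + 1)" by simp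
    then have "(n + k + ?L + 2) ^ 1400 \<le> (?X ^ (?L + 1)) ^ 1400" by (rule power_mono) simp
    then show "(n + k + ?L + 2) ^ 1400 \<le> ?X ^ (1400 * (?L + 1))" by (simp only: power_mult[symmetric] mult.commute)
  qed (simp add: ac_simps)
  show ?thesis
  proof (rule exI[of _ C], rule exI[of _ 1400], intro allI impI)
    fix \<delta> :: real assume \<delta>: "0 < \<delta> \<and> \<delta> < 1"
    let ?P = "alg (log_inv \<delta>)"
    have A: "\<forall>n k E wt xs. 1 \<le> k \<and> weighted_graph n E wt \<and> insert_only_stream E wt xs \<longrightarrow>
            solves_k_matching \<delta> k E wt (initial ?P n k xs) \<and>
            runs_in_space ((n + k + log_inv \<delta> + 2) ^ 1400) (C * (k ^ 2 * log_inv \<delta>)) (initial ?P n k xs) \<and>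
            update_time_le (C * log_inv \<delta>) (initial ?P n k xs)"
      using main \<delta> by blast
    have B: "\<forall>n k E wt xs. 1 \<le> k \<and> weighted_graph n E wt \<and> insert_only_stream E wt xs \<longrightarrow>
            runs_in_space ((n + k + 2) ^ (1400 * (log_inv \<delta> + 1))) (C * log_inv \<delta> * k ^ 2) (initial ?P n k xs) \<and>
            update_time_le (C * log_inv \<delta>) (initial ?P n k xs)"
      by (intro allI impI conjI; (rule const | rule main(3))) (use \<delta> in auto)
    show "\<exists>P. (\<forall>n k E wt xs. 1 \<le> k \<and> weighted_graph n E wt \<and> insert_only_stream E wt xs \<longrightarrow>
            solves_k_matching \<delta> k E wt (initial P n k xs) \<and>
            runs_in_space ((n + k + log_inv \<delta> + 2) ^ 1400) (C * (k ^ 2 * log_inv \<delta>)) (initial P n k xs) \<and>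
            update_time_le (C * log_inv \<delta>) (initial P n k xs)) \<and>
       (\<exists>C' d'. \<forall>n k E wt xs. 1 \<le> k \<and> weighted_graph n E wt \<and> insert_only_stream E wt xs \<longrightarrow>
            runs_in_space ((n + k + 2) ^ d') (C' * k ^ 2) (initial P n k xs) \<and>
            update_time_le C' (initial P n k xs))"
      by (rule exI[of _ ?P], rule conjI[OF A], rule exI, rule exI, rule B)
  qed
qed

end
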